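(* Let $m\ge2$, $N>2m$ and let $\Omega\subset\mathbb{R}^N$ be a bounded smooth domain with $0\in\Omega$. Let $\{K_\varepsilon\}_{\varepsilon>0}$ be a family of compact sets uniformly concentrating to $\{0\}$ such that, for some compact set $\mathcal{K}\subset\mathbb{R}^N$: (a) there exists a compact set $M\subset\mathbb{R}^N$ with $\varepsilon^{-1}K_\varepsilon\subseteq M$ for all $\varepsilon\in(0,1)$; (b) $D^{m,2}_0(\mathbb{R}^N\setminus\varepsilon^{-1}K_\varepsilon)$ converges to $D^{m,2}_0(\mathbb{R}^N\setminus\mathcal{K})$ in the sense of Mosco as $\varepsilon\to0$. Let $\lambda_J$ be an eigenvalue of $(-\Delta)^m$ in $\Omega$ with Dirichlet boundary conditions and let $u_J\in H^m_0(\Omega)$ be a corresponding eigenfunction normalized in $L^2(\Omega)$. Let $\gamma$ and $U_0$ be the vanishing order and the limiting homogeneous polynomial of $u_J$ at $0$ (as defined in the context). Then $$\mathrm{cap}_{m,\Omega}(K_\varepsilon,u_J)=\varepsilon^{N-2m+2\gamma}\big(\mathrm{cap}_{m,\mathbb{R}^N}(\mathcal{K},U_0)+o(1)\big)\qquad\text{as }\varepsilon\to0.$$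
   Context: Functions are real valued. $\nabla^m f:=\Delta^{m/2}f$ if $m$ is even and $\nabla^m f:=\nabla\Delta^{(m-1)/2}f$ if $m$ is odd. $H^m_0(\Omega)$ is the closure of $C_0^\infty(\Omega)$ in $H^m(\Omega)$; for $K\subset\Omega$ compact, $H^m_0(\Omega\setminus K)$ is the closure of $C_0^\infty(\Omega\setminus K)$ in $H^m(\Omega)$. Uniformly concentrating to $\{0\}$: $K_\varepsilon\subset\overline{B_{C\varepsilon}(0)}$ for some constant $C>0$ and all $\varepsilon$ small enough (this is implied by (a)). Eigenpair (Dirichlet): $u_J\in H^m_0(\Omega)\setminus\{0\}$ and $\int_\Omega\nabla^m u_J\,\nabla^m\varphi=\lambda_J\int_\Omega u_J\varphi$ for all $\varphi\in H^m_0(\Omega)$. Capacity in $\Omega$: for $K\subset\Omega$ compact and $u\in H^m_0(\Omega)$, $\mathrm{cap}_{m,\Omega}(K,u):=\inf\{\int_\Omega|\nabla^m f|^2: f\in H^m_0(\Omega),\ f-u\in H^m_0(\Omega\setminus K)\}$. Homogeneous spaces ($N>2m$): $D^{m,2}_0(\mathbb{R}^N)$ is the completion of $C_0^\infty(\mathbb{R}^N)$ for the norm $\|\nabla^m\cdot\|_{L^2(\mathbb{R}^N)}$ (a space of functions, embedded in $L^{2N/(N-2m)}(\mathbb{R}^N)$), and for $K\subset\mathbb{R}^N$ compact $D^{m,2}_0(\mathbb{R}^N\setminus K)$ is the closure in it of $C_0^\infty(\mathbb{R}^N\setminus K)$. Mosco convergence in (b) means: (i) if $u_\varepsilon\in D^{m,2}_0(\mathbb{R}^N\setminus\varepsilon^{-1}K_\varepsilon)$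 and $u_\varepsilon\rightharpoonup u$ weakly in $D^{m,2}_0(\mathbb{R}^N)$ as $\varepsilon\to0$ (the same being required for weak limits along any sequence $\varepsilon_n\to0$), then $u\in D^{m,2}_0(\mathbb{R}^N\setminus\mathcal{K})$; (ii) for every $u\in D^{m,2}_0(\mathbb{R}^N\setminus\mathcal{K})$ there is a family $u_\varepsilon\in D^{m,2}_0(\mathbb{R}^N\setminus\varepsilon^{-1}K_\varepsilon)$ with $u_\varepsilon\to u$ in $D^{m,2}_0(\mathbb{R}^N)$ as $\varepsilon\to0$. Capacity in $\mathbb{R}^N$: for $u\in H^m_{loc}(\mathbb{R}^N)$, $\mathrm{cap}_{m,\mathbb{R}^N}(\mathcal{K},u):=\inf\{\int_{\mathbb{R}^N}|\nabla^m f|^2: f\in D^{m,2}_0(\mathbb{R}^N),\ f-\eta u\in D^{m,2}_0(\mathbb{R}^N\setminus\mathcal{K})\}$, where $\eta\in C_0^\infty(\mathbb{R}^N)$ is any function equal to $1$ in a neighbourhood of $\mathcal{K}$ (the value does not depend on $\eta$). $\gamma$ and $U_0$: since $u_J$ is analytic and nontrivial near $0$, there exist $\gamma\in\mathbb{N}$ (possibly $0$) and a $\gamma$-homogeneous polyharmonic polynomial $U_0\not\equiv0$ (i.e. $(-\Delta)^mU_0=0$) such that $u_J(\varepsilon\,\cdot)/\varepsilon^\gamma\to U_0$ in $H^m(B_R(0))$ as $\varepsilon\to0$, for all $R>0$. *)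

theory Defs
  imports "HOL-Analysis.Analysis" "HOL-Library.Landau_Symbols"
begin

section \<open>Smooth functions and classical differential operators\<close>

definition partial :: "'a::euclidean_space \<Rightarrow> ('a \<Rightarrow> real) \<Rightarrow> 'a \<Rightarrow> real" where
  "partial b f x = frechet_derivative f (at x) b"

text \<open>Multi-indices are encoded as lists of basis vectors: the list \<open>[b1, \<dots>, bk]\<close> stands for the
  iterated derivative of order \<open>k\<close> in the directions \<open>b1, \<dots>, bk\<close>.\<close>

definition partials :: "'a::euclidean_space list \<Rightarrow> ('a \<Rightarrow> real) \<Rightarrow> 'a \<Rightarrow> real" where
  "partials bs f = foldr partial bs f"

definition smooth :: "('a::euclidean_space \<Rightarrow> real) \<Rightarrow> bool" where
  "smooth f \<longleftrightarrow> (\<forall>bs. set bs \<subseteq> Basis \<longrightarrow> partials bs f differentiable_on UNIV)"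

definition test_functions :: "'a::euclidean_space set \<Rightarrow> ('a \<Rightarrow> real) set" where
  "test_functions U =
    {\<phi>. smooth \<phi> \<and> compact (closure {x. \<phi> x \<noteq> 0}) \<and> closure {x. \<phi> x \<noteq> 0} \<subseteq> U}"

definition laplacian :: "('a::euclidean_space \<Rightarrow> real) \<Rightarrow> 'a \<Rightarrow> real" where
  "laplacian f x = (\<Sum>b\<in>Basis. partials [b, b] f x)"

text \<open>Near each boundary point, the domain is the strict epigraph of a smooth function over a
  hyperplane, whose unit normal is \<open>\<nu>\<close>; only the values of \<open>g\<close> on that hyperplane matter.\<close>

definition bounded_smooth_domain :: "'a::euclidean_space set \<Rightarrow> bool" where
  "bounded_smooth_domain \<Omega> \<longleftrightarrow>
    open \<Omega> \<and> connected \<Omega> \<and> \<Omega> \<noteq> {} \<and> bounded \<Omega> \<and>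
    (\<forall>x0\<in>frontier \<Omega>. \<exists>r>0. \<exists>\<nu> g. norm \<nu> = 1 \<and> smooth g \<and>
       \<Omega> \<inter> ball x0 r = {x \<in> ball x0 r. x \<bullet> \<nu> > g (x - (x \<bullet> \<nu>) *\<^sub>R \<nu>)})"


section \<open>Weak derivatives and Sobolev spaces\<close>

text \<open>Elements of the function spaces are represented by functions on the whole space; for a space
  over \<open>\<Omega>\<close> only the values almost everywhere on \<open>\<Omega>\<close> matter.\<close>

definition locally_integrable :: "'a::euclidean_space set \<Rightarrow> ('a \<Rightarrow> real) \<Rightarrow> bool" where
  "locally_integrable \<Omega> u \<longleftrightarrow> (\<forall>C. compact C \<and> C \<subseteq> \<Omega> \<longrightarrow> integrable (lebesgue_on C) u)"

definition has_weak_deriv ::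
  "'a::euclidean_space set \<Rightarrow> 'a list \<Rightarrow> ('a \<Rightarrow> real) \<Rightarrow> ('a \<Rightarrow> real) \<Rightarrow> bool" where
  "has_weak_deriv \<Omega> bs u v \<longleftrightarrow>
    locally_integrable \<Omega> u \<and> locally_integrable \<Omega> v \<and>
    (\<forall>\<phi>\<in>test_functions \<Omega>.
       (LINT x|lebesgue_on \<Omega>. u x * partials bs \<phi> x) =
       (-1) ^ length bs * (LINT x|lebesgue_on \<Omega>. v x * \<phi> x))"

text \<open>The weak derivative is unique up to null sets, so all integrals below are independent of
  the choice made here.\<close>

definition weak_deriv ::
  "'a::euclidean_space set \<Rightarrow> 'a list \<Rightarrow> ('a \<Rightarrow> real) \<Rightarrow> 'a \<Rightarrow> real" where
  "weak_deriv \<Omega> bs u = (SOME v. has_weak_deriv \<Omega> bs u v)"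

definition L2 :: "'a::euclidean_space set \<Rightarrow> ('a \<Rightarrow> real) set" where
  "L2 \<Omega> = {u \<in> borel_measurable (lebesgue_on \<Omega>). integrable (lebesgue_on \<Omega>) (\<lambda>x. (u x)\<^sup>2)}"

definition multi_indices :: "nat \<Rightarrow> 'a::euclidean_space list set" where
  "multi_indices m = {bs. set bs \<subseteq> Basis \<and> length bs \<le> m}"

definition Hm :: "nat \<Rightarrow> 'a::euclidean_space set \<Rightarrow> ('a \<Rightarrow> real) set" where
  "Hm m \<Omega> = {u \<in> L2 \<Omega>. \<forall>bs\<in>multi_indices m. \<exists>v\<in>L2 \<Omega>. has_weak_deriv \<Omega> bs u v}"

text \<open>Since multi-indices are lists, this is the norm built from the Euclidean norms of the full
  derivative tensors of order \<open>0, \<dots>, m\<close>.\<close>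

definition Hm_norm :: "nat \<Rightarrow> 'a::euclidean_space set \<Rightarrow> ('a \<Rightarrow> real) \<Rightarrow> real" where
  "Hm_norm m \<Omega> u =
    sqrt (\<Sum>bs\<in>multi_indices m. LINT x|lebesgue_on \<Omega>. (weak_deriv \<Omega> bs u x)\<^sup>2)"

definition tendsto_Hm ::
  "nat \<Rightarrow> 'a::euclidean_space set \<Rightarrow> ('i \<Rightarrow> 'a \<Rightarrow> real) \<Rightarrow> ('a \<Rightarrow> real) \<Rightarrow> 'i filter \<Rightarrow> bool" where
  "tendsto_Hm m \<Omega> f u F \<longleftrightarrow>
    u \<in> Hm m \<Omega> \<and> eventually (\<lambda>i. f i \<in> Hm m \<Omega>) F \<and>
    ((\<lambda>i. Hm_norm m \<Omega> (\<lambda>x. f i x - u x)) \<longlongrightarrow> 0) F"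

text \<open>The closure of \<open>C_0^\<infinity>(U)\<close> in \<open>H^m(\<Omega>)\<close>; so \<open>Hm0 m \<Omega> \<Omega>\<close> is \<open>H^m_0(\<Omega>)\<close> and
  \<open>Hm0 m \<Omega> (\<Omega> - K)\<close> is \<open>H^m_0(\<Omega> \<setminus> K)\<close>.\<close>

definition Hm0 :: "nat \<Rightarrow> 'a::euclidean_space set \<Rightarrow> 'a set \<Rightarrow> ('a \<Rightarrow> real) set" where
  "Hm0 m \<Omega> U =
    {u. \<exists>\<phi>. (\<forall>n::nat. \<phi> n \<in> test_functions U) \<and> tendsto_Hm m \<Omega> \<phi> u sequentially}"

definition weak_laplacian ::
  "'a::euclidean_space set \<Rightarrow> ('a \<Rightarrow> real) \<Rightarrow> 'a \<Rightarrow> real" where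
  "weak_laplacian \<Omega> u x = (\<Sum>b\<in>Basis. weak_deriv \<Omega> [b, b] u x)"

definition weak_gradient ::
  "'a::euclidean_space set \<Rightarrow> ('a \<Rightarrow> real) \<Rightarrow> 'a \<Rightarrow> 'a" where
  "weak_gradient \<Omega> u x = (\<Sum>b\<in>Basis. weak_deriv \<Omega> [b] u x *\<^sub>R b)"

text \<open>\<open>\<nabla>\<^sup>m u\<close> is scalar for even \<open>m\<close> and a vector for odd \<open>m\<close>; both cases are embedded into
  \<open>\<real> \<times> \<real>\<^sup>N\<close>, with the other component zero, so that products and norms are those of the nonzero
  component.\<close>

definition nabla_pow ::
  "nat \<Rightarrow> 'a::euclidean_space set \<Rightarrow> ('a \<Rightarrow> real) \<Rightarrow> 'a \<Rightarrow> real \<times> 'a" where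
  "nabla_pow m \<Omega> u x =
    (if even m then ((weak_laplacian \<Omega> ^^ (m div 2)) u x, 0)
     else (0, weak_gradient \<Omega> ((weak_laplacian \<Omega> ^^ ((m - 1) div 2)) u) x))"

definition dirichlet_form ::
  "nat \<Rightarrow> 'a::euclidean_space set \<Rightarrow> ('a \<Rightarrow> real) \<Rightarrow> ('a \<Rightarrow> real) \<Rightarrow> real" where
  "dirichlet_form m \<Omega> u v = (LINT x|lebesgue_on \<Omega>. nabla_pow m \<Omega> u x \<bullet> nabla_pow m \<Omega> v x)"

definition dirichlet_energy ::
  "nat \<Rightarrow> 'a::euclidean_space set \<Rightarrow> ('a \<Rightarrow> real) \<Rightarrow> real" where
  "dirichlet_energy m \<Omega> u = (LINT x|lebesgue_on \<Omega>. (norm (nabla_pow m \<Omega> u x))\<^sup>2)"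

definition dirichlet_eigenpair ::
  "nat \<Rightarrow> 'a::euclidean_space set \<Rightarrow> real \<Rightarrow> ('a \<Rightarrow> real) \<Rightarrow> bool" where
  "dirichlet_eigenpair m \<Omega> lam u \<longleftrightarrow>
    u \<in> Hm0 m \<Omega> \<Omega> \<and> \<not> (AE x in lebesgue_on \<Omega>. u x = 0) \<and>
    (\<forall>\<phi>\<in>Hm0 m \<Omega> \<Omega>. dirichlet_form m \<Omega> u \<phi> = lam * (LINT x|lebesgue_on \<Omega>. u x * \<phi> x))"

definition cap_in :: "nat \<Rightarrow> 'a::euclidean_space set \<Rightarrow> 'a set \<Rightarrow> ('a \<Rightarrow> real) \<Rightarrow> real" where
  "cap_in m \<Omega> K u =
    Inf {dirichlet_energy m \<Omega> f | f. f \<in> Hm0 m \<Omega> \<Omega> \<and> (\<lambda>x. f x - u x) \<in> Hm0 m \<Omega> (\<Omega> - K)}"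


section \<open>Homogeneous Sobolev spaces\<close>

definition Dm_norm :: "nat \<Rightarrow> ('a::euclidean_space \<Rightarrow> real) \<Rightarrow> real" where
  "Dm_norm m u = sqrt (dirichlet_energy m UNIV u)"

text \<open>The completion of the test functions is realised as a space of functions: an element is the
  limit in \<open>L^p\<close>, \<open>p = 2N / (N - 2m)\<close>, of a sequence that is Cauchy for the energy norm. Meaningful for
  \<open>N > 2m\<close>, where the Sobolev inequality identifies this with the abstract completion.\<close>

definition Dm0 :: "nat \<Rightarrow> ('a::euclidean_space \<Rightarrow> real) set" where
  "Dm0 m =
    (let p = 2 * real DIM('a) / (real DIM('a) - 2 * real m) in
      {u \<in> borel_measurable lebesgue. integrable lebesgue (\<lambda>x. \<bar>u x\<bar> powr p) \<and>
        (\<exists>\<phi>. (\<forall>n::nat. \<phi> n \<in> test_functions UNIV) \<and>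
          (\<forall>e>0. \<exists>M. \<forall>n\<ge>M. \<forall>k\<ge>M. Dm_norm m (\<lambda>x. \<phi> n x - \<phi> k x) < e) \<and>
          (\<lambda>n. LINT x|lebesgue. \<bar>\<phi> n x - u x\<bar> powr p) \<longlonglongrightarrow> 0)})"

text \<open>\<open>Dm0_minus m K\<close> is \<open>D^{m,2}_0(\<real>\<^sup>N \<setminus> K)\<close>.\<close>

definition Dm0_minus :: "nat \<Rightarrow> 'a::euclidean_space set \<Rightarrow> ('a \<Rightarrow> real) set" where
  "Dm0_minus m K =
    {u \<in> Dm0 m. \<exists>\<phi>. (\<forall>n::nat. \<phi> n \<in> test_functions (- K)) \<and>
       (\<lambda>n. Dm_norm m (\<lambda>x. \<phi> n x - u x)) \<longlonglongrightarrow> 0}"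

definition Dm_weakly_tendsto ::
  "nat \<Rightarrow> ('i \<Rightarrow> 'a::euclidean_space \<Rightarrow> real) \<Rightarrow> ('a \<Rightarrow> real) \<Rightarrow> 'i filter \<Rightarrow> bool" where
  "Dm_weakly_tendsto m w u F \<longleftrightarrow>
    (\<forall>v\<in>Dm0 m. ((\<lambda>i. dirichlet_form m UNIV (w i) v) \<longlongrightarrow> dirichlet_form m UNIV u v) F)"

text \<open>Mosco convergence of the spaces over the complements of \<open>A \<epsilon>\<close>, as \<open>\<epsilon> \<rightarrow> 0+\<close>. The condition on
  weak limits along sequences contains the one for families indexed by all \<open>\<epsilon> > 0\<close>.\<close>

definition Dm_mosco :: "nat \<Rightarrow> (real \<Rightarrow> 'a::euclidean_space set) \<Rightarrow> 'a set \<Rightarrow> bool" where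
  "Dm_mosco m A K \<longleftrightarrow>
    (\<forall>e w u. (\<forall>n::nat. e n > 0) \<and> e \<longlonglongrightarrow> 0 \<and> (\<forall>n. w n \<in> Dm0_minus m (A (e n))) \<and>
       u \<in> Dm0 m \<and> Dm_weakly_tendsto m w u sequentially \<longrightarrow> u \<in> Dm0_minus m K) \<and>
    (\<forall>u\<in>Dm0_minus m K. \<exists>w. (\<forall>\<epsilon>>0. w \<epsilon> \<in> Dm0_minus m (A \<epsilon>)) \<and>
       ((\<lambda>\<epsilon>. Dm_norm m (\<lambda>x. w \<epsilon> x - u x)) \<longlongrightarrow> 0) (at_right 0))"

definition cutoff :: "'a::euclidean_space set \<Rightarrow> ('a \<Rightarrow> real) \<Rightarrow> bool" where
  "cutoff K \<eta> \<longleftrightarrow> \<eta> \<in> test_functions UNIV \<and> (\<exists>V. open V \<and> K \<subseteq> V \<and> (\<forall>x\<in>V. \<eta> x = 1))"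

text \<open>Whether \<open>f\<close> is admissible does not depend on the cutoff \<open>\<eta>\<close>, hence the existential quantifier.\<close>

definition cap_RN :: "nat \<Rightarrow> 'a::euclidean_space set \<Rightarrow> ('a \<Rightarrow> real) \<Rightarrow> real" where
  "cap_RN m K u =
    Inf {dirichlet_energy m UNIV f | f. f \<in> Dm0 m \<and>
      (\<exists>\<eta>. cutoff K \<eta> \<and> (\<lambda>x. f x - \<eta> x * u x) \<in> Dm0_minus m K)}"


section \<open>Concentrating families and vanishing order\<close>

definition uniformly_concentrating :: "(real \<Rightarrow> 'a::euclidean_space set) \<Rightarrow> bool" where
  "uniformly_concentrating K \<longleftrightarrow> (\<exists>C>0. \<forall>\<^sub>F \<epsilon> in at_right 0. K \<epsilon> \<subseteq> cball 0 (C * \<epsilon>))"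

definition rescaled :: "(real \<Rightarrow> 'a::euclidean_space set) \<Rightarrow> real \<Rightarrow> 'a set" where
  "rescaled K \<epsilon> = (\<lambda>x. (1 / \<epsilon>) *\<^sub>R x) ` K \<epsilon>"

definition homogeneous_polyharmonic :: "nat \<Rightarrow> nat \<Rightarrow> ('a::euclidean_space \<Rightarrow> real) \<Rightarrow> bool" where
  "homogeneous_polyharmonic m \<gamma> U \<longleftrightarrow>
    real_polynomial_function U \<and> (\<forall>t x. U (t *\<^sub>R x) = t ^ \<gamma> * U x) \<and>
    (\<forall>x. ((\<lambda>f x. - laplacian f x) ^^ m) U x = 0)"

text \<open>\<open>\<gamma>\<close> is the vanishing order of \<open>u\<close> at the origin and \<open>U\<close> the limiting polynomial.\<close>

definition vanishing_profile ::
  "nat \<Rightarrow> ('a::euclidean_space \<Rightarrow> real) \<Rightarrow> nat \<Rightarrow> ('a \<Rightarrow> real) \<Rightarrow> bool" where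
  "vanishing_profile m u \<gamma> U \<longleftrightarrow>
    homogeneous_polyharmonic m \<gamma> U \<and> (\<exists>x. U x \<noteq> 0) \<and>
    (\<forall>R>0. tendsto_Hm m (ball 0 R) (\<lambda>\<epsilon> x. u (\<epsilon> *\<^sub>R x) / \<epsilon> ^ \<gamma>) U (at_right 0))"

end

(*
  Only test functions are ever rescaled or cut off: both capacities are approximated by energies
  of test functions, and u_J by test functions \<phi> so close in H^m that the blow-up
  up \<epsilon> \<phi>, i.e. x \<mapsto> \<phi>(\<epsilon> x) / \<epsilon>^\<gamma>, still tends to U_0 in H^m on balls. With a cutoff \<eta> equal to 1
  near all sets K_\<epsilon>/\<epsilon> and near the limit set, the part (1 - \<eta>) up \<epsilon> \<phi> of the blow-up vanishes near
  K_\<epsilon>/\<epsilon>, so adding or removing it does not affect admissibility. The square root of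
  cap(K_\<epsilon>, u_J) / \<epsilon>^(N-2m+2\<gamma>) thus differs by o(1) from the distance in the energy norm of \<eta> U_0 to
  the test functions avoiding K_\<epsilon>/\<epsilon>. Part (i) of Mosco convergence, applied to a weakly convergent
  subsequence of near-minimisers, bounds this distance from below; part (ii), applied to a
  near-minimiser for the limit set, bounds it from above.

  Weak limits lie in the homogeneous space because suitable convex combinations of a bounded
  sequence of test functions are Cauchy for the energy, and Cauchy sequences converge by the Sobolev
  inequality. The latter follows from the case p = 1, proved by the Gagliardo-Nirenberg argument
  with iterated one-dimensional integrals of continuous functions.
*)

theory Submission
  imports Defs "HOL-Library.Diagonal_Subsequence"
begin

text \<open>Two obstacles shape the proof. Weak derivatives are chosen representatives and
  \<open>nabla_pow\<close> iterates these choices, so a function is handled through a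
  \<open>weak_family\<close> of all its derivatives up to order m, and iterates are first compared
  as distributions. Moreover truncation needs a product rule; it is applied to smooth functions
  only, where the classical rule suffices. The lower-order terms it creates must be paid for by the
  energy, which sees only derivatives of order m. For test functions, integrating by parts shows
  that the energy is the sum of the squares of all derivatives of order m; since N > 2m, the Sobolev
  inequality can be iterated m times and bounds every lower derivative on balls. The test function
  approximating u_J varies with \<epsilon>: it is taken within \<epsilon>^(N+\<gamma>+1) in H^m,
  because the blow-up multiplies the squared norm by at most \<epsilon>^(-N-2\<gamma>). In the upper
  bound the functions furnished by Mosco convergence may reach outside the blown-up domain; a second
  cutoff truncates them and leaves the compactly supported limit competitor unchanged.\<close>

section \<open>Iterated partial derivatives and closure properties of smooth functions\<close>

lemma partials_Nil [simp]: "partials [] f = f"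
  by (simp add: partials_def)

lemma partials_Cons [simp]: "partials (b # bs) f = partial b (partials bs f)"
  by (simp add: partials_def)

lemma partials_append: "partials (bs @ cs) f = partials bs (partials cs f)"
  by (simp add: partials_def)

lemma partial_eq: "(f has_derivative f') (at x) \<Longrightarrow> partial b f x = f' b"
  by (metis frechet_derivative_at partial_def)

lemma smooth_partials_differentiable:
  "smooth f \<Longrightarrow> set bs \<subseteq> Basis \<Longrightarrow> partials bs f differentiable (at x)"
  by (simp add: smooth_def differentiable_on_def)

lemma smooth_differentiable: "smooth f \<Longrightarrow> f differentiable (at x)"
  using smooth_partials_differentiable[of f "[]"] by simp

lemma smooth_partials: "smooth f \<Longrightarrow> set bs \<subseteq> Basis \<Longrightarrow> smooth (partials bs f)"
  unfolding smooth_def by (metis le_sup_iff partials_append set_append)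

lemma smooth_partial: "smooth f \<Longrightarrow> b \<in> Basis \<Longrightarrow> smooth (partial b f)"
  using smooth_partials[of f "[b]"] by simp

text \<open>A set closed under \<open>partial\<close> traps the derivatives of every order, so the
  induction on the order is done here once; later closure properties only exhibit such a
  set.\<close>

lemma smooth_coinduct:
  assumes "f \<in> S"
    and S: "\<And>g. g \<in> S \<Longrightarrow> g differentiable_on UNIV \<and> (\<forall>b\<in>Basis. partial b g \<in> S)"
  shows "smooth f"
proof -
  have "partials bs f \<in> S" if "set bs \<subseteq> Basis" for bs
    using that by (induction bs) (use assms in auto)
  then show ?thesis
    unfolding smooth_def using S by blast
qed

lemma smooth_has_derivative:
  fixes f :: "'a::euclidean_space \<Rightarrow> real"
  assumes "smooth f"
  shows "(f has_derivative (\<lambda>h. \<Sum>b\<in>Basis. (h \<bullet> b) * partial b f x)) (at x)"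
proof -
  have D: "(f has_derivative frechet_derivative f (at x)) (at x)"
    using assms smooth_differentiable frechet_derivative_works by blast
  then interpret bounded_linear "frechet_derivative f (at x)"
    by (rule has_derivative_bounded_linear)
  have "frechet_derivative f (at x) = (\<lambda>h. \<Sum>b\<in>Basis. (h \<bullet> b) * partial b f x)"
  proof
    fix h
    have "frechet_derivative f (at x) h = frechet_derivative f (at x) (\<Sum>b\<in>Basis. (h \<bullet> b) *\<^sub>R b)"
      by (simp add: euclidean_representation)
    then show "frechet_derivative f (at x) h = (\<Sum>b\<in>Basis. (h \<bullet> b) * partial b f x)"
      by (simp add: sum scaleR partial_def)
  qed
  with D show ?thesis by simp
qed

lemma smooth_continuous_on: "smooth f \<Longrightarrow> continuous_on A f"
  by (intro continuous_at_imp_continuous_on ballI differentiable_imp_continuous_within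
      smooth_differentiable)

lemma partial_has_derivative:
  "f differentiable (at x) \<Longrightarrow> (f has_derivative (\<lambda>b. partial b f x)) (at x)"
  by (simp add: partial_def frechet_derivative_works[symmetric])

lemma partial_add:
  assumes "f differentiable (at x)" "g differentiable (at x)"
  shows "partial b (\<lambda>x. f x + g x) x = partial b f x + partial b g x"
  by (rule partial_eq[OF has_derivative_add]) (intro partial_has_derivative assms)+

lemma partial_mult:
  fixes f g :: "'a::euclidean_space \<Rightarrow> real"
  assumes "f differentiable (at x)" "g differentiable (at x)"
  shows "partial b (\<lambda>x. f x * g x) x = f x * partial b g x + partial b f x * g x"
  by (rule partial_eq[OF has_derivative_mult]) (intro partial_has_derivative assms)+

lemma partial_comp:
  fixes g :: "real \<Rightarrow> real"
  assumes "f differentiable (at x)" "g differentiable (at (f x))"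
  shows "partial b (\<lambda>x. g (f x)) x = partial 1 g (f x) * partial b f x"
proof -
  have f: "(f has_derivative frechet_derivative f (at x)) (at x)"
    and g: "(g has_derivative frechet_derivative g (at (f x))) (at (f x))"
    using assms by (simp_all add: frechet_derivative_works[symmetric])
  interpret g: bounded_linear "frechet_derivative g (at (f x))"
    using g by (rule has_derivative_bounded_linear)
  have "partial b (\<lambda>x. g (f x)) x = frechet_derivative g (at (f x)) (frechet_derivative f (at x) b)"
    by (rule partial_eq[OF has_derivative_compose[OF f g]])
  also have "\<dots> = frechet_derivative f (at x) b * frechet_derivative g (at (f x)) 1"
    by (metis g.scaleR mult.right_neutral real_scaleR_def)
  finally show ?thesis by (simp add: partial_def)
qed

lemma partial_inverse:
  fixes f :: "'a::euclidean_space \<Rightarrow> real"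
  assumes "f differentiable (at x)" "f x \<noteq> 0"
  shows "partial b (\<lambda>x. inverse (f x)) x = - 1 * (partial b f x * (inverse (f x) * inverse (f x)))"
proof -
  have f: "(f has_derivative frechet_derivative f (at x)) (at x)"
    using assms by (simp add: frechet_derivative_works[symmetric])
  show ?thesis
    using partial_eq[OF Deriv.has_derivative_inverse[OF assms(2) f], of b] by (simp add: partial_def)
qed

text \<open>The closure of the smooth functions under the operations whose derivatives stay inside the
  closure; a coinduction then shows that nothing new has been added.\<close>

inductive smooth_gen :: "('a::euclidean_space \<Rightarrow> real) \<Rightarrow> ('a \<Rightarrow> real) \<Rightarrow> bool" for f0 where
  base: "smooth f \<Longrightarrow> smooth_gen f0 f"
| add: "smooth_gen f0 f \<Longrightarrow> smooth_gen f0 g \<Longrightarrow> smooth_gen f0 (\<lambda>x. f x + g x)"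
| mult: "smooth_gen f0 f \<Longrightarrow> smooth_gen f0 g \<Longrightarrow> smooth_gen f0 (\<lambda>x. f x * g x)"
| comp: "smooth f0 \<Longrightarrow> smooth (g :: real \<Rightarrow> real) \<Longrightarrow> smooth_gen f0 (\<lambda>x. g (f0 x))"
| inv: "smooth f0 \<Longrightarrow> (\<And>x. f0 x \<noteq> 0) \<Longrightarrow> smooth_gen f0 (\<lambda>x. inverse (f0 x))"

lemma smooth_const [simp]: "smooth (\<lambda>x::'a::euclidean_space. c)"
proof (rule smooth_coinduct[where S = "range (\<lambda>c (x::'a). c)"])
  fix g :: "'a \<Rightarrow> real" assume "g \<in> range (\<lambda>c x. c)"
  then obtain c where g: "g = (\<lambda>x. c)" by blast
  have "partial b g = (\<lambda>x. 0)" for b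
    unfolding g by (rule ext, rule partial_eq) (rule has_derivative_const)
  then show "g differentiable_on UNIV \<and> (\<forall>b\<in>Basis. partial b g \<in> range (\<lambda>c x. c))"
    using g by simp
qed auto

lemma partial_const [simp]: "partial b (\<lambda>x. c) = (\<lambda>x. 0)"
  by (rule ext, rule partial_eq) (rule has_derivative_const)

text \<open>The rules \<open>comp\<close> and \<open>inv\<close> act on the fixed \<open>f0\<close>
  alone. The chain rule then produces \<open>partial b f0\<close>, a base case, times functions that
  are generated already, so the set is closed under \<open>partial\<close>.\<close>

lemma smooth_gen_smooth:
  assumes "smooth_gen f0 f" shows "smooth f"
proof (rule smooth_coinduct[where S = "Collect (smooth_gen f0)"])
  fix f assume "f \<in> Collect (smooth_gen f0)"
  then have "smooth_gen f0 f" by simp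
  then have "(\<forall>x. f differentiable (at x)) \<and> (\<forall>b\<in>Basis. smooth_gen f0 (partial b f))"
  proof induction
    case (base f)
    then show ?case by (simp add: smooth_differentiable smooth_partial smooth_gen.base)
  next
    case (add f g)
    then have "partial b (\<lambda>x. f x + g x) = (\<lambda>x. partial b f x + partial b g x)" for b
      by (simp add: partial_add fun_eq_iff)
    with add show ?case by (auto intro: smooth_gen.add)
  next
    case (mult f g)
    then have "partial b (\<lambda>x. f x * g x) = (\<lambda>x. f x * partial b g x + partial b f x * g x)" for b
      by (simp add: partial_mult fun_eq_iff)
    with mult show ?case
      by (auto intro!: smooth_gen.add[of f0 "\<lambda>x. f x * partial _ g x"] smooth_gen.mult)
  next
    case (comp g)
    then have "partial b (\<lambda>x. g (f0 x)) = (\<lambda>x. partial 1 g (f0 x) * partial b f0 x)" for b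
      by (simp add: partial_comp fun_eq_iff smooth_differentiable)
    moreover have "(\<lambda>x. g (f0 x)) differentiable (at x)" for x
      using differentiable_chain_at[of f0 x g, OF smooth_differentiable smooth_differentiable] comp
      by (simp add: o_def)
    ultimately show ?case
      using comp by (auto intro!: smooth_gen.mult smooth_gen.comp smooth_gen.base[of "partial _ f0"]
        smooth_partial)
  next
    case inv
    then have P: "partial b (\<lambda>x. inverse (f0 x)) =
        (\<lambda>x. - 1 * (partial b f0 x * (inverse (f0 x) * inverse (f0 x))))" for b
      by (simp add: partial_inverse fun_eq_iff smooth_differentiable)
    moreover have "(\<lambda>x. inverse (f0 x)) differentiable (at x)" for x
      using inv by (intro differentiable_inverse smooth_differentiable)
    ultimately show ?case
    proof (intro conjI allI ballI)
      fix b :: 'a assume "b \<in> Basis"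
      with inv show "smooth_gen f0 (partial b (\<lambda>x. inverse (f0 x)))"
        unfolding P
        by (intro smooth_gen.mult smooth_gen.inv smooth_gen.base[of "partial _ f0"]
          smooth_gen.base[of "\<lambda>x. - 1"] smooth_const smooth_partial)
    qed
  qed
  then show "f differentiable_on UNIV \<and> (\<forall>b\<in>Basis. partial b f \<in> Collect (smooth_gen f0))"
    by (simp add: differentiable_on_def)
qed (use assms in auto)

lemma smooth_add [intro]: "smooth f \<Longrightarrow> smooth g \<Longrightarrow> smooth (\<lambda>x. f x + g x)"
  by (rule smooth_gen_smooth[OF smooth_gen.add]) (auto intro: smooth_gen.base)

lemma smooth_mult [intro]: "smooth f \<Longrightarrow> smooth g \<Longrightarrow> smooth (\<lambda>x. f x * g x)"
  by (rule smooth_gen_smooth[OF smooth_gen.mult]) (auto intro: smooth_gen.base)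

lemma smooth_comp: "smooth f \<Longrightarrow> smooth (g :: real \<Rightarrow> real) \<Longrightarrow> smooth (\<lambda>x. g (f x))"
  by (rule smooth_gen_smooth[OF smooth_gen.comp])

lemma smooth_inverse: "smooth f \<Longrightarrow> (\<And>x. f x \<noteq> 0) \<Longrightarrow> smooth (\<lambda>x. inverse (f x))"
  by (rule smooth_gen_smooth[OF smooth_gen.inv])

lemma smooth_minus [intro]: "smooth f \<Longrightarrow> smooth (\<lambda>x. - f x)"
  using smooth_mult[of "\<lambda>_. -1" f] by simp

lemma smooth_diff [intro]: "smooth f \<Longrightarrow> smooth g \<Longrightarrow> smooth (\<lambda>x. f x - g x)"
  using smooth_add[of f "\<lambda>x. - g x"] by auto

lemma smooth_sum: "(\<And>i. i \<in> I \<Longrightarrow> smooth (f i)) \<Longrightarrow> smooth (\<lambda>x. \<Sum>i\<in>I. f i x)"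
  by (induction I rule: infinite_finite_induct) auto

lemma smooth_prod: "(\<And>i. i \<in> I \<Longrightarrow> smooth (f i)) \<Longrightarrow> smooth (\<lambda>x. \<Prod>i\<in>I. f i x)"
  by (induction I rule: infinite_finite_induct) auto

lemma smooth_inner: "smooth (\<lambda>x::'a::euclidean_space. x \<bullet> a)"
proof (rule smooth_coinduct[where S = "insert (\<lambda>x. x \<bullet> a) (range (\<lambda>c (x::'a). c))"])
  fix g :: "'a \<Rightarrow> real" assume g: "g \<in> insert (\<lambda>x. x \<bullet> a) (range (\<lambda>c (x::'a). c))"
  have "partial b (\<lambda>x. x \<bullet> a) = (\<lambda>x. b \<bullet> a)" for b
    by (rule ext, rule partial_eq) (auto intro!: derivative_eq_intros)
  with g show "g differentiable_on UNIV \<and>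
      (\<forall>b\<in>Basis. partial b g \<in> insert (\<lambda>x. x \<bullet> a) (range (\<lambda>c (x::'a). c)))"
    by (auto simp: differentiable_on_def intro!: differentiableI derivative_eq_intros)
qed auto

lemma smooth_real_polynomial_function: "real_polynomial_function p \<Longrightarrow> smooth p"
proof (induction rule: real_polynomial_function.induct)
  case (linear f)
  then interpret bounded_linear f .
  have "f = (\<lambda>x. \<Sum>b\<in>Basis. (x \<bullet> b) * f b)"
  proof
    fix x
    have "f x = f (\<Sum>b\<in>Basis. (x \<bullet> b) *\<^sub>R b)" by (simp add: euclidean_representation)
    then show "f x = (\<Sum>b\<in>Basis. (x \<bullet> b) * f b)" by (simp add: sum scaleR)
  qed
  moreover have "smooth (\<lambda>x. \<Sum>b\<in>Basis. (x \<bullet> b) * f b)"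
    by (intro smooth_sum smooth_mult smooth_inner smooth_const)
  ultimately show ?case by simp
qed auto

lemma partials_add:
  assumes "smooth f" "smooth g" "set bs \<subseteq> Basis"
  shows "partials bs (\<lambda>x. f x + g x) = (\<lambda>x. partials bs f x + partials bs g x)"
  using assms(3)
proof (induction bs)
  case (Cons b bs)
  then have "partials bs f differentiable (at x)" "partials bs g differentiable (at x)" for x
    using assms smooth_partials_differentiable by auto
  then have "partial b (\<lambda>x. partials bs f x + partials bs g x) = (\<lambda>x. partials (b # bs) f x + partials (b # bs) g x)"
    by (intro ext) (simp only: partial_add partials_Cons)
  with Cons show ?case by (simp only: partials_Cons) auto
qed simp

lemma partials_cmult:
  assumes "smooth f" "set bs \<subseteq> Basis"
  shows "partials bs (\<lambda>x. c * f x) = (\<lambda>x. c * partials bs f x)"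
  using assms(2)
proof (induction bs)
  case (Cons b bs)
  then have "partials bs f differentiable (at x)" for x
    using assms smooth_partials_differentiable by auto
  then have "partial b (\<lambda>x. c * partials bs f x) = (\<lambda>x. c * partials (b # bs) f x)"
    by (intro ext) (simp add: partial_mult)
  with Cons show ?case by (simp only: partials_Cons) auto
qed simp

lemma partials_diff:
  assumes "smooth f" "smooth g" "set bs \<subseteq> Basis"
  shows "partials bs (\<lambda>x. f x - g x) = (\<lambda>x. partials bs f x - partials bs g x)"
  using partials_add[of f "\<lambda>x. -1 * g x" bs] partials_cmult[of g bs "-1"] assms by auto

lemma partials_zero [simp]: "partials bs (\<lambda>x. 0) = (\<lambda>x. 0)"
  by (induction bs) simp_all

lemma partials_sum:
  assumes "\<And>i. i \<in> I \<Longrightarrow> smooth (f i)" "set bs \<subseteq> Basis"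
  shows "partials bs (\<lambda>x. \<Sum>i\<in>I. f i x) = (\<lambda>x. \<Sum>i\<in>I. partials bs (f i) x)"
  using assms(1)
proof (induction I rule: infinite_finite_induct)
  case (insert i I)
  have "partials bs (\<lambda>x. f i x + (\<Sum>i\<in>I. f i x)) =
      (\<lambda>x. partials bs (f i) x + partials bs (\<lambda>x. \<Sum>i\<in>I. f i x) x)"
    using insert.prems by (intro partials_add smooth_sum assms(2)) auto
  with insert show ?case by (simp del: partials_Cons)
qed simp_all

lemma partials_scaleR:
  assumes "smooth f" "set bs \<subseteq> Basis"
  shows "partials bs (\<lambda>x. f (c *\<^sub>R x)) = (\<lambda>x. c ^ length bs * partials bs f (c *\<^sub>R x))"
    and "smooth (\<lambda>x. f (c *\<^sub>R x))"
proof -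
  have D: "((\<lambda>x. a * g (c *\<^sub>R x)) has_derivative
      (\<lambda>h. a * (\<Sum>b\<in>Basis. ((c *\<^sub>R h) \<bullet> b) * partial b g (c *\<^sub>R x)))) (at x)"
    if "smooth g" for g :: "'a \<Rightarrow> real" and a x
    by (intro has_derivative_mult_right
      has_derivative_compose[OF _ smooth_has_derivative[OF that], of "\<lambda>x. c *\<^sub>R x" "\<lambda>h. c *\<^sub>R h"]
      derivative_eq_intros refl) auto
  have P: "partial b (\<lambda>x. a * g (c *\<^sub>R x)) = (\<lambda>x. (a * c) * partial b g (c *\<^sub>R x))"
    if "smooth g" "b \<in> Basis" for g :: "'a \<Rightarrow> real" and a b
  proof
    fix x
    have "(\<Sum>d\<in>Basis. ((c *\<^sub>R b) \<bullet> d) * partial d g (c *\<^sub>R x)) =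
        (\<Sum>d\<in>Basis. if d = b then c * partial d g (c *\<^sub>R x) else 0)"
      using that by (intro sum.cong) (auto simp: inner_Basis)
    then show "partial b (\<lambda>x. a * g (c *\<^sub>R x)) x = (a * c) * partial b g (c *\<^sub>R x)"
      using partial_eq[OF D[OF that(1)], of b a x] that(2) by simp
  qed
  show "partials bs (\<lambda>x. f (c *\<^sub>R x)) = (\<lambda>x. c ^ length bs * partials bs f (c *\<^sub>R x))"
    using assms(2)
  proof (induction bs)
    case (Cons b bs)
    then show ?case using P[of "partials bs f" b "c ^ length bs"]
      by (simp add: smooth_partials assms(1) mult_ac)
  qed simp
  \<comment> \<open>The scalar \<open>a\<close> absorbs the factor \<open>c\<close> that each
    derivative brings out.\<close>
  let ?S = "{\<lambda>x::'a. a * g (c *\<^sub>R x) | a g. smooth g}"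
  have "f (c *\<^sub>R x) = 1 * f (c *\<^sub>R x)" for x by simp
  then have "(\<lambda>x. f (c *\<^sub>R x)) \<in> ?S" using assms(1) by (simp only: mem_Collect_eq) (intro exI[of _ 1] exI[of _ f], simp)
  then show "smooth (\<lambda>x. f (c *\<^sub>R x))"
  proof (rule smooth_coinduct)
    fix h assume "h \<in> ?S"
    then obtain a g where h: "h = (\<lambda>x. a * g (c *\<^sub>R x))" and g: "smooth g" by blast
    show "h differentiable_on UNIV \<and> (\<forall>b\<in>Basis. partial b h \<in> ?S)"
    proof (intro conjI ballI)
      show "h differentiable_on UNIV"
        unfolding h differentiable_on_def using D[OF g, THEN differentiableI] by simp
      show "partial b h \<in> ?S" if "b \<in> Basis" for b
        unfolding h P[OF g that] using smooth_partial[OF g that] by blast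
    qed
  qed
qed

lemma smooth_DERIV_line:
  fixes f :: "'a::euclidean_space \<Rightarrow> real"
  assumes "smooth f" "b \<in> Basis"
  shows "((\<lambda>t. f (x + t *\<^sub>R b)) has_real_derivative partial b f (x + t *\<^sub>R b)) (at t)"
proof -
  have "((\<lambda>t. f (x + t *\<^sub>R b)) has_derivative
      (\<lambda>h. \<Sum>d\<in>Basis. ((h *\<^sub>R b) \<bullet> d) * partial d f (x + t *\<^sub>R b))) (at t)"
    by (rule has_derivative_compose[OF _ smooth_has_derivative[OF assms(1)]])
      (auto intro!: derivative_eq_intros)
  moreover have "(\<Sum>d\<in>Basis. ((h *\<^sub>R b) \<bullet> d) * partial d f (x + t *\<^sub>R b)) =
      (\<Sum>d\<in>Basis. if d = b then h * partial d f (x + t *\<^sub>R b) else 0)" for h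
    using assms(2) by (intro sum.cong) (auto simp: inner_Basis)
  ultimately show ?thesis
    using assms(2) by (simp add: has_field_derivative_def mult.commute[of _ "partial b f (x + t *\<^sub>R b)"])
qed

section \<open>Symmetry of mixed derivatives\<close>

text \<open>The one-dimensional mean value theorem is used twice: along \<open>a\<close> for the
  increment in direction \<open>b\<close>, then along \<open>b\<close> for the derivative so
  obtained.\<close>

lemma second_difference_mean_value:
  fixes f :: "'a::euclidean_space \<Rightarrow> real"
  assumes "smooth f" "a \<in> Basis" "b \<in> Basis" "h > 0"
  obtains s t where "0 \<le> s" "s \<le> h" "0 \<le> t" "t \<le> h"
    "f (x + h *\<^sub>R a + h *\<^sub>R b) - f (x + h *\<^sub>R a) - f (x + h *\<^sub>R b) + f x
      = h\<^sup>2 * partial b (partial a f) (x + s *\<^sub>R a + t *\<^sub>R b)"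
proof -
  define G where "G = (\<lambda>s. f ((x + h *\<^sub>R b) + s *\<^sub>R a) - f (x + s *\<^sub>R a))"
  have "(G has_real_derivative (partial a f ((x + h *\<^sub>R b) + s *\<^sub>R a) - partial a f (x + s *\<^sub>R a))) (at s)" for s
    unfolding G_def by (intro DERIV_diff smooth_DERIV_line assms)
  then obtain s where s: "0 < s" "s < h"
    "G h - G 0 = (h - 0) * (partial a f ((x + h *\<^sub>R b) + s *\<^sub>R a) - partial a f (x + s *\<^sub>R a))"
    using MVT2[OF \<open>h > 0\<close>, of G
      "\<lambda>s. partial a f ((x + h *\<^sub>R b) + s *\<^sub>R a) - partial a f (x + s *\<^sub>R a)"] by blast
  define H where "H = (\<lambda>t. partial a f ((x + s *\<^sub>R a) + t *\<^sub>R b))"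
  have "(H has_real_derivative partial b (partial a f) ((x + s *\<^sub>R a) + t *\<^sub>R b)) (at t)" for t
    unfolding H_def by (intro smooth_DERIV_line smooth_partial assms)
  then obtain t where t: "0 < t" "t < h"
    "H h - H 0 = (h - 0) * partial b (partial a f) ((x + s *\<^sub>R a) + t *\<^sub>R b)"
    using MVT2[OF \<open>h > 0\<close>, of H "\<lambda>t. partial b (partial a f) ((x + s *\<^sub>R a) + t *\<^sub>R b)"] by blast
  have "G h - G 0 = h * (H h - H 0)"
    using s(3) unfolding H_def by (simp add: add_ac)
  also have "\<dots> = h\<^sup>2 * partial b (partial a f) (x + s *\<^sub>R a + t *\<^sub>R b)"
    using t(3) by (simp add: power2_eq_square)
  finally show ?thesis
    using that[of s t] s t by (auto simp: G_def algebra_simps)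
qed

text \<open>The second difference is symmetric in \<open>a\<close> and \<open>b\<close>, so both
  mixed derivatives take a common value at points arbitrarily close to x. Both are continuous, which
  rules out a gap at x itself.\<close>

lemma partial_commute:
  fixes f :: "'a::euclidean_space \<Rightarrow> real"
  assumes "smooth f" "a \<in> Basis" "b \<in> Basis"
  shows "partial a (partial b f) = partial b (partial a f)"
proof
  fix x
  let ?A = "partial a (partial b f)" and ?B = "partial b (partial a f)"
  show "?A x = ?B x"
  proof (rule ccontr)
    assume ne: "?A x \<noteq> ?B x"
    define e where "e = \<bar>?A x - ?B x\<bar> / 2"
    have e: "e > 0" using ne by (simp add: e_def)
    have sm: "smooth ?A" "smooth ?B"
      using assms by (simp_all add: smooth_partial)
    have "isCont ?A x" "isCont ?B x"
      using smooth_continuous_on[OF sm(1), of UNIV] smooth_continuous_on[OF sm(2), of UNIV]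
      by (simp_all add: continuous_on_eq_continuous_at)
    then obtain d1 d2 where d: "d1 > 0" "\<And>y. dist y x < d1 \<Longrightarrow> dist (?A y) (?A x) < e"
      "d2 > 0" "\<And>y. dist y x < d2 \<Longrightarrow> dist (?B y) (?B x) < e"
      unfolding continuous_at_eps_delta using e that by blast
    \<comment> \<open>The intermediate points have distance at most \<open>2 * h\<close> from x and
      so lie inside both continuity radii.\<close>
    define h where "h = min d1 d2 / 4"
    have h: "h > 0" "2 * h < d1" "2 * h < d2" using d by (auto simp: h_def)
    obtain s t where st: "0 \<le> s" "s \<le> h" "0 \<le> t" "t \<le> h"
      "f (x + h *\<^sub>R a + h *\<^sub>R b) - f (x + h *\<^sub>R a) - f (x + h *\<^sub>R b) + f x
        = h\<^sup>2 * ?B (x + s *\<^sub>R a + t *\<^sub>R b)"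
      using second_difference_mean_value[OF assms h(1)] by metis
    obtain s' t' where st': "0 \<le> s'" "s' \<le> h" "0 \<le> t'" "t' \<le> h"
      "f (x + h *\<^sub>R b + h *\<^sub>R a) - f (x + h *\<^sub>R b) - f (x + h *\<^sub>R a) + f x
        = h\<^sup>2 * ?A (x + s' *\<^sub>R b + t' *\<^sub>R a)"
      using second_difference_mean_value[OF assms(1,3,2) h(1)] by metis
    have "h\<^sup>2 * ?B (x + s *\<^sub>R a + t *\<^sub>R b) = h\<^sup>2 * ?A (x + s' *\<^sub>R b + t' *\<^sub>R a)"
      using st(5) st'(5) by (simp only: add.assoc[of x] add.commute[of "h *\<^sub>R b"])
    then have eq: "?B (x + s *\<^sub>R a + t *\<^sub>R b) = ?A (x + s' *\<^sub>R b + t' *\<^sub>R a)"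
      using h by simp
    have n: "norm (p *\<^sub>R c + q *\<^sub>R d) \<le> 2 * h"
      if "c \<in> Basis" "d \<in> Basis" "0 \<le> p" "p \<le> h" "0 \<le> q" "q \<le> h" for c d :: 'a and p q
      using norm_triangle_ineq[of "p *\<^sub>R c" "q *\<^sub>R d"] that by simp
    have "dist (x + s *\<^sub>R a + t *\<^sub>R b) x < d2" "dist (x + s' *\<^sub>R b + t' *\<^sub>R a) x < d1"
      using n[of a b s t] n[of b a s' t'] st st' h assms by (auto simp: dist_norm add.assoc)
    then have "dist (?B (x + s *\<^sub>R a + t *\<^sub>R b)) (?B x) < e"
      "dist (?A (x + s' *\<^sub>R b + t' *\<^sub>R a)) (?A x) < e" using d by auto
    then show False unfolding eq e_def dist_real_def by argo
  qed
qed

lemma partials_partial_commute: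
  assumes "smooth f" "set bs \<subseteq> Basis" "b \<in> Basis"
  shows "partials bs (partial b f) = partial b (partials bs f)"
  using assms(2)
  by (induction bs) (auto simp: partial_commute smooth_partials assms)

lemma partials_commute:
  assumes "smooth f" "set bs \<subseteq> Basis" "set cs \<subseteq> Basis"
  shows "partials bs (partials cs f) = partials cs (partials bs f)"
  using assms(3)
  by (induction cs) (auto simp: partials_partial_commute smooth_partials assms)

subsection \<open>Cutoff functions\<close>

text \<open>The case k = 0 is the classical flat function exp(-1/t). The powers of 1/t are included
  because differentiation stays in the linear span of this family, which is what the coinduction
  needs.\<close>

definition flat_power :: "nat \<Rightarrow> real \<Rightarrow> real" where
  "flat_power k t = (if t > 0 then inverse t ^ k * exp (- inverse t) else 0)"

lemma flat_power_tendsto_0: "(flat_power k \<longlongrightarrow> 0) (at_right 0)"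
proof -
  have "((\<lambda>y::real. y ^ k / exp y) \<longlongrightarrow> 0) at_top"
    by (rule tendsto_power_div_exp_0)
  then have "((\<lambda>t::real. inverse t ^ k / exp (inverse t)) \<longlongrightarrow> 0) (at_right 0)"
    by (rule filterlim_compose) (rule filterlim_inverse_at_top_right)
  then show ?thesis
    by (rule Lim_transform_eventually)
      (auto simp: flat_power_def exp_minus field_simps eventually_at_right_field intro!: exI[of _ 1])
qed

lemma DERIV_flat_power:
  "(flat_power k has_real_derivative (flat_power (k + 2) t - real k * flat_power (k + 1) t)) (at t)"
proof -
  consider "t > 0" | "t < 0" | "t = 0" by linarith
  then show ?thesis
  proof cases
    case 1
    have "((\<lambda>t. inverse t ^ k * exp (- inverse t)) has_real_derivative
        (flat_power (k + 2) t - real k * flat_power (k + 1) t)) (at t)"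
    proof (cases k)
      case 0
      then show ?thesis using 1
        by (auto intro!: derivative_eq_intros simp: flat_power_def power2_eq_square)
    next
      case (Suc j)
      then show ?thesis using 1
        by (auto intro!: derivative_eq_intros simp: flat_power_def power2_eq_square algebra_simps)
          (metis One_nat_def Suc_pred neq0_conv power_Suc)
    qed
    then show ?thesis
      by (rule has_field_derivative_transform_within_open[where S = "{0<..}"])
        (use 1 in \<open>auto simp: flat_power_def\<close>)
  next
    case 2
    have "((\<lambda>t. 0) has_real_derivative 0) (at t)" by simp
    then have "(flat_power k has_real_derivative 0) (at t)"
      by (rule has_field_derivative_transform_within_open[where S = "{..<0}"])
        (use 2 in \<open>auto simp: flat_power_def\<close>)
    with 2 show ?thesis by (simp add: flat_power_def)
  next
    case 3
    \<comment> \<open>At the origin the difference quotient is \<open>flat_power (k + 1)\<close>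
      from the right and zero from the left.\<close>
    have r: "((\<lambda>y. flat_power k y / y) \<longlongrightarrow> 0) (at_right 0)"
      by (rule Lim_transform_eventually[OF flat_power_tendsto_0[of "k + 1"]])
        (auto simp: flat_power_def field_simps eventually_at_right_field intro!: exI[of _ 1])
    have l: "((\<lambda>y. flat_power k y / y) \<longlongrightarrow> 0) (at_left 0)"
      by (rule Lim_transform_eventually[OF tendsto_const])
        (auto simp: flat_power_def eventually_at_left_field intro!: exI[of _ "-1"])
    have "((\<lambda>y. flat_power k y / y) \<longlongrightarrow> 0) (at 0)"
      using l r by (simp add: filterlim_split_at)
    then have "(flat_power k has_real_derivative 0) (at 0)"
      by (simp add: has_field_derivative_iff flat_power_def)
    with 3 show ?thesis by (simp add: flat_power_def)
  qed
qed

inductive flat_span :: "(real \<Rightarrow> real) \<Rightarrow> bool" where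
  base: "flat_span (flat_power k)"
| lin: "flat_span f \<Longrightarrow> flat_span g \<Longrightarrow> flat_span (\<lambda>x. f x + c * g x)"

lemma smooth_flat_power: "smooth (flat_power k)"
proof (rule smooth_coinduct[where S = "Collect flat_span"])
  fix f assume "f \<in> Collect flat_span"
  then have "flat_span f" by simp
  then have "\<exists>f'. flat_span f' \<and> (\<forall>x. (f has_real_derivative f' x) (at x))"
  proof induction
    case (base k)
    show ?case
      using DERIV_flat_power[of k] flat_span.lin[OF flat_span.base[of "k+2"] flat_span.base[of "k+1"], of "- real k"]
      by auto
  next
    case (lin f g c)
    then obtain f' g' where "flat_span f'" "flat_span g'"
      "\<And>x. (f has_real_derivative f' x) (at x)" "\<And>x. (g has_real_derivative g' x) (at x)"
      by blast
    then show ?case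
      by (intro exI[of _ "\<lambda>x. f' x + c * g' x"])
        (auto intro!: flat_span.lin derivative_eq_intros)
  qed
  then obtain f' where f': "flat_span f'" "\<And>x. (f has_real_derivative f' x) (at x)" by blast
  have "partial 1 f = f'"
    by (rule ext, subst partial_eq[OF f'(2)[unfolded has_field_derivative_def]]) simp
  moreover have "f differentiable_on UNIV"
    using f' by (auto simp: differentiable_on_def intro!: differentiableI
      dest: has_field_derivative_imp_has_derivative)
  ultimately show "f differentiable_on UNIV \<and> (\<forall>b\<in>Basis. partial b f \<in> Collect flat_span)"
    using f' by simp
qed (auto intro: flat_span.base)

definition smooth_step :: "real \<Rightarrow> real" where
  "smooth_step t = flat_power 0 t * inverse (flat_power 0 t + flat_power 0 (1 - t))"

text \<open>For every t one of t and 1 - t is positive, so the denominator in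
  \<open>smooth_step\<close> never vanishes.\<close>

lemma smooth_step:
  shows "smooth smooth_step" "t \<le> 0 \<Longrightarrow> smooth_step t = 0" "t \<ge> 1 \<Longrightarrow> smooth_step t = 1"
    "0 \<le> smooth_step t" "smooth_step t \<le> 1"
proof -
  have pos: "flat_power 0 t + flat_power 0 (1 - t) > 0" for t
    by (auto simp: flat_power_def add_pos_pos)
  have ge: "flat_power 0 t \<ge> 0" for t by (simp add: flat_power_def)
  have "smooth (\<lambda>t. flat_power 0 (1 - t))"
    by (rule smooth_comp[OF _ smooth_flat_power])
      (use smooth_diff[OF smooth_const[of 1] smooth_inner[of "1::real"]] in simp)
  then show "smooth smooth_step"
    unfolding smooth_step_def using pos
    by (intro smooth_mult smooth_inverse smooth_add smooth_flat_power less_imp_neq[THEN not_sym])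
  show "t \<le> 0 \<Longrightarrow> smooth_step t = 0" by (simp add: smooth_step_def flat_power_def)
  show "t \<ge> 1 \<Longrightarrow> smooth_step t = 1" by (simp add: smooth_step_def flat_power_def)
  show "0 \<le> smooth_step t" "smooth_step t \<le> 1"
    using pos[of t] ge[of t] ge[of "1 - t"] by (auto simp: smooth_step_def field_simps)
qed

text \<open>Any compact set containing the non-zero set can stand in for the closed support, so
  later constructions need not compute closures.\<close>

lemma test_functionsI:
  assumes "smooth \<phi>" "compact C" "C \<subseteq> U" "\<And>x. x \<notin> C \<Longrightarrow> \<phi> x = 0"
  shows "\<phi> \<in> test_functions U"
proof -
  have "{x. \<phi> x \<noteq> 0} \<subseteq> C" using assms(4) by blast
  then have "closure {x. \<phi> x \<noteq> 0} \<subseteq> C"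
    using assms(2) by (simp add: closure_minimal compact_imp_closed)
  then show ?thesis
    using assms by (auto simp: test_functions_def compact_closure intro: bounded_subset[OF compact_imp_bounded])
qed

lemma test_functionsE:
  assumes "\<phi> \<in> test_functions U"
  obtains C where "smooth \<phi>" "compact C" "C \<subseteq> U" "\<And>x. x \<notin> C \<Longrightarrow> \<phi> x = 0"
proof (rule that[of "closure {x. \<phi> x \<noteq> 0}"])
  show "\<phi> x = 0" if "x \<notin> closure {x. \<phi> x \<noteq> 0}" for x
    using that closure_subset[of "{x. \<phi> x \<noteq> 0}"] by blast
qed (use assms in \<open>simp_all add: test_functions_def\<close>)

lemma cutoff_ball_exists:
  assumes "R > 0"
  obtains \<eta> :: "'a::euclidean_space \<Rightarrow> real" where "smooth \<eta>"
    "\<And>x. norm x \<le> R \<Longrightarrow> \<eta> x = 1" "\<And>x. norm x \<ge> R + 1 \<Longrightarrow> \<eta> x = 0"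
proof
  \<comment> \<open>\<open>(R + 1)\<^sup>2 - (norm x)\<^sup>2\<close> is at least 2R + 1 on the ball
    of radius R and at most 0 outside radius R + 1. The squared norm is used because it is a
    polynomial, hence smooth at the origin too.\<close>
  define \<eta> :: "'a \<Rightarrow> real" where
    "\<eta> = (\<lambda>x. smooth_step (inverse (2 * R + 1) * ((R + 1)\<^sup>2 - (\<Sum>b\<in>Basis. (x \<bullet> b) * (x \<bullet> b)))))"
  show "smooth \<eta>" unfolding \<eta>_def
    by (rule smooth_comp[OF _ smooth_step(1)])
      (intro smooth_mult smooth_diff smooth_const smooth_sum smooth_inner)
  have n: "(\<Sum>b\<in>Basis. (x \<bullet> b) * (x \<bullet> b)) = (norm x)\<^sup>2" for x :: 'a
    by (simp add: power2_norm_eq_inner euclidean_inner[symmetric])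
  show "\<eta> x = 1" if "norm x \<le> R" for x
    unfolding \<eta>_def n
  proof (rule smooth_step(3))
    have "(norm x)\<^sup>2 \<le> R\<^sup>2" using that by (simp add: power_mono)
    then show "inverse (2 * R + 1) * ((R + 1)\<^sup>2 - (norm x)\<^sup>2) \<ge> 1"
      using assms by (simp add: field_simps power2_eq_square)
  qed
  show "\<eta> x = 0" if "norm x \<ge> R + 1" for x
    unfolding \<eta>_def n
  proof (rule smooth_step(2))
    have "(R + 1)\<^sup>2 \<le> (norm x)\<^sup>2" using that assms by (simp add: power_mono)
    then show "inverse (2 * R + 1) * ((R + 1)\<^sup>2 - (norm x)\<^sup>2) \<le> 0"
      using assms by (simp add: mult_nonneg_nonpos)
  qed
qed

subsection \<open>Test functions and integration by parts\<close>

text \<open>Derivatives depend only on germs. This is how derivatives are seen to vanish off a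
  support.\<close>

lemma partials_local:
  assumes "open S" "\<And>y. y \<in> S \<Longrightarrow> f y = g y" "x \<in> S"
  shows "partials bs f x = partials bs g x"
  using assms(3)
proof (induction bs arbitrary: x)
  case (Cons b bs)
  have "(partials bs f has_derivative F) (at x) \<longleftrightarrow> (partials bs g has_derivative F) (at x)" for F
    using Cons assms(1)
    by (auto intro: has_derivative_transform_within_open[where s = S])
  then show ?case by (simp add: partial_def frechet_derivative_def)
qed (use assms in auto)

lemma test_functions_mono: "U \<subseteq> V \<Longrightarrow> \<phi> \<in> test_functions U \<Longrightarrow> \<phi> \<in> test_functions V"
  by (auto simp: test_functions_def)

lemma test_functions_smooth: "\<phi> \<in> test_functions U \<Longrightarrow> smooth \<phi>"
  by (simp add: test_functions_def)

lemma test_functions_partials: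
  assumes "\<phi> \<in> test_functions U" "set bs \<subseteq> Basis"
  shows "partials bs \<phi> \<in> test_functions U"
proof -
  obtain C where C: "smooth \<phi>" "compact C" "C \<subseteq> U" "\<And>x. x \<notin> C \<Longrightarrow> \<phi> x = 0"
    using test_functionsE[OF assms(1)] by metis
  show ?thesis
  proof (rule test_functionsI[OF _ C(2,3)])
    show "partials bs \<phi> x = 0" if "x \<notin> C" for x
      using partials_local[of "- C" \<phi> "\<lambda>_. 0" x bs] C that
      by (simp add: compact_imp_closed open_Compl)
    show "smooth (partials bs \<phi>)" by (rule smooth_partials) (use C assms in auto)
  qed
qed

lemma test_functions_zero [simp]: "(\<lambda>x. 0) \<in> test_functions U"
  by (rule test_functionsI[of _ "{}"]) auto

lemma test_functions_add:
  assumes "\<phi> \<in> test_functions U" "\<psi> \<in> test_functions U"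
  shows "(\<lambda>x. \<phi> x + \<psi> x) \<in> test_functions U"
proof -
  obtain C where C: "smooth \<phi>" "compact C" "C \<subseteq> U" "\<And>x. x \<notin> C \<Longrightarrow> \<phi> x = 0"
    using test_functionsE[OF assms(1)] by metis
  obtain D where D: "smooth \<psi>" "compact D" "D \<subseteq> U" "\<And>x. x \<notin> D \<Longrightarrow> \<psi> x = 0"
    using test_functionsE[OF assms(2)] by metis
  show ?thesis
    by (rule test_functionsI[of _ "C \<union> D"]) (use C D in auto)
qed

lemma test_functions_smooth_mult:
  assumes "\<phi> \<in> test_functions U" "smooth g"
  shows "(\<lambda>x. g x * \<phi> x) \<in> test_functions U" "(\<lambda>x. \<phi> x * g x) \<in> test_functions U"
proof -
  obtain C where C: "smooth \<phi>" "compact C" "C \<subseteq> U" "\<And>x. x \<notin> C \<Longrightarrow> \<phi> x = 0"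
    using test_functionsE[OF assms(1)] by metis
  show "(\<lambda>x. g x * \<phi> x) \<in> test_functions U"
    by (rule test_functionsI[of _ C]) (use C assms in auto)
  then show "(\<lambda>x. \<phi> x * g x) \<in> test_functions U" by (simp add: mult.commute)
qed

lemma test_functions_cmult:
  "\<phi> \<in> test_functions U \<Longrightarrow> (\<lambda>x. c * \<phi> x) \<in> test_functions U"
  by (rule test_functions_smooth_mult) auto

lemma test_functions_lin:
  "\<phi> \<in> test_functions U \<Longrightarrow> \<psi> \<in> test_functions U \<Longrightarrow> (\<lambda>x. a * \<phi> x + b * \<psi> x) \<in> test_functions U"
  by (intro test_functions_add test_functions_cmult)

lemma test_functions_diff:
  "\<phi> \<in> test_functions U \<Longrightarrow> \<psi> \<in> test_functions U \<Longrightarrow> (\<lambda>x. \<phi> x - \<psi> x) \<in> test_functions U"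
  using test_functions_lin[of \<phi> U \<psi> 1 "-1"] by simp

lemma test_functions_sum:
  "(\<And>i. i \<in> I \<Longrightarrow> f i \<in> test_functions U) \<Longrightarrow> (\<lambda>x. \<Sum>i\<in>I. f i x) \<in> test_functions U"
  by (induction I rule: infinite_finite_induct) (auto intro: test_functions_add)

lemma test_functions_scaleR:
  assumes "\<phi> \<in> test_functions U" "c \<noteq> 0"
  shows "(\<lambda>x. \<phi> (c *\<^sub>R x)) \<in> test_functions ((\<lambda>x. x /\<^sub>R c) ` U)"
proof -
  obtain C where C: "smooth \<phi>" "compact C" "C \<subseteq> U" "\<And>x. x \<notin> C \<Longrightarrow> \<phi> x = 0"
    using test_functionsE[OF assms(1)] by metis
  show ?thesis
  proof (rule test_functionsI[of _ "(\<lambda>x. x /\<^sub>R c) ` C"])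
    show "smooth (\<lambda>x. \<phi> (c *\<^sub>R x))" using partials_scaleR(2)[of \<phi> "[]" c] C by simp
    show "compact ((\<lambda>x. x /\<^sub>R c) ` C)" using C by (simp add: compact_scaling)
    show "\<phi> (c *\<^sub>R x) = 0" if "x \<notin> (\<lambda>x. x /\<^sub>R c) ` C" for x
    proof (rule C(4))
      show "c *\<^sub>R x \<notin> C"
        using that assms(2) by (auto simp: image_iff dest: bspec[of _ _ "c *\<^sub>R x"])
    qed
  qed (use C in auto)
qed

lemma continuous_compact_support_integrable:
  fixes f :: "'a::euclidean_space \<Rightarrow> real"
  assumes "continuous_on UNIV f" "compact C" "\<And>x. x \<notin> C \<Longrightarrow> f x = 0"
  shows "integrable lborel f" "integrable lebesgue f"
proof -
  have "integrable lborel (\<lambda>x. indicator C x *\<^sub>R f x)"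
    by (rule borel_integrable_compact[OF assms(2) continuous_on_subset[OF assms(1)]]) auto
  moreover have "(\<lambda>x. indicator C x *\<^sub>R f x) = f"
    using assms(3) by (auto simp: fun_eq_iff indicator_def)
  ultimately show "integrable lborel f" by simp
  then show "integrable lebesgue f"
    using integrable_completion[of f lborel] by (simp add: borel_measurable_integrable)
qed

lemma continuous_borel_lebesgue:
  fixes f :: "'a::euclidean_space \<Rightarrow> real"
  assumes "continuous_on UNIV f" shows "f \<in> borel_measurable lebesgue"
  using borel_measurable_continuous_onI[OF assms]
  by (simp add: measurable_completion)

lemma smooth_measurable [measurable_dest]:
  "smooth f \<Longrightarrow> f \<in> borel_measurable lebesgue"
  by (intro continuous_borel_lebesgue smooth_continuous_on)

lemma test_functions_integrable:
  assumes "\<phi> \<in> test_functions U"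
  shows "integrable lborel \<phi>" "integrable lebesgue \<phi>"
proof -
  obtain C where C: "smooth \<phi>" "compact C" "C \<subseteq> U" "\<And>x. x \<notin> C \<Longrightarrow> \<phi> x = 0"
    using test_functionsE[OF assms(1)] by metis
  then show "integrable lborel \<phi>" "integrable lebesgue \<phi>"
    using continuous_compact_support_integrable[of \<phi> C] smooth_continuous_on by auto
qed

lemma test_functions_bounded:
  assumes "\<phi> \<in> test_functions U"
  obtains B where "B > 0" "\<And>x. \<bar>\<phi> x\<bar> \<le> B"
proof -
  obtain C where C: "smooth \<phi>" "compact C" "C \<subseteq> U" "\<And>x. x \<notin> C \<Longrightarrow> \<phi> x = 0"
    using test_functionsE[OF assms(1)] by metis
  then have "bounded (\<phi> ` C)"
    by (intro compact_imp_bounded compact_continuous_image smooth_continuous_on)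
  then obtain B where B: "\<And>x. x \<in> C \<Longrightarrow> \<bar>\<phi> x\<bar> \<le> B"
    by (auto simp: bounded_iff)
  have "\<bar>\<phi> x\<bar> \<le> max B 1" for x
    using B[of x] C(4)[of x] by (cases "x \<in> C") auto
  then show ?thesis by (intro that[of "max B 1"]) auto
qed

lemma integral_translation:
  fixes f :: "'a::euclidean_space \<Rightarrow> real"
  assumes "f \<in> borel_measurable borel"
  shows "(LINT x|lborel. f (x + a)) = (LINT x|lborel. f x)"
proof -
  have "(LINT x|lborel. f x) = (LINT x|distr lborel borel ((+) a). f x)"
    by (simp add: lborel_distr_plus)
  also have "\<dots> = (LINT x|lborel. f (a + x))"
    by (rule integral_distr) (use assms in auto)
  finally show ?thesis by (simp add: add.commute)
qed

text \<open>By translation invariance all difference quotients have integral zero.\<close>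

lemma integral_partial_eq_0:
  fixes \<phi> :: "'a::euclidean_space \<Rightarrow> real"
  assumes "\<phi> \<in> test_functions U" "b \<in> Basis"
  shows "(LINT x|lebesgue. partial b \<phi> x) = 0"
proof -
  obtain C where C: "smooth \<phi>" "compact C" "C \<subseteq> U" "\<And>x. x \<notin> C \<Longrightarrow> \<phi> x = 0"
    using test_functionsE[OF assms(1)] by metis
  have p: "partial b \<phi> \<in> test_functions U"
    using test_functions_partials[OF assms(1), of "[b]"] assms by simp
  obtain B where B: "B > 0" "\<And>x. \<bar>partial b \<phi> x\<bar> \<le> B"
    using test_functions_bounded[OF p] by metis
  obtain r where r: "C \<subseteq> cball 0 r"
    using bounded_subset_ballD[OF compact_imp_bounded[OF C(2)], of 0] ball_subset_cball by blast
  define h where "h n = inverse (real (Suc n))" for n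
  have h: "0 < h n" "h n \<le> 1" for n by (auto simp: h_def field_simps)
  define q where "q n x = (\<phi> (x + h n *\<^sub>R b) - \<phi> x) / h n" for n x
  have m: "\<phi> \<in> borel_measurable borel"
    using C(1) by (intro borel_measurable_continuous_onI smooth_continuous_on)
  have mp: "partial b \<phi> \<in> borel_measurable borel"
    using test_functions_smooth[OF p] by (intro borel_measurable_continuous_onI smooth_continuous_on)
  have int0: "(LINT x|lborel. q n x) = 0" for n
  proof -
    have i: "integrable lborel \<phi>" using test_functions_integrable assms by blast
    have "integrable (distr lborel borel ((+) (h n *\<^sub>R b))) \<phi>"
      using i by (simp add: lborel_distr_plus)
    then have "integrable lborel (\<lambda>x. \<phi> (h n *\<^sub>R b + x))"
      by (subst (asm) integrable_distr_eq) (use m in auto)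
    then have "(LINT x|lborel. q n x) = ((LINT x|lborel. \<phi> (x + h n *\<^sub>R b)) - (LINT x|lborel. \<phi> x)) / h n"
      unfolding q_def using i by (simp add: add.commute)
    then show ?thesis using integral_translation[OF m] by simp
  qed
  \<comment> \<open>By the mean value theorem each quotient is a value of the derivative, hence at
    most \<open>B\<close>; as \<open>h n\<close> is at most 1, all quotients vanish outside the ball
    of radius \<open>r + 1\<close>. This gives an integrable majorant.\<close>
  have "(\<lambda>n. LINT x|lborel. q n x) \<longlonglongrightarrow> (LINT x|lborel. partial b \<phi> x)"
  proof (rule integral_dominated_convergence[where w = "\<lambda>x. B * indicator (cball 0 (r + 1)) x"])
    show "AE x in lborel. (\<lambda>n. q n x) \<longlonglongrightarrow> partial b \<phi> x"
    proof (rule AE_I2)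
      fix x
      have "((\<lambda>t. \<phi> (x + t *\<^sub>R b)) has_real_derivative partial b \<phi> (x + 0 *\<^sub>R b)) (at 0)"
        by (rule smooth_DERIV_line[OF C(1) assms(2)])
      then have "((\<lambda>t. (\<phi> (x + t *\<^sub>R b) - \<phi> x) / t) \<longlongrightarrow> partial b \<phi> x) (at 0)"
        by (simp add: has_field_derivative_iff)
      moreover have "filterlim h (at 0) sequentially"
        unfolding filterlim_at
        using h LIMSEQ_inverse_real_of_nat[folded h_def] by (auto simp: less_imp_neq[THEN not_sym])
      ultimately show "(\<lambda>n. q n x) \<longlonglongrightarrow> partial b \<phi> x"
        unfolding q_def by (rule filterlim_compose)
    qed
    show "AE x in lborel. norm (q n x) \<le> B * indicator (cball 0 (r + 1)) x" for n
    proof (rule AE_I2)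
      fix x
      show "norm (q n x) \<le> B * indicator (cball 0 (r + 1)) x"
      proof (cases "norm x \<le> r + 1")
        case True
        obtain z where "\<phi> (x + h n *\<^sub>R b) - \<phi> (x + 0 *\<^sub>R b) = (h n - 0) * partial b \<phi> (x + z *\<^sub>R b)"
          using MVT2[OF h(1)[of n], of "\<lambda>t. \<phi> (x + t *\<^sub>R b)" "\<lambda>t. partial b \<phi> (x + t *\<^sub>R b)"]
            smooth_DERIV_line[OF C(1) assms(2)] by metis
        then have "q n x = partial b \<phi> (x + z *\<^sub>R b)"
          using h[of n] by (simp add: q_def)
        then show ?thesis using B True by simp
      next
        case False
        have "norm x \<le> norm (x + h n *\<^sub>R b) + norm (h n *\<^sub>R b)"
          using norm_triangle_ineq4[of "x + h n *\<^sub>R b" "h n *\<^sub>R b"] by simp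
        then have "norm (x + h n *\<^sub>R b) > r" "norm x > r"
          using False h[of n] assms(2) by auto
        then have "\<phi> (x + h n *\<^sub>R b) = 0" "\<phi> x = 0"
          using r by (auto intro!: C(4) simp: subset_iff)
        then show ?thesis using B by (simp add: q_def)
      qed
    qed
    show "integrable lborel (\<lambda>x. B * indicator (cball 0 (r + 1)) x)"
      using emeasure_lborel_cball_finite[of 0 "r + 1"] by (intro integrable_mult_right integrable_real_indicator) auto
  qed (use m mp in \<open>auto simp: q_def[abs_def]\<close>)
  then have "(LINT x|lborel. partial b \<phi> x) = 0"
    using int0 by (simp add: LIMSEQ_const_iff)
  then show ?thesis using mp by (simp add: integral_completion)
qed

text \<open>The product of f and \<phi> is again a test function, so its derivative integrates to
  zero. Only \<phi> needs compact support.\<close>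

lemma integral_by_parts:
  assumes "smooth f" "\<phi> \<in> test_functions U" "b \<in> Basis"
  shows "(LINT x|lebesgue. f x * partial b \<phi> x) = - (LINT x|lebesgue. partial b f x * \<phi> x)"
proof -
  have p: "partial b \<phi> \<in> test_functions U"
    using test_functions_partials[OF assms(2), of "[b]"] assms by simp
  have i: "integrable lebesgue (\<lambda>x. f x * partial b \<phi> x)" "integrable lebesgue (\<lambda>x. partial b f x * \<phi> x)"
    using assms p test_functions_integrable(2)[OF test_functions_smooth_mult(1)] smooth_partial by blast+
  have "0 = (LINT x|lebesgue. partial b (\<lambda>x. f x * \<phi> x) x)"
    using integral_partial_eq_0[OF test_functions_smooth_mult(1)[OF assms(2,1)] assms(3)] by simp
  also have "\<dots> = (LINT x|lebesgue. f x * partial b \<phi> x + partial b f x * \<phi> x)"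
    using assms by (simp add: partial_mult smooth_differentiable test_functions_smooth)
  finally show ?thesis using i by simp
qed

lemma integral_by_parts_partials:
  assumes "smooth f" "\<phi> \<in> test_functions U" "set bs \<subseteq> Basis"
  shows "(LINT x|lebesgue. f x * partials bs \<phi> x)
    = (-1) ^ length bs * (LINT x|lebesgue. partials bs f x * \<phi> x)"
  using assms(1,3)
proof (induction bs arbitrary: f)
  case (Cons b bs)
  then show ?case
    using integral_by_parts[OF Cons.prems(1) test_functions_partials[OF assms(2)], of bs b]
    by (simp add: Cons.IH smooth_partial partials_partial_commute)
qed simp

subsection \<open>The energy controls all derivatives of top order\<close>

text \<open>Each mixed derivative occurs once for every ordering of its directions, so sums of
  squares over \<open>index_lists k\<close> are squared Euclidean norms of the full derivative
  tensor of order k.\<close>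

definition index_lists :: "nat \<Rightarrow> 'a::euclidean_space list set" where
  "index_lists k = {bs. set bs \<subseteq> Basis \<and> length bs = k}"

lemma finite_index_lists [simp]: "finite (index_lists k)"
  unfolding index_lists_def by (rule finite_lists_length_eq) simp

lemma index_lists_D: "bs \<in> index_lists k \<Longrightarrow> set bs \<subseteq> Basis" "bs \<in> index_lists k \<Longrightarrow> length bs = k"
  by (auto simp: index_lists_def)

lemma index_lists_0 [simp]: "index_lists 0 = {[]}"
  by (auto simp: index_lists_def)

lemma sum_index_lists_Suc:
  "(\<Sum>bs\<in>index_lists (Suc k). g bs) = (\<Sum>b\<in>Basis. \<Sum>bs\<in>index_lists k. g (b # bs))"
proof -
  have eq: "index_lists (Suc k) = (\<lambda>(b, bs). b # bs) ` (Basis \<times> index_lists k)"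
    by (force simp: index_lists_def length_Suc_conv)
  have "inj_on (\<lambda>(b, bs). b # bs) (Basis \<times> index_lists k)"
    by (auto simp: inj_on_def)
  then have "(\<Sum>bs\<in>index_lists (Suc k). g bs) = (\<Sum>(b, bs)\<in>Basis \<times> index_lists k. g (b # bs))"
    unfolding eq by (subst sum.reindex) (auto simp: split_def)
  then show ?thesis by (simp add: sum.cartesian_product)
qed

definition top_energy :: "nat \<Rightarrow> ('a::euclidean_space \<Rightarrow> real) \<Rightarrow> real" where
  "top_energy k f = (\<Sum>bs\<in>index_lists k. LINT x|lebesgue. (partials bs f x)\<^sup>2)"

lemma top_energy_nonneg [simp]: "top_energy k f \<ge> 0"
  unfolding top_energy_def by (intro sum_nonneg) simp

lemma test_functions_laplacian: "\<phi> \<in> test_functions U \<Longrightarrow> laplacian \<phi> \<in> test_functions U"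
  unfolding laplacian_def[abs_def] by (intro test_functions_sum test_functions_partials) auto

lemma partials_laplacian:
  assumes "smooth f" "set bs \<subseteq> Basis"
  shows "partials bs (laplacian f) = laplacian (partials bs f)"
proof -
  have "partials bs (laplacian f) = (\<lambda>x. \<Sum>b\<in>Basis. partials bs (partials [b, b] f) x)"
    unfolding laplacian_def[abs_def]
    by (rule partials_sum) (use assms in \<open>auto intro!: smooth_partials simp del: partials_Cons\<close>)
  also have "\<dots> = laplacian (partials bs f)"
    unfolding laplacian_def[abs_def]
    by (intro ext sum.cong refl) (use assms in \<open>simp add: partials_commute del: partials_Cons\<close>)
  finally show ?thesis .
qed

text \<open>Two integrations by parts turn the square of the mixed derivative in directions a, b
  into the product of the two pure second derivatives. The double sum of these products is the
  square of the Laplacian.\<close>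

lemma integral_hessian_eq_laplacian:
  fixes \<psi> :: "'a::euclidean_space \<Rightarrow> real"
  assumes "\<psi> \<in> test_functions U"
  shows "(\<Sum>a\<in>Basis. \<Sum>b\<in>Basis. LINT x|lebesgue. (partial a (partial b \<psi>) x)\<^sup>2)
    = (LINT x|lebesgue. (laplacian \<psi> x)\<^sup>2)"
proof -
  have t: "partials bs \<psi> \<in> test_functions U" if "set bs \<subseteq> Basis" for bs
    using test_functions_partials[OF assms that] .
  note sm = test_functions_smooth[OF t]
  have int: "integrable lebesgue (\<lambda>x. partials bs \<psi> x * partials cs \<psi> x)"
    if "set bs \<subseteq> Basis" "set cs \<subseteq> Basis" for bs cs
    using test_functions_integrable(2)[OF test_functions_smooth_mult(1)[OF t sm]] that by blast
  have "(LINT x|lebesgue. (partial a (partial b \<psi>) x)\<^sup>2)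
      = (LINT x|lebesgue. partials [a, a] \<psi> x * partials [b, b] \<psi> x)"
    if "a \<in> Basis" "b \<in> Basis" for a b
  proof -
    have "(LINT x|lebesgue. (partial a (partial b \<psi>) x)\<^sup>2)
        = (LINT x|lebesgue. partials [a, b] \<psi> x * partial a (partials [b] \<psi>) x)"
      by (simp add: power2_eq_square)
    also have "\<dots> = - (LINT x|lebesgue. partial a (partials [a, b] \<psi>) x * partials [b] \<psi> x)"
      using that by (intro integral_by_parts[OF sm t]) auto
    \<comment> \<open>Commuting the derivatives brings \<open>b\<close> outermost, ready for the
      second integration by parts.\<close>
    also have "(\<lambda>x. partial a (partials [a, b] \<psi>) x * partials [b] \<psi> x)
        = (\<lambda>x. partials [b] \<psi> x * partial b (partials [a, a] \<psi>) x)"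
      using that partials_partial_commute[OF test_functions_smooth[OF assms], of "[a, a]" b]
      by (simp add: mult.commute)
    also have "- (LINT x|lebesgue. partials [b] \<psi> x * partial b (partials [a, a] \<psi>) x)
        = (LINT x|lebesgue. partial b (partials [b] \<psi>) x * partials [a, a] \<psi> x)"
      using that by (subst integral_by_parts[OF sm t]) auto
    finally show ?thesis by (simp add: mult.commute)
  qed
  then have "(\<Sum>a\<in>Basis. \<Sum>b\<in>Basis. LINT x|lebesgue. (partial a (partial b \<psi>) x)\<^sup>2)
      = (\<Sum>a\<in>Basis. \<Sum>b\<in>Basis. LINT x|lebesgue. partials [a, a] \<psi> x * partials [b, b] \<psi> x)"
    by (intro sum.cong refl) auto
  also have "\<dots> = (LINT x|lebesgue. (\<Sum>a\<in>Basis. \<Sum>b\<in>Basis. partials [a, a] \<psi> x * partials [b, b] \<psi> x))"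
    using int by (subst Bochner_Integration.integral_sum; simp del: partials_Cons)
  also have "\<dots> = (LINT x|lebesgue. (laplacian \<psi> x)\<^sup>2)"
    by (simp add: laplacian_def power2_eq_square sum_product del: partials_Cons)
  finally show ?thesis .
qed

text \<open>The Hessian identity, applied to each \<open>partials bs \<phi>\<close>, trades two
  orders of differentiation for one Laplacian. Iterated, it leads from all derivatives of order m to
  the energy.\<close>

lemma top_energy_Suc_Suc:
  assumes "\<phi> \<in> test_functions U"
  shows "top_energy (Suc (Suc k)) \<phi> = top_energy k (laplacian \<phi>)"
proof -
  have "top_energy (Suc (Suc k)) \<phi> = (\<Sum>a\<in>Basis. \<Sum>b\<in>Basis. \<Sum>bs\<in>index_lists k.
      LINT x|lebesgue. (partial a (partial b (partials bs \<phi>)) x)\<^sup>2)"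
    by (simp add: top_energy_def sum_index_lists_Suc)
  also have "\<dots> = (\<Sum>a\<in>Basis. \<Sum>bs\<in>index_lists k. \<Sum>b\<in>Basis.
      LINT x|lebesgue. (partial a (partial b (partials bs \<phi>)) x)\<^sup>2)"
    by (intro sum.cong refl sum.swap)
  also have "\<dots> = (\<Sum>bs\<in>index_lists k. \<Sum>a\<in>Basis. \<Sum>b\<in>Basis.
      LINT x|lebesgue. (partial a (partial b (partials bs \<phi>)) x)\<^sup>2)"
    by (rule sum.swap)
  also have "\<dots> = (\<Sum>bs\<in>index_lists k. LINT x|lebesgue. (laplacian (partials bs \<phi>) x)\<^sup>2)"
    by (intro sum.cong refl integral_hessian_eq_laplacian[of _ U] test_functions_partials[OF assms] index_lists_D(1))
  also have "\<dots> = top_energy k (laplacian \<phi>)"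
    unfolding top_energy_def
    by (intro sum.cong refl) (simp add: partials_laplacian index_lists_D test_functions_smooth[OF assms])
  finally show ?thesis .
qed

lemma top_energy_laplacian_pow:
  assumes "\<phi> \<in> test_functions U"
  shows "top_energy (2 * j + k) \<phi> = top_energy k ((laplacian ^^ j) \<phi>)"
  using assms
proof (induction j arbitrary: \<phi>)
  case (Suc j)
  have "top_energy (2 * Suc j + k) \<phi> = top_energy (2 * j + k) (laplacian \<phi>)"
    using top_energy_Suc_Suc[OF Suc.prems, of "2 * j + k"] by simp
  then show ?case
    using Suc.IH[OF test_functions_laplacian[OF Suc.prems]] by (simp add: funpow_swap1)
qed simp

subsection \<open>Uniqueness of weak derivatives\<close>

text \<open>Boxes form an intersection-stable generator of the Borel sets, and the sets over which
  the integral vanishes are closed under complements and disjoint unions. So the integral vanishes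
  over every Borel set, and the density is zero almost everywhere.\<close>

lemma AE_zero_if_box_integrals_zero:
  fixes f :: "'a::euclidean_space \<Rightarrow> real"
  assumes f: "integrable lebesgue f"
    and box: "\<And>c d. (LINT x|lebesgue. indicator (box c d) x * f x) = 0"
  shows "AE x in lebesgue. f x = 0"
proof -
  \<comment> \<open>The generated \<sigma>-algebra contains Borel sets only, so f is first replaced
    by a Borel representative.\<close>
  obtain g where g: "g \<in> borel_measurable lborel" "AE x in lborel. f x = g x"
    using completion_ex_borel_measurable_real[of f lborel] f by auto
  then have fg: "AE x in lebesgue. f x = g x" by (simp add: AE_completion)
  have gm: "g \<in> borel_measurable borel" using g by simp
  have "integrable lebesgue g"
    using integrable_cong_AE[THEN iffD1, OF _ _ fg f] f measurable_completion[OF g(1)] by simp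
  then have gi: "integrable lborel g"
    using integrable_completion g(1) by blast
  have set0: "(LINT x:A|lborel. g x) = 0" if "A \<in> sets borel" for A
  proof -
    have "A \<in> sigma_sets UNIV (range (\<lambda>(a, b). box a b :: 'a set))"
      using that by (subst (asm) borel_eq_box) (simp add: sets_measure_of)
    moreover have "Int_stable (range (\<lambda>(a, b). box a b :: 'a set))"
      by (force simp: Int_stable_def box_Int_box)
    moreover have "range (\<lambda>(a, b). box a b) \<subseteq> Pow (UNIV :: 'a set)" by simp
    ultimately show ?thesis
    proof (rule_tac sigma_sets_induct_disjoint[where P = "\<lambda>A. (LINT x:A|lborel. g x) = 0"])
      fix A :: "'a set" assume "A \<in> range (\<lambda>(a, b). box a b)"
      then obtain c d where A: "A = box c d" by auto
      have "(LINT x:A|lborel. g x) = (LINT x|lebesgue. indicator A x * g x)"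
        unfolding set_lebesgue_integral_def A using gm by (subst integral_completion) auto
      also have "\<dots> = (LINT x|lebesgue. indicator A x * f x)"
        using fg borel_measurable_integrable[OF f] measurable_completion[OF g(1)]
        by (intro integral_cong_AE borel_measurable_times borel_measurable_indicator) (auto simp: A)
      finally show "(LINT x:A|lborel. g x) = 0" using box A by simp
    next
      fix A :: "'a set" assume A: "A \<in> sigma_sets UNIV (range (\<lambda>(a, b). box a b))"
        and "(LINT x:A|lborel. g x) = 0"
      have Ab: "A \<in> sets borel" using A by (subst borel_eq_box) (simp add: sets_measure_of)
      \<comment> \<open>Complements require the integral over the whole space, which is the limit of
        the integrals over growing boxes.\<close>
      have "(LINT x|lborel. g x) = 0"
      proof -
        have "(\<lambda>n::nat. LINT x|lebesgue. indicator (box (- real n *\<^sub>R One) (real n *\<^sub>R One)) x * f x)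
            \<longlonglongrightarrow> (LINT x|lebesgue. f x)"
        proof (rule integral_dominated_convergence[where w = "\<lambda>x. norm (f x)"])
          show "AE x in lebesgue. (\<lambda>n. indicator (box (- real n *\<^sub>R One) (real n *\<^sub>R One)) x * f x) \<longlonglongrightarrow> f x"
          proof (rule AE_I2, rule tendsto_eventually)
            fix x :: 'a
            obtain k :: nat where k: "norm x < real k" using reals_Archimedean2 by blast
            show "\<forall>\<^sub>F n in sequentially. indicator (box (- real n *\<^sub>R One) (real n *\<^sub>R One)) x * f x = f x"
            proof (rule eventually_sequentiallyI[of k])
              fix n assume "k \<le> n"
              have "\<bar>x \<bullet> b\<bar> < real n" if "b \<in> Basis" for b
                using Basis_le_norm[OF that, of x] k \<open>k \<le> n\<close> by simp
              then have "x \<in> box (- real n *\<^sub>R One) (real n *\<^sub>R One)"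
                by (simp add: mem_box abs_less_iff minus_less_iff)
              then show "indicator (box (- real n *\<^sub>R One) (real n *\<^sub>R One)) x * f x = f x" by simp
            qed
          qed
        qed (use f in \<open>auto simp: abs_mult mult_left_le_one_le intro!: borel_measurable_times borel_measurable_indicator\<close>)
        then have "(LINT x|lebesgue. f x) = 0" unfolding box by (simp add: LIMSEQ_const_iff)
        moreover have "(LINT x|lebesgue. f x) = (LINT x|lebesgue. g x)"
          using fg f g(1) by (intro integral_cong_AE) (auto simp: measurable_completion)
        ultimately show ?thesis using g(1) by (simp add: integral_completion)
      qed
      moreover have "(LINT x:(A \<union> (UNIV - A))|lborel. g x) = (LINT x:A|lborel. g x) + (LINT x:(UNIV - A)|lborel. g x)"
        by (rule set_integral_Un; (unfold set_integrable_def, rule integrable_mult_indicator[OF _ gi])?)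
          (use Ab in auto)
      ultimately show "(LINT x:(UNIV - A)|lborel. g x) = 0"
        using \<open>(LINT x:A|lborel. g x) = 0\<close> by (simp add: set_lebesgue_integral_def)
    next
      fix A :: "nat \<Rightarrow> 'a set"
      assume A: "disjoint_family A" "range A \<subseteq> sigma_sets UNIV (range (\<lambda>(a, b). box a b))"
        "\<And>i. (LINT x:A i|lborel. g x) = 0"
      have Ab: "A i \<in> sets borel" for i
        using A(2) by (subst borel_eq_box) (auto simp: sets_measure_of)
      have "(LINT x:(\<Union>i. A i)|lborel. g x) = (\<Sum>i. (LINT x:A i|lborel. g x))"
      proof (rule lebesgue_integral_countable_add)
        show "set_integrable lborel (\<Union>i. A i) g"
          unfolding set_integrable_def by (rule integrable_mult_indicator[OF _ gi]) (use Ab in auto)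
      qed (use Ab A(1) in \<open>auto simp: disjoint_family_on_def\<close>)
      then show "(LINT x:(\<Union>i. A i)|lborel. g x) = 0" using A(3) by simp
    qed (auto simp: set_lebesgue_integral_def)
  qed
  have "AE x in lborel. g x = 0"
    by (rule density_unique_real) (use gi set0 in \<open>auto simp: set_lebesgue_integral_def\<close>)
  then have "AE x in lebesgue. g x = 0" by (rule AE_completion)
  with fg show ?thesis by eventually_elim simp
qed

lemma integral_test_lebesgue_on:
  fixes u :: "'a::euclidean_space \<Rightarrow> real"
  assumes "open \<Omega>" "\<phi> \<in> test_functions \<Omega>"
  shows "(LINT x|lebesgue_on \<Omega>. u x * \<phi> x) = (LINT x|lebesgue. u x * \<phi> x)"
proof -
  have "indicator \<Omega> x *\<^sub>R (u x * \<phi> x) = u x * \<phi> x" for x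
    using assms(2) by (auto elim!: test_functionsE simp: indicator_def)
  then have eq: "(\<lambda>x. indicator \<Omega> x *\<^sub>R (u x * \<phi> x)) = (\<lambda>x. u x * \<phi> x)" by blast
  show ?thesis using assms(1) by (subst integral_restrict_space) (simp_all only: eq, simp)
qed

lemma locally_integrable_mult_test:
  fixes u :: "'a::euclidean_space \<Rightarrow> real"
  assumes "locally_integrable \<Omega> u" "\<phi> \<in> test_functions \<Omega>"
  shows "integrable lebesgue (\<lambda>x. u x * \<phi> x)"
proof -
  obtain C where C: "smooth \<phi>" "compact C" "C \<subseteq> \<Omega>" "\<And>x. x \<notin> C \<Longrightarrow> \<phi> x = 0"
    using test_functionsE[OF assms(2)] by metis
  obtain B where B: "\<And>x. \<bar>\<phi> x\<bar> \<le> B" using test_functions_bounded[OF assms(2)] by metis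
  have Cl: "C \<in> sets lebesgue" using C(2) by (simp add: lmeasurable_compact fmeasurableD)
  have i: "integrable lebesgue (\<lambda>x. indicator C x *\<^sub>R u x)"
    using assms(1) C Cl unfolding locally_integrable_def
    by (intro integrable_restrict_space[THEN iffD1]) auto
  have eq: "u x * \<phi> x = (indicator C x *\<^sub>R u x) * \<phi> x" for x
    using C(4)[of x] by (cases "x \<in> C") auto
  show ?thesis
    unfolding eq
  proof (rule Bochner_Integration.integrable_bound[where f = "\<lambda>x. B * (indicator C x *\<^sub>R u x)"])
    show "integrable lebesgue (\<lambda>x. B * (indicator C x *\<^sub>R u x))" using i by simp
    show "(\<lambda>x. (indicator C x *\<^sub>R u x) * \<phi> x) \<in> borel_measurable lebesgue"
      by (rule borel_measurable_times[OF borel_measurable_integrable[OF i] smooth_measurable[OF C(1)]])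
    show "AE x in lebesgue. norm (indicator C x *\<^sub>R u x * \<phi> x) \<le> norm (B * (indicator C x *\<^sub>R u x))"
    proof (rule AE_I2)
      fix x
      have "\<bar>indicator C x *\<^sub>R u x\<bar> * \<bar>\<phi> x\<bar> \<le> \<bar>indicator C x *\<^sub>R u x\<bar> * \<bar>B\<bar>"
        by (rule mult_left_mono) (use B[of x] in auto)
      then show "norm (indicator C x *\<^sub>R u x * \<phi> x) \<le> norm (B * (indicator C x *\<^sub>R u x))"
        by (simp only: real_norm_def abs_mult mult.commute)
    qed
  qed
qed

lemma tendsto_smooth_step_mult:
  "(\<lambda>n. smooth_step (real n * t)) \<longlonglongrightarrow> (if t > 0 then 1 else 0)"
proof (cases "t > 0")
  case True
  obtain k :: nat where k: "1 / t < real k" using reals_Archimedean2 by blast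
  have "smooth_step (real n * t) = 1" if "n \<ge> k" for n
  proof (rule smooth_step(3))
    have "1 / t \<le> real n" using k that by linarith
    then show "1 \<le> real n * t" using True by (simp add: field_simps)
  qed
  then show ?thesis using True by (auto intro!: tendsto_eventually eventually_sequentiallyI[of k])
next
  case False
  then have "smooth_step (real n * t) = 0" for n
    by (intro smooth_step(2)) (simp add: mult_nonneg_nonpos)
  then show ?thesis using False by simp
qed

text \<open>A smooth approximation of the indicator of an open box from inside: the steps steepen
  with n but the function stays zero off the box, so a box whose closure lies in the domain gives an
  admissible test function.\<close>

definition box_bump :: "'a::euclidean_space \<Rightarrow> 'a \<Rightarrow> nat \<Rightarrow> 'a \<Rightarrow> real" where
  "box_bump c d n x = (\<Prod>b\<in>Basis. smooth_step (real n * (x \<bullet> b - c \<bullet> b)) * smooth_step (real n * (d \<bullet> b - x \<bullet> b)))"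

lemma box_bump:
  fixes c d :: "'a::euclidean_space"
  shows "cbox c d \<subseteq> U \<Longrightarrow> box_bump c d n \<in> test_functions U"
    and "(\<lambda>n. box_bump c d n x) \<longlonglongrightarrow> indicator (box c d) x"
    and "\<bar>box_bump c d n x\<bar> \<le> 1"
    and "x \<notin> box c d \<Longrightarrow> box_bump c d n x = 0"
proof -
  show out: "box_bump c d n x = 0" if x: "x \<notin> box c d" for x
  proof -
    obtain b where b: "b \<in> Basis" "\<not> (c \<bullet> b < x \<bullet> b \<and> x \<bullet> b < d \<bullet> b)" using x by (auto simp: mem_box)
    then have "real n * (x \<bullet> b - c \<bullet> b) \<le> 0 \<or> real n * (d \<bullet> b - x \<bullet> b) \<le> 0"
      by (auto simp: mult_nonneg_nonpos not_less)
    then have "smooth_step (real n * (x \<bullet> b - c \<bullet> b)) * smooth_step (real n * (d \<bullet> b - x \<bullet> b)) = 0"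
      using smooth_step(2) by auto
    then show ?thesis unfolding box_bump_def using b(1) by (intro prod_zero) auto
  qed
  show "box_bump c d n \<in> test_functions U" if "cbox c d \<subseteq> U"
  proof (rule test_functionsI[OF _ compact_cbox that])
    show "smooth (box_bump c d n)"
      unfolding box_bump_def[abs_def]
      by (intro smooth_prod smooth_mult smooth_comp[OF _ smooth_step(1)] smooth_diff smooth_const smooth_inner)
    show "box_bump c d n x = 0" if "x \<notin> cbox c d" for x
      using that out box_subset_cbox by blast
  qed
  show "\<bar>box_bump c d n x\<bar> \<le> 1"
    unfolding box_bump_def abs_prod
    by (rule prod_le_1) (auto simp: abs_mult smooth_step intro!: mult_le_one)
  have "(\<lambda>n. box_bump c d n x) \<longlonglongrightarrow>
      (\<Prod>b\<in>Basis. (if x \<bullet> b - c \<bullet> b > 0 then 1 else 0) * (if d \<bullet> b - x \<bullet> b > 0 then 1 else 0))"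
    unfolding box_bump_def by (intro tendsto_prod tendsto_mult tendsto_smooth_step_mult)
  also have "(\<Prod>b\<in>Basis. (if x \<bullet> b - c \<bullet> b > 0 then 1 else 0) * (if d \<bullet> b - x \<bullet> b > 0 then 1 else 0)) = (indicator (box c d) x :: real)"
  proof (cases "x \<in> box c d")
    case False
    then obtain b where b: "b \<in> Basis" "\<not> (c \<bullet> b < x \<bullet> b \<and> x \<bullet> b < d \<bullet> b)" by (auto simp: mem_box)
    then have "(\<Prod>b\<in>Basis. (if x \<bullet> b - c \<bullet> b > 0 then 1 else 0) * (if d \<bullet> b - x \<bullet> b > 0 then 1 else 0)) = (0::real)"
      by (intro prod_zero) auto
    then show ?thesis using False by simp
  qed (auto simp: mem_box)
  finally show "(\<lambda>n. box_bump c d n x) \<longlonglongrightarrow> indicator (box c d) x" .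
qed

text \<open>The bumps converge boundedly to indicators of boxes, so by dominated convergence v
  integrates to zero over every box inside a fixed box with closure in \<Omega>. Countably many
  closed boxes then exhaust \<Omega>.\<close>

lemma fundamental_lemma:
  fixes v :: "'a::euclidean_space \<Rightarrow> real"
  assumes \<Omega>: "open \<Omega>" and v: "locally_integrable \<Omega> v"
    and 0: "\<And>\<phi>. \<phi> \<in> test_functions \<Omega> \<Longrightarrow> (LINT x|lebesgue. v x * \<phi> x) = 0"
  shows "AE x in lebesgue_on \<Omega>. v x = 0"
proof -
  have on_box: "AE x in lebesgue. x \<in> box a b \<longrightarrow> v x = 0" if ab: "cbox a b \<subseteq> \<Omega>" for a b
  proof -
    have i0: "integrable lebesgue (\<lambda>x. indicator (cbox a b) x *\<^sub>R v x)"
      using v ab unfolding locally_integrable_def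
      by (intro integrable_restrict_space[THEN iffD1]) auto
    have "integrable lebesgue (\<lambda>x. indicator (box a b) x *\<^sub>R (indicator (cbox a b) x *\<^sub>R v x))"
      by (rule integrable_mult_indicator[OF _ i0]) auto
    moreover have eq: "indicator (box a b) x *\<^sub>R (indicator (cbox a b) x *\<^sub>R v x) = indicator (box a b) x * v x" for x
      using box_subset_cbox[of a b] by (auto simp: indicator_def)
    ultimately have i: "integrable lebesgue (\<lambda>x. indicator (box a b) x * v x)" by (simp only: eq)
    have "AE x in lebesgue. indicator (box a b) x * v x = 0"
    proof (rule AE_zero_if_box_integrals_zero[OF i])
      fix c d
      obtain p q where pq: "box a b \<inter> box c d = box p q" using box_Int_box[of a b c d] by blast
      have "(LINT x|lebesgue. indicator (box p q) x * v x) = 0"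
      proof (cases "box p q = {}")
        case False
        have "cbox p q \<subseteq> cbox a b"
          using pq closure_minimal[OF _ closed_cbox, of "box p q" a b] box_subset_cbox[of a b]
          unfolding closure_box[OF False] by blast
        then have sub: "cbox p q \<subseteq> \<Omega>" using ab by blast
        have m: "(\<lambda>x. indicator (box a b) x * v x) \<in> borel_measurable lebesgue"
          using i by (rule borel_measurable_integrable)
        have e: "box_bump p q n x * (indicator (box a b) x * v x) = v x * box_bump p q n x" for n x
        proof (cases "x \<in> box p q")
          case True
          then have "x \<in> box a b" using pq by blast
          then show ?thesis by simp
        qed (simp add: box_bump(4))
        have "(\<lambda>n. LINT x|lebesgue. box_bump p q n x * (indicator (box a b) x * v x)) \<longlonglongrightarrow>
            (LINT x|lebesgue. indicator (box p q) x * (indicator (box a b) x * v x))"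
        proof (rule integral_dominated_convergence[where w = "\<lambda>x. norm (indicator (box a b) x * v x)"])
          show "AE x in lebesgue. (\<lambda>n. box_bump p q n x * (indicator (box a b) x * v x)) \<longlonglongrightarrow>
              indicator (box p q) x * (indicator (box a b) x * v x)"
            by (intro AE_I2 tendsto_mult box_bump tendsto_const)
          show "AE x in lebesgue. norm (box_bump p q n x * (indicator (box a b) x * v x)) \<le> norm (indicator (box a b) x * v x)" for n
            using box_bump(3)[of p q n] by (intro AE_I2) (simp add: abs_mult mult_left_le_one_le)
          show "(\<lambda>x. box_bump p q n x * (indicator (box a b) x * v x)) \<in> borel_measurable lebesgue" for n
            by (rule borel_measurable_times[OF smooth_measurable[OF test_functions_smooth[OF box_bump(1)[OF sub]]] m])
          show "(\<lambda>x. indicator (box p q) x * (indicator (box a b) x * v x)) \<in> borel_measurable lebesgue"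
            by (rule borel_measurable_times[OF borel_measurable_indicator m]) simp
        qed (use i in auto)
        moreover have "(LINT x|lebesgue. box_bump p q n x * (indicator (box a b) x * v x)) = 0" for n
          unfolding e by (rule 0[OF box_bump(1)[OF sub]])
        moreover have e1: "indicator (box p q) x * (indicator (box a b) x * v x) = indicator (box p q) x * v x" for x
          using pq by (auto simp: indicator_def)
        ultimately show ?thesis by (simp only: e1 LIMSEQ_const_iff)
      qed simp
      moreover have e2: "indicator (box c d) x * (indicator (box a b) x * v x) = indicator (box p q) x * v x" for x
        unfolding pq[symmetric] by (auto simp: indicator_def)
      ultimately show "(LINT x|lebesgue. indicator (box c d) x * (indicator (box a b) x * v x)) = 0"
        by (simp only: e2)
    qed
    then show ?thesis by eventually_elim (auto simp: indicator_def)
  qed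
  \<comment> \<open>The countable cover consists of closed boxes; their faces are
    negligible.\<close>
  have on_cbox: "AE x in lebesgue. x \<in> cbox a b \<longrightarrow> v x = 0" if ab: "cbox a b \<subseteq> \<Omega>" for a b
  proof -
    have "negligible (cbox a b - box a b)" by (rule negligible_frontier_interval)
    then have "cbox a b - box a b \<in> null_sets lebesgue" by (simp add: negligible_iff_null_sets)
    then have "AE x in lebesgue. x \<notin> cbox a b - box a b" by (rule AE_not_in)
    with on_box[OF ab] show ?thesis by eventually_elim auto
  qed
  obtain \<D> where D: "countable \<D>" "\<D> \<subseteq> Pow \<Omega>" "\<And>X. X \<in> \<D> \<Longrightarrow> \<exists>a b. X = cbox a b" "\<Union>\<D> = \<Omega>"
    using open_countable_Union_open_cbox[OF \<Omega>] by metis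
  have "AE x in lebesgue. \<forall>X\<in>\<D>. x \<in> X \<longrightarrow> v x = 0"
    unfolding AE_ball_countable[OF D(1)]
  proof
    fix X assume X: "X \<in> \<D>"
    then obtain a b where "X = cbox a b" using D(3) by blast
    then show "AE x in lebesgue. x \<in> X \<longrightarrow> v x = 0" using on_cbox[of a b] X D(2) by auto
  qed
  then have "AE x in lebesgue. x \<in> \<Omega> \<longrightarrow> v x = 0"
    by eventually_elim (use D(4) in blast)
  then show ?thesis using \<Omega> by (simp add: AE_restrict_space_iff)
qed

section \<open>Elementary calculus of weak derivatives\<close>

lemma locally_integrable_lin:
  assumes "locally_integrable \<Omega> u" "locally_integrable \<Omega> v"
  shows "locally_integrable \<Omega> (\<lambda>x. a * u x + b * v x)"
  using assms by (auto simp: locally_integrable_def)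

lemma locally_integrable_sum:
  "(\<And>i. i \<in> I \<Longrightarrow> locally_integrable \<Omega> (f i)) \<Longrightarrow> locally_integrable \<Omega> (\<lambda>x. \<Sum>i\<in>I. f i x)"
  by (auto simp: locally_integrable_def)

lemma weak_eqI:
  fixes v :: "'a::euclidean_space \<Rightarrow> real"
  assumes "open \<Omega>" "locally_integrable \<Omega> v" "locally_integrable \<Omega> w"
    and eq: "\<And>\<phi>. \<phi> \<in> test_functions \<Omega> \<Longrightarrow> (LINT x|lebesgue. v x * \<phi> x) = (LINT x|lebesgue. w x * \<phi> x)"
  shows "AE x in lebesgue_on \<Omega>. v x = w x"
proof -
  have "AE x in lebesgue_on \<Omega>. 1 * v x + (-1) * w x = 0"
  proof (rule fundamental_lemma[OF assms(1) locally_integrable_lin[OF assms(2,3)]])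
    fix \<phi> :: "'a \<Rightarrow> real" assume \<phi>: "\<phi> \<in> test_functions \<Omega>"
    show "(LINT x|lebesgue. (1 * v x + (-1) * w x) * \<phi> x) = 0"
      using eq[OF \<phi>] locally_integrable_mult_test[OF assms(2) \<phi>] locally_integrable_mult_test[OF assms(3) \<phi>]
      by (simp add: left_diff_distrib)
  qed
  then show ?thesis by simp
qed

text \<open>Test functions and their derivatives vanish off \<Omega>, so integrals over \<Omega> may
  be read over the whole space. Translating once allows later computations to ignore the domain of
  integration.\<close>

lemma has_weak_deriv_iff:
  fixes u :: "'a::euclidean_space \<Rightarrow> real"
  assumes "open \<Omega>" "set bs \<subseteq> Basis"
  shows "has_weak_deriv \<Omega> bs u v \<longleftrightarrow> locally_integrable \<Omega> u \<and> locally_integrable \<Omega> v \<and>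
    (\<forall>\<phi>\<in>test_functions \<Omega>. (LINT x|lebesgue. u x * partials bs \<phi> x)
      = (-1) ^ length bs * (LINT x|lebesgue. v x * \<phi> x))"
  unfolding has_weak_deriv_def
  by (intro conj_cong refl ball_cong)
    (simp add: integral_test_lebesgue_on[OF assms(1)] test_functions_partials[OF _ assms(2)])

lemma has_weak_deriv_unique:
  fixes u :: "'a::euclidean_space \<Rightarrow> real"
  assumes "open \<Omega>" "set bs \<subseteq> Basis" "has_weak_deriv \<Omega> bs u v" "has_weak_deriv \<Omega> bs u w"
  shows "AE x in lebesgue_on \<Omega>. v x = w x"
  using assms by (intro weak_eqI) (auto simp: has_weak_deriv_iff)

lemma has_weak_deriv_weak_deriv:
  "has_weak_deriv \<Omega> bs u v \<Longrightarrow> has_weak_deriv \<Omega> bs u (weak_deriv \<Omega> bs u)"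
  unfolding weak_deriv_def by (rule someI[of "has_weak_deriv \<Omega> bs u"])

lemma weak_deriv_AE:
  fixes u :: "'a::euclidean_space \<Rightarrow> real"
  assumes "open \<Omega>" "set bs \<subseteq> Basis" "has_weak_deriv \<Omega> bs u v"
  shows "AE x in lebesgue_on \<Omega>. weak_deriv \<Omega> bs u x = v x"
  using has_weak_deriv_unique[OF assms(1,2) has_weak_deriv_weak_deriv[OF assms(3)] assms(3)] .

lemma continuous_locally_integrable:
  fixes f :: "'a::euclidean_space \<Rightarrow> real"
  assumes "continuous_on UNIV f"
  shows "locally_integrable \<Omega> f"
  unfolding locally_integrable_def
proof (intro allI impI)
  fix C :: "'a set" assume C: "compact C \<and> C \<subseteq> \<Omega>"
  then have Cl: "C \<in> sets lebesgue" by (simp add: lmeasurable_compact fmeasurableD)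
  have "integrable lborel (\<lambda>x. indicator C x *\<^sub>R f x)"
    using C assms continuous_on_subset by (intro borel_integrable_compact) blast+
  then have "integrable lebesgue (\<lambda>x. indicator C x *\<^sub>R f x)"
    using integrable_completion borel_measurable_integrable by blast
  then show "integrable (lebesgue_on C) f" using Cl by (simp add: integrable_restrict_space)
qed

lemma smooth_locally_integrable: "smooth f \<Longrightarrow> locally_integrable \<Omega> f"
  by (intro continuous_locally_integrable smooth_continuous_on)

lemma smooth_has_weak_deriv:
  assumes "smooth f" "open \<Omega>" "set bs \<subseteq> Basis"
  shows "has_weak_deriv \<Omega> bs f (partials bs f)"
  using assms integral_by_parts_partials[OF assms(1) _ assms(3)]
  by (auto simp: has_weak_deriv_iff smooth_locally_integrable smooth_partials)

lemma has_weak_deriv_lin: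
  fixes u :: "'a::euclidean_space \<Rightarrow> real"
  assumes "open \<Omega>" "set bs \<subseteq> Basis" "has_weak_deriv \<Omega> bs u v" "has_weak_deriv \<Omega> bs u' v'"
  shows "has_weak_deriv \<Omega> bs (\<lambda>x. a * u x + b * u' x) (\<lambda>x. a * v x + b * v' x)"
proof -
  note iff = has_weak_deriv_iff[OF assms(1,2)]
  note l = assms(3,4)[unfolded iff]
  show ?thesis
    unfolding iff
  proof (intro conjI ballI)
    fix \<phi> assume \<phi>: "\<phi> \<in> test_functions \<Omega>"
    note p = test_functions_partials[OF \<phi> assms(2)]
    have "(LINT x|lebesgue. (a * u x + b * u' x) * partials bs \<phi> x)
      = a * (LINT x|lebesgue. u x * partials bs \<phi> x) + b * (LINT x|lebesgue. u' x * partials bs \<phi> x)"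
      using locally_integrable_mult_test[OF _ p] l by (simp add: distrib_right mult.assoc)
    also have "\<dots> = (-1) ^ length bs * (a * (LINT x|lebesgue. v x * \<phi> x) + b * (LINT x|lebesgue. v' x * \<phi> x))"
      using l \<phi> by (simp add: distrib_left)
    also have "a * (LINT x|lebesgue. v x * \<phi> x) + b * (LINT x|lebesgue. v' x * \<phi> x)
      = (LINT x|lebesgue. (a * v x + b * v' x) * \<phi> x)"
      using locally_integrable_mult_test[OF _ \<phi>] l by (simp add: distrib_right mult.assoc)
    finally show "(LINT x|lebesgue. (a * u x + b * u' x) * partials bs \<phi> x)
      = (-1) ^ length bs * (LINT x|lebesgue. (a * v x + b * v' x) * \<phi> x)" .
  qed (use l locally_integrable_lin in auto)
qed

subsection \<open>Iterated weak Laplacians\<close>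

text \<open>Local integrability speaks about compact subsets only; measurability on \<Omega> is
  glued from a countable cover by closed boxes. It is what transferring integrals along almost
  everywhere equality requires.\<close>

lemma locally_integrable_measurable:
  fixes u :: "'a::euclidean_space \<Rightarrow> real"
  assumes "open \<Omega>" "locally_integrable \<Omega> u"
  shows "u \<in> borel_measurable (lebesgue_on \<Omega>)"
proof -
  obtain \<D> where D: "countable \<D>" "\<D> \<subseteq> Pow \<Omega>" "\<And>X. X \<in> \<D> \<Longrightarrow> \<exists>a b. X = cbox a b" "\<Union>\<D> = \<Omega>"
    using open_countable_Union_open_cbox[OF assms(1)] by metis
  show ?thesis
  proof (rule measurable_piecewise_restrict[OF D(1)])
    fix X assume X: "X \<in> \<D>"
    then obtain a b where ab: "X = cbox a b" using D(3) by blast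
    have sub: "X \<subseteq> \<Omega>" using X D(2) by blast
    have Xs: "X \<in> sets lebesgue" unfolding ab by simp
    have Os: "\<Omega> \<in> sets lebesgue" using assms(1) by simp
    have XO: "X \<inter> \<Omega> = X" "\<Omega> \<inter> X = X" using sub by blast+
    have sp: "space (lebesgue_on \<Omega>) = \<Omega>" by simp
    have "\<Omega> \<inter> X \<in> sets (lebesgue_on \<Omega>)"
      unfolding sets_restrict_space by (rule imageI[OF Xs])
    then show "X \<inter> space (lebesgue_on \<Omega>) \<in> sets (lebesgue_on \<Omega>)"
      unfolding sp XO .
    have "integrable (lebesgue_on X) u"
      using assms(2) sub compact_cbox[of a b] unfolding locally_integrable_def ab by blast
    then have "u \<in> borel_measurable (lebesgue_on X)" by (rule borel_measurable_integrable)
    moreover have "restrict_space (lebesgue_on \<Omega>) X = lebesgue_on X"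
      using restrict_restrict_space[of \<Omega> lebesgue X] Xs Os unfolding XO by simp
    ultimately show "u \<in> borel_measurable (restrict_space (lebesgue_on \<Omega>) X)" by simp
  qed (use D in auto)
qed

text \<open>Equality as distributions. Unlike equality almost everywhere it passes through
  \<open>has_weak_deriv\<close> by mere substitution, so it survives further weak
  differentiation.\<close>

definition weakly_eq :: "'a::euclidean_space set \<Rightarrow> ('a \<Rightarrow> real) \<Rightarrow> ('a \<Rightarrow> real) \<Rightarrow> bool" where
  "weakly_eq \<Omega> v w \<longleftrightarrow> locally_integrable \<Omega> v \<and> locally_integrable \<Omega> w \<and>
    (\<forall>\<phi>\<in>test_functions \<Omega>. (LINT x|lebesgue. v x * \<phi> x) = (LINT x|lebesgue. w x * \<phi> x))"

lemma weakly_eq_sum: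
  fixes f g :: "'i \<Rightarrow> 'a::euclidean_space \<Rightarrow> real"
  assumes "\<And>i. i \<in> I \<Longrightarrow> weakly_eq \<Omega> (f i) (g i)"
  shows "weakly_eq \<Omega> (\<lambda>x. \<Sum>i\<in>I. f i x) (\<lambda>x. \<Sum>i\<in>I. g i x)"
  unfolding weakly_eq_def
proof (intro conjI ballI locally_integrable_sum)
  fix \<phi> :: "'a \<Rightarrow> real" assume \<phi>: "\<phi> \<in> test_functions \<Omega>"
  have "integrable lebesgue (\<lambda>x. f i x * \<phi> x)" "integrable lebesgue (\<lambda>x. g i x * \<phi> x)" if "i \<in> I" for i
    using assms[OF that] locally_integrable_mult_test[OF _ \<phi>] by (auto simp: weakly_eq_def)
  then show "(LINT x|lebesgue. (\<Sum>i\<in>I. f i x) * \<phi> x) = (LINT x|lebesgue. (\<Sum>i\<in>I. g i x) * \<phi> x)"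
    using assms \<phi> by (simp add: sum_distrib_right weakly_eq_def)
qed (use assms in \<open>auto simp: weakly_eq_def\<close>)

lemma has_weak_deriv_sum:
  fixes f g :: "'i \<Rightarrow> 'a::euclidean_space \<Rightarrow> real"
  assumes "open \<Omega>" "set bs \<subseteq> Basis" "\<And>i. i \<in> I \<Longrightarrow> has_weak_deriv \<Omega> bs (f i) (g i)"
  shows "has_weak_deriv \<Omega> bs (\<lambda>x. \<Sum>i\<in>I. f i x) (\<lambda>x. \<Sum>i\<in>I. g i x)"
  unfolding has_weak_deriv_iff[OF assms(1,2)]
proof (intro conjI ballI locally_integrable_sum)
  note iff = has_weak_deriv_iff[OF assms(1,2)]
  fix \<phi> :: "'a \<Rightarrow> real" assume \<phi>: "\<phi> \<in> test_functions \<Omega>"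
  note p = test_functions_partials[OF \<phi> assms(2)]
  have "integrable lebesgue (\<lambda>x. f i x * partials bs \<phi> x)" "integrable lebesgue (\<lambda>x. g i x * \<phi> x)" if "i \<in> I" for i
    using assms(3)[OF that] locally_integrable_mult_test[OF _ \<phi>] locally_integrable_mult_test[OF _ p]
    by (auto simp: iff)
  then show "(LINT x|lebesgue. (\<Sum>i\<in>I. f i x) * partials bs \<phi> x) =
      (-1) ^ length bs * (LINT x|lebesgue. (\<Sum>i\<in>I. g i x) * \<phi> x)"
    using assms(3) \<phi> by (simp add: sum_distrib_right iff) (simp add: sum_distrib_left)
qed (use assms(3) in \<open>auto simp: has_weak_deriv_iff[OF assms(1,2)]\<close>)

lemma has_weak_deriv_cong:
  assumes "open \<Omega>" "set bs \<subseteq> Basis" "weakly_eq \<Omega> v v'" "has_weak_deriv \<Omega> bs v' w"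
  shows "has_weak_deriv \<Omega> bs v w"
  using assms test_functions_partials[OF _ assms(2), of _ \<Omega>]
  by (auto simp: has_weak_deriv_iff weakly_eq_def)

text \<open>The defining identity of the derivative along \<open>bs\<close> is tested with
  \<open>partials cs \<phi>\<close>, itself a test function. The derivatives commute on \<phi>, and
  the two signs combine.\<close>

lemma has_weak_deriv_compose:
  fixes u :: "'a::euclidean_space \<Rightarrow> real"
  assumes "open \<Omega>" "set bs \<subseteq> Basis" "set cs \<subseteq> Basis"
    "has_weak_deriv \<Omega> bs u v" "has_weak_deriv \<Omega> (cs @ bs) u w"
  shows "has_weak_deriv \<Omega> cs v w"
proof -
  have cb: "set (cs @ bs) \<subseteq> Basis" using assms by simp
  note 1 = assms(4)[unfolded has_weak_deriv_iff[OF assms(1,2)]]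
  note 2 = assms(5)[unfolded has_weak_deriv_iff[OF assms(1) cb]]
  show ?thesis
    unfolding has_weak_deriv_iff[OF assms(1,3)]
  proof (intro conjI ballI)
    fix \<phi> :: "'a \<Rightarrow> real" assume \<phi>: "\<phi> \<in> test_functions \<Omega>"
    have "(-1) ^ length bs * (LINT x|lebesgue. v x * partials cs \<phi> x)
        = (LINT x|lebesgue. u x * partials bs (partials cs \<phi>) x)"
      using 1 test_functions_partials[OF \<phi> assms(3)] by simp
    also have "partials bs (partials cs \<phi>) = partials (cs @ bs) \<phi>"
      using partials_commute[OF test_functions_smooth[OF \<phi>] assms(2,3)] by (simp add: partials_append)
    also have "(LINT x|lebesgue. u x * partials (cs @ bs) \<phi> x)
        = (-1) ^ length bs * ((-1) ^ length cs * (LINT x|lebesgue. w x * \<phi> x))"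
      using 2 \<phi> by (simp add: power_add)
    finally show "(LINT x|lebesgue. v x * partials cs \<phi> x) = (-1) ^ length cs * (LINT x|lebesgue. w x * \<phi> x)"
      by simp
  qed (use 1 2 in auto)
qed

text \<open>The k-th power of the Laplacian is the sum of the derivatives along
  \<open>doubled bs\<close> over all \<open>bs\<close> in \<open>index_lists k\<close>.\<close>

definition doubled :: "'a list \<Rightarrow> 'a list" where
  "doubled bs = concat (map (\<lambda>b. [b, b]) bs)"

lemma doubled_simps [simp]:
  "doubled [] = []" "doubled (b # bs) = b # b # doubled bs"
  "length (doubled bs) = 2 * length bs" "set (doubled bs) = set bs"
  by (simp_all add: doubled_def) (induction bs; simp)+

lemma doubled_inject: "doubled bs = doubled cs \<longleftrightarrow> bs = cs"
  by (induction bs arbitrary: cs) (case_tac cs; auto)+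

text \<open>A simultaneous choice of the derivatives of all orders up to m. The intermediate orders
  are included because \<open>weak_laplacian\<close> is iterated: each stage differentiates the
  previous one.\<close>

definition weak_family ::
  "nat \<Rightarrow> 'a::euclidean_space set \<Rightarrow> ('a \<Rightarrow> real) \<Rightarrow> ('a list \<Rightarrow> 'a \<Rightarrow> real) \<Rightarrow> bool" where
  "weak_family m \<Omega> u D \<longleftrightarrow> (\<forall>bs\<in>multi_indices m. has_weak_deriv \<Omega> bs u (D bs))"

lemma multi_indices_iff: "bs \<in> multi_indices m \<longleftrightarrow> set bs \<subseteq> Basis \<and> length bs \<le> m"
  by (simp add: multi_indices_def)

lemma weak_family_has_weak_deriv:
  "weak_family m \<Omega> u D \<Longrightarrow> set bs \<subseteq> Basis \<Longrightarrow> length bs \<le> m \<Longrightarrow> has_weak_deriv \<Omega> bs u (D bs)"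
  by (auto simp: weak_family_def multi_indices_iff)

lemma weak_deriv_weakly_eq:
  assumes "open \<Omega>" "set bs \<subseteq> Basis" "has_weak_deriv \<Omega> bs u v"
  shows "weakly_eq \<Omega> (weak_deriv \<Omega> bs u) v"
  using assms(3) has_weak_deriv_weak_deriv[OF assms(3)]
  unfolding has_weak_deriv_iff[OF assms(1,2)] weakly_eq_def by auto

lemma weakly_eq_AE:
  "open \<Omega> \<Longrightarrow> weakly_eq \<Omega> v w \<Longrightarrow> AE x in lebesgue_on \<Omega>. v x = w x"
  by (intro weak_eqI) (auto simp: weakly_eq_def)

lemma has_weak_deriv_Nil: "open \<Omega> \<Longrightarrow> has_weak_deriv \<Omega> [] u v \<longleftrightarrow> weakly_eq \<Omega> u v"
  by (simp add: has_weak_deriv_iff weakly_eq_def)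

lemma weak_family_step:
  assumes "open \<Omega>" "weak_family m \<Omega> u D" "2 * j + length cs \<le> m" "set cs \<subseteq> Basis"
  shows "has_weak_deriv \<Omega> cs (\<lambda>x. \<Sum>bs\<in>index_lists j. D (doubled bs) x)
    (\<lambda>x. \<Sum>bs\<in>index_lists j. D (cs @ doubled bs) x)"
proof (rule has_weak_deriv_sum[OF assms(1,4)])
  fix bs :: "'a list" assume "bs \<in> index_lists j"
  then have "set bs \<subseteq> Basis" "length bs = j" by (auto dest: index_lists_D)
  then show "has_weak_deriv \<Omega> cs (D (doubled bs)) (D (cs @ doubled bs))"
    using assms by (intro has_weak_deriv_compose[of \<Omega> "doubled bs" cs u] weak_family_has_weak_deriv) auto
qed

text \<open>Every iterate contains fresh choices of representatives, so it can match the family only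
  weakly; \<open>has_weak_deriv_cong\<close> carries this weaker equality through the next two
  derivatives.\<close>

lemma weak_laplacian_pow:
  fixes u :: "'a::euclidean_space \<Rightarrow> real"
  assumes "open \<Omega>" "weak_family m \<Omega> u D" "2 * j \<le> m"
  shows "weakly_eq \<Omega> ((weak_laplacian \<Omega> ^^ j) u) (\<lambda>x. \<Sum>bs\<in>index_lists j. D (doubled bs) x)"
  using assms(3)
proof (induction j)
  case 0
  then show ?case
    using weak_family_has_weak_deriv[OF assms(2), of "[]"] has_weak_deriv_Nil[OF assms(1)] by simp
next
  case (Suc j)
  let ?v = "(weak_laplacian \<Omega> ^^ j) u"
  have "weakly_eq \<Omega> (weak_deriv \<Omega> [c, c] ?v) (\<lambda>x. \<Sum>bs\<in>index_lists j. D (doubled (c # bs)) x)"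
    if c: "c \<in> Basis" for c
    using weak_family_step[OF assms(1,2), of j "[c, c]"] Suc c assms(1)
    by (intro weak_deriv_weakly_eq has_weak_deriv_cong[where v = ?v]) auto
  then have "weakly_eq \<Omega> (\<lambda>x. \<Sum>c\<in>Basis. weak_deriv \<Omega> [c, c] ?v x)
      (\<lambda>x. \<Sum>c\<in>Basis. \<Sum>bs\<in>index_lists j. D (doubled (c # bs)) x)"
    by (rule weakly_eq_sum)
  moreover have "(weak_laplacian \<Omega> ^^ Suc j) u = (\<lambda>x. \<Sum>c\<in>Basis. weak_deriv \<Omega> [c, c] ?v x)"
    by (simp add: weak_laplacian_def[abs_def])
  ultimately show ?case by (simp only: sum_index_lists_Suc)
qed

text \<open>\<open>\<nabla>\<^sup>m\<close> as a linear function of the array of all derivatives at a point.\<close>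

definition nabla_of :: "nat \<Rightarrow> ('a::euclidean_space list \<Rightarrow> real) \<Rightarrow> real \<times> 'a" where
  "nabla_of m d =
    (if even m then (\<Sum>bs\<in>index_lists (m div 2). d (doubled bs), 0)
     else (0, \<Sum>b\<in>Basis. (\<Sum>bs\<in>index_lists ((m - 1) div 2). d (b # doubled bs)) *\<^sub>R b))"

text \<open>Here the iterated choices are traded for a fixed linear expression in D. Measurability
  is recorded alongside since the change of integrands under the integral depends on it.\<close>

lemma nabla_pow_AE:
  fixes u :: "'a::euclidean_space \<Rightarrow> real"
  assumes "open \<Omega>" "weak_family m \<Omega> u D"
  shows "AE x in lebesgue_on \<Omega>. nabla_pow m \<Omega> u x = nabla_of m (\<lambda>bs. D bs x)"
    and "nabla_pow m \<Omega> u \<in> borel_measurable (lebesgue_on \<Omega>)"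
proof -
  have "(AE x in lebesgue_on \<Omega>. nabla_pow m \<Omega> u x = nabla_of m (\<lambda>bs. D bs x)) \<and>
      nabla_pow m \<Omega> u \<in> borel_measurable (lebesgue_on \<Omega>)"
  proof (cases "even m")
    case True
    have w: "weakly_eq \<Omega> ((weak_laplacian \<Omega> ^^ (m div 2)) u) (\<lambda>x. \<Sum>bs\<in>index_lists (m div 2). D (doubled bs) x)"
      using weak_laplacian_pow[OF assms] True by simp
    then have "(weak_laplacian \<Omega> ^^ (m div 2)) u \<in> borel_measurable (lebesgue_on \<Omega>)"
      using assms(1) by (auto simp: weakly_eq_def locally_integrable_measurable)
    then show ?thesis
      using weakly_eq_AE[OF assms(1) w] True
      by (auto simp: nabla_pow_def[abs_def] nabla_of_def elim: AE_mp intro!: AE_I2)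
  next
    case False
    let ?k = "(m - 1) div 2"
    let ?v = "(weak_laplacian \<Omega> ^^ ?k) u"
    have "weakly_eq \<Omega> ?v (\<lambda>x. \<Sum>bs\<in>index_lists ?k. D (doubled bs) x)"
      using weak_laplacian_pow[OF assms, of ?k] False by (simp add: odd_pos)
    then have w: "weakly_eq \<Omega> (weak_deriv \<Omega> [b] ?v) (\<lambda>x. \<Sum>bs\<in>index_lists ?k. D (b # doubled bs) x)"
      if "b \<in> Basis" for b
      using weak_family_step[OF assms, of ?k "[b]"] that assms(1) False
      by (intro weak_deriv_weakly_eq has_weak_deriv_cong[where v = ?v]) (auto elim!: oddE)
    then have "AE x in lebesgue_on \<Omega>. \<forall>b\<in>Basis. weak_deriv \<Omega> [b] ?v x = (\<Sum>bs\<in>index_lists ?k. D (b # doubled bs) x)"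
      using weakly_eq_AE[OF assms(1)] by (intro AE_finite_allI) auto
    moreover have "weak_gradient \<Omega> ?v \<in> borel_measurable (lebesgue_on \<Omega>)"
      unfolding weak_gradient_def[abs_def]
      using w assms(1) by (intro borel_measurable_sum borel_measurable_scaleR borel_measurable_const
        locally_integrable_measurable) (auto simp: weakly_eq_def)
    moreover have "nabla_pow m \<Omega> u = (\<lambda>x. (0, weak_gradient \<Omega> ?v x))"
      using False by (simp add: nabla_pow_def[abs_def])
    moreover have "(0, weak_gradient \<Omega> ?v x) = nabla_of m (\<lambda>bs. D bs x)"
      if "\<forall>b\<in>Basis. weak_deriv \<Omega> [b] ?v x = (\<Sum>bs\<in>index_lists ?k. D (b # doubled bs) x)" for x
      using that False by (simp add: nabla_of_def weak_gradient_def)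
    ultimately show ?thesis by (auto elim!: eventually_mono)
  qed
  then show "AE x in lebesgue_on \<Omega>. nabla_pow m \<Omega> u x = nabla_of m (\<lambda>bs. D bs x)"
    and "nabla_pow m \<Omega> u \<in> borel_measurable (lebesgue_on \<Omega>)" by auto
qed

lemma nabla_of_lin:
  "nabla_of m (\<lambda>bs. a * d bs + b * e bs) = a *\<^sub>R nabla_of m d + b *\<^sub>R nabla_of m e"
  by (simp add: nabla_of_def sum.distrib scaleR_add_left scaleR_sum_right sum_distrib_left)

text \<open>Doubling is injective, so no derivative of order m occurs twice in
  \<open>nabla_of\<close> and the triangle inequality suffices.\<close>

lemma norm_nabla_of_le: "norm (nabla_of m d) \<le> (\<Sum>bs\<in>index_lists m. \<bar>d bs\<bar>)"
proof (cases "even m")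
  case True
  have "\<bar>\<Sum>bs\<in>index_lists (m div 2). d (doubled bs)\<bar> \<le> (\<Sum>bs\<in>index_lists (m div 2). \<bar>d (doubled bs)\<bar>)"
    by (rule sum_abs)
  also have "\<dots> = (\<Sum>bs\<in>doubled ` index_lists (m div 2). \<bar>d bs\<bar>)"
    by (subst sum.reindex) (auto simp: inj_on_def doubled_inject)
  also have "\<dots> \<le> (\<Sum>bs\<in>index_lists m. \<bar>d bs\<bar>)"
    by (rule sum_mono2[OF finite_index_lists]) (use True in \<open>auto simp: index_lists_def\<close>)
  finally show ?thesis using True by (simp add: nabla_of_def norm_Pair)
next
  case False
  let ?k = "(m - 1) div 2"
  have "norm (\<Sum>b\<in>Basis. (\<Sum>bs\<in>index_lists ?k. d (b # doubled bs)) *\<^sub>R b)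
      \<le> (\<Sum>b\<in>Basis. norm ((\<Sum>bs\<in>index_lists ?k. d (b # doubled bs)) *\<^sub>R b))"
    by (rule norm_sum)
  also have "\<dots> = (\<Sum>b\<in>Basis. \<bar>\<Sum>bs\<in>index_lists ?k. d (b # doubled bs)\<bar>)"
    by simp
  also have "\<dots> \<le> (\<Sum>b\<in>Basis. \<Sum>bs\<in>index_lists ?k. \<bar>d (b # doubled bs)\<bar>)"
    by (intro sum_mono sum_abs)
  also have "\<dots> = (\<Sum>p\<in>Basis \<times> index_lists ?k. \<bar>d (fst p # doubled (snd p))\<bar>)"
    by (simp add: sum.cartesian_product split_def)
  also have "\<dots> = (\<Sum>bs\<in>(\<lambda>p. fst p # doubled (snd p)) ` (Basis \<times> index_lists ?k). \<bar>d bs\<bar>)"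
    by (subst sum.reindex) (auto simp: inj_on_def doubled_inject)
  also have "\<dots> \<le> (\<Sum>bs\<in>index_lists m. \<bar>d bs\<bar>)"
    by (rule sum_mono2[OF finite_index_lists]) (use False in \<open>auto simp: index_lists_def elim!: oddE\<close>)
  finally show ?thesis using False by (simp add: nabla_of_def norm_Pair)
qed

lemma norm_nabla_of_sq_le:
  fixes d :: "'a::euclidean_space list \<Rightarrow> real"
  shows "(norm (nabla_of m d))\<^sup>2
    \<le> real (card (index_lists m :: 'a list set)) * (\<Sum>bs\<in>index_lists m. (d bs)\<^sup>2)"
proof -
  have "(norm (nabla_of m d))\<^sup>2 \<le> (\<Sum>bs\<in>index_lists m. \<bar>d bs\<bar>)\<^sup>2"
    by (intro power_mono norm_nabla_of_le) simp
  also have "\<dots> \<le> real (card (index_lists m :: 'a list set)) * (\<Sum>bs\<in>index_lists m. \<bar>d bs\<bar>\<^sup>2)"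
    using sum_squared_le_sum_of_squares[of "\<lambda>bs. \<bar>d bs\<bar>" "index_lists m"] by (simp add: mult.commute)
  finally show ?thesis by simp
qed

lemma laplacian_pow_eq:
  assumes "smooth f"
  shows "(laplacian ^^ k) f = (\<lambda>x. \<Sum>bs\<in>index_lists k. partials (doubled bs) f x)"
proof (induction k)
  case (Suc k)
  have "partials [c, c] (\<lambda>x. \<Sum>bs\<in>index_lists k. partials (doubled bs) f x)
      = (\<lambda>x. \<Sum>bs\<in>index_lists k. partials [c, c] (partials (doubled bs) f) x)" if "c \<in> Basis" for c
    using that by (intro partials_sum smooth_partials assms) (auto dest: index_lists_D)
  then have "laplacian (\<lambda>x. \<Sum>bs\<in>index_lists k. partials (doubled bs) f x)
      = (\<lambda>x. \<Sum>bs\<in>index_lists (Suc k). partials (doubled bs) f x)"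
    by (simp add: laplacian_def[abs_def] sum_index_lists_Suc)
  then show ?case by (simp add: Suc.IH)
qed simp

subsection \<open>Semi-inner products\<close>

text \<open>Only semidefiniteness is required: functions that agree almost everywhere have distance
  zero, and on the whole space polynomials of degree below m have energy zero. Limits in the
  seminorm are therefore not unique.\<close>

locale semi_inner =
  fixes V :: "('a \<Rightarrow> real) set" and B :: "('a \<Rightarrow> real) \<Rightarrow> ('a \<Rightarrow> real) \<Rightarrow> real"
  assumes lin: "f \<in> V \<Longrightarrow> g \<in> V \<Longrightarrow> (\<lambda>x. a * f x + b * g x) \<in> V"
    and form_lin: "f \<in> V \<Longrightarrow> g \<in> V \<Longrightarrow> h \<in> V \<Longrightarrow>
      B (\<lambda>x. a * f x + b * g x) h = a * B f h + b * B g h"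
    and form_sym: "f \<in> V \<Longrightarrow> g \<in> V \<Longrightarrow> B f g = B g f"
    and form_nonneg: "f \<in> V \<Longrightarrow> B f f \<ge> 0"
begin

lemma form_lin_right:
  "f \<in> V \<Longrightarrow> g \<in> V \<Longrightarrow> h \<in> V \<Longrightarrow> B h (\<lambda>x. a * f x + b * g x) = a * B h f + b * B h g"
  using form_lin[of f g h a b] form_sym[of h "\<lambda>x. a * f x + b * g x"] form_sym[of h f] form_sym[of h g] lin
  by simp

lemma add_mem: "f \<in> V \<Longrightarrow> g \<in> V \<Longrightarrow> (\<lambda>x. f x + g x) \<in> V"
  using lin[of f g 1 1] by simp

lemma diff_mem: "f \<in> V \<Longrightarrow> g \<in> V \<Longrightarrow> (\<lambda>x. f x - g x) \<in> V"
  using lin[of f g 1 "-1"] by simp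

lemma cmult_mem: "f \<in> V \<Longrightarrow> (\<lambda>x. c * f x) \<in> V"
  using lin[of f f c 0] by simp

lemma form_add: "f \<in> V \<Longrightarrow> g \<in> V \<Longrightarrow> h \<in> V \<Longrightarrow> B (\<lambda>x. f x + g x) h = B f h + B g h"
  using form_lin[of f g h 1 1] by simp

lemma form_diff: "f \<in> V \<Longrightarrow> g \<in> V \<Longrightarrow> h \<in> V \<Longrightarrow> B (\<lambda>x. f x - g x) h = B f h - B g h"
  using form_lin[of f g h 1 "-1"] by simp

lemma form_lin_lin:
  assumes "f \<in> V" "g \<in> V"
  shows "B (\<lambda>x. a * f x + b * g x) (\<lambda>x. a * f x + b * g x) = a\<^sup>2 * B f f + 2 * a * b * B f g + b\<^sup>2 * B g g"
  using assms form_sym[OF assms]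
  by (simp add: form_lin form_lin_right lin power2_eq_square algebra_simps)

definition seminorm :: "('a \<Rightarrow> real) \<Rightarrow> real" where
  "seminorm f = sqrt (B f f)"

lemma seminorm_nonneg: "f \<in> V \<Longrightarrow> seminorm f \<ge> 0"
  by (simp add: seminorm_def form_nonneg)

lemma seminorm_sq: "f \<in> V \<Longrightarrow> (seminorm f)\<^sup>2 = B f f"
  by (simp add: seminorm_def form_nonneg)

lemma form_near_zero:
  assumes "f \<in> V" "g \<in> V" "B g g = 0" shows "B f g = 0"
proof (rule ccontr)
  assume ne: "B f g \<noteq> 0"
  \<comment> \<open>The value at which the affine function \<open>B f f + 2 * b * B f g\<close> of b
    equals -1.\<close>
  define b where "b = - (B f f + 1) / (2 * B f g)"
  have "0 \<le> B (\<lambda>x. 1 * f x + b * g x) (\<lambda>x. 1 * f x + b * g x)"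
    by (intro form_nonneg lin assms)
  also have "\<dots> = B f f + 2 * b * B f g" using form_lin_lin[OF assms(1,2), of 1 b] assms(3) by simp
  also have "\<dots> = -1" using ne by (simp add: b_def field_simps)
  finally show False by simp
qed

lemma Cauchy_Schwarz:
  assumes "f \<in> V" "g \<in> V" shows "\<bar>B f g\<bar> \<le> seminorm f * seminorm g"
proof -
  have "(B f g)\<^sup>2 \<le> B f f * B g g"
  proof (cases "B g g = 0")
    case True
    then show ?thesis using form_near_zero[OF assms] by simp
  next
    case False
    then have pos: "B g g > 0" using form_nonneg[OF assms(2)] by simp
    \<comment> \<open>This is \<open>B g g\<close> times the component of f orthogonal to g, written
      without a division.\<close>
    have "0 \<le> B (\<lambda>x. B g g * f x + (- B f g) * g x) (\<lambda>x. B g g * f x + (- B f g) * g x)"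
      by (intro form_nonneg lin assms)
    also have "\<dots> = B g g * (B f f * B g g - (B f g)\<^sup>2)"
      unfolding form_lin_lin[OF assms] by (simp add: power2_eq_square algebra_simps)
    finally show ?thesis using pos by (simp add: zero_le_mult_iff)
  qed
  then have "sqrt ((B f g)\<^sup>2) \<le> sqrt (B f f * B g g)" by (rule real_sqrt_le_mono)
  then show ?thesis by (simp add: seminorm_def real_sqrt_mult)
qed

lemma seminorm_triangle:
  assumes "f \<in> V" "g \<in> V" shows "seminorm (\<lambda>x. f x + g x) \<le> seminorm f + seminorm g"
proof (rule power2_le_imp_le)
  have "(seminorm (\<lambda>x. f x + g x))\<^sup>2 = B f f + 2 * B f g + B g g"
    using form_lin_lin[OF assms, of 1 1] seminorm_sq[OF add_mem[OF assms]] by simp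
  also have "\<dots> \<le> (seminorm f)\<^sup>2 + 2 * (seminorm f * seminorm g) + (seminorm g)\<^sup>2"
    using Cauchy_Schwarz[OF assms] assms by (simp add: seminorm_sq abs_le_iff)
  finally show "(seminorm (\<lambda>x. f x + g x))\<^sup>2 \<le> (seminorm f + seminorm g)\<^sup>2"
    by (simp add: power2_sum)
qed (use assms seminorm_nonneg in auto)

lemma seminorm_cmult: "f \<in> V \<Longrightarrow> seminorm (\<lambda>x. c * f x) = \<bar>c\<bar> * seminorm f"
  using form_lin_lin[of f f c 0] by (simp add: seminorm_def real_sqrt_mult)

lemma seminorm_minus_commute: "f \<in> V \<Longrightarrow> g \<in> V \<Longrightarrow> seminorm (\<lambda>x. f x - g x) = seminorm (\<lambda>x. g x - f x)"
  using seminorm_cmult[OF diff_mem[of f g], of "-1"] by simp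

lemma seminorm_triangle_diff:
  assumes "f \<in> V" "g \<in> V" shows "seminorm f \<le> seminorm g + seminorm (\<lambda>x. f x - g x)"
  using seminorm_triangle[OF assms(2) diff_mem[OF assms]] by simp

lemma seminorm_triangle3:
  assumes "f \<in> V" "g \<in> V" "h \<in> V"
  shows "seminorm (\<lambda>x. f x - h x) \<le> seminorm (\<lambda>x. f x - g x) + seminorm (\<lambda>x. g x - h x)"
  using seminorm_triangle[OF diff_mem[OF assms(1,2)] diff_mem[OF assms(2,3)]] by simp

lemma parallelogram:
  assumes "f \<in> V" "g \<in> V"
  shows "(seminorm (\<lambda>x. f x - g x))\<^sup>2
    = 2 * (seminorm f)\<^sup>2 + 2 * (seminorm g)\<^sup>2 - 4 * (seminorm (\<lambda>x. 1/2 * f x + 1/2 * g x))\<^sup>2"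
proof -
  have 1: "(seminorm (\<lambda>x. f x - g x))\<^sup>2 = B f f - 2 * B f g + B g g"
    using form_lin_lin[OF assms, of 1 "-1"] seminorm_sq[OF diff_mem[OF assms]] by simp
  have 2: "(seminorm (\<lambda>x. 1/2 * f x + 1/2 * g x))\<^sup>2 = (B f f + 2 * B f g + B g g) / 4"
    using form_lin_lin[OF assms, of "1/2" "1/2"] seminorm_sq[OF lin[OF assms, of "1/2" "1/2"]]
    by (simp add: power2_eq_square field_simps)
  show ?thesis unfolding 1 2 using assms by (simp add: seminorm_sq field_simps)
qed

text \<open>A minimising sequence for the seminorm on a convex set is Cauchy.\<close>

lemma near_minimal_close:
  assumes "f \<in> V" "g \<in> V" "d \<ge> 0" "(seminorm f)\<^sup>2 \<le> d + e" "(seminorm g)\<^sup>2 \<le> d + e"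
    "d \<le> (seminorm (\<lambda>x. 1/2 * f x + 1/2 * g x))\<^sup>2"
  shows "(seminorm (\<lambda>x. f x - g x))\<^sup>2 \<le> 4 * e"
  using parallelogram[OF assms(1,2)] assms(4-6) by linarith

text \<open>The best choice of t lowers the squared seminorm by (B w \<theta>)^2 / B \<theta>
  \<theta>. A minimiser up to e cannot be lowered by more than e, so it is almost orthogonal to
  \<theta>.\<close>

lemma near_projection_orthogonal:
  assumes "w \<in> V" "\<theta> \<in> V" "e \<ge> 0" "(seminorm w)\<^sup>2 \<le> d + e"
    and min: "\<And>t. d \<le> (seminorm (\<lambda>x. 1 * w x + t * \<theta> x))\<^sup>2"
  shows "(B w \<theta>)\<^sup>2 \<le> e * B \<theta> \<theta>"
proof (cases "B \<theta> \<theta> = 0")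
  case True
  then show ?thesis using form_near_zero[OF assms(1,2)] by simp
next
  case False
  then have pos: "B \<theta> \<theta> > 0" using form_nonneg[OF assms(2)] by simp
  let ?t = "- B w \<theta> / B \<theta> \<theta>"
  have "d \<le> B w w + 2 * ?t * B w \<theta> + ?t\<^sup>2 * B \<theta> \<theta>"
    using min[of ?t] form_lin_lin[OF assms(1,2), of 1 ?t] seminorm_sq[OF lin[OF assms(1,2)], of 1 ?t] by simp
  also have "\<dots> = B w w - (B w \<theta>)\<^sup>2 / B \<theta> \<theta>"
    using pos by (simp add: power2_eq_square field_simps)
  finally have "(B w \<theta>)\<^sup>2 / B \<theta> \<theta> \<le> e" using assms(4) seminorm_sq[OF assms(1)] by linarith
  then show ?thesis using pos by (simp add: field_simps)
qed

subsection \<open>Weak sequential compactness\<close>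

inductive_set span_seq :: "(nat \<Rightarrow> 'a \<Rightarrow> real) \<Rightarrow> ('a \<Rightarrow> real) set" for \<theta> where
  base: "\<theta> k \<in> span_seq \<theta>"
| comb: "f \<in> span_seq \<theta> \<Longrightarrow> g \<in> span_seq \<theta> \<Longrightarrow> (\<lambda>x. a * f x + b * g x) \<in> span_seq \<theta>"

text \<open>The convex hull of a tail, generated by binary combinations so that no coefficient
  families or index sets appear.\<close>

inductive_set convex_tail :: "(nat \<Rightarrow> 'a \<Rightarrow> real) \<Rightarrow> nat \<Rightarrow> ('a \<Rightarrow> real) set" for \<theta> k where
  base: "n \<ge> k \<Longrightarrow> \<theta> n \<in> convex_tail \<theta> k"
| comb: "f \<in> convex_tail \<theta> k \<Longrightarrow> g \<in> convex_tail \<theta> k \<Longrightarrow> 0 \<le> a \<Longrightarrow> 0 \<le> b \<Longrightarrow> a + b = 1 \<Longrightarrow>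
    (\<lambda>x. a * f x + b * g x) \<in> convex_tail \<theta> k"

lemma span_seq_mem: "range \<theta> \<subseteq> V \<Longrightarrow> f \<in> span_seq \<theta> \<Longrightarrow> f \<in> V"
  by (rotate_tac 1, induction rule: span_seq.induct) (auto intro: lin)

lemma convex_tail_mem: "range \<theta> \<subseteq> V \<Longrightarrow> f \<in> convex_tail \<theta> k \<Longrightarrow> f \<in> V"
  by (rotate_tac 1, induction rule: convex_tail.induct) (auto intro: lin)

lemma convex_tail_mono: "k \<le> l \<Longrightarrow> f \<in> convex_tail \<theta> l \<Longrightarrow> f \<in> convex_tail \<theta> k"
  by (rotate_tac 1, induction rule: convex_tail.induct) (auto intro: convex_tail.intros)

lemma convex_tail_range:
  assumes "range \<theta> \<subseteq> V" "v \<in> V" "\<And>n. n \<ge> k \<Longrightarrow> B (\<theta> n) v \<in> {l..u}" "f \<in> convex_tail \<theta> k"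
  shows "B f v \<in> {l..u}"
  using assms(4)
proof induction
  case (comb f g a b)
  have "B (\<lambda>x. a * f x + b * g x) v = a * B f v + b * B g v"
    using comb convex_tail_mem[OF assms(1)] assms(2) by (intro form_lin) auto
  moreover have "convex {l..u}" by simp
  ultimately show ?case
    using comb convexD[of "{l..u}" "B f v" "B g v" a b] by simp
qed (use assms(3) in auto)

lemma weak_Cauchy_span:
  assumes \<theta>: "range \<theta> \<subseteq> V" and conv: "\<And>k. convergent (\<lambda>n. B (\<theta> n) (\<theta> k))"
    and "f \<in> span_seq \<theta>"
  shows "convergent (\<lambda>n. B (\<theta> n) f)"
  using assms(3)
proof induction
  case (comb f g a b)
  have "B (\<theta> n) (\<lambda>x. a * f x + b * g x) = a * B (\<theta> n) f + b * B (\<theta> n) g" for n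
    using comb span_seq_mem[OF \<theta>] \<theta> by (intro form_lin_right) auto
  then show ?case using comb.IH by (simp add: convergent_add convergent_mult_const_iff convergent_mult convergent_const)
qed (rule conv)

text \<open>Up to an error that is almost orthogonal to the whole sequence, every \<open>v\<close> lies in the span.\<close>

lemma weak_Cauchy_all:
  assumes \<theta>: "range \<theta> \<subseteq> V" and conv: "\<And>k. convergent (\<lambda>n. B (\<theta> n) (\<theta> k))"
    and bnd: "\<And>n. B (\<theta> n) (\<theta> n) \<le> C" and v: "v \<in> V"
  shows "convergent (\<lambda>n. B (\<theta> n) v)"
proof -
  let ?S = "(\<lambda>p. (seminorm (\<lambda>x. v x - p x))\<^sup>2) ` span_seq \<theta>"
  define d where "d = Inf ?S"
  have bdd: "bdd_below ?S" by (rule bdd_belowI[of _ 0]) auto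
  have ne: "?S \<noteq> {}" using span_seq.base by blast
  have "Cauchy (\<lambda>n. B (\<theta> n) v)"
    unfolding Cauchy_altdef2
  proof (intro allI impI)
    fix e :: real assume e: "e > 0"
    have C: "C \<ge> 0" using bnd[of 0] form_nonneg[of "\<theta> 0"] \<theta> by (auto intro: order_trans)
    \<comment> \<open>Makes \<open>\<delta> * C\<close> at most (e/4)^2; with \<open>C + 1\<close>
      in the denominator C = 0 is allowed.\<close>
    define \<delta> where "\<delta> = (e / 4)\<^sup>2 / (C + 1)"
    have \<delta>: "\<delta> > 0" using e C by (simp add: \<delta>_def)
    have "Inf ?S < d + \<delta>" using \<delta> by (simp add: d_def)
    then obtain p where p: "p \<in> span_seq \<theta>" "(seminorm (\<lambda>x. v x - p x))\<^sup>2 < d + \<delta>"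
      using cInf_less_iff[OF ne bdd] by auto
    have pV: "p \<in> V" using span_seq_mem[OF \<theta> p(1)] .
    have wV: "(\<lambda>x. v x - p x) \<in> V" by (rule diff_mem[OF v pV])
    have small: "\<bar>B (\<theta> n) v - B (\<theta> n) p\<bar> \<le> e / 4" for n
    proof -
      have nV: "\<theta> n \<in> V" using \<theta> by auto
      have "(B (\<lambda>x. v x - p x) (\<theta> n))\<^sup>2 \<le> \<delta> * B (\<theta> n) (\<theta> n)"
      proof (rule near_projection_orthogonal[OF wV nV])
        fix t
        have "(\<lambda>x. 1 * p x + (- t) * \<theta> n x) \<in> span_seq \<theta>" by (intro span_seq.intros p)
        then have "d \<le> (seminorm (\<lambda>x. v x - (1 * p x + (- t) * \<theta> n x)))\<^sup>2"
          unfolding d_def by (intro cInf_lower[OF _ bdd]) auto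
        then show "d \<le> (seminorm (\<lambda>x. 1 * (v x - p x) + t * \<theta> n x))\<^sup>2" by (simp add: algebra_simps)
      qed (use p \<delta> in auto)
      also have "\<dots> \<le> \<delta> * C" using bnd \<delta> by (simp add: mult_left_mono)
      also have "\<dots> \<le> (e / 4)\<^sup>2"
        using C e by (simp add: \<delta>_def field_simps mult_left_mono)
      finally have "\<bar>B (\<lambda>x. v x - p x) (\<theta> n)\<bar> \<le> \<bar>e / 4\<bar>" by (simp only: abs_le_square_iff)
      moreover have "B (\<lambda>x. v x - p x) (\<theta> n) = B (\<theta> n) v - B (\<theta> n) p"
        using form_diff[OF v pV nV] form_sym[OF nV v] form_sym[OF nV pV] by simp
      ultimately show ?thesis using e by simp
    qed
    have "Cauchy (\<lambda>n. B (\<theta> n) p)" using weak_Cauchy_span[OF \<theta> conv p(1)] by (rule convergent_Cauchy)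
    then obtain N where N: "\<And>n. n \<ge> N \<Longrightarrow> dist (B (\<theta> n) p) (B (\<theta> N) p) < e / 2"
      unfolding Cauchy_altdef2 using e by (meson half_gt_zero)
    have "dist (B (\<theta> n) v) (B (\<theta> N) v) < e" if "n \<ge> N" for n
      using N[OF that] small[of n] small[of N] unfolding dist_real_def by linarith
    then show "\<exists>N. \<forall>n\<ge>N. dist (B (\<theta> n) v) (B (\<theta> N) v) < e" by blast
  qed
  then show ?thesis by (rule Cauchy_convergent)
qed

text \<open>A diagonal extraction makes the pairings with each \<open>\<theta> k\<close> converge,
  and \<open>weak_Cauchy_all\<close> extends this to every v. No limit element is claimed at this
  stage; the space is not assumed complete, and the limit comes from convex combinations
  later.\<close>

lemma weak_subsequence:
  assumes \<theta>: "range \<theta> \<subseteq> V" and bnd: "\<And>n. B (\<theta> n) (\<theta> n) \<le> C"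
  obtains r :: "nat \<Rightarrow> nat" where "strict_mono r" "\<And>v. v \<in> V \<Longrightarrow> convergent (\<lambda>n. B (\<theta> (r n)) v)"
proof -
  have sn: "seminorm (\<theta> n) \<le> sqrt C" for n
    unfolding seminorm_def using bnd by simp
  have bounded: "\<bar>B (\<theta> n) (\<theta> k)\<bar> \<le> sqrt C * sqrt C" for n k
  proof -
    have "\<bar>B (\<theta> n) (\<theta> k)\<bar> \<le> seminorm (\<theta> n) * seminorm (\<theta> k)"
      using \<theta> by (intro Cauchy_Schwarz) auto
    also have "\<dots> \<le> sqrt C * sqrt C"
      using sn \<theta> order_trans[OF seminorm_nonneg sn, of 0] by (intro mult_mono seminorm_nonneg) auto
    finally show ?thesis .
  qed
  interpret subseqs "\<lambda>k s. convergent (\<lambda>n. B (\<theta> (s n)) (\<theta> k))"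
  proof
    fix k and s :: "nat \<Rightarrow> nat" assume "strict_mono s"
    have "bounded (range (\<lambda>n. B (\<theta> (s n)) (\<theta> k)))"
      unfolding bounded_iff using bounded by auto
    then obtain l r where "strict_mono r" "((\<lambda>n. B (\<theta> (s n)) (\<theta> k)) \<circ> r) \<longlonglongrightarrow> l"
      using bounded_imp_convergent_subsequence by blast
    then show "\<exists>r'. strict_mono r' \<and> convergent (\<lambda>n. B (\<theta> ((s \<circ> r') n)) (\<theta> k))"
      by (auto simp: convergent_def o_def)
  qed
  have dg: "convergent (\<lambda>n. B (\<theta> (diagseq n)) (\<theta> k))" for k
  proof -
    \<comment> \<open>The diagonal is a subsequence of the k-th extraction only from index
      \<open>Suc k\<close> on.\<close>
    have "convergent (\<lambda>n. B (\<theta> ((diagseq \<circ> (+) (Suc k)) n)) (\<theta> k))"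
    proof (rule diagseq_holds)
      fix k and s r :: "nat \<Rightarrow> nat" assume "strict_mono r" "convergent (\<lambda>n. B (\<theta> (s n)) (\<theta> k))"
      then show "convergent (\<lambda>n. B (\<theta> ((s \<circ> r) n)) (\<theta> k))"
        using convergent_subseq_convergent[of "\<lambda>n. B (\<theta> (s n)) (\<theta> k)" r] by (simp add: o_def)
    qed
    then show ?thesis
      using convergent_ignore_initial_segment[of "\<lambda>n. B (\<theta> (diagseq n)) (\<theta> k)" "Suc k"]
      by (simp add: o_def add.commute)
  qed
  have "convergent (\<lambda>n. B (\<theta> (diagseq n)) v)" if "v \<in> V" for v
    by (rule weak_Cauchy_all[of "\<lambda>n. \<theta> (diagseq n)"]) (use \<theta> dg bnd that in auto)
  with subseq_diagseq that show ?thesis by blast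
qed

text \<open>A form of Mazur's lemma. The minimal squared seminorms \<open>d k\<close> of the tail
  hulls increase with k and are bounded by C, so near-minimisers of late tails are almost minimal
  for an earlier one, and the parallelogram law brings them together.\<close>

lemma convex_tail_Cauchy:
  assumes \<theta>: "range \<theta> \<subseteq> V" and bnd: "\<And>n. B (\<theta> n) (\<theta> n) \<le> C"
  obtains y where "\<And>k. y k \<in> convex_tail \<theta> k"
    "\<forall>e>0. \<exists>M. \<forall>n\<ge>M. \<forall>k\<ge>M. seminorm (\<lambda>x. y n x - y k x) < e"
proof -
  define S where "S k = (\<lambda>f. (seminorm f)\<^sup>2) ` convex_tail \<theta> k" for k
  define d where "d k = Inf (S k)" for k
  have bdd: "bdd_below (S k)" for k unfolding S_def by (rule bdd_belowI[of _ 0]) auto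
  have ne: "S k \<noteq> {}" for k unfolding S_def using convex_tail.base[of k k] by blast
  have dmono: "d k \<le> d l" if "k \<le> l" for k l
    unfolding d_def using convex_tail_mono[OF that] by (intro cInf_superset_mono ne bdd) (auto simp: S_def)
  have dC: "d k \<le> C" for k
  proof -
    have "d k \<le> (seminorm (\<theta> k))\<^sup>2"
      unfolding d_def using convex_tail.base[of k k] by (intro cInf_lower bdd) (auto simp: S_def)
    also have "\<dots> = B (\<theta> k) (\<theta> k)" by (rule seminorm_sq) (use \<theta> in auto)
    also have "\<dots> \<le> C" by (rule bnd)
    finally show ?thesis .
  qed
  have d0: "d k \<ge> 0" for k unfolding d_def by (rule cInf_greatest[OF ne]) (auto simp: S_def)
  have "\<exists>f\<in>convex_tail \<theta> k. (seminorm f)\<^sup>2 < d k + inverse (real (Suc k))" for k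
  proof -
    have "Inf (S k) < d k + inverse (real (Suc k))" by (simp add: d_def)
    then show ?thesis using cInf_less_iff[OF ne bdd] by (auto simp: S_def)
  qed
  then obtain y where y: "\<And>k. y k \<in> convex_tail \<theta> k" "\<And>k. (seminorm (y k))\<^sup>2 < d k + inverse (real (Suc k))"
    by metis
  have yV: "y k \<in> V" for k using convex_tail_mem[OF \<theta> y(1)] .
  have "Bseq d"
    by (rule BseqI'[of d C]) (use dC d0 in auto)
  then have "convergent d"
    by (rule Bseq_mono_convergent) (use dmono in auto)
  then obtain l where l: "d \<longlonglongrightarrow> l" by (auto simp: convergent_def)
  have dl: "d k \<le> l" for k using LIMSEQ_le_const[OF l, of "d k"] dmono by blast
  have "\<forall>e>0. \<exists>M. \<forall>n\<ge>M. \<forall>k\<ge>M. seminorm (\<lambda>x. y n x - y k x) < e"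
  proof (intro allI impI)
    fix e :: real assume e: "e > 0"
    have "e\<^sup>2 / 16 > 0" using e by simp
    then obtain M1 where M1: "\<And>n. n \<ge> M1 \<Longrightarrow> \<bar>d n - l\<bar> < e\<^sup>2 / 16"
      using l unfolding LIMSEQ_iff real_norm_def by metis
    obtain M2 where M2: "\<And>n. n \<ge> M2 \<Longrightarrow> inverse (real (Suc n)) < e\<^sup>2 / 16"
    proof -
      have "(\<lambda>n. inverse (real (Suc n))) \<longlonglongrightarrow> 0" by (rule LIMSEQ_inverse_real_of_nat)
      then show ?thesis using that \<open>e\<^sup>2 / 16 > 0\<close> unfolding LIMSEQ_iff real_norm_def
        by (metis abs_of_pos diff_zero inverse_positive_iff_positive of_nat_0_less_iff zero_less_Suc)
    qed
    define M where "M = max M1 M2"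
    have "seminorm (\<lambda>x. y n x - y k x) < e" if nk: "n \<ge> M" "k \<ge> M" for n k
    proof -
      have t: "y n \<in> convex_tail \<theta> M" "y k \<in> convex_tail \<theta> M"
        using convex_tail_mono nk y(1) by blast+
      have "(\<lambda>x. 1/2 * y n x + 1/2 * y k x) \<in> convex_tail \<theta> M"
        by (rule convex_tail.comb[OF t]) auto
      then have "d M \<le> (seminorm (\<lambda>x. 1/2 * y n x + 1/2 * y k x))\<^sup>2"
        unfolding d_def by (intro cInf_lower bdd) (auto simp: S_def)
      \<comment> \<open>One e^2/16 comes from the distance of \<open>d M\<close> to the limit of d,
        the other from the near-minimality of \<open>y j\<close>.\<close>
      moreover have up: "(seminorm (y j))\<^sup>2 \<le> d M + e\<^sup>2 / 8" if "j \<ge> M" for j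
        using y(2)[of j] M1[of M] M2[of j] dl[of j] that unfolding M_def by linarith
      ultimately have "(seminorm (\<lambda>x. y n x - y k x))\<^sup>2 \<le> 4 * (e\<^sup>2 / 8)"
        using nk by (intro near_minimal_close[OF yV yV d0[of M]]) auto
      also have "\<dots> < e\<^sup>2" using e by simp
      finally show ?thesis using e by (simp add: power_less_imp_less_base)
    qed
    then show "\<exists>M. \<forall>n\<ge>M. \<forall>k\<ge>M. seminorm (\<lambda>x. y n x - y k x) < e" by blast
  qed
  with y(1) that show ?thesis by blast
qed

text \<open>From some index on all pairings with v lie in a small interval, and convex combinations
  stay in it. So the strong limit of the combinations represents the weak limit of the
  sequence.\<close>

lemma convex_tail_weak_limit:
  assumes \<theta>: "range \<theta> \<subseteq> V" and y: "\<And>k. y k \<in> convex_tail \<theta> k"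
    and v: "v \<in> V" and conv: "convergent (\<lambda>n. B (\<theta> n) v)"
    and u: "u \<in> V" and lim: "(\<lambda>k. seminorm (\<lambda>x. y k x - u x)) \<longlonglongrightarrow> 0"
  shows "(\<lambda>n. B (\<theta> n) v) \<longlonglongrightarrow> B u v"
proof -
  obtain l where l: "(\<lambda>n. B (\<theta> n) v) \<longlonglongrightarrow> l" using conv by (auto simp: convergent_def)
  have yV: "y k \<in> V" for k using convex_tail_mem[OF \<theta> y] .
  have "(\<lambda>k. B (y k) v) \<longlonglongrightarrow> l"
  proof (rule LIMSEQ_I)
    fix e :: real assume e: "e > 0"
    then obtain N where N: "\<And>n. n \<ge> N \<Longrightarrow> norm (B (\<theta> n) v - l) < e / 2"
      using LIMSEQ_D[OF l, of "e / 2"] by auto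
    have "norm (B (y k) v - l) < e" if "k \<ge> N" for k
    proof -
      have "B (y k) v \<in> {l - e / 2 .. l + e / 2}"
      proof (rule convex_tail_range[OF \<theta> v _ y])
        show "B (\<theta> n) v \<in> {l - e / 2 .. l + e / 2}" if "n \<ge> k" for n
          using N[of n] \<open>k \<ge> N\<close> that unfolding real_norm_def atLeastAtMost_iff by linarith
      qed
      then show ?thesis using e by (auto simp: abs_less_iff)
    qed
    then show "\<exists>N. \<forall>k\<ge>N. norm (B (y k) v - l) < e" by blast
  qed
  moreover have "(\<lambda>k. B (y k) v) \<longlonglongrightarrow> B u v"
  proof (rule LIM_zero_cancel, rule Lim_null_comparison)
    show "\<forall>\<^sub>F k in sequentially. norm (B (y k) v - B u v) \<le> seminorm (\<lambda>x. y k x - u x) * seminorm v"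
    proof (rule always_eventually, rule allI)
      fix k
      show "norm (B (y k) v - B u v) \<le> seminorm (\<lambda>x. y k x - u x) * seminorm v"
        using Cauchy_Schwarz[OF diff_mem[OF yV u] v, of k] form_diff[OF yV u v, of k] by simp
    qed
    show "(\<lambda>k. seminorm (\<lambda>x. y k x - u x) * seminorm v) \<longlonglongrightarrow> 0"
      using tendsto_mult_left_zero[OF lim] .
  qed
  ultimately show ?thesis using l LIMSEQ_unique by blast
qed

end

subsection \<open>The energy form\<close>

lemma L2_lin:
  assumes "f \<in> L2 \<Omega>" "g \<in> L2 \<Omega>" shows "(\<lambda>x. a * f x + b * g x) \<in> L2 \<Omega>"
proof -
  have m: "f \<in> borel_measurable (lebesgue_on \<Omega>)" "g \<in> borel_measurable (lebesgue_on \<Omega>)"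
    and i: "integrable (lebesgue_on \<Omega>) (\<lambda>x. (f x)\<^sup>2)" "integrable (lebesgue_on \<Omega>) (\<lambda>x. (g x)\<^sup>2)"
    using assms by (auto simp: L2_def)
  have "integrable (lebesgue_on \<Omega>) (\<lambda>x. (a * f x + b * g x)\<^sup>2)"
  proof (rule Bochner_Integration.integrable_bound)
    show "integrable (lebesgue_on \<Omega>) (\<lambda>x. 2 * a\<^sup>2 * (f x)\<^sup>2 + 2 * b\<^sup>2 * (g x)\<^sup>2)" using i by simp
    show "(\<lambda>x. (a * f x + b * g x)\<^sup>2) \<in> borel_measurable (lebesgue_on \<Omega>)" using m by simp
    show "AE x in lebesgue_on \<Omega>. norm ((a * f x + b * g x)\<^sup>2) \<le> norm (2 * a\<^sup>2 * (f x)\<^sup>2 + 2 * b\<^sup>2 * (g x)\<^sup>2)"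
    proof (rule AE_I2)
      fix x
      have "(a * f x + b * g x)\<^sup>2 + (a * f x - b * g x)\<^sup>2 = 2 * a\<^sup>2 * (f x)\<^sup>2 + 2 * b\<^sup>2 * (g x)\<^sup>2"
        by (simp add: power2_eq_square algebra_simps)
      moreover have "(a * f x - b * g x)\<^sup>2 \<ge> 0" by simp
      ultimately have "(a * f x + b * g x)\<^sup>2 \<le> 2 * a\<^sup>2 * (f x)\<^sup>2 + 2 * b\<^sup>2 * (g x)\<^sup>2" by linarith
      then show "norm ((a * f x + b * g x)\<^sup>2) \<le> norm (2 * a\<^sup>2 * (f x)\<^sup>2 + 2 * b\<^sup>2 * (g x)\<^sup>2)"
        by (simp only: real_norm_def abs_of_nonneg zero_le_power2)
    qed
  qed
  then show ?thesis using m by (simp add: L2_def)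
qed

text \<open>Square integrability is asked of the derivatives of order m only. The lower derivatives
  of elements of the homogeneous space lie in other Lebesgue spaces, and this common domain of the
  form contains them as well as H^m.\<close>

definition weak_space :: "nat \<Rightarrow> 'a::euclidean_space set \<Rightarrow> ('a \<Rightarrow> real) set" where
  "weak_space m \<Omega> = {u. \<exists>D. weak_family m \<Omega> u D \<and> (\<forall>bs\<in>index_lists m. D bs \<in> L2 \<Omega>)}"

lemma index_lists_multi_indices: "index_lists m \<subseteq> multi_indices m"
  by (auto simp: index_lists_def multi_indices_def)

lemma finite_multi_indices [simp]: "finite (multi_indices m)"
  unfolding multi_indices_def by (rule finite_lists_length_le) simp

lemma weak_family_lin:
  assumes "open \<Omega>" "weak_family m \<Omega> u D" "weak_family m \<Omega> v E"
  shows "weak_family m \<Omega> (\<lambda>x. a * u x + b * v x) (\<lambda>bs x. a * D bs x + b * E bs x)"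
  using assms by (auto simp: weak_family_def multi_indices_iff intro!: has_weak_deriv_lin)

lemma weak_family_measurable:
  assumes "open \<Omega>" "weak_family m \<Omega> u D" "bs \<in> multi_indices m"
  shows "D bs \<in> borel_measurable (lebesgue_on \<Omega>)"
  using assms by (auto simp: weak_family_def has_weak_deriv_def intro!: locally_integrable_measurable)

lemma weak_space_lin:
  assumes "open \<Omega>" "u \<in> weak_space m \<Omega>" "v \<in> weak_space m \<Omega>"
  shows "(\<lambda>x. a * u x + b * v x) \<in> weak_space m \<Omega>"
proof -
  obtain D where D: "weak_family m \<Omega> u D" "\<And>bs. bs \<in> index_lists m \<Longrightarrow> D bs \<in> L2 \<Omega>"
    using assms(2) by (auto simp: weak_space_def)
  obtain E where E: "weak_family m \<Omega> v E" "\<And>bs. bs \<in> index_lists m \<Longrightarrow> E bs \<in> L2 \<Omega>"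
    using assms(3) by (auto simp: weak_space_def)
  show ?thesis
    unfolding weak_space_def mem_Collect_eq
    using weak_family_lin[OF assms(1) D(1) E(1), of a b] L2_lin[OF D(2) E(2), of _ _ a b] by blast
qed

lemma nabla_of_measurable:
  assumes "open \<Omega>" "weak_family m \<Omega> u D"
  shows "(\<lambda>x. nabla_of m (\<lambda>bs. D bs x)) \<in> borel_measurable (lebesgue_on \<Omega>)"
proof (cases "even m")
  case True
  have "D (doubled bs) \<in> borel_measurable (lebesgue_on \<Omega>)" if "bs \<in> index_lists (m div 2)" for bs
    using that True by (intro weak_family_measurable[OF assms]) (auto simp: multi_indices_iff index_lists_def)
  then show ?thesis using True
    by (auto simp: nabla_of_def intro!: borel_measurable_Pair borel_measurable_sum)
next
  case False
  have "D (b # doubled bs) \<in> borel_measurable (lebesgue_on \<Omega>)"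
    if "b \<in> Basis" "bs \<in> index_lists ((m - 1) div 2)" for b bs
    using that False by (intro weak_family_measurable[OF assms]) (auto simp: multi_indices_iff index_lists_def elim!: oddE)
  then show ?thesis using False
    by (auto simp: nabla_of_def intro!: borel_measurable_Pair borel_measurable_sum borel_measurable_scaleR)
qed

lemma dirichlet_form_eq:
  assumes "open \<Omega>" "weak_family m \<Omega> u D" "weak_family m \<Omega> v E"
  shows "dirichlet_form m \<Omega> u v
    = (LINT x|lebesgue_on \<Omega>. nabla_of m (\<lambda>bs. D bs x) \<bullet> nabla_of m (\<lambda>bs. E bs x))"
  unfolding dirichlet_form_def
proof (rule integral_cong_AE)
  show "AE x in lebesgue_on \<Omega>. nabla_pow m \<Omega> u x \<bullet> nabla_pow m \<Omega> v x
      = nabla_of m (\<lambda>bs. D bs x) \<bullet> nabla_of m (\<lambda>bs. E bs x)"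
    using nabla_pow_AE(1)[OF assms(1,2)] nabla_pow_AE(1)[OF assms(1,3)] by eventually_elim simp
qed (rule borel_measurable_inner[OF nabla_pow_AE(2)[OF assms(1,2)] nabla_pow_AE(2)[OF assms(1,3)]]
    borel_measurable_inner[OF nabla_of_measurable[OF assms(1,2)] nabla_of_measurable[OF assms(1,3)]])+

lemma dirichlet_energy_form: "dirichlet_energy m \<Omega> u = dirichlet_form m \<Omega> u u"
  by (simp add: dirichlet_energy_def dirichlet_form_def power2_norm_eq_inner)

lemma nabla_of_sq_integrable:
  assumes "open \<Omega>" "weak_family m \<Omega> u D" "\<And>bs. bs \<in> index_lists m \<Longrightarrow> D bs \<in> L2 \<Omega>"
  shows "integrable (lebesgue_on \<Omega>) (\<lambda>x. (norm (nabla_of m (\<lambda>bs. D bs x)))\<^sup>2)"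
proof (rule Bochner_Integration.integrable_bound)
  show "integrable (lebesgue_on \<Omega>) (\<lambda>x. card (index_lists m :: 'a list set) * (\<Sum>bs\<in>index_lists m. (D bs x)\<^sup>2))"
    using assms(3) by (intro integrable_mult_right Bochner_Integration.integrable_sum) (auto simp: L2_def)
  show "AE x in lebesgue_on \<Omega>. norm ((norm (nabla_of m (\<lambda>bs. D bs x)))\<^sup>2)
      \<le> norm (card (index_lists m :: 'a list set) * (\<Sum>bs\<in>index_lists m. (D bs x)\<^sup>2))"
    using norm_nabla_of_sq_le by (intro AE_I2) (auto intro: order_trans[OF _ abs_ge_self])
qed (rule borel_measurable_power[OF measurable_compose[OF nabla_of_measurable[OF assms(1,2)] borel_measurable_norm]])

lemma nabla_of_inner_integrable:
  assumes "open \<Omega>" "weak_family m \<Omega> u D" "\<And>bs. bs \<in> index_lists m \<Longrightarrow> D bs \<in> L2 \<Omega>"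
    "weak_family m \<Omega> v E" "\<And>bs. bs \<in> index_lists m \<Longrightarrow> E bs \<in> L2 \<Omega>"
  shows "integrable (lebesgue_on \<Omega>) (\<lambda>x. nabla_of m (\<lambda>bs. D bs x) \<bullet> nabla_of m (\<lambda>bs. E bs x))"
proof (rule Bochner_Integration.integrable_bound)
  show "integrable (lebesgue_on \<Omega>) (\<lambda>x. (norm (nabla_of m (\<lambda>bs. D bs x)))\<^sup>2 + (norm (nabla_of m (\<lambda>bs. E bs x)))\<^sup>2)"
    using assms by (intro Bochner_Integration.integrable_add nabla_of_sq_integrable)
  show "AE x in lebesgue_on \<Omega>. norm (nabla_of m (\<lambda>bs. D bs x) \<bullet> nabla_of m (\<lambda>bs. E bs x))
      \<le> norm ((norm (nabla_of m (\<lambda>bs. D bs x)))\<^sup>2 + (norm (nabla_of m (\<lambda>bs. E bs x)))\<^sup>2)"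
  proof (rule AE_I2)
    fix x
    let ?a = "nabla_of m (\<lambda>bs. D bs x)" and ?b = "nabla_of m (\<lambda>bs. E bs x)"
    have "\<bar>?a \<bullet> ?b\<bar> \<le> norm ?a * norm ?b" by (rule Cauchy_Schwarz_ineq2)
    also have "\<dots> \<le> (norm ?a)\<^sup>2 + (norm ?b)\<^sup>2"
      using sum_squares_bound[of "norm ?a" "norm ?b"] mult_nonneg_nonneg[OF norm_ge_zero norm_ge_zero, of ?a ?b]
      unfolding mult.assoc by linarith
    finally show "norm (?a \<bullet> ?b) \<le> norm ((norm ?a)\<^sup>2 + (norm ?b)\<^sup>2)" by simp
  qed
qed (rule borel_measurable_inner[OF nabla_of_measurable[OF assms(1,2)] nabla_of_measurable[OF assms(1,4)]])

lemma semi_inner_weak_space: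
  assumes "open \<Omega>"
  shows "semi_inner (weak_space m \<Omega>) (dirichlet_form m \<Omega>)"
proof
  fix f g h :: "'a \<Rightarrow> real" and a b
  assume "f \<in> weak_space m \<Omega>" "g \<in> weak_space m \<Omega>"
  then show "(\<lambda>x. a * f x + b * g x) \<in> weak_space m \<Omega>" by (rule weak_space_lin[OF assms])
next
  fix f g h :: "'a \<Rightarrow> real" and a b
  assume *: "f \<in> weak_space m \<Omega>" "g \<in> weak_space m \<Omega>" "h \<in> weak_space m \<Omega>"
  obtain D where D: "weak_family m \<Omega> f D" "\<And>bs. bs \<in> index_lists m \<Longrightarrow> D bs \<in> L2 \<Omega>"
    using *(1) by (auto simp: weak_space_def)
  obtain E where E: "weak_family m \<Omega> g E" "\<And>bs. bs \<in> index_lists m \<Longrightarrow> E bs \<in> L2 \<Omega>"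
    using *(2) by (auto simp: weak_space_def)
  obtain F where F: "weak_family m \<Omega> h F" "\<And>bs. bs \<in> index_lists m \<Longrightarrow> F bs \<in> L2 \<Omega>"
    using *(3) by (auto simp: weak_space_def)
  show "dirichlet_form m \<Omega> (\<lambda>x. a * f x + b * g x) h = a * dirichlet_form m \<Omega> f h + b * dirichlet_form m \<Omega> g h"
    unfolding dirichlet_form_eq[OF assms weak_family_lin[OF assms D(1) E(1)] F(1)]
      dirichlet_form_eq[OF assms D(1) F(1)] dirichlet_form_eq[OF assms E(1) F(1)]
    using nabla_of_inner_integrable[OF assms D F] nabla_of_inner_integrable[OF assms E F]
    by (simp add: nabla_of_lin inner_add_left)
next
  show "dirichlet_form m \<Omega> f g = dirichlet_form m \<Omega> g f" for f g
    by (simp add: dirichlet_form_def inner_commute)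
  show "dirichlet_form m \<Omega> f f \<ge> 0" for f
    by (simp add: dirichlet_form_def)
qed

lemma semi_inner_seminorm: "semi_inner.seminorm (dirichlet_form m \<Omega>) u = sqrt (dirichlet_energy m \<Omega> u)"
  if "open \<Omega>"
  using semi_inner.seminorm_def[OF semi_inner_weak_space[OF that]] by (simp add: dirichlet_energy_form)

lemma smooth_weak_family: "smooth f \<Longrightarrow> open \<Omega> \<Longrightarrow> weak_family m \<Omega> f (\<lambda>bs. partials bs f)"
  by (simp add: weak_family_def multi_indices_iff smooth_has_weak_deriv)

lemma integrable_lebesgue_on:
  fixes f :: "'a::euclidean_space \<Rightarrow> real"
  assumes "integrable lebesgue f" "\<Omega> \<in> sets lebesgue"
  shows "integrable (lebesgue_on \<Omega>) f"
  by (rule integrable_restrict_space[THEN iffD2]) (use assms in \<open>auto intro: integrable_mult_indicator[where f = f, simplified]\<close>)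

lemma smooth_L2_if_vanishing:
  fixes f :: "'a::euclidean_space \<Rightarrow> real"
  assumes "\<phi> \<in> test_functions U" "open \<Omega>"
  shows "\<phi> \<in> L2 \<Omega>"
proof -
  have "integrable lebesgue (\<lambda>x. \<phi> x * \<phi> x)"
    by (rule test_functions_integrable(2)[OF test_functions_smooth_mult(1)[OF assms(1) test_functions_smooth[OF assms(1)]]])
  then show ?thesis
    using assms(2) smooth_measurable[OF test_functions_smooth[OF assms(1)]]
    by (auto simp: L2_def power2_eq_square intro!: integrable_lebesgue_on measurable_restrict_space1)
qed

lemma test_functions_weak_space:
  assumes "\<phi> \<in> test_functions U" "open \<Omega>" shows "\<phi> \<in> weak_space m \<Omega>"
  unfolding weak_space_def
  using smooth_weak_family[OF test_functions_smooth[OF assms(1)] assms(2)]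
    smooth_L2_if_vanishing[OF test_functions_partials[OF assms(1)] assms(2)]
  by (intro CollectI exI[of _ "\<lambda>bs. partials bs \<phi>"]) (auto simp: index_lists_def)

lemma norm_nabla_of_partials:
  fixes f :: "'a::euclidean_space \<Rightarrow> real"
  assumes "smooth f"
  shows "(norm (nabla_of m (\<lambda>bs. partials bs f x)))\<^sup>2 =
    (\<Sum>bs\<in>index_lists (m mod 2). (partials bs ((laplacian ^^ (m div 2)) f) x)\<^sup>2)"
proof (cases "even m")
  case True
  then show ?thesis
    by (simp add: nabla_of_def norm_Pair laplacian_pow_eq[OF assms])
next
  case False
  let ?k = "m div 2"
  have k: "(m - 1) div 2 = ?k" "m mod 2 = Suc 0" using False by (auto elim!: oddE)
  have p: "partial b ((laplacian ^^ ?k) f) x = (\<Sum>bs\<in>index_lists ?k. partials (b # doubled bs) f x)"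
    if "b \<in> Basis" for b
  proof -
    have "partials [b] (\<lambda>x. \<Sum>bs\<in>index_lists ?k. partials (doubled bs) f x)
        = (\<lambda>x. \<Sum>bs\<in>index_lists ?k. partials [b] (partials (doubled bs) f) x)"
      using that by (intro partials_sum smooth_partials assms) (auto dest: index_lists_D)
    then show ?thesis by (simp add: laplacian_pow_eq[OF assms])
  qed
  have "(norm (\<Sum>b\<in>Basis. c b *\<^sub>R b :: 'a))\<^sup>2 = (\<Sum>b\<in>Basis. (c b)\<^sup>2)" for c
    unfolding power2_norm_eq_inner by (subst euclidean_inner) (simp add: power2_eq_square)
  then have "(norm (nabla_of m (\<lambda>bs. partials bs f x)))\<^sup>2 = (\<Sum>b\<in>Basis. (partial b ((laplacian ^^ ?k) f) x)\<^sup>2)"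
    using False p k(1) by (simp add: nabla_of_def norm_Pair sum_nonneg)
  then show ?thesis unfolding k(2) by (simp add: sum_index_lists_Suc)
qed

text \<open>The integrand is the square of the derivatives of order \<open>m mod 2\<close> of a
  power of the Laplacian; the Hessian identity converts its integral back into all derivatives of
  order m.\<close>

lemma dirichlet_energy_test:
  fixes \<phi> :: "'a::euclidean_space \<Rightarrow> real"
  assumes "\<phi> \<in> test_functions \<Omega>" "open \<Omega>"
  shows "dirichlet_energy m \<Omega> \<phi> = top_energy m \<phi>"
proof -
  have sm: "smooth \<phi>" using test_functions_smooth[OF assms(1)] .
  have lt: "(laplacian ^^ k) \<phi> \<in> test_functions \<Omega>" for k
    by (induction k) (auto intro: test_functions_laplacian assms)
  let ?g = "(laplacian ^^ (m div 2)) \<phi>"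
  have t: "(\<lambda>x. partials bs ?g x * partials bs ?g x) \<in> test_functions \<Omega>" if "bs \<in> index_lists (m mod 2)" for bs
    using that index_lists_D test_functions_partials[OF lt] test_functions_smooth
    by (intro test_functions_smooth_mult(1)) blast+
  have "dirichlet_energy m \<Omega> \<phi> = (LINT x|lebesgue_on \<Omega>. (norm (nabla_of m (\<lambda>bs. partials bs \<phi> x)))\<^sup>2)"
    unfolding dirichlet_energy_form
    by (subst dirichlet_form_eq[OF assms(2) smooth_weak_family[OF sm assms(2)] smooth_weak_family[OF sm assms(2)]])
      (simp add: power2_norm_eq_inner)
  \<comment> \<open>The factor 1 gives the integrand the form of a function times a test
    function.\<close>
  also have "\<dots> = (LINT x|lebesgue_on \<Omega>. 1 * (\<Sum>bs\<in>index_lists (m mod 2). partials bs ?g x * partials bs ?g x))"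
    unfolding norm_nabla_of_partials[OF sm] by (simp add: power2_eq_square)
  also have "\<dots> = (LINT x|lebesgue. 1 * (\<Sum>bs\<in>index_lists (m mod 2). partials bs ?g x * partials bs ?g x))"
    by (rule integral_test_lebesgue_on[OF assms(2) test_functions_sum[OF t]])
  also have "\<dots> = top_energy (m mod 2) ?g"
    using test_functions_integrable(2)[OF t] by (simp add: top_energy_def power2_eq_square)
  also have "\<dots> = top_energy m \<phi>"
    using top_energy_laplacian_pow[OF assms(1), of "m div 2" "m mod 2"] by simp
  finally show ?thesis .
qed

subsection \<open>The spaces \<open>H\<^sup>m\<close>\<close>

lemma Hm_family:
  assumes "u \<in> Hm m \<Omega>"
  obtains D where "weak_family m \<Omega> u D" "\<And>bs. bs \<in> multi_indices m \<Longrightarrow> D bs \<in> L2 \<Omega>"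
proof -
  have "\<forall>bs\<in>multi_indices m. \<exists>v. v \<in> L2 \<Omega> \<and> has_weak_deriv \<Omega> bs u v"
    using assms by (auto simp: Hm_def)
  then obtain D where "\<forall>bs\<in>multi_indices m. D bs \<in> L2 \<Omega> \<and> has_weak_deriv \<Omega> bs u (D bs)"
    by (rule bchoice[THEN exE])
  then show ?thesis by (intro that[of D]) (auto simp: weak_family_def)
qed

text \<open>Frees the norm from the choices inside \<open>weak_deriv\<close>: any family computes
  it, in particular the classical derivatives of a smooth function.\<close>

lemma Hm_norm_eq:
  assumes "open \<Omega>" "weak_family m \<Omega> u D"
  shows "Hm_norm m \<Omega> u = sqrt (\<Sum>bs\<in>multi_indices m. LINT x|lebesgue_on \<Omega>. (D bs x)\<^sup>2)"
proof -
  have "(LINT x|lebesgue_on \<Omega>. (weak_deriv \<Omega> bs u x)\<^sup>2) = (LINT x|lebesgue_on \<Omega>. (D bs x)\<^sup>2)"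
    if bs: "bs \<in> multi_indices m" for bs
  proof (rule integral_cong_AE)
    have h: "has_weak_deriv \<Omega> bs u (D bs)" using assms(2) bs by (auto simp: weak_family_def)
    have "set bs \<subseteq> Basis" using bs by (simp add: multi_indices_iff)
    from weak_deriv_AE[OF assms(1) this h]
    show "AE x in lebesgue_on \<Omega>. (weak_deriv \<Omega> bs u x)\<^sup>2 = (D bs x)\<^sup>2" by eventually_elim simp
    show "(\<lambda>x. (D bs x)\<^sup>2) \<in> borel_measurable (lebesgue_on \<Omega>)"
      using weak_family_measurable[OF assms bs] by simp
    have "locally_integrable \<Omega> (weak_deriv \<Omega> bs u)"
      using has_weak_deriv_weak_deriv[OF h] by (simp add: has_weak_deriv_def)
    then show "(\<lambda>x. (weak_deriv \<Omega> bs u x)\<^sup>2) \<in> borel_measurable (lebesgue_on \<Omega>)"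
      using locally_integrable_measurable[OF assms(1)] by simp
  qed
  then show ?thesis by (simp add: Hm_norm_def)
qed

lemma Hm_weak_space: "u \<in> Hm m \<Omega> \<Longrightarrow> u \<in> weak_space m \<Omega>"
  unfolding weak_space_def using index_lists_multi_indices by (auto elim!: Hm_family)

lemma Hm_lin:
  assumes "open \<Omega>" "u \<in> Hm m \<Omega>" "v \<in> Hm m \<Omega>"
  shows "(\<lambda>x. a * u x + b * v x) \<in> Hm m \<Omega>"
proof -
  obtain D where D: "weak_family m \<Omega> u D" "\<And>bs. bs \<in> multi_indices m \<Longrightarrow> D bs \<in> L2 \<Omega>"
    using Hm_family[OF assms(2)] by blast
  obtain E where E: "weak_family m \<Omega> v E" "\<And>bs. bs \<in> multi_indices m \<Longrightarrow> E bs \<in> L2 \<Omega>"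
    using Hm_family[OF assms(3)] by blast
  show ?thesis
    using weak_family_lin[OF assms(1) D(1) E(1), of a b] L2_lin[OF D(2) E(2)] L2_lin[of u \<Omega> v a b] assms(2,3)
    unfolding Hm_def weak_family_def by blast
qed

lemma Hm_norm_sq:
  assumes "open \<Omega>" "weak_family m \<Omega> u D"
  shows "(Hm_norm m \<Omega> u)\<^sup>2 = (\<Sum>bs\<in>multi_indices m. LINT x|lebesgue_on \<Omega>. (D bs x)\<^sup>2)"
  unfolding Hm_norm_eq[OF assms] by (rule real_sqrt_pow2) (intro sum_nonneg, simp)

text \<open>The square is estimated pointwise, with a factor 2 in place of the triangle inequality;
  the loss is harmless where errors tend to zero.\<close>

lemma Hm_norm_sq_add_le:
  assumes "open \<Omega>" "u \<in> Hm m \<Omega>" "v \<in> Hm m \<Omega>"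
  shows "(Hm_norm m \<Omega> (\<lambda>x. u x + v x))\<^sup>2 \<le> 2 * (Hm_norm m \<Omega> u)\<^sup>2 + 2 * (Hm_norm m \<Omega> v)\<^sup>2"
proof -
  obtain D where D: "weak_family m \<Omega> u D" "\<And>bs. bs \<in> multi_indices m \<Longrightarrow> D bs \<in> L2 \<Omega>"
    using Hm_family[OF assms(2)] by blast
  obtain E where E: "weak_family m \<Omega> v E" "\<And>bs. bs \<in> multi_indices m \<Longrightarrow> E bs \<in> L2 \<Omega>"
    using Hm_family[OF assms(3)] by blast
  have "weak_family m \<Omega> (\<lambda>x. u x + v x) (\<lambda>bs x. D bs x + E bs x)"
    using weak_family_lin[OF assms(1) D(1) E(1), of 1 1] by simp
  then have "(Hm_norm m \<Omega> (\<lambda>x. u x + v x))\<^sup>2 = (\<Sum>bs\<in>multi_indices m. LINT x|lebesgue_on \<Omega>. (D bs x + E bs x)\<^sup>2)"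
    by (rule Hm_norm_sq[OF assms(1)])
  also have "\<dots> \<le> (\<Sum>bs\<in>multi_indices m. LINT x|lebesgue_on \<Omega>. 2 * (D bs x)\<^sup>2 + 2 * (E bs x)\<^sup>2)"
  proof (intro sum_mono integral_mono)
    fix bs :: "'a list" assume bs: "bs \<in> multi_indices m"
    show "integrable (lebesgue_on \<Omega>) (\<lambda>x. (D bs x + E bs x)\<^sup>2)"
      using L2_lin[OF D(2)[OF bs] E(2)[OF bs], of 1 1] by (simp add: L2_def)
    show "integrable (lebesgue_on \<Omega>) (\<lambda>x. 2 * (D bs x)\<^sup>2 + 2 * (E bs x)\<^sup>2)"
      using D(2)[OF bs] E(2)[OF bs] by (simp add: L2_def)
    show "(D bs x + E bs x)\<^sup>2 \<le> 2 * (D bs x)\<^sup>2 + 2 * (E bs x)\<^sup>2" for x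
      using sum_squares_bound[of "D bs x" "E bs x"] by (simp add: power2_sum)
  qed
  also have "\<dots> = 2 * (Hm_norm m \<Omega> u)\<^sup>2 + 2 * (Hm_norm m \<Omega> v)\<^sup>2"
    using D(2) E(2) unfolding Hm_norm_sq[OF assms(1) D(1)] Hm_norm_sq[OF assms(1) E(1)]
    by (simp add: L2_def sum.distrib sum_distrib_left)
  finally show ?thesis .
qed

text \<open>On a general domain only an inequality is available this way: the equality for test
  functions comes from integrating by parts without boundary terms. The constant is the
  Cauchy-Schwarz factor of a sum over all lists.\<close>

lemma dirichlet_energy_le_top:
  fixes u :: "'a::euclidean_space \<Rightarrow> real"
  assumes "open \<Omega>" "weak_family m \<Omega> u D" "\<And>bs. bs \<in> index_lists m \<Longrightarrow> D bs \<in> L2 \<Omega>"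
  shows "dirichlet_energy m \<Omega> u \<le> real (card (index_lists m :: 'a list set)) *
    (\<Sum>bs\<in>index_lists m. LINT x|lebesgue_on \<Omega>. (D bs x)\<^sup>2)"
proof -
  have i: "integrable (lebesgue_on \<Omega>) (\<lambda>x. (D bs x)\<^sup>2)" if "bs \<in> index_lists m" for bs
    using assms(3)[OF that] by (simp add: L2_def)
  have "dirichlet_energy m \<Omega> u = (LINT x|lebesgue_on \<Omega>. (norm (nabla_of m (\<lambda>bs. D bs x)))\<^sup>2)"
    unfolding dirichlet_energy_form dirichlet_form_eq[OF assms(1,2,2)] by (simp add: power2_norm_eq_inner)
  also have "\<dots> \<le> (LINT x|lebesgue_on \<Omega>. real (card (index_lists m :: 'a list set)) * (\<Sum>bs\<in>index_lists m. (D bs x)\<^sup>2))"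
    using assms(3) i norm_nabla_of_sq_le
    by (intro integral_mono nabla_of_sq_integrable[OF assms(1,2)] integrable_mult_right Bochner_Integration.integrable_sum) auto
  also have "\<dots> = real (card (index_lists m :: 'a list set)) * (\<Sum>bs\<in>index_lists m. LINT x|lebesgue_on \<Omega>. (D bs x)\<^sup>2)"
    using i by simp
  finally show ?thesis .
qed

lemma dirichlet_energy_le_Hm_norm:
  fixes u :: "'a::euclidean_space \<Rightarrow> real"
  assumes "open \<Omega>" "u \<in> Hm m \<Omega>"
  shows "dirichlet_energy m \<Omega> u \<le> real (card (index_lists m :: 'a list set)) * (Hm_norm m \<Omega> u)\<^sup>2"
proof -
  obtain D where D: "weak_family m \<Omega> u D" "\<And>bs. bs \<in> multi_indices m \<Longrightarrow> D bs \<in> L2 \<Omega>"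
    using Hm_family[OF assms(2)] by blast
  have "dirichlet_energy m \<Omega> u \<le> real (card (index_lists m :: 'a list set)) *
      (\<Sum>bs\<in>index_lists m. LINT x|lebesgue_on \<Omega>. (D bs x)\<^sup>2)"
    using index_lists_multi_indices D(2) by (intro dirichlet_energy_le_top[OF assms(1) D(1)]) blast
  also have "\<dots> \<le> real (card (index_lists m :: 'a list set)) * (Hm_norm m \<Omega> u)\<^sup>2"
    unfolding Hm_norm_sq[OF assms(1) D(1)]
    by (intro mult_left_mono sum_mono2 index_lists_multi_indices) auto
  finally show ?thesis .
qed

lemma test_functions_Hm:
  assumes "\<phi> \<in> test_functions U" "open \<Omega>" shows "\<phi> \<in> Hm m \<Omega>"
  unfolding Hm_def
  using smooth_weak_family[OF test_functions_smooth[OF assms(1)] assms(2), of m]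
    smooth_L2_if_vanishing[OF test_functions_partials[OF assms(1)] assms(2)]
    smooth_L2_if_vanishing[OF assms]
  by (auto simp: multi_indices_iff weak_family_def)

lemma Hm0_Hm: "u \<in> Hm0 m \<Omega> U \<Longrightarrow> u \<in> Hm m \<Omega>"
  by (auto simp: Hm0_def tendsto_Hm_def)

lemma Hm_norm_zero: "open \<Omega> \<Longrightarrow> Hm_norm m \<Omega> (\<lambda>x. 0) = 0"
  using Hm_norm_eq[OF _ smooth_weak_family[of "\<lambda>x. 0" \<Omega> m]] by simp

lemma test_functions_Hm0:
  assumes "\<phi> \<in> test_functions U" "open \<Omega>" shows "\<phi> \<in> Hm0 m \<Omega> U"
  unfolding Hm0_def tendsto_Hm_def mem_Collect_eq
  using assms test_functions_Hm[OF assms] by (intro exI[of _ "\<lambda>_. \<phi>"]) (simp add: Hm_norm_zero)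

lemma Hm0_approx:
  assumes "u \<in> Hm0 m \<Omega> U" "e > 0"
  obtains \<phi> where "\<phi> \<in> test_functions U" "\<phi> \<in> Hm m \<Omega>" "\<bar>Hm_norm m \<Omega> (\<lambda>x. \<phi> x - u x)\<bar> < e"
proof -
  obtain \<phi> where \<phi>: "\<And>n::nat. \<phi> n \<in> test_functions U" "\<forall>\<^sub>F n in sequentially. \<phi> n \<in> Hm m \<Omega>"
    "(\<lambda>n. Hm_norm m \<Omega> (\<lambda>x. \<phi> n x - u x)) \<longlonglongrightarrow> 0"
    using assms(1) by (auto simp: Hm0_def tendsto_Hm_def)
  have "\<forall>\<^sub>F n in sequentially. \<bar>Hm_norm m \<Omega> (\<lambda>x. \<phi> n x - u x)\<bar> < e"
    using tendstoD[OF \<phi>(3) assms(2)] by (simp add: dist_real_def)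
  with \<phi>(2) have "\<forall>\<^sub>F n in sequentially. \<phi> n \<in> Hm m \<Omega> \<and> \<bar>Hm_norm m \<Omega> (\<lambda>x. \<phi> n x - u x)\<bar> < e"
    by eventually_elim simp
  then obtain n where "\<phi> n \<in> Hm m \<Omega> \<and> \<bar>Hm_norm m \<Omega> (\<lambda>x. \<phi> n x - u x)\<bar> < e"
    using eventually_happens'[OF sequentially_bot] by blast
  with \<phi>(1) show ?thesis using that by blast
qed

text \<open>Shifting the approximating sequence by \<psi> leaves all differences unchanged.\<close>

lemma Hm0_add_test:
  assumes "u \<in> Hm0 m \<Omega> U" "\<psi> \<in> test_functions U" "open \<Omega>"
  shows "(\<lambda>x. u x + \<psi> x) \<in> Hm0 m \<Omega> U"
proof -
  obtain \<phi> where \<phi>: "\<And>n::nat. \<phi> n \<in> test_functions U" "\<forall>\<^sub>F n in sequentially. \<phi> n \<in> Hm m \<Omega>"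
    "(\<lambda>n. Hm_norm m \<Omega> (\<lambda>x. \<phi> n x - u x)) \<longlonglongrightarrow> 0" "u \<in> Hm m \<Omega>"
    using assms(1) by (auto simp: Hm0_def tendsto_Hm_def)
  have "(\<lambda>x. u x + \<psi> x) \<in> Hm m \<Omega>"
    using Hm_lin[OF assms(3) \<phi>(4) test_functions_Hm[OF assms(2,3)], of 1 1] by simp
  moreover have "\<forall>\<^sub>F n in sequentially. (\<lambda>x. \<phi> n x + \<psi> x) \<in> Hm m \<Omega>"
    using \<phi>(1) assms by (intro always_eventually allI test_functions_Hm[OF test_functions_add]) auto
  ultimately show ?thesis
    unfolding Hm0_def tendsto_Hm_def mem_Collect_eq
    using \<phi>(1,3) assms(2) by (intro exI[of _ "\<lambda>n x. \<phi> n x + \<psi> x"]) (auto intro: test_functions_add)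
qed

subsection \<open>Loomis--Whitney type inequality\<close>

lemma powr_AM_GM:
  fixes f :: "'i \<Rightarrow> real"
  assumes "finite K" "K \<noteq> {}" "\<And>i. i \<in> K \<Longrightarrow> f i \<ge> 0"
  shows "(\<Prod>i\<in>K. f i powr (1 / card K)) \<le> (\<Sum>i\<in>K. f i) / card K"
proof (cases "\<exists>i\<in>K. f i = 0")
  case True
  then have "(\<Prod>i\<in>K. f i powr (1 / card K)) = 0" using assms(1) by (intro prod_zero) auto
  moreover have "(\<Sum>i\<in>K. f i) / card K \<ge> 0" by (intro divide_nonneg_nonneg sum_nonneg assms(3)) auto
  ultimately show ?thesis by linarith
next
  case False
  then have "\<And>i. i \<in> K \<Longrightarrow> f i > 0" using assms(3) by (simp add: order_less_le)
  then show ?thesis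
    using arith_geom_mean[OF assms(1,2), of f] assms(1,3)
    by (simp add: prod_powr_distrib sum_divide_distrib)
qed

lemma continuous_on_powr_const:
  fixes f :: "'b::topological_space \<Rightarrow> real"
  assumes "continuous_on S f" "\<And>x. x \<in> S \<Longrightarrow> f x \<ge> 0" "a > 0"
  shows "continuous_on S (\<lambda>x. f x powr a)"
  by (rule continuous_on_powr') (use assms in auto)

text \<open>Hoelder's inequality for equally many equal exponents: each factor is divided by its
  integral and the pointwise inequality of the means is integrated. If one integral vanishes, its
  continuous non-negative factor is zero throughout.\<close>

lemma Holder_prod_interval:
  fixes f :: "'i \<Rightarrow> real \<Rightarrow> real"
  assumes K: "finite K" "K \<noteq> {}" and R: "l < r"
    and c: "\<And>i. i \<in> K \<Longrightarrow> continuous_on {l..r} (f i)"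
    and nn: "\<And>i t. i \<in> K \<Longrightarrow> t \<in> {l..r} \<Longrightarrow> f i t \<ge> 0"
  shows "integral {l..r} (\<lambda>t. \<Prod>i\<in>K. f i t powr (1 / card K)) \<le> (\<Prod>i\<in>K. integral {l..r} (f i) powr (1 / card K))"
proof (cases "\<exists>i\<in>K. integral {l..r} (f i) = 0")
  case True
  then obtain i where i: "i \<in> K" "integral {l..r} (f i) = 0" by blast
  then have "f i t = 0" if "t \<in> {l..r}" for t
    using integral_eq_0_iff[OF c[OF i(1)] R] nn[OF i(1)] that by auto
  then have "integral {l..r} (\<lambda>t. \<Prod>i\<in>K. f i t powr (1 / card K)) = integral {l..r} (\<lambda>t. 0)"
    using i(1) K(1) by (intro integral_cong prod_zero) auto
  then show ?thesis by (simp add: prod_nonneg)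
next
  case False
  let ?k = "real (card K)"
  have k: "?k > 0" using K by (simp add: card_gt_0_iff)
  define A where "A i = integral {l..r} (f i)" for i
  have int: "f i integrable_on {l..r}" if "i \<in> K" for i
    using c[OF that] by (rule integrable_continuous_interval)
  have A: "A i > 0" if "i \<in> K" for i
    using False that integral_nonneg[OF int[OF that] nn[OF that]] by (force simp: A_def)
  have cp: "continuous_on {l..r} (\<lambda>t. \<Prod>i\<in>K. f i t powr (1 / ?k))"
    using k by (intro continuous_on_prod continuous_on_powr_const c nn) auto
  have le: "(\<Prod>i\<in>K. f i t powr (1 / ?k)) \<le> (\<Prod>i\<in>K. A i powr (1 / ?k)) * ((\<Sum>i\<in>K. f i t / A i) / ?k)"
    if t: "t \<in> {l..r}" for t
  proof -
    have "(\<Prod>i\<in>K. f i t powr (1 / ?k)) = (\<Prod>i\<in>K. A i powr (1 / ?k) * (f i t / A i) powr (1 / ?k))"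
    proof (rule prod.cong[OF refl])
      fix i assume i: "i \<in> K"
      have "A i powr (1 / ?k) * (f i t / A i) powr (1 / ?k) = (A i * (f i t / A i)) powr (1 / ?k)"
        using A[OF i] nn[OF i t] by (subst powr_mult) auto
      then show "f i t powr (1 / ?k) = A i powr (1 / ?k) * (f i t / A i) powr (1 / ?k)" using A[OF i] by simp
    qed
    also have "\<dots> = (\<Prod>i\<in>K. A i powr (1 / ?k)) * (\<Prod>i\<in>K. (f i t / A i) powr (1 / ?k))"
      by (rule prod.distrib)
    also have "\<dots> \<le> (\<Prod>i\<in>K. A i powr (1 / ?k)) * ((\<Sum>i\<in>K. f i t / A i) / ?k)"
      using A nn t K by (intro mult_left_mono powr_AM_GM prod_nonneg) (auto simp: less_imp_le)
    finally show ?thesis .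
  qed
  have hs: "((\<lambda>t. \<Sum>i\<in>K. f i t / A i) has_integral (\<Sum>i\<in>K. A i / A i)) {l..r}"
    using int K(1) by (intro has_integral_sum has_integral_divide) (auto simp: A_def integrable_integral)
  have "integral {l..r} (\<lambda>t. \<Prod>i\<in>K. f i t powr (1 / ?k))
      \<le> integral {l..r} (\<lambda>t. (\<Prod>i\<in>K. A i powr (1 / ?k)) * ((\<Sum>i\<in>K. f i t / A i) / ?k))"
    using le has_integral_integrable[OF has_integral_mult_right[OF has_integral_divide[OF hs]]]
    by (intro integral_le[OF integrable_continuous_interval[OF cp]]) auto
  also have "\<dots> = (\<Prod>i\<in>K. A i powr (1 / ?k)) * ((\<Sum>i\<in>K. A i / A i) / ?k)"
    by (intro integral_unique has_integral_mult_right has_integral_divide hs)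
  also have "(\<Sum>i\<in>K. A i / A i) = (\<Sum>i\<in>K. 1)"
    using A by (intro sum.cong) (auto simp: less_imp_neq[THEN not_sym])
  finally show ?thesis using k by (simp add: A_def)
qed

text \<open>Integration over the line segment through \<open>x\<close> on which the \<open>b\<close>-coordinate runs over \<open>[-R, R]\<close>;
  on continuous functions the iterated integrals involve neither infinities nor measurability.\<close>

definition line_int :: "real \<Rightarrow> 'a::euclidean_space \<Rightarrow> ('a \<Rightarrow> real) \<Rightarrow> 'a \<Rightarrow> real" where
  "line_int R b F x = integral {-R..R} (\<lambda>t. F (x + (t - x \<bullet> b) *\<^sub>R b))"

definition lines_int :: "real \<Rightarrow> 'a::euclidean_space list \<Rightarrow> ('a \<Rightarrow> real) \<Rightarrow> 'a \<Rightarrow> real" where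
  "lines_int R bs F = foldr (line_int R) bs F"

lemma lines_int_simps [simp]:
  "lines_int R [] F = F" "lines_int R (b # bs) F = line_int R b (lines_int R bs F)"
  by (simp_all add: lines_int_def)

lemma line_continuous:
  fixes F :: "'a::euclidean_space \<Rightarrow> real"
  assumes "continuous_on UNIV F"
  shows "continuous_on S (\<lambda>t::real. F (x + (t - c) *\<^sub>R b))"
  by (rule continuous_on_compose2[OF assms]) (auto intro!: continuous_intros)

lemma line_int_continuous:
  fixes F :: "'a::euclidean_space \<Rightarrow> real"
  assumes "continuous_on UNIV F"
  shows "continuous_on UNIV (line_int R b F)"
proof -
  have "continuous_on UNIV (\<lambda>x. integral (cbox (-R) R) (\<lambda>t. F (x + (t - x \<bullet> b) *\<^sub>R b)))"
    by (rule integral_continuous_on_param)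
      (auto simp: split_def intro!: continuous_on_compose2[OF assms] continuous_intros)
  then show ?thesis by (simp add: line_int_def[abs_def])
qed

lemma lines_int_continuous:
  "continuous_on UNIV F \<Longrightarrow> continuous_on UNIV (lines_int R bs F)"
  by (induction bs) (auto intro: line_int_continuous)

lemma line_int_mono:
  fixes F G :: "'a::euclidean_space \<Rightarrow> real"
  assumes "continuous_on UNIV F" "continuous_on UNIV G" "\<And>x. F x \<le> G x"
  shows "line_int R b F x \<le> line_int R b G x"
  unfolding line_int_def
  by (intro integral_le integrable_continuous_interval line_continuous assms)

lemma lines_int_mono:
  fixes F G :: "'a::euclidean_space \<Rightarrow> real"
  assumes "continuous_on UNIV F" "continuous_on UNIV G" "\<And>x. F x \<le> G x"
  shows "lines_int R bs F x \<le> lines_int R bs G x"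
  by (induction bs arbitrary: x) (auto intro: line_int_mono lines_int_continuous assms)

lemma line_int_nonneg:
  fixes F :: "'a::euclidean_space \<Rightarrow> real"
  assumes "continuous_on UNIV F" "\<And>x. 0 \<le> F x"
  shows "0 \<le> line_int R b F x"
  unfolding line_int_def
  by (intro integral_nonneg integrable_continuous_interval line_continuous assms)

lemma lines_int_nonneg:
  fixes F :: "'a::euclidean_space \<Rightarrow> real"
  assumes "continuous_on UNIV F" "\<And>x. 0 \<le> F x"
  shows "0 \<le> lines_int R bs F x"
  by (induction bs arbitrary: x) (auto intro: line_int_nonneg lines_int_continuous assms)

text \<open>Independence of the coordinate along b is what allows this factor to leave the next
  integral in direction b.\<close>

lemma line_int_shift:
  "b \<in> Basis \<Longrightarrow> line_int R b F (x + s *\<^sub>R b) = line_int R b F x"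
  by (simp add: line_int_def inner_add_left algebra_simps)

lemma line_int_commute:
  fixes F :: "'a::euclidean_space \<Rightarrow> real"
  assumes "continuous_on UNIV F" "a \<in> Basis" "b \<in> Basis"
  shows "line_int R a (line_int R b F) = line_int R b (line_int R a F)"
proof (cases "a = b")
  case False
  show ?thesis
  proof
    fix x
    let ?f = "\<lambda>s t. F (x + (s - x \<bullet> a) *\<^sub>R a + (t - x \<bullet> b) *\<^sub>R b)"
    have ab: "a \<bullet> b = 0" "b \<bullet> a = 0" using False assms by (auto simp: inner_Basis)
    have "line_int R a (line_int R b F) x = integral (cbox (-R) R) (\<lambda>s. integral (cbox (-R) R) (?f s))"
      by (simp add: line_int_def inner_add_left ab)
    also have "\<dots> = integral (cbox (-R) R) (\<lambda>t. integral (cbox (-R) R) (\<lambda>s. ?f s t))"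
      by (rule integral_swap_continuous)
        (auto simp: split_def intro!: continuous_on_compose2[OF assms(1)] continuous_intros)
    also have "\<dots> = line_int R b (line_int R a F) x"
      by (simp add: line_int_def inner_add_left ab add.commute add.left_commute)
    finally show "line_int R a (line_int R b F) x = line_int R b (line_int R a F) x" .
  qed
qed simp

lemma lines_int_line_int_commute:
  fixes F :: "'a::euclidean_space \<Rightarrow> real"
  assumes "continuous_on UNIV F" "a \<in> Basis" "set bs \<subseteq> Basis"
  shows "lines_int R bs (line_int R a F) = line_int R a (lines_int R bs F)"
  using assms(3)
  by (induction bs) (auto simp: line_int_commute lines_int_continuous assms)

text \<open>Induction on the directions integrated so far. When direction j comes up, factor j is
  constant along it and leaves the integral; the other N - 1 factors are separated by Hoelder with N
  - 1 equal exponents. Factor i is thus never integrated twice in its own direction, which explains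
  the case distinction.\<close>

lemma lines_int_prod_le:
  fixes F :: "'a::euclidean_space \<Rightarrow> 'a \<Rightarrow> real"
  assumes n: "DIM('a) \<ge> 2" and R: "R > 0"
    and c: "\<And>i. i \<in> Basis \<Longrightarrow> continuous_on UNIV (F i)" and nn: "\<And>i x. i \<in> Basis \<Longrightarrow> F i x \<ge> 0"
    and bs: "distinct bs" "set bs \<subseteq> Basis"
  defines "p \<equiv> 1 / real (DIM('a) - 1)"
  shows "lines_int R bs (\<lambda>x. \<Prod>i\<in>Basis. line_int R i (F i) x powr p) x
    \<le> (\<Prod>i\<in>Basis. lines_int R bs (if i \<in> set bs then F i else line_int R i (F i)) x powr p)"
  using bs
proof (induction bs arbitrary: x)
  case Nil
  then show ?case by simp
next
  case (Cons j bs)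
  have p: "p > 0" using n by (simp add: p_def)
  let ?P = "\<lambda>x. \<Prod>i\<in>Basis. line_int R i (F i) x powr p"
  define h where "h i = lines_int R bs (if i \<in> set bs then F i else line_int R i (F i))" for i
  have j: "j \<in> Basis" "j \<notin> set bs" and bsB: "set bs \<subseteq> Basis" using Cons.prems by auto
  have hc: "continuous_on UNIV (h i)" if "i \<in> Basis" for i
    unfolding h_def using c[OF that] by (auto intro!: lines_int_continuous line_int_continuous)
  have hn: "h i x \<ge> 0" if "i \<in> Basis" for i x
    unfolding h_def using c[OF that] nn[OF that]
    by (auto intro!: lines_int_nonneg line_int_continuous line_int_nonneg)
  have Pc: "continuous_on UNIV ?P"
    using c nn p by (intro continuous_on_prod continuous_on_powr_const line_int_continuous line_int_nonneg) auto
  have hpc: "continuous_on UNIV (\<lambda>x. \<Prod>i\<in>Basis. h i x powr p)"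
    using hc hn p by (intro continuous_on_prod continuous_on_powr_const) auto
  \<comment> \<open>The line integral built into factor j is commuted to the outside, so
    \<open>h j\<close> does not depend on the coordinate j.\<close>
  have hj: "h j = line_int R j (lines_int R bs (F j))"
    unfolding h_def using j bsB lines_int_line_int_commute[OF c[OF j(1)] j(1) bsB] by simp
  define K where "K = Basis - {j}"
  have K: "finite K" "card K = DIM('a) - 1" "K \<subseteq> Basis" "j \<notin> K"
    using j by (auto simp: K_def card_Diff_singleton)
  then have Kne: "K \<noteq> {}" using n by auto
  have split: "(\<Prod>i\<in>Basis. f i) = f j * (\<Prod>i\<in>K. f i)" for f :: "'a \<Rightarrow> real"
    unfolding K_def using j by (intro prod.remove) auto
  have "lines_int R (j # bs) ?P x \<le> line_int R j (\<lambda>x. \<Prod>i\<in>Basis. h i x powr p) x"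
    using Cons.IH Cons.prems by (auto simp: h_def intro!: line_int_mono lines_int_continuous Pc hpc[unfolded h_def])
  also have "\<dots> = h j x powr p * integral {-R..R} (\<lambda>t. \<Prod>i\<in>K. h i (x + (t - x \<bullet> j) *\<^sub>R j) powr p)"
  proof -
    have "h j (x + s *\<^sub>R j) = h j x" for s unfolding hj by (rule line_int_shift[OF j(1)])
    then show ?thesis by (simp add: line_int_def split)
  qed
  also have "integral {-R..R} (\<lambda>t. \<Prod>i\<in>K. h i (x + (t - x \<bullet> j) *\<^sub>R j) powr p)
      \<le> (\<Prod>i\<in>K. integral {-R..R} (\<lambda>t. h i (x + (t - x \<bullet> j) *\<^sub>R j)) powr p)"
    unfolding p_def K(2)[symmetric]
    using K Kne hc hn R by (intro Holder_prod_interval line_continuous) auto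
  also have "h j x powr p * (\<Prod>i\<in>K. integral {-R..R} (\<lambda>t. h i (x + (t - x \<bullet> j) *\<^sub>R j)) powr p)
      = (\<Prod>i\<in>Basis. lines_int R (j # bs) (if i \<in> set (j # bs) then F i else line_int R i (F i)) x powr p)"
    unfolding split using K(4)
    by (auto simp: hj intro!: arg_cong2[of _ _ _ _ "(*)"] prod.cong) (auto simp: h_def line_int_def)
  finally show ?case by (simp add: mult_left_mono)
qed


text \<open>Links the iterated one-dimensional integrals with product measure. Coordinates outside
  \<open>bs\<close> stay frozen at those of x, so that the induction can release one more of
  them.\<close>

lemma lines_int_nn_integral:
  fixes F :: "'a::euclidean_space \<Rightarrow> real"
  assumes c: "continuous_on UNIV F" and nn: "\<And>x. F x \<ge> 0" and "distinct bs" "set bs \<subseteq> Basis"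
  shows "ennreal (lines_int R bs F x) =
    (\<integral>\<^sup>+f. (\<Prod>b\<in>set bs. indicator {-R..R} (f b)) *
      ennreal (F ((\<Sum>b\<in>set bs. f b *\<^sub>R b) + (\<Sum>b\<in>Basis - set bs. (x \<bullet> b) *\<^sub>R b))) \<partial>PiM (set bs) (\<lambda>_. lborel))"
  using assms(3,4)
proof (induction bs arbitrary: x)
  interpret product_sigma_finite "\<lambda>_::'a. lborel :: real measure" ..
  case Nil
  show ?case unfolding list.set by (subst nn_integral_empty) (simp_all add: euclidean_representation)
next
  interpret product_sigma_finite "\<lambda>_::'a. lborel :: real measure" ..
  case (Cons j bs)
  have j: "j \<in> Basis" "j \<notin> set bs" and bsB: "set bs \<subseteq> Basis" "distinct bs" using Cons.prems by auto
  have Fm [measurable]: "F \<in> borel_measurable borel" by (rule borel_measurable_continuous_onI[OF c])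
  have m: "(\<lambda>f. (\<Prod>b\<in>I. indicator {-R..R} (f b)) * ennreal (F ((\<Sum>b\<in>I. f b *\<^sub>R b) + v)))
      \<in> borel_measurable (PiM I (\<lambda>_. lborel :: real measure))" for I :: "'a set" and v
    by measurable
  let ?G = "lines_int R bs F"
  let ?v = "\<Sum>b\<in>Basis - set (j # bs). (x \<bullet> b) *\<^sub>R b"
  let ?H = "\<lambda>f. (\<Prod>b\<in>set (j # bs). indicator {-R..R} (f b)) * ennreal (F ((\<Sum>b\<in>set (j # bs). f b *\<^sub>R b) + ?v))"
  have Gt: "indicator {-R..R} t * ennreal (?G (x + (t - x \<bullet> j) *\<^sub>R j)) = (\<integral>\<^sup>+f. ?H (f(j := t)) \<partial>PiM (set bs) (\<lambda>_. lborel))" for t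
  proof -
    have ins: "Basis - set bs = insert j (Basis - set (j # bs))" using j by auto
    have "(\<Sum>b\<in>Basis - set bs. ((x + (t - x \<bullet> j) *\<^sub>R j) \<bullet> b) *\<^sub>R b)
        = ((x + (t - x \<bullet> j) *\<^sub>R j) \<bullet> j) *\<^sub>R j + (\<Sum>b\<in>Basis - set (j # bs). ((x + (t - x \<bullet> j) *\<^sub>R j) \<bullet> b) *\<^sub>R b)"
      unfolding ins by (rule sum.insert) auto
    also have "(x + (t - x \<bullet> j) *\<^sub>R j) \<bullet> j = t" using j by (simp add: inner_add_left)
    also have "(\<Sum>b\<in>Basis - set (j # bs). ((x + (t - x \<bullet> j) *\<^sub>R j) \<bullet> b) *\<^sub>R b) = ?v"
      using j by (intro sum.cong refl) (auto simp: inner_add_left inner_Basis)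
    finally have v: "(\<Sum>b\<in>Basis - set bs. ((x + (t - x \<bullet> j) *\<^sub>R j) \<bullet> b) *\<^sub>R b) = t *\<^sub>R j + ?v" .
    have H: "?H (f(j := t)) = indicator {-R..R} t * ((\<Prod>b\<in>set bs. indicator {-R..R} (f b)) *
        ennreal (F ((\<Sum>b\<in>set bs. f b *\<^sub>R b) + (t *\<^sub>R j + ?v))))" for f
    proof -
      have "(\<Prod>b\<in>set bs. indicator {-R..R} ((f(j := t)) b)) = (\<Prod>b\<in>set bs. indicator {-R..R} (f b) :: ennreal)"
        "(\<Sum>b\<in>set bs. (f(j := t)) b *\<^sub>R b) = (\<Sum>b\<in>set bs. f b *\<^sub>R b)"
        using j by (auto intro!: prod.cong sum.cong)
      then show ?thesis using j by (simp add: mult.assoc add_ac)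
    qed
    show ?thesis
      unfolding H using Cons.IH[OF bsB(2,1), of "x + (t - x \<bullet> j) *\<^sub>R j"] unfolding v
      by (subst nn_integral_cmult[OF m]) simp
  qed
  have int: "(\<lambda>t. ?G (x + (t - x \<bullet> j) *\<^sub>R j)) integrable_on {-R..R}"
    by (intro integrable_continuous_interval line_continuous lines_int_continuous c)
  have "ennreal (lines_int R (j # bs) F x) = (\<integral>\<^sup>+t. ennreal (?G (x + (t - x \<bullet> j) *\<^sub>R j)) * indicator {-R..R} t \<partial>lborel)"
    using nn_integral_has_integral_lebesgue'[OF _ integrable_integral[OF int]] lines_int_nonneg[OF c nn]
    by (simp add: line_int_def)
  also have "\<dots> = (\<integral>\<^sup>+t. (\<integral>\<^sup>+f. ?H (f(j := t)) \<partial>PiM (set bs) (\<lambda>_. lborel)) \<partial>lborel)"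
    by (intro nn_integral_cong) (simp only: Gt[symmetric] mult.commute)
  also have "\<dots> = integral\<^sup>N (PiM (insert j (set bs)) (\<lambda>_. lborel)) ?H"
    using m[of "insert j (set bs)" ?v] j by (intro product_nn_integral_insert_rev[symmetric]) auto
  finally show ?case by simp
qed

text \<open>With all directions integrated no coordinate of x survives, and Lebesgue measure is the
  image of the product measure under the coordinate representation. The support condition removes
  the restriction to the box.\<close>

lemma lines_int_eq_integral:
  fixes F :: "'a::euclidean_space \<Rightarrow> real"
  assumes c: "continuous_on UNIV F" and nn: "\<And>x. F x \<ge> 0" and bs: "distinct bs" "set bs = Basis"
    and R: "\<And>x b. b \<in> Basis \<Longrightarrow> \<bar>x \<bullet> b\<bar> > R \<Longrightarrow> F x = 0"
  shows "lines_int R bs F x = (LINT x|lebesgue. F x)" "integrable lebesgue F"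
proof -
  have Fm [measurable]: "F \<in> borel_measurable borel" by (rule borel_measurable_continuous_onI[OF c])
  let ?c = "cbox (- R *\<^sub>R One) (R *\<^sub>R One) :: 'a set"
  have out: "F x = 0" if "x \<notin> ?c" for x
  proof -
    have "\<not> (\<forall>b\<in>Basis. - R \<le> x \<bullet> b \<and> x \<bullet> b \<le> R)" using that by (simp add: mem_box)
    then obtain b where "b \<in> Basis" "\<not> (- R \<le> x \<bullet> b \<and> x \<bullet> b \<le> R)" by blast
    then show ?thesis using R[of b x] by auto
  qed
  have i: "integrable lborel F" "integrable lebesgue F"
    using continuous_compact_support_integrable[OF c compact_cbox out] by auto
  have ind: "(\<Prod>b\<in>Basis. indicator {-R..R} (x \<bullet> b)) * ennreal (F x) = ennreal (F x)" for x :: 'a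
  proof (cases "x \<in> ?c")
    case True
    then have "(\<Prod>b\<in>Basis. indicator {-R..R} (x \<bullet> b) :: ennreal) = (\<Prod>b\<in>(Basis :: 'a set). 1)"
      by (intro prod.cong) (auto simp: mem_box)
    then show ?thesis by simp
  qed (simp add: out)
  have "ennreal (lines_int R bs F x) = (\<integral>\<^sup>+f. (\<Prod>b\<in>Basis. indicator {-R..R} (f b)) *
      ennreal (F (\<Sum>b\<in>Basis. f b *\<^sub>R b)) \<partial>PiM Basis (\<lambda>_. lborel))"
    using lines_int_nn_integral[OF c nn bs(1), of R x] bs(2) by simp
  also have "\<dots> = (\<integral>\<^sup>+f. (\<Prod>b\<in>Basis. indicator {-R..R} ((\<Sum>b\<in>Basis. f b *\<^sub>R b) \<bullet> b)) *
      ennreal (F (\<Sum>b\<in>Basis. f b *\<^sub>R b)) \<partial>PiM Basis (\<lambda>_. lborel))"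
    by (intro nn_integral_cong arg_cong2[of _ _ _ _ "(*)"] prod.cong) auto
  also have "\<dots> = (\<integral>\<^sup>+x. (\<Prod>b\<in>Basis. indicator {-R..R} (x \<bullet> b)) * ennreal (F x) \<partial>lborel)"
  proof -
    have "(\<lambda>x::'a. (\<Prod>b\<in>Basis. indicator {-R..R} (x \<bullet> b)) * ennreal (F x)) \<in> borel_measurable borel"
      by measurable
    moreover have "(\<lambda>f. \<Sum>b\<in>(Basis :: 'a set). f b *\<^sub>R b) \<in> borel_measurable (PiM Basis (\<lambda>_. lborel))"
      by measurable
    ultimately have "(\<integral>\<^sup>+x. (\<Prod>b\<in>Basis. indicator {-R..R} (x \<bullet> b)) * ennreal (F x)
        \<partial>distr (PiM Basis (\<lambda>_. lborel)) borel (\<lambda>f. \<Sum>b\<in>Basis. f b *\<^sub>R b))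
      = (\<integral>\<^sup>+f. (\<Prod>b\<in>Basis. indicator {-R..R} ((\<Sum>b\<in>Basis. f b *\<^sub>R b) \<bullet> b)) *
        ennreal (F (\<Sum>b\<in>Basis. f b *\<^sub>R b)) \<partial>PiM Basis (\<lambda>_. lborel))"
      by (intro nn_integral_distr) simp_all
    then show ?thesis by (simp only: lborel_eq[symmetric])
  qed
  also have "\<dots> = (\<integral>\<^sup>+x. ennreal (F x) \<partial>lborel)" by (simp only: ind)
  also have "\<dots> = ennreal (LINT x|lborel. F x)"
    using nn by (intro nn_integral_eq_integral i) auto
  finally have "lines_int R bs F x = (LINT x|lborel. F x)"
    using nn by (subst (asm) ennreal_inj) (auto intro: lines_int_nonneg c)
  then show "lines_int R bs F x = (LINT x|lebesgue. F x)" by (simp add: integral_completion)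
  show "integrable lebesgue F" by (rule i)
qed

text \<open>Gagliardo's argument: the N bounds of w by line integrals, each raised to the power 1/(N
  - 1), are multiplied and integrated. The exponent on the left is N/(N - 1).\<close>

lemma Gagliardo_product_bound:
  fixes w :: "'a::euclidean_space \<Rightarrow> real" and F :: "'a \<Rightarrow> 'a \<Rightarrow> real"
  assumes n: "DIM('a) \<ge> 2" and R: "R > 0"
    and w: "continuous_on UNIV w" "\<And>x. w x \<ge> 0" "\<And>x b. b \<in> Basis \<Longrightarrow> \<bar>x \<bullet> b\<bar> > R \<Longrightarrow> w x = 0"
    and F: "\<And>i. i \<in> Basis \<Longrightarrow> continuous_on UNIV (F i)" "\<And>i x. i \<in> Basis \<Longrightarrow> F i x \<ge> 0"
      "\<And>i x b. i \<in> Basis \<Longrightarrow> b \<in> Basis \<Longrightarrow> \<bar>x \<bullet> b\<bar> > R \<Longrightarrow> F i x = 0"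
    and le: "\<And>i x. i \<in> Basis \<Longrightarrow> w x \<le> line_int R i (F i) x"
  defines "p \<equiv> 1 / real (DIM('a) - 1)"
  shows "(LINT x|lebesgue. w x powr (real DIM('a) * p)) \<le> (\<Prod>i\<in>Basis. (LINT x|lebesgue. F i x) powr p)"
proof -
  have p: "p > 0" using n by (simp add: p_def)
  obtain bs :: "'a list" where bs: "set bs = Basis" "distinct bs"
    using finite_distinct_list[OF finite_Basis] by blast
  have wc: "continuous_on UNIV (\<lambda>x. w x powr (real DIM('a) * p))"
    using w p n by (intro continuous_on_powr_const) auto
  have Pc: "continuous_on UNIV (\<lambda>x. \<Prod>i\<in>Basis. line_int R i (F i) x powr p)"
    using F p by (intro continuous_on_prod continuous_on_powr_const line_int_continuous line_int_nonneg) auto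
  have pt: "w x powr (real DIM('a) * p) \<le> (\<Prod>i\<in>Basis. line_int R i (F i) x powr p)" for x
  proof -
    have "w x powr (real DIM('a) * p) = (w x powr p) ^ DIM('a)"
      by (cases "w x = 0") (use powr_power[of "w x" p "DIM('a)"] in auto)
    also have "\<dots> = (\<Prod>i\<in>(Basis :: 'a set). w x powr p)" by simp
    also have "\<dots> \<le> (\<Prod>i\<in>Basis. line_int R i (F i) x powr p)"
      using le w(2) p by (intro prod_mono conjI powr_mono2) auto
    finally show ?thesis .
  qed
  have "(LINT x|lebesgue. w x powr (real DIM('a) * p)) = lines_int R bs (\<lambda>x. w x powr (real DIM('a) * p)) 0"
    using w(3) by (intro lines_int_eq_integral(1)[symmetric] wc bs) auto
  also have "\<dots> \<le> lines_int R bs (\<lambda>x. \<Prod>i\<in>Basis. line_int R i (F i) x powr p) 0"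
    by (intro lines_int_mono wc Pc pt)
  also have "\<dots> \<le> (\<Prod>i\<in>Basis. lines_int R bs (if i \<in> set bs then F i else line_int R i (F i)) 0 powr p)"
    unfolding p_def using bs F by (intro lines_int_prod_le n R) auto
  also have "\<dots> = (\<Prod>i\<in>Basis. (LINT x|lebesgue. F i x) powr p)"
    using bs F by (intro prod.cong refl) (simp add: lines_int_eq_integral(1))
  finally show ?thesis .
qed

subsection \<open>The Gagliardo--Nirenberg--Sobolev inequality\<close>

text \<open>Young's inequality after normalising with A + d and B + d instead of A and B; letting d
  decrease to 0 covers vanishing integrals without a case distinction.\<close>

lemma Holder_integral:
  fixes f g :: "'b \<Rightarrow> real"
  assumes pq: "p > 1" "q > 1" "1 / p + 1 / q = 1"
    and nn: "\<And>x. f x \<ge> 0" "\<And>x. g x \<ge> 0"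
    and int: "integrable M (\<lambda>x. f x powr p)" "integrable M (\<lambda>x. g x powr q)" "integrable M (\<lambda>x. f x * g x)"
  shows "(LINT x|M. f x * g x) \<le> (LINT x|M. f x powr p) powr (1 / p) * (LINT x|M. g x powr q) powr (1 / q)"
proof -
  define A where "A = (LINT x|M. f x powr p)"
  define B where "B = (LINT x|M. g x powr q)"
  have A0: "A \<ge> 0" and B0: "B \<ge> 0" by (auto simp: A_def B_def)
  have bound: "(LINT x|M. f x * g x) \<le> (A + d) powr (1 / p) * (B + d) powr (1 / q)" if d: "d > 0" for d
  proof -
    let ?a = "(A + d) powr (1 / p)" and ?b = "(B + d) powr (1 / q)"
    have pos: "?a > 0" "?b > 0" using A0 B0 d by auto
    have pw: "?a powr p = A + d" "?b powr q = B + d" using A0 B0 d pq by (auto simp: powr_powr)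
    have pt: "f x * g x \<le> ?a * ?b * (f x powr p / (A + d) / p + g x powr q / (B + d) / q)" for x
    proof -
      have "(f x / ?a) * (g x / ?b) \<le> (f x / ?a) powr p / p + (g x / ?b) powr q / q"
        using pos nn by (intro Youngs_inequality pq) auto
      also have "\<dots> = f x powr p / (A + d) / p + g x powr q / (B + d) / q"
        using pos nn by (simp add: powr_divide pw)
      finally have "(?a * ?b) * ((f x / ?a) * (g x / ?b)) \<le> (?a * ?b) * (f x powr p / (A + d) / p + g x powr q / (B + d) / q)"
        using pos by (intro mult_left_mono) auto
      then show ?thesis using pos by simp
    qed
    have "(LINT x|M. f x * g x) \<le> (LINT x|M. ?a * ?b * (f x powr p / (A + d) / p + g x powr q / (B + d) / q))"
      by (rule integral_mono[OF int(3) _ pt]) (use int in simp)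
    also have "\<dots> = ?a * ?b * (A / (A + d) / p + B / (B + d) / q)"
      using int by (simp add: A_def B_def)
    also have "\<dots> \<le> ?a * ?b * (1 / p + 1 / q)"
      using A0 B0 d pq pos by (intro mult_left_mono add_mono divide_right_mono) auto
    finally show ?thesis using pq(3) by simp
  qed
  have "((\<lambda>d. (A + d) powr (1 / p) * (B + d) powr (1 / q)) \<longlongrightarrow> (A + 0) powr (1 / p) * (B + 0) powr (1 / q)) (at_right 0)"
    using pq A0 B0
    by (intro tendsto_mult tendsto_powr2 tendsto_add tendsto_const tendsto_ident_at)
      (auto simp: eventually_at_right_field intro!: exI[of _ 1])
  moreover have "\<forall>\<^sub>F d in at_right 0. (LINT x|M. f x * g x) \<le> (A + d) powr (1 / p) * (B + d) powr (1 / q)"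
    using bound by (auto simp: eventually_at_right_field intro!: exI[of _ 1])
  ultimately have "(LINT x|M. f x * g x) \<le> (A + 0) powr (1 / p) * (B + 0) powr (1 / q)"
    by (intro tendsto_lowerbound) auto
  then show ?thesis by (simp add: A_def B_def)
qed

text \<open>Since s > 1 the power of the absolute value is differentiable at 0 too, so the
  fundamental theorem applies to powers of functions that change sign.\<close>

lemma DERIV_abs_powr:
  fixes s :: real assumes "s > 1"
  shows "((\<lambda>y. \<bar>y\<bar> powr s) has_real_derivative s * \<bar>y\<bar> powr (s - 1) * sgn y) (at y)"
proof -
  consider "y > 0" | "y < 0" | "y = 0" by linarith
  then show ?thesis
  proof cases
    case 1
    have "((\<lambda>y. y powr s) has_real_derivative s * y powr (s - 1)) (at y)"
      using 1 by (rule has_real_derivative_powr)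
    then have "((\<lambda>y. \<bar>y\<bar> powr s) has_real_derivative s * y powr (s - 1)) (at y)"
      by (rule has_field_derivative_transform_within_open[where S = "{0<..}"]) (use 1 in auto)
    with 1 show ?thesis by simp
  next
    case 2
    have "((\<lambda>y. (- y) powr s) has_real_derivative - (s * (- y) powr (s - 1))) (at y)"
      using 2 DERIV_chain2[OF has_real_derivative_powr[of "- y" s] DERIV_minus[OF DERIV_ident]] by simp
    then have "((\<lambda>y. \<bar>y\<bar> powr s) has_real_derivative - (s * (- y) powr (s - 1))) (at y)"
      by (rule has_field_derivative_transform_within_open[where S = "{..<0}"]) (use 2 in auto)
    with 2 show ?thesis by simp
  next
    case 3
    have "((\<lambda>h::real. \<bar>h\<bar> powr (s - 1)) \<longlongrightarrow> 0 powr (s - 1)) (at 0)"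
      using assms by (intro tendsto_powr2) (auto intro!: tendsto_eq_intros)
    then have "((\<lambda>h::real. \<bar>h\<bar> powr (s - 1)) \<longlongrightarrow> 0) (at 0)" by simp
    then have "((\<lambda>h::real. \<bar>h\<bar> powr s / h) \<longlongrightarrow> 0) (at 0)"
    proof (rule Lim_null_comparison[rotated])
      show "\<forall>\<^sub>F h::real in at 0. norm (\<bar>h\<bar> powr s / h) \<le> \<bar>h\<bar> powr (s - 1)"
      proof (rule eventually_at_filter[THEN iffD2], rule always_eventually, intro allI impI)
        fix h :: real assume "h \<noteq> 0"
        then show "norm (\<bar>h\<bar> powr s / h) \<le> \<bar>h\<bar> powr (s - 1)" by (simp add: powr_diff)
      qed
    qed
    then show ?thesis using 3 by (simp add: has_field_derivative_iff)
  qed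
qed

text \<open>The derivative of the power is integrated from the face -R, where \<phi> vanishes, up to
  x; enlarging the range to the whole segment makes the bound independent of the coordinate along
  b.\<close>

lemma line_int_fundamental:
  fixes \<phi> :: "'a::euclidean_space \<Rightarrow> real"
  assumes sm: "smooth \<phi>" and b: "b \<in> Basis" and s: "s > 1"
    and R: "\<And>x. \<bar>x \<bullet> b\<bar> \<ge> R \<Longrightarrow> \<phi> x = 0"
  shows "\<bar>\<phi> x\<bar> powr s \<le> line_int R b (\<lambda>x. s * (\<bar>\<phi> x\<bar> powr (s - 1) * \<bar>partial b \<phi> x\<bar>)) x"
proof -
  let ?F = "\<lambda>x. s * (\<bar>\<phi> x\<bar> powr (s - 1) * \<bar>partial b \<phi> x\<bar>)"
  have sp: "smooth (partial b \<phi>)" by (rule smooth_partial[OF sm b])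
  have Fc: "continuous_on UNIV ?F"
    using s by (intro continuous_intros continuous_on_powr_const smooth_continuous_on sm sp) auto
  have Fn: "?F x \<ge> 0" for x using s by simp
  show ?thesis
  proof (cases "\<bar>x \<bullet> b\<bar> \<ge> R")
    case True
    then show ?thesis using R[of x] line_int_nonneg[OF Fc Fn] s by simp
  next
    case False
    define y where "y t = x + (t - x \<bullet> b) *\<^sub>R b" for t
    have yb: "y t \<bullet> b = t" for t using b by (simp add: y_def inner_add_left)
    have y_eq: "y t = (x - (x \<bullet> b) *\<^sub>R b) + t *\<^sub>R b" for t by (simp add: y_def algebra_simps)
    let ?\<psi>' = "\<lambda>t. s * \<bar>\<phi> (y t)\<bar> powr (s - 1) * sgn (\<phi> (y t)) * partial b \<phi> (y t)"
    have D: "((\<lambda>t. \<bar>\<phi> (y t)\<bar> powr s) has_real_derivative ?\<psi>' t) (at t)" for t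
    proof -
      have "((\<lambda>t. \<phi> (y t)) has_real_derivative partial b \<phi> (y t)) (at t)"
        unfolding y_eq by (rule smooth_DERIV_line[OF sm b])
      from DERIV_chain2[OF DERIV_abs_powr[OF s] this] show ?thesis .
    qed
    have lt: "- R \<le> x \<bullet> b" "x \<bullet> b \<le> R" using False by auto
    have "(?\<psi>' has_integral (\<bar>\<phi> (y (x \<bullet> b))\<bar> powr s - \<bar>\<phi> (y (- R))\<bar> powr s)) {-R..x \<bullet> b}"
      using D by (intro fundamental_theorem_of_calculus lt)
        (auto simp: has_real_derivative_iff_has_vector_derivative[symmetric] intro: DERIV_subset)
    moreover have "\<phi> (y (- R)) = 0" using lt by (intro R) (simp add: yb)
    moreover have "y (x \<bullet> b) = x" by (simp add: y_def)
    ultimately have hi: "(?\<psi>' has_integral \<bar>\<phi> x\<bar> powr s) {-R..x \<bullet> b}" using s by simp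
    have Fi: "(\<lambda>t. ?F (y t)) integrable_on {c..d}" for c d
      unfolding y_def by (intro integrable_continuous_interval line_continuous[OF Fc])
    have "\<bar>\<phi> x\<bar> powr s \<le> integral {-R..x \<bullet> b} (\<lambda>t. ?F (y t))"
    proof (rule has_integral_le[OF hi integrable_integral[OF Fi]])
      fix t
      have "?\<psi>' t \<le> \<bar>?\<psi>' t\<bar>" by (rule abs_ge_self)
      also have "\<dots> \<le> ?F (y t)" using s by (simp add: abs_mult abs_sgn_eq mult_ac)
      finally show "?\<psi>' t \<le> ?F (y t)" .
    qed
    also have "\<dots> \<le> integral {-R..R} (\<lambda>t. ?F (y t))"
      using lt Fn by (intro integral_subset_le Fi) auto
    finally show ?thesis by (simp add: line_int_def y_def)
  qed
qed

lemma test_functions_powr_integrable: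
  fixes \<phi> :: "'a::euclidean_space \<Rightarrow> real"
  assumes "\<phi> \<in> test_functions U" "a > 0"
  shows "integrable lebesgue (\<lambda>x. \<bar>\<phi> x\<bar> powr a)"
proof -
  obtain C where C: "smooth \<phi>" "compact C" "C \<subseteq> U" "\<And>x. x \<notin> C \<Longrightarrow> \<phi> x = 0"
    using test_functionsE[OF assms(1)] by metis
  show ?thesis
    using C assms(2)
    by (intro continuous_compact_support_integrable(2)[OF _ C(2)] continuous_on_powr_const
        continuous_on_rabs smooth_continuous_on) auto
qed

definition Lnorm :: "real \<Rightarrow> ('a::euclidean_space \<Rightarrow> real) \<Rightarrow> real" where
  "Lnorm q f = (LINT x|lebesgue. \<bar>f x\<bar> powr q) powr (1 / q)"

text \<open>The product bound is applied to the s-th power of |\<phi>|, followed by Hoelder on the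
  right. The exponent s is determined by s N/(N - 1) = (s - 1) q' = r, so the same integral
  \<open>A\<close> appears on both sides. It is finite, and dividing by its power leaves the
  exponent (N - 1)/N - 1/q' = 1/r.\<close>

lemma Gagliardo_Nirenberg_Sobolev:
  fixes \<phi> :: "'a::euclidean_space \<Rightarrow> real" and q :: real
  defines "n \<equiv> real DIM('a)"
  assumes \<phi>: "\<phi> \<in> test_functions U" and q: "q \<ge> 2" "q < n" and G: "G \<ge> 0"
    and le: "\<And>b. b \<in> Basis \<Longrightarrow> Lnorm q (partial b \<phi>) \<le> G"
  shows "Lnorm (n * q / (n - q)) \<phi> \<le> (q * (n - 1) / (n - q)) * G"
proof -
  define s where "s = q * (n - 1) / (n - q)"
  define r where "r = n * q / (n - q)"
  define q' where "q' = q / (q - 1)"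
  define p where "p = 1 / real (DIM('a) - 1)"
  have n: "n > 2" "DIM('a) \<ge> 2" using q by (auto simp: n_def)
  have pn: "p = 1 / (n - 1)" using n by (simp add: p_def n_def of_nat_diff)
  have s: "s > 1" using q n by (simp add: s_def field_simps)
  have r: "r > 0" using q n by (simp add: r_def)
  have sr: "s * (n * p) = r"
  proof -
    have "q * e / d * (n * (1 / e)) = n * q / d" if "e > 0" for d e :: real
      using that by simp
    then show ?thesis using n unfolding s_def r_def pn by simp
  qed
  have srq: "(s - 1) * q' = r"
  proof -
    have "s - 1 = n * (q - 1) / (n - q)" using q by (simp add: s_def field_simps)
    moreover have "n * e / d * (q / e) = n * q / d" if "e > 0" for d e :: real
      using that by simp
    ultimately show ?thesis using q unfolding q'_def r_def by simp
  qed
  have q': "q' > 1" "1 / q' + 1 / q = 1" using q by (auto simp: q'_def field_simps)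
  obtain C where C: "smooth \<phi>" "compact C" "C \<subseteq> U" "\<And>x. x \<notin> C \<Longrightarrow> \<phi> x = 0"
    using test_functionsE[OF \<phi>] by metis
  obtain R0 where R0: "R0 > 0" "C \<subseteq> ball 0 R0"
    using bounded_subset_ballD[OF compact_imp_bounded[OF C(2)], of 0] by blast
  define R where "R = R0"
  have R: "R > 0" using R0 by (simp add: R_def)
  have out: "\<phi> x = 0" if "b \<in> Basis" "\<bar>x \<bullet> b\<bar> \<ge> R" for x b
    using Basis_le_norm[OF that(1), of x] that(2) R0 by (intro C(4)) (auto simp: R_def subset_iff)
  define F where "F b x = s * (\<bar>\<phi> x\<bar> powr (s - 1) * \<bar>partial b \<phi> x\<bar>)" for b x
  have pt: "partial b \<phi> \<in> test_functions U" if "b \<in> Basis" for b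
    using test_functions_partials[OF \<phi>, of "[b]"] that by simp
  have Fc: "continuous_on UNIV (F b)" if "b \<in> Basis" for b
    unfolding F_def[abs_def] using s that
    by (intro continuous_intros continuous_on_powr_const smooth_continuous_on C smooth_partial) auto
  define A where "A = (LINT x|lebesgue. \<bar>\<phi> x\<bar> powr r)"
  have A0: "A \<ge> 0" by (simp add: A_def)
  have Fint: "(LINT x|lebesgue. F b x) \<le> s * (A powr (1 / q') * G)" if b: "b \<in> Basis" for b
  proof -
    have "(LINT x|lebesgue. \<bar>\<phi> x\<bar> powr (s - 1) * \<bar>partial b \<phi> x\<bar>)
        \<le> (LINT x|lebesgue. (\<bar>\<phi> x\<bar> powr (s - 1)) powr q') powr (1 / q') * (LINT x|lebesgue. \<bar>partial b \<phi> x\<bar> powr q) powr (1 / q)"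
    proof (rule Holder_integral)
      show "integrable lebesgue (\<lambda>x. (\<bar>\<phi> x\<bar> powr (s - 1)) powr q')"
        using test_functions_powr_integrable[OF \<phi> r] by (simp add: powr_powr srq)
      show "integrable lebesgue (\<lambda>x. \<bar>partial b \<phi> x\<bar> powr q)"
        using test_functions_powr_integrable[OF pt[OF b]] q by simp
      show "integrable lebesgue (\<lambda>x. \<bar>\<phi> x\<bar> powr (s - 1) * \<bar>partial b \<phi> x\<bar>)"
        using s C b by (intro continuous_compact_support_integrable(2)[OF _ C(2)] continuous_on_mult
          continuous_on_powr_const continuous_on_rabs smooth_continuous_on smooth_partial) auto
    qed (use q q' in auto)
    also have "\<dots> = A powr (1 / q') * Lnorm q (partial b \<phi>)"
      by (simp add: powr_powr srq A_def Lnorm_def)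
    also have "\<dots> \<le> A powr (1 / q') * G" by (intro mult_left_mono le b) simp
    finally show ?thesis unfolding F_def using s by simp
  qed
  have "A = (LINT x|lebesgue. (\<bar>\<phi> x\<bar> powr s) powr (real DIM('a) * p))"
    unfolding A_def powr_powr sr[symmetric] n_def ..
  also have "\<dots> \<le> (\<Prod>b\<in>Basis. (LINT x|lebesgue. F b x) powr p)"
    unfolding p_def
  proof (rule Gagliardo_product_bound[OF n(2) R])
    show "continuous_on UNIV (\<lambda>x. \<bar>\<phi> x\<bar> powr s)"
      using s C by (intro continuous_on_powr_const continuous_on_rabs smooth_continuous_on) auto
    show "\<bar>\<phi> x\<bar> powr s \<le> line_int R b (F b) x" if "b \<in> Basis" for b x
      unfolding F_def[abs_def] by (rule line_int_fundamental[OF C(1) that s out[OF that]])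
    show "\<bar>\<phi> x\<bar> powr s = 0" if "b \<in> Basis" "\<bar>x \<bullet> b\<bar> > R" for x b
      using out[OF that(1), of x] that s by simp
    show "F i x = 0" if "b \<in> Basis" "\<bar>x \<bullet> b\<bar> > R" for i x b
      using out[OF that(1), of x] that s by (simp add: F_def)
  qed (use s Fc in \<open>auto simp: F_def\<close>)
  also have "\<dots> \<le> (\<Prod>b\<in>(Basis :: 'a set). (s * (A powr (1 / q') * G)) powr p)"
    using Fint s n by (intro prod_mono conjI powr_mono2 integral_nonneg_AE) (auto simp: F_def p_def)
  also have "\<dots> = ((s * G) * A powr (1 / q')) powr (p * n)"
  proof (cases "(s * (A powr (1 / q') * G)) = 0")
    case True
    then show ?thesis using n s by auto
  next
    case False
    then show ?thesis by (simp add: powr_power n_def mult_ac)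
  qed
  finally have main: "A \<le> ((s * G) * A powr (1 / q')) powr (p * n)" .
  have "A powr (1 / r) \<le> s * G"
  proof (cases "A = 0")
    case True
    then show ?thesis using s G by simp
  next
    case False
    then have Ap: "A > 0" using A0 by simp
    have pnp: "p * n > 0" using n by (simp add: pn)
    have "A powr (1 / (p * n)) \<le> (((s * G) * A powr (1 / q')) powr (p * n)) powr (1 / (p * n))"
      using main Ap pnp by (intro powr_mono2) auto
    also have "\<dots> = (s * G) * A powr (1 / q')"
    proof -
      have "p * n \<noteq> 0" using pnp by linarith
      then have "p * n * (1 / (p * n)) = 1" by simp
      then show ?thesis using s G unfolding powr_powr by (simp only:) (simp add: powr_one)
    qed
    finally have "A powr (1 / (p * n)) / A powr (1 / q') \<le> s * G"
      using Ap by (simp add: field_simps)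
    then have "A powr (1 / (p * n) - 1 / q') \<le> s * G" by (simp add: powr_diff)
    moreover have "1 / (p * n) - 1 / q' = 1 / r"
      using q n by (simp add: pn q'_def r_def field_simps)
    ultimately show ?thesis by simp
  qed
  then show ?thesis unfolding Lnorm_def A_def r_def s_def .
qed

text \<open>At j = 0 the exponent is 2 and the bound is read off the energy. Each step gives up one
  derivative and passes from exponent 2N/(N - 2j) to 2N/(N - 2j - 2).\<close>

lemma Sobolev_chain:
  fixes U :: "'a::euclidean_space set"
  assumes N: "DIM('a) > 2 * m" and "j \<le> m"
  shows "\<exists>C\<ge>0. \<forall>\<phi>\<in>test_functions U. \<forall>bs\<in>index_lists (m - j).
    Lnorm (2 * real DIM('a) / (real DIM('a) - 2 * real j)) (partials bs \<phi>) \<le> C * sqrt (top_energy m \<phi>)"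
  using assms(2)
proof (induction j)
  case 0
  have "Lnorm 2 (partials bs \<phi>) \<le> 1 * sqrt (top_energy m \<phi>)"
    if "\<phi> \<in> test_functions U" "bs \<in> index_lists m" for \<phi> :: "'a \<Rightarrow> real" and bs
  proof -
    have "(LINT x|lebesgue. \<bar>partials bs \<phi> x\<bar> powr 2) = (LINT x|lebesgue. (partials bs \<phi> x)\<^sup>2)"
      by (intro Bochner_Integration.integral_cong) (auto simp: powr_numeral)
    also have "\<dots> \<le> top_energy m \<phi>"
      unfolding top_energy_def by (rule member_le_sum[OF that(2)]) auto
    finally show ?thesis by (simp add: Lnorm_def powr_half_sqrt)
  qed
  then show ?case by (intro exI[of _ 1]) auto
next
  case (Suc j)
  let ?n = "real DIM('a)"
  define q where "q = 2 * ?n / (?n - 2 * real j)"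
  obtain C where C: "C \<ge> 0" "\<And>\<phi> bs. \<phi> \<in> test_functions U \<Longrightarrow> bs \<in> index_lists (m - j) \<Longrightarrow>
      Lnorm q (partials bs \<phi>) \<le> C * sqrt (top_energy m \<phi>)"
    using Suc unfolding q_def by auto
  have nj: "?n > 2 * real j + 2" using N Suc.prems by linarith
  \<comment> \<open>\<open>q < ?n\<close> amounts to 2j + 2 < N, which N > 2m provides at every
    step.\<close>
  have "?n * (2 * real j + 2) < ?n * ?n" using nj by (intro mult_strict_left_mono) auto
  then have q: "q \<ge> 2" "q < ?n" using nj by (auto simp: q_def field_simps)
  have next_exponent: "n * (2 * n / d) / (n - 2 * n / d) = 2 * n / (d - 2)" if "n > 0" "d > 2" for n d :: real
  proof -
    have "n - 2 * n / d = n * (d - 2) / d" using that by (simp add: field_simps)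
    then show ?thesis using that by simp
  qed
  have q_next: "?n * q / (?n - q) = 2 * ?n / (?n - 2 * real (Suc j))"
    using next_exponent[of ?n "?n - 2 * real j"] nj by (simp add: q_def algebra_simps)
  let ?s = "q * (?n - 1) / (?n - q)"
  have s: "?s \<ge> 0" using q by simp
  have "Lnorm (?n * q / (?n - q)) (partials bs \<phi>) \<le> (?s * C) * sqrt (top_energy m \<phi>)"
    if \<phi>: "\<phi> \<in> test_functions U" and bs: "bs \<in> index_lists (m - Suc j)" for \<phi> :: "'a \<Rightarrow> real" and bs
  proof -
    have t: "partials bs \<phi> \<in> test_functions U"
      by (rule test_functions_partials[OF \<phi> index_lists_D(1)[OF bs]])
    have "Lnorm (?n * q / (?n - q)) (partials bs \<phi>) \<le> ?s * (C * sqrt (top_energy m \<phi>))"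
    proof (rule Gagliardo_Nirenberg_Sobolev[OF t q])
      fix b :: 'a assume b: "b \<in> Basis"
      have "b # bs \<in> index_lists (m - j)" using bs b Suc.prems by (auto simp: index_lists_def)
      from C(2)[OF \<phi> this] show "Lnorm q (partial b (partials bs \<phi>)) \<le> C * sqrt (top_energy m \<phi>)" by simp
    qed (use C in simp)
    then show ?thesis by simp
  qed
  then show ?case unfolding q_next by (intro exI[of _ "?s * C"] conjI ballI mult_nonneg_nonneg s C(1))
qed

subsection \<open>Completeness of \<open>L\<^sup>p\<close>\<close>

lemma powr_add_le:
  fixes a b p :: real
  assumes "p > 0"
  shows "\<bar>a + b\<bar> powr p \<le> 2 powr p * (\<bar>a\<bar> powr p + \<bar>b\<bar> powr p)"
proof -
  have "\<bar>a + b\<bar> powr p \<le> (2 * max \<bar>a\<bar> \<bar>b\<bar>) powr p"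
    using assms by (intro powr_mono2) auto
  also have "\<dots> = 2 powr p * max \<bar>a\<bar> \<bar>b\<bar> powr p" by (simp add: powr_mult)
  also have "\<dots> \<le> 2 powr p * (\<bar>a\<bar> powr p + \<bar>b\<bar> powr p)"
    by (intro mult_left_mono) (auto simp: max_def)
  finally show ?thesis .
qed

lemma powr_integrable_add:
  assumes "p > 0" "f \<in> borel_measurable M" "g \<in> borel_measurable M"
    "integrable M (\<lambda>x. \<bar>f x\<bar> powr p)" "integrable M (\<lambda>x. \<bar>g x\<bar> powr p)"
  shows "integrable M (\<lambda>x. \<bar>f x + g x\<bar> powr (p::real))"
proof (rule Bochner_Integration.integrable_bound)
  show "integrable M (\<lambda>x. 2 powr p * (\<bar>f x\<bar> powr p + \<bar>g x\<bar> powr p))" using assms by simp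
  show "AE x in M. norm (\<bar>f x + g x\<bar> powr p) \<le> norm (2 powr p * (\<bar>f x\<bar> powr p + \<bar>g x\<bar> powr p))"
    using powr_add_le[OF assms(1)] by (intro AE_I2) auto
qed (use assms in measurable)

text \<open>The rate is chosen so that the increments, scaled up by 2^k and raised to the power p,
  have integrals at most 2^(-k). Their sum is finite almost everywhere, so the increments are
  eventually below 2^(-k) and hence summable.\<close>

lemma Lp_fast_Cauchy_AE_convergent:
  fixes f :: "nat \<Rightarrow> 'b \<Rightarrow> real"
  assumes p: "p > 0" and m: "\<And>n. f n \<in> borel_measurable M"
    and int: "\<And>k. integrable M (\<lambda>x. \<bar>f (Suc k) x - f k x\<bar> powr p)"
    and fast: "\<And>k. (LINT x|M. \<bar>f (Suc k) x - f k x\<bar> powr p) \<le> (1/2) ^ k * (1/2 ^ k) powr p"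
  shows "AE x in M. convergent (\<lambda>k. f k x)"
proof -
  define h where "h k x = (2 ^ k * \<bar>f (Suc k) x - f k x\<bar>) powr p" for k x
  have hm [measurable]: "h k \<in> borel_measurable M" for k
    unfolding h_def using m by measurable
  have hi: "(\<integral>\<^sup>+x. ennreal (h k x) \<partial>M) \<le> ennreal ((1/2) ^ k)" for k
  proof -
    have h_eq: "h k x = (2 ^ k) powr p * \<bar>f (Suc k) x - f k x\<bar> powr p" for x
      by (simp add: h_def powr_mult)
    have "(\<integral>\<^sup>+x. ennreal (h k x) \<partial>M) = ennreal (LINT x|M. h k x)"
      unfolding h_eq using int by (intro nn_integral_eq_integral) auto
    also have "(LINT x|M. h k x) = (2 ^ k) powr p * (LINT x|M. \<bar>f (Suc k) x - f k x\<bar> powr p)"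
      unfolding h_eq by simp
    also have "\<dots> \<le> (2 ^ k) powr p * ((1/2) ^ k * (1/2 ^ k) powr p)"
      by (intro mult_left_mono fast) auto
    also have "\<dots> = (1/2) ^ k" by (simp add: powr_divide)
    finally show ?thesis by (simp add: ennreal_leI)
  qed
  have "(\<integral>\<^sup>+x. (\<Sum>k. ennreal (h k x)) \<partial>M) = (\<Sum>k. \<integral>\<^sup>+x. ennreal (h k x) \<partial>M)"
    by (rule nn_integral_suminf) measurable
  also have "\<dots> \<le> (\<Sum>k. ennreal ((1/2) ^ k))" by (intro suminf_le hi) auto
  also have "\<dots> = ennreal (\<Sum>k. (1/2) ^ k)" by (intro suminf_ennreal2) (auto intro: summable_geometric)
  finally have "(\<integral>\<^sup>+x. (\<Sum>k. ennreal (h k x)) \<partial>M) \<noteq> \<infinity>" by (auto simp: top_unique)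
  then have "AE x in M. (\<Sum>k. ennreal (h k x)) \<noteq> \<infinity>"
    by (intro nn_integral_noteq_infinite) measurable
  then show ?thesis
  proof eventually_elim
    case (elim x)
    have "summable (\<lambda>k. h k x)"
      using elim by (intro summable_suminf_not_top) (auto simp: h_def)
    then have "(\<lambda>k. h k x) \<longlonglongrightarrow> 0" by (rule summable_LIMSEQ_zero)
    then have "\<forall>\<^sub>F k in sequentially. h k x < 1" by (rule order_tendstoD) simp
    then obtain N where N: "\<And>k. k \<ge> N \<Longrightarrow> h k x < 1" by (auto simp: eventually_sequentially)
    have "norm (f (Suc k) x - f k x) \<le> (1/2) ^ k" if "k \<ge> N" for k
    proof (rule ccontr)
      assume "\<not> norm (f (Suc k) x - f k x) \<le> (1/2) ^ k"
      then have "2 ^ k * \<bar>f (Suc k) x - f k x\<bar> \<ge> 1" by (simp add: field_simps power_one_over)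
      then have "1 powr p \<le> h k x" unfolding h_def using p by (intro powr_mono2) auto
      then show False using N[OF that] by simp
    qed
    then have "summable (\<lambda>k. f (Suc k) x - f k x)"
    proof (rule summable_comparison_test'[where N = N, rotated])
      show "summable (\<lambda>k. (1/2 :: real) ^ k)" by (rule summable_geometric) simp
    qed
    then have "convergent (\<lambda>n. \<Sum>k<n. f (Suc k) x - f k x)" by (simp add: summable_iff_convergent)
    then have "convergent (\<lambda>n. f n x - f 0 x)" by (simp only: sum_lessThan_telescope[of "\<lambda>k. f k x"])
    from convergent_add[OF this convergent_const[of "f 0 x"]] show ?case by simp
  qed
qed

text \<open>A fast subsequence converges almost everywhere, and Fatou's lemma transfers the Cauchy
  estimate to its limit. No triangle inequality is used, so every p > 0 is covered.\<close>

lemma Lp_complete: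
  fixes f :: "nat \<Rightarrow> 'b \<Rightarrow> real"
  assumes p: "p > 0" and m: "\<And>n. f n \<in> borel_measurable M"
    and int: "\<And>n. integrable M (\<lambda>x. \<bar>f n x\<bar> powr p)"
    and cau: "\<And>e. e > 0 \<Longrightarrow> \<exists>N. \<forall>n\<ge>N. \<forall>k\<ge>N. (LINT x|M. \<bar>f n x - f k x\<bar> powr p) < e"
  obtains g where "g \<in> borel_measurable M" "integrable M (\<lambda>x. \<bar>g x\<bar> powr p)"
    "(\<lambda>n. LINT x|M. \<bar>f n x - g x\<bar> powr p) \<longlonglongrightarrow> 0"
proof -
  have intd: "integrable M (\<lambda>x. \<bar>f n x - f k x\<bar> powr p)" for n k
    using powr_integrable_add[OF p m[of n], of "\<lambda>x. - f k x"] m int by simp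
  have "\<forall>k. \<exists>N. \<forall>n\<ge>N. \<forall>l\<ge>N. (LINT x|M. \<bar>f n x - f l x\<bar> powr p) < (1/2) ^ k * (1/2 ^ k) powr p"
    using cau by simp
  then obtain N where N: "\<And>k n l. n \<ge> N k \<Longrightarrow> l \<ge> N k \<Longrightarrow>
      (LINT x|M. \<bar>f n x - f l x\<bar> powr p) < (1/2) ^ k * (1/2 ^ k) powr p" by metis
  \<comment> \<open>The sum makes r increasing and at least \<open>N k\<close>; adding k makes it
    unbounded.\<close>
  define r where "r k = (\<Sum>i\<le>k. N i) + k" for k
  have rN: "r k \<ge> N k" for k unfolding r_def by (rule trans_le_add1) (rule member_le_sum, auto)
  have rS: "r k \<le> r (Suc k)" for k by (simp add: r_def)
  have rk: "r k \<ge> k" for k by (simp add: r_def)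
  have "AE x in M. convergent (\<lambda>k. f (r k) x)"
  proof (rule Lp_fast_Cauchy_AE_convergent[OF p])
    show "(LINT x|M. \<bar>f (r (Suc k)) x - f (r k) x\<bar> powr p) \<le> (1/2) ^ k * (1/2 ^ k) powr p" for k
      using N[of k "r (Suc k)" "r k"] rN[of k] rS[of k] by simp
  qed (use m intd in auto)
  moreover define g where "g x = lim (\<lambda>k. f (r k) x)" for x
  ultimately have lim: "AE x in M. (\<lambda>k. f (r k) x) \<longlonglongrightarrow> g x"
    by (auto simp: convergent_LIMSEQ_iff elim: eventually_mono)
  have gm [measurable]: "g \<in> borel_measurable M"
    unfolding g_def[abs_def] using m by (intro borel_measurable_lim_metric)
  have nn: "(\<integral>\<^sup>+x. ennreal (\<bar>f n x - g x\<bar> powr p) \<partial>M) \<le> ennreal e"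
    if "e > 0" and M: "\<forall>i\<ge>M'. \<forall>k\<ge>M'. (LINT x|M. \<bar>f i x - f k x\<bar> powr p) < e" "n \<ge> M'" for e M' n
  proof -
    have "(\<integral>\<^sup>+x. ennreal (\<bar>f n x - g x\<bar> powr p) \<partial>M) = (\<integral>\<^sup>+x. liminf (\<lambda>k. ennreal (\<bar>f n x - f (r k) x\<bar> powr p)) \<partial>M)"
    proof (rule nn_integral_cong_AE)
      show "AE x in M. ennreal (\<bar>f n x - g x\<bar> powr p) = liminf (\<lambda>k. ennreal (\<bar>f n x - f (r k) x\<bar> powr p))"
        using lim
      proof eventually_elim
        case (elim x)
        have "(\<lambda>k. \<bar>f n x - f (r k) x\<bar> powr p) \<longlonglongrightarrow> \<bar>f n x - g x\<bar> powr p"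
          using p elim by (intro tendsto_powr2 tendsto_intros) auto
        then have "(\<lambda>k. ennreal (\<bar>f n x - f (r k) x\<bar> powr p)) \<longlonglongrightarrow> ennreal (\<bar>f n x - g x\<bar> powr p)"
          by (rule tendsto_ennrealI)
        then show ?case by (intro lim_imp_Liminf[symmetric]) auto
      qed
    qed
    also have "\<dots> \<le> liminf (\<lambda>k. \<integral>\<^sup>+x. ennreal (\<bar>f n x - f (r k) x\<bar> powr p) \<partial>M)"
      using m by (intro nn_integral_liminf) measurable
    also have "\<dots> \<le> ennreal e"
    proof (rule Liminf_le)
      show "\<forall>\<^sub>F k in sequentially. (\<integral>\<^sup>+x. ennreal (\<bar>f n x - f (r k) x\<bar> powr p) \<partial>M) \<le> ennreal e"
      proof (rule eventually_sequentiallyI[of M'])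
        fix k assume "k \<ge> M'"
        then have "(LINT x|M. \<bar>f n x - f (r k) x\<bar> powr p) < e" using M rk[of k] by auto
        then show "(\<integral>\<^sup>+x. ennreal (\<bar>f n x - f (r k) x\<bar> powr p) \<partial>M) \<le> ennreal e"
          using intd by (subst nn_integral_eq_integral) (auto intro!: ennreal_leI)
      qed
    qed simp
    finally show ?thesis .
  qed
  have intg: "integrable M (\<lambda>x. \<bar>f n x - g x\<bar> powr p)"
    if "e > 0" and M: "\<forall>i\<ge>M'. \<forall>k\<ge>M'. (LINT x|M. \<bar>f i x - f k x\<bar> powr p) < e" "n \<ge> M'" for e M' n
    using nn[OF that] m by (intro integrableI_bounded) (auto intro: le_less_trans)
  obtain M0 where M0: "\<forall>i\<ge>M0. \<forall>k\<ge>M0. (LINT x|M. \<bar>f i x - f k x\<bar> powr p) < 1" using cau[of 1] by auto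
  have "integrable M (\<lambda>x. \<bar>f M0 x + (g x - f M0 x)\<bar> powr p)"
  proof (rule powr_integrable_add[OF p m _ int])
    show "integrable M (\<lambda>x. \<bar>g x - f M0 x\<bar> powr p)"
      using intg[OF _ M0, of M0] by (simp add: abs_minus_commute)
  qed (use m in measurable)
  then have g: "integrable M (\<lambda>x. \<bar>g x\<bar> powr p)" by simp
  have "(\<lambda>n. LINT x|M. \<bar>f n x - g x\<bar> powr p) \<longlonglongrightarrow> 0"
  proof (rule LIMSEQ_I)
    fix e :: real assume e: "e > 0"
    then obtain M' where M': "\<forall>i\<ge>M'. \<forall>k\<ge>M'. (LINT x|M. \<bar>f i x - f k x\<bar> powr p) < e / 2"
      using cau[of "e / 2"] by auto
    have "norm ((LINT x|M. \<bar>f n x - g x\<bar> powr p) - 0) < e" if "n \<ge> M'" for n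
    proof -
      have "ennreal (LINT x|M. \<bar>f n x - g x\<bar> powr p) \<le> ennreal (e / 2)"
        using nn[OF _ M' that] intg[OF _ M' that] e by (subst nn_integral_eq_integral[symmetric]) auto
      then have "(LINT x|M. \<bar>f n x - g x\<bar> powr p) \<le> e / 2" using e by simp
      moreover have "0 \<le> (LINT x|M. \<bar>f n x - g x\<bar> powr p)" by simp
      ultimately show ?thesis using e by simp
    qed
    then show "\<exists>M'. \<forall>n\<ge>M'. norm ((LINT x|M. \<bar>f n x - g x\<bar> powr p) - 0) < e" by blast
  qed
  with gm g that show ?thesis by blast
qed

lemma Lp_locally_integrable:
  fixes f :: "'a::euclidean_space \<Rightarrow> real"
  assumes "f \<in> borel_measurable lebesgue" "integrable lebesgue (\<lambda>x. \<bar>f x\<bar> powr q)" "q \<ge> 1"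
  shows "locally_integrable \<Omega> f"
  unfolding locally_integrable_def
proof (intro allI impI)
  fix C :: "'a set" assume "compact C \<and> C \<subseteq> \<Omega>"
  then have C: "C \<in> lmeasurable" "C \<in> sets lebesgue" by (auto simp: lmeasurable_compact fmeasurableD)
  show "integrable (lebesgue_on C) f"
  proof (rule Bochner_Integration.integrable_bound)
    have "integrable lebesgue (\<lambda>x. indicat_real C x)" using C(1) by (simp add: lmeasurable_iff_integrable)
    then have "integrable (lebesgue_on C) (\<lambda>x. 1::real)"
      using C by (intro integrable_restrict_space[THEN iffD2]) auto
    then show "integrable (lebesgue_on C) (\<lambda>x. 1 + \<bar>f x\<bar> powr q)"
      using integrable_lebesgue_on[OF assms(2) C(2)] by (rule Bochner_Integration.integrable_add)
    show "AE x in lebesgue_on C. norm (f x) \<le> norm (1 + \<bar>f x\<bar> powr q)"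
    proof (rule AE_I2)
      fix x
      have "\<bar>f x\<bar> \<le> 1 + \<bar>f x\<bar> powr q"
      proof (cases "\<bar>f x\<bar> \<le> 1")
        case False
        then have "\<bar>f x\<bar> powr 1 \<le> \<bar>f x\<bar> powr q" using assms(3) by (intro powr_mono) auto
        then show ?thesis using False by simp
      qed (simp add: add_increasing2)
      then show "norm (f x) \<le> norm (1 + \<bar>f x\<bar> powr q)" by simp
    qed
  qed (use assms(1) in \<open>simp add: measurable_restrict_space1\<close>)
qed

text \<open>Hoelder's inequality with the conjugate exponent; it carries the integration by parts
  formula from test functions to their limits.\<close>

lemma Lp_tendsto_test:
  fixes f :: "nat \<Rightarrow> 'a::euclidean_space \<Rightarrow> real"
  assumes q: "q > 1" and m: "\<And>n. f n \<in> borel_measurable lebesgue" "g \<in> borel_measurable lebesgue"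
    and i: "\<And>n. integrable lebesgue (\<lambda>x. \<bar>f n x\<bar> powr q)" "integrable lebesgue (\<lambda>x. \<bar>g x\<bar> powr q)"
    and lim: "(\<lambda>n. LINT x|lebesgue. \<bar>f n x - g x\<bar> powr q) \<longlonglongrightarrow> 0"
    and \<psi>: "\<psi> \<in> test_functions UNIV"
  shows "(\<lambda>n. LINT x|lebesgue. f n x * \<psi> x) \<longlonglongrightarrow> (LINT x|lebesgue. g x * \<psi> x)"
proof -
  define q' where "q' = q / (q - 1)"
  have q': "q' > 1" "1 / q + 1 / q' = 1" using q by (auto simp: q'_def field_simps)
  have li: "locally_integrable UNIV (f n)" "locally_integrable UNIV g" for n
    using Lp_locally_integrable[OF m(1) i(1)] Lp_locally_integrable[OF m(2) i(2)] q by auto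
  have idf: "integrable lebesgue (\<lambda>x. \<bar>f n x - g x\<bar> powr q)" for n
    using powr_integrable_add[of q "f n" lebesgue "\<lambda>x. - g x"] q m i by simp
  have bound: "norm ((LINT x|lebesgue. f n x * \<psi> x) - (LINT x|lebesgue. g x * \<psi> x))
      \<le> (LINT x|lebesgue. \<bar>f n x - g x\<bar> powr q) powr (1 / q) * Lnorm q' \<psi>" for n
  proof -
    have I: "integrable lebesgue (\<lambda>x. f n x * \<psi> x)" "integrable lebesgue (\<lambda>x. g x * \<psi> x)"
      using li locally_integrable_mult_test[OF _ \<psi>] by auto
    have Id: "integrable lebesgue (\<lambda>x. f n x * \<psi> x - g x * \<psi> x)" using I by simp
    have "(LINT x|lebesgue. f n x * \<psi> x) - (LINT x|lebesgue. g x * \<psi> x) = (LINT x|lebesgue. f n x * \<psi> x - g x * \<psi> x)"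
      using I by simp
    then have "norm ((LINT x|lebesgue. f n x * \<psi> x) - (LINT x|lebesgue. g x * \<psi> x))
        \<le> (LINT x|lebesgue. norm (f n x * \<psi> x - g x * \<psi> x))"
      by (simp only: integral_norm_bound)
    also have "\<dots> = (LINT x|lebesgue. \<bar>f n x - g x\<bar> * \<bar>\<psi> x\<bar>)"
      by (simp add: abs_mult left_diff_distrib[symmetric])
    also have "\<dots> \<le> (LINT x|lebesgue. \<bar>f n x - g x\<bar> powr q) powr (1 / q) * (LINT x|lebesgue. \<bar>\<psi> x\<bar> powr q') powr (1 / q')"
    proof (rule Holder_integral[OF q q'])
      show "integrable lebesgue (\<lambda>x. \<bar>f n x - g x\<bar> * \<bar>\<psi> x\<bar>)"
        using integrable_norm[OF Id] by (simp add: abs_mult left_diff_distrib[symmetric])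
      show "integrable lebesgue (\<lambda>x. \<bar>\<psi> x\<bar> powr q')"
        using test_functions_powr_integrable[OF \<psi>] q' by simp
    qed (use idf in auto)
    finally show ?thesis by (simp add: Lnorm_def)
  qed
  have "(\<lambda>n. (LINT x|lebesgue. \<bar>f n x - g x\<bar> powr q) powr (1 / q) * Lnorm q' \<psi>) \<longlonglongrightarrow> 0 powr (1 / q) * Lnorm q' \<psi>"
    using q lim by (intro tendsto_mult tendsto_powr2 tendsto_const) auto
  then have "(\<lambda>n. (LINT x|lebesgue. \<bar>f n x - g x\<bar> powr q) powr (1 / q) * Lnorm q' \<psi>) \<longlonglongrightarrow> 0"
    by simp
  then have "(\<lambda>n. (LINT x|lebesgue. f n x * \<psi> x) - (LINT x|lebesgue. g x * \<psi> x)) \<longlonglongrightarrow> 0"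
    by (rule Lim_null_comparison[OF always_eventually[OF allI[OF bound]]])
  then show ?thesis by (rule LIM_zero_cancel)
qed

subsection \<open>The homogeneous spaces\<close>

text \<open>The Sobolev exponent of the derivatives of order \<open>k\<close> of a function with \<open>m\<close> derivatives in \<open>L\<^sup>2\<close>.\<close>

definition chain_exp :: "'a::euclidean_space itself \<Rightarrow> nat \<Rightarrow> nat \<Rightarrow> real" where
  "chain_exp _ m k = 2 * real DIM('a) / (real DIM('a) - 2 * real (m - k))"

lemma chain_exp:
  assumes "DIM('a::euclidean_space) > 2 * m"
  shows "chain_exp TYPE('a) m k \<ge> 2" "chain_exp TYPE('a) m m = 2"
    "chain_exp TYPE('a) m 0 = 2 * real DIM('a) / (real DIM('a) - 2 * real m)"
proof -
  have "real DIM('a) > 2 * real m" using assms by linarith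
  moreover have "real (m - k) \<le> real m" by simp
  ultimately have "real DIM('a) - 2 * real (m - k) > 0" by linarith
  then show "chain_exp TYPE('a) m k \<ge> 2" by (simp add: chain_exp_def field_simps)
qed (simp_all add: chain_exp_def)

lemma Sobolev_derivatives:
  assumes "DIM('a::euclidean_space) > 2 * m"
  obtains C where "C \<ge> 0" "\<And>(\<phi> :: 'a \<Rightarrow> real) bs. \<phi> \<in> test_functions UNIV \<Longrightarrow> bs \<in> multi_indices m \<Longrightarrow>
    Lnorm (chain_exp TYPE('a) m (length bs)) (partials bs \<phi>) \<le> C * sqrt (top_energy m \<phi>)"
proof -
  have "\<forall>j. \<exists>C. j \<le> m \<longrightarrow> C \<ge> 0 \<and> (\<forall>\<phi>\<in>test_functions (UNIV :: 'a set). \<forall>bs\<in>index_lists (m - j).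
    Lnorm (2 * real DIM('a) / (real DIM('a) - 2 * real j)) (partials bs \<phi>) \<le> C * sqrt (top_energy m \<phi>))"
    using Sobolev_chain[OF assms] by blast
  then obtain C where C: "\<And>j. j \<le> m \<Longrightarrow> C j \<ge> 0" "\<And>j (\<phi> :: 'a \<Rightarrow> real) bs. j \<le> m \<Longrightarrow> \<phi> \<in> test_functions UNIV \<Longrightarrow>
      bs \<in> index_lists (m - j) \<Longrightarrow>
      Lnorm (2 * real DIM('a) / (real DIM('a) - 2 * real j)) (partials bs \<phi>) \<le> C j * sqrt (top_energy m \<phi>)"
    by metis
  show ?thesis
  proof (rule that[of "\<Sum>j\<le>m. C j"])
    show "(\<Sum>j\<le>m. C j) \<ge> 0" using C(1) by (auto intro: sum_nonneg)
    fix \<phi> :: "'a \<Rightarrow> real" and bs :: "'a list"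
    assume \<phi>: "\<phi> \<in> test_functions UNIV" and bs: "bs \<in> multi_indices m"
    define j where "j = m - length bs"
    have j: "j \<le> m" "bs \<in> index_lists (m - j)" using bs by (auto simp: j_def index_lists_def multi_indices_iff)
    have "Lnorm (chain_exp TYPE('a) m (length bs)) (partials bs \<phi>) \<le> C j * sqrt (top_energy m \<phi>)"
      using C(2)[OF j(1) \<phi> j(2)] by (simp add: chain_exp_def j_def)
    also have "\<dots> \<le> (\<Sum>j\<le>m. C j) * sqrt (top_energy m \<phi>)"
      using j(1) C(1) by (intro mult_right_mono member_le_sum) auto
    finally show "Lnorm (chain_exp TYPE('a) m (length bs)) (partials bs \<phi>) \<le> (\<Sum>j\<le>m. C j) * sqrt (top_energy m \<phi>)" .
  qed
qed

lemma Dm_norm_test: "\<phi> \<in> test_functions UNIV \<Longrightarrow> Dm_norm m \<phi> = sqrt (top_energy m \<phi>)"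
  by (simp add: Dm_norm_def dirichlet_energy_test)

definition Dm_Cauchy :: "nat \<Rightarrow> (nat \<Rightarrow> 'a::euclidean_space \<Rightarrow> real) \<Rightarrow> bool" where
  "Dm_Cauchy m \<phi> \<longleftrightarrow> (\<forall>n. \<phi> n \<in> test_functions UNIV) \<and>
    (\<forall>e>0. \<exists>M. \<forall>n\<ge>M. \<forall>k\<ge>M. Dm_norm m (\<lambda>x. \<phi> n x - \<phi> k x) < e)"

lemma Dm_Cauchy_limits:
  fixes \<phi> :: "nat \<Rightarrow> 'a::euclidean_space \<Rightarrow> real"
  assumes N: "DIM('a) > 2 * m" and \<phi>: "Dm_Cauchy m \<phi>" and bs: "bs \<in> multi_indices m"
  defines "q \<equiv> chain_exp TYPE('a) m (length bs)"
  obtains v where "v \<in> borel_measurable lebesgue" "integrable lebesgue (\<lambda>x. \<bar>v x\<bar> powr q)"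
    "(\<lambda>n. LINT x|lebesgue. \<bar>partials bs (\<phi> n) x - v x\<bar> powr q) \<longlonglongrightarrow> 0"
proof (rule Lp_complete)
  have q: "q \<ge> 2" unfolding q_def by (rule chain_exp(1)[OF N])
  have t: "\<phi> n \<in> test_functions UNIV" for n using \<phi> by (simp add: Dm_Cauchy_def)
  have bsB: "set bs \<subseteq> Basis" using bs by (simp add: multi_indices_iff)
  have tp: "partials bs (\<phi> n) \<in> test_functions UNIV" for n by (rule test_functions_partials[OF t bsB])
  show "q > 0" using q by simp
  show "partials bs (\<phi> n) \<in> borel_measurable lebesgue" for n
    by (rule smooth_measurable[OF test_functions_smooth[OF tp]])
  show "integrable lebesgue (\<lambda>x. \<bar>partials bs (\<phi> n) x\<bar> powr q)" for n
    by (rule test_functions_powr_integrable[OF tp]) (use q in simp)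
  obtain C where C: "C \<ge> 0" "\<And>(\<phi> :: 'a \<Rightarrow> real) bs. \<phi> \<in> test_functions UNIV \<Longrightarrow> bs \<in> multi_indices m \<Longrightarrow>
      Lnorm (chain_exp TYPE('a) m (length bs)) (partials bs \<phi>) \<le> C * sqrt (top_energy m \<phi>)"
    using Sobolev_derivatives[OF N] by metis
  fix e :: real assume e: "e > 0"
  \<comment> \<open>Keeps \<open>C * d\<close> strictly below the q-th root of e, also for C =
    0.\<close>
  define d where "d = e powr (1 / q) / (C + 1)"
  have d: "d > 0" using e C(1) by (simp add: d_def)
  then obtain M where M: "\<And>n k. n \<ge> M \<Longrightarrow> k \<ge> M \<Longrightarrow> Dm_norm m (\<lambda>x. \<phi> n x - \<phi> k x) < d"
    using \<phi> unfolding Dm_Cauchy_def by metis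
  have "(LINT x|lebesgue. \<bar>partials bs (\<phi> n) x - partials bs (\<phi> k) x\<bar> powr q) < e" if nk: "n \<ge> M" "k \<ge> M" for n k
  proof -
    let ?A = "LINT x|lebesgue. \<bar>partials bs (\<phi> n) x - partials bs (\<phi> k) x\<bar> powr q"
    have td: "(\<lambda>x. \<phi> n x - \<phi> k x) \<in> test_functions UNIV" by (rule test_functions_diff[OF t t])
    have "?A powr (1 / q) = Lnorm q (partials bs (\<lambda>x. \<phi> n x - \<phi> k x))"
      by (simp add: Lnorm_def partials_diff[OF test_functions_smooth[OF t] test_functions_smooth[OF t] bsB])
    also have "\<dots> \<le> C * Dm_norm m (\<lambda>x. \<phi> n x - \<phi> k x)"
      unfolding q_def Dm_norm_test[OF td] by (rule C(2)[OF td bs])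
    also have "\<dots> \<le> C * d" using M[OF nk] C(1) by (intro mult_left_mono) auto
    also have "\<dots> < (C + 1) * d" using d by simp
    also have "\<dots> = e powr (1 / q)" using C(1) by (simp add: d_def)
    finally have "?A powr (1 / q) < e powr (1 / q)" .
    then show ?thesis using powr_mono2[of "1 / q" e ?A] q e by (cases "?A < e") auto
  qed
  then show "\<exists>N. \<forall>n\<ge>N. \<forall>k\<ge>N. (LINT x|lebesgue. \<bar>partials bs (\<phi> n) x - partials bs (\<phi> k) x\<bar> powr q) < e" by blast
qed (use that in blast)

text \<open>The derivatives of each order converge in their own Lebesgue space, and testing
  identifies the limits as weak derivatives of u. At order m the exponent is 2, which turns this
  convergence into convergence in energy.\<close>

lemma Dm_Cauchy_weak_space:
  fixes \<phi> :: "nat \<Rightarrow> 'a::euclidean_space \<Rightarrow> real"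
  assumes N: "DIM('a) > 2 * m" and \<phi>: "Dm_Cauchy m \<phi>"
    and u: "u \<in> borel_measurable lebesgue" "integrable lebesgue (\<lambda>x. \<bar>u x\<bar> powr chain_exp TYPE('a) m 0)"
    and lim: "(\<lambda>n. LINT x|lebesgue. \<bar>\<phi> n x - u x\<bar> powr chain_exp TYPE('a) m 0) \<longlonglongrightarrow> 0"
  shows "u \<in> weak_space m UNIV" "(\<lambda>n. Dm_norm m (\<lambda>x. \<phi> n x - u x)) \<longlonglongrightarrow> 0"
proof -
  let ?q = "chain_exp TYPE('a) m"
  have q: "?q k \<ge> 2" for k by (rule chain_exp(1)[OF N])
  have q1: "?q k > 1" "?q k \<ge> 1" "?q k > 0" for k using q[of k] by linarith+
  have t: "\<phi> n \<in> test_functions UNIV" for n using \<phi> by (simp add: Dm_Cauchy_def)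
  have "\<forall>bs\<in>multi_indices m. \<exists>v. v \<in> borel_measurable lebesgue \<and> integrable lebesgue (\<lambda>x. \<bar>v x\<bar> powr ?q (length bs))
      \<and> (\<lambda>n. LINT x|lebesgue. \<bar>partials bs (\<phi> n) x - v x\<bar> powr ?q (length bs)) \<longlonglongrightarrow> 0"
  proof
    fix bs :: "'a list" assume "bs \<in> multi_indices m"
    from Dm_Cauchy_limits[OF N \<phi> this] show "\<exists>v. v \<in> borel_measurable lebesgue \<and> integrable lebesgue (\<lambda>x. \<bar>v x\<bar> powr ?q (length bs))
      \<and> (\<lambda>n. LINT x|lebesgue. \<bar>partials bs (\<phi> n) x - v x\<bar> powr ?q (length bs)) \<longlonglongrightarrow> 0" by blast
  qed
  then obtain D where D: "\<And>bs. bs \<in> multi_indices m \<Longrightarrow> D bs \<in> borel_measurable lebesgue"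
    "\<And>bs. bs \<in> multi_indices m \<Longrightarrow> integrable lebesgue (\<lambda>x. \<bar>D bs x\<bar> powr ?q (length bs))"
    "\<And>bs. bs \<in> multi_indices m \<Longrightarrow> (\<lambda>n. LINT x|lebesgue. \<bar>partials bs (\<phi> n) x - D bs x\<bar> powr ?q (length bs)) \<longlonglongrightarrow> 0"
    by (auto dest!: bchoice)
  have fam: "weak_family m UNIV u D"
    unfolding weak_family_def
  proof
    fix bs :: "'a list" assume bs: "bs \<in> multi_indices m"
    then have bsB: "set bs \<subseteq> Basis" by (simp add: multi_indices_iff)
    have tp: "partials bs (\<phi> n) \<in> test_functions UNIV" for n by (rule test_functions_partials[OF t bsB])
    show "has_weak_deriv UNIV bs u (D bs)"
      unfolding has_weak_deriv_iff[OF open_UNIV bsB]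
    proof (intro conjI ballI)
      show "locally_integrable UNIV u" using Lp_locally_integrable[OF u q1(2)] .
      show "locally_integrable UNIV (D bs)" using Lp_locally_integrable[OF D(1,2)[OF bs] q1(2)] .
      fix \<psi> :: "'a \<Rightarrow> real" assume \<psi>: "\<psi> \<in> test_functions UNIV"
      have "(\<lambda>n. LINT x|lebesgue. \<phi> n x * partials bs \<psi> x) \<longlonglongrightarrow> (LINT x|lebesgue. u x * partials bs \<psi> x)"
        using q1 u lim test_functions_powr_integrable[OF t q1(3)[of 0]] smooth_measurable[OF test_functions_smooth[OF t]]
        by (intro Lp_tendsto_test[of "?q 0"] test_functions_partials[OF \<psi> bsB]) auto
      moreover have "(LINT x|lebesgue. \<phi> n x * partials bs \<psi> x) = (-1) ^ length bs * (LINT x|lebesgue. partials bs (\<phi> n) x * \<psi> x)" for n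
        by (rule integral_by_parts_partials[OF test_functions_smooth[OF t] \<psi> bsB])
      moreover have "(\<lambda>n. (-1) ^ length bs * (LINT x|lebesgue. partials bs (\<phi> n) x * \<psi> x))
          \<longlonglongrightarrow> (-1) ^ length bs * (LINT x|lebesgue. D bs x * \<psi> x)"
        using q1 D[OF bs] test_functions_powr_integrable[OF tp q1(3)[of "length bs"]] smooth_measurable[OF test_functions_smooth[OF tp]]
        by (intro tendsto_mult tendsto_const Lp_tendsto_test[of "?q (length bs)"] \<psi>) auto
      ultimately show "(LINT x|lebesgue. u x * partials bs \<psi> x) = (-1) ^ length bs * (LINT x|lebesgue. D bs x * \<psi> x)"
        by (simp add: LIMSEQ_unique)
    qed
  qed
  have bm: "bs \<in> multi_indices m" "length bs = m" "set bs \<subseteq> Basis" if "bs \<in> index_lists m" for bs :: "'a list"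
    using that index_lists_multi_indices by (auto simp: index_lists_def)
  have sq: "\<bar>y\<bar> powr 2 = y\<^sup>2" for y :: real by (simp add: powr_numeral)
  have q2: "?q m = 2" by (rule chain_exp(2)[OF N])
  have DL2: "D bs \<in> L2 UNIV" if "bs \<in> index_lists m" for bs
    using D(1,2)[OF bm(1)[OF that]] unfolding bm(2)[OF that] q2 sq by (simp add: L2_def lebesgue_on_UNIV_eq)
  then show uw: "u \<in> weak_space m UNIV" using fam by (auto simp: weak_space_def)
  have famn: "weak_family m UNIV (\<lambda>x. \<phi> n x - u x) (\<lambda>bs x. partials bs (\<phi> n) x - D bs x)" for n
    using weak_family_lin[OF open_UNIV smooth_weak_family[OF test_functions_smooth[OF t[of n]] open_UNIV] fam, of 1 "-1"] by simp
  have L2n: "(\<lambda>x. partials bs (\<phi> n) x - D bs x) \<in> L2 UNIV" if "bs \<in> index_lists m" for bs n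
    using L2_lin[OF smooth_L2_if_vanishing[OF test_functions_partials[OF t[of n] bm(3)[OF that]] open_UNIV] DL2[OF that], of 1 "-1"] by simp
  let ?c = "real (card (index_lists m :: 'a list set))"
  have bound: "norm (dirichlet_energy m UNIV (\<lambda>x. \<phi> n x - u x)) \<le> ?c * (\<Sum>bs\<in>index_lists m. LINT x|lebesgue. (partials bs (\<phi> n) x - D bs x)\<^sup>2)" for n
    using dirichlet_energy_le_top[OF open_UNIV famn L2n, of n]
    by (simp add: lebesgue_on_UNIV_eq) (simp add: dirichlet_energy_def)
  have "(\<lambda>n. ?c * (\<Sum>bs\<in>index_lists m. LINT x|lebesgue. (partials bs (\<phi> n) x - D bs x)\<^sup>2)) \<longlonglongrightarrow> ?c * (\<Sum>bs\<in>(index_lists m :: 'a list set). 0)"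
  proof (intro tendsto_mult tendsto_const tendsto_sum)
    fix bs :: "'a list" assume bs: "bs \<in> index_lists m"
    show "(\<lambda>n. LINT x|lebesgue. (partials bs (\<phi> n) x - D bs x)\<^sup>2) \<longlonglongrightarrow> 0"
      using D(3)[OF bm(1)[OF bs]] unfolding bm(2)[OF bs] q2 sq .
  qed
  then have "(\<lambda>n. ?c * (\<Sum>bs\<in>index_lists m. LINT x|lebesgue. (partials bs (\<phi> n) x - D bs x)\<^sup>2)) \<longlonglongrightarrow> 0"
    by simp
  then have "(\<lambda>n. dirichlet_energy m UNIV (\<lambda>x. \<phi> n x - u x)) \<longlonglongrightarrow> 0"
    by (rule Lim_null_comparison[OF always_eventually[OF allI[OF bound]]])
  from tendsto_real_sqrt[OF this]
  show "(\<lambda>n. Dm_norm m (\<lambda>x. \<phi> n x - u x)) \<longlonglongrightarrow> 0"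
    unfolding Dm_norm_def by simp
qed

lemma Dm0_iff:
  fixes u :: "'a::euclidean_space \<Rightarrow> real"
  assumes "DIM('a) > 2 * m"
  shows "u \<in> Dm0 m \<longleftrightarrow> u \<in> borel_measurable lebesgue \<and> integrable lebesgue (\<lambda>x. \<bar>u x\<bar> powr chain_exp TYPE('a) m 0) \<and>
    (\<exists>\<phi>. Dm_Cauchy m \<phi> \<and> (\<lambda>n. LINT x|lebesgue. \<bar>\<phi> n x - u x\<bar> powr chain_exp TYPE('a) m 0) \<longlonglongrightarrow> 0)"
  unfolding Dm0_def Let_def chain_exp(3)[OF assms] Dm_Cauchy_def by auto

lemma Dm0_weak_space:
  fixes u :: "'a::euclidean_space \<Rightarrow> real"
  assumes "DIM('a) > 2 * m" "u \<in> Dm0 m"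
  shows "u \<in> weak_space m UNIV"
  using assms(2) Dm_Cauchy_weak_space(1)[OF assms(1)] unfolding Dm0_iff[OF assms(1)] by blast

lemma Dm0_complete:
  fixes \<phi> :: "nat \<Rightarrow> 'a::euclidean_space \<Rightarrow> real"
  assumes "DIM('a) > 2 * m" "Dm_Cauchy m \<phi>"
  obtains u where "u \<in> Dm0 m" "(\<lambda>n. Dm_norm m (\<lambda>x. \<phi> n x - u x)) \<longlonglongrightarrow> 0"
proof -
  \<comment> \<open>The empty list stands for the function itself, whose exponent is the one in the
    definition of \<open>Dm0\<close>.\<close>
  have "[] \<in> multi_indices m" by (simp add: multi_indices_iff)
  from Dm_Cauchy_limits[OF assms this] obtain u where u: "u \<in> borel_measurable lebesgue"
    "integrable lebesgue (\<lambda>x. \<bar>u x\<bar> powr chain_exp TYPE('a) m 0)"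
    "(\<lambda>n. LINT x|lebesgue. \<bar>\<phi> n x - u x\<bar> powr chain_exp TYPE('a) m 0) \<longlonglongrightarrow> 0"
    by (auto simp: list.size)
  show ?thesis
    using that[of u] Dm_Cauchy_weak_space(2)[OF assms u] u assms(2) unfolding Dm0_iff[OF assms(1)] by blast
qed

lemma Dm0_add_test:
  fixes u :: "'a::euclidean_space \<Rightarrow> real"
  assumes N: "DIM('a) > 2 * m" and u: "u \<in> Dm0 m" and \<psi>: "\<psi> \<in> test_functions UNIV"
  shows "(\<lambda>x. u x + \<psi> x) \<in> Dm0 m"
proof -
  let ?q = "chain_exp TYPE('a) m 0"
  have q: "?q > 0" using chain_exp(1)[OF N, of 0] by simp
  obtain \<phi> where \<phi>: "u \<in> borel_measurable lebesgue" "integrable lebesgue (\<lambda>x. \<bar>u x\<bar> powr ?q)" "Dm_Cauchy m \<phi>"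
    "(\<lambda>n. LINT x|lebesgue. \<bar>\<phi> n x - u x\<bar> powr ?q) \<longlonglongrightarrow> 0"
    using u unfolding Dm0_iff[OF N] by blast
  have "Dm_Cauchy m (\<lambda>n x. \<phi> n x + \<psi> x)"
    using \<phi>(3) \<psi> by (auto simp: Dm_Cauchy_def intro: test_functions_add)
  moreover have "(\<lambda>n. LINT x|lebesgue. \<bar>(\<phi> n x + \<psi> x) - (u x + \<psi> x)\<bar> powr ?q) \<longlonglongrightarrow> 0"
    using \<phi>(4) by simp
  moreover have "integrable lebesgue (\<lambda>x. \<bar>u x + \<psi> x\<bar> powr ?q)"
    by (rule powr_integrable_add[OF q \<phi>(1) smooth_measurable[OF test_functions_smooth[OF \<psi>]] \<phi>(2)
      test_functions_powr_integrable[OF \<psi> q]])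
  moreover have "(\<lambda>x. u x + \<psi> x) \<in> borel_measurable lebesgue"
    by (rule borel_measurable_add[OF \<phi>(1) smooth_measurable[OF test_functions_smooth[OF \<psi>]]])
  ultimately show ?thesis unfolding Dm0_iff[OF N] by blast
qed

lemma test_functions_Dm0:
  fixes \<psi> :: "'a::euclidean_space \<Rightarrow> real"
  assumes N: "DIM('a) > 2 * m" and \<psi>: "\<psi> \<in> test_functions U"
  shows "\<psi> \<in> Dm0 m"
proof -
  have p: "\<psi> \<in> test_functions UNIV" using test_functions_mono[OF _ \<psi>] by simp
  have "top_energy m (\<lambda>x::'a. 0) = 0" by (simp add: top_energy_def)
  then have z: "Dm_norm m (\<lambda>x::'a. 0) = 0" by (simp add: Dm_norm_test)
  have q: "chain_exp TYPE('a) m 0 > 0" using chain_exp(1)[OF N, of 0] by simp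
  have "Dm_Cauchy m (\<lambda>n. \<psi>)" using p z by (simp add: Dm_Cauchy_def)
  then show ?thesis
    unfolding Dm0_iff[OF N]
    using p test_functions_powr_integrable[OF p q] smooth_measurable[OF test_functions_smooth[OF p]]
    by (intro conjI exI[of _ "\<lambda>n. \<psi>"]) auto
qed

lemma test_functions_Dm0_minus:
  fixes \<psi> :: "'a::euclidean_space \<Rightarrow> real"
  assumes N: "DIM('a) > 2 * m" and \<psi>: "\<psi> \<in> test_functions (- K)"
  shows "\<psi> \<in> Dm0_minus m K"
proof -
  have "top_energy m (\<lambda>x::'a. 0) = 0" by (simp add: top_energy_def)
  then have z: "Dm_norm m (\<lambda>x::'a. 0) = 0" by (simp add: Dm_norm_test)
  show ?thesis
    unfolding Dm0_minus_def using test_functions_Dm0[OF assms] \<psi> z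
    by (intro CollectI conjI exI[of _ "\<lambda>n. \<psi>"]) auto
qed

subsection \<open>Multiplication by cutoff functions\<close>

lemma multi_indices_mono: "k \<le> m \<Longrightarrow> multi_indices k \<subseteq> multi_indices m"
  by (auto simp: multi_indices_def)

lemma Leibniz_pointwise:
  fixes \<eta> :: "'a::euclidean_space \<Rightarrow> real"
  assumes "\<eta> \<in> test_functions U" "set bs \<subseteq> Basis"
  shows "\<exists>B\<ge>0. \<forall>g. smooth g \<longrightarrow> (\<forall>x. \<bar>partials bs (\<lambda>x. \<eta> x * g x) x\<bar> \<le>
    B * (\<Sum>cs\<in>multi_indices (length bs). \<bar>partials cs g x\<bar>))"
  using assms
proof (induction bs arbitrary: \<eta> rule: rev_induct)
  case Nil
  obtain B where B: "B > 0" "\<And>x. \<bar>\<eta> x\<bar> \<le> B" using test_functions_bounded[OF Nil(1)] by metis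
  have "multi_indices 0 = {[] :: 'a list}" by (auto simp: multi_indices_def)
  with B show ?case by (intro exI[of _ B]) (auto simp: abs_mult intro: mult_right_mono)
next
  case (snoc b bs)
  have b: "b \<in> Basis" "set bs \<subseteq> Basis" using snoc.prems by auto
  have sm: "smooth \<eta>" by (rule test_functions_smooth[OF snoc.prems(1)])
  have pt: "partial b \<eta> \<in> test_functions U"
    using test_functions_partials[OF snoc.prems(1), of "[b]"] b by simp
  obtain B1 where B1: "B1 \<ge> 0" "\<And>g x. smooth g \<Longrightarrow> \<bar>partials bs (\<lambda>x. \<eta> x * g x) x\<bar> \<le>
      B1 * (\<Sum>cs\<in>multi_indices (length bs). \<bar>partials cs g x\<bar>)" using snoc.IH[OF snoc.prems(1) b(2)] by blast
  obtain B2 where B2: "B2 \<ge> 0" "\<And>g x. smooth g \<Longrightarrow> \<bar>partials bs (\<lambda>x. partial b \<eta> x * g x) x\<bar> \<le>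
      B2 * (\<Sum>cs\<in>multi_indices (length bs). \<bar>partials cs g x\<bar>)" using snoc.IH[OF pt b(2)] by blast
  have "\<bar>partials (bs @ [b]) (\<lambda>x. \<eta> x * g x) x\<bar> \<le> (B1 + B2) * (\<Sum>cs\<in>multi_indices (length (bs @ [b])). \<bar>partials cs g x\<bar>)"
    if g: "smooth g" for g x
  proof -
    let ?S = "\<Sum>cs\<in>multi_indices (length (bs @ [b])). \<bar>partials cs g x\<bar>"
    have "partial b (\<lambda>x. \<eta> x * g x) = (\<lambda>x. \<eta> x * partial b g x + partial b \<eta> x * g x)"
      using g sm by (intro ext partial_mult smooth_differentiable)
    then have "partials (bs @ [b]) (\<lambda>x. \<eta> x * g x) x
        = partials bs (\<lambda>x. \<eta> x * partial b g x) x + partials bs (\<lambda>x. partial b \<eta> x * g x) x"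
      using partials_add[of "\<lambda>x. \<eta> x * partial b g x" "\<lambda>x. partial b \<eta> x * g x" bs] b g sm
      by (simp add: partials_append smooth_mult smooth_partial)
    then have "\<bar>partials (bs @ [b]) (\<lambda>x. \<eta> x * g x) x\<bar>
        \<le> B1 * (\<Sum>cs\<in>multi_indices (length bs). \<bar>partials cs (partial b g) x\<bar>)
          + B2 * (\<Sum>cs\<in>multi_indices (length bs). \<bar>partials cs g x\<bar>)"
      using B1(2)[OF smooth_partial[OF g b(1)], of x] B2(2)[OF g, of x] by linarith
    also have "(\<Sum>cs\<in>multi_indices (length bs). \<bar>partials cs (partial b g) x\<bar>)
        = (\<Sum>cs\<in>(\<lambda>cs. cs @ [b]) ` multi_indices (length bs). \<bar>partials cs g x\<bar>)"
      by (subst sum.reindex) (auto simp: inj_on_def partials_append)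
    also have "\<dots> \<le> ?S" using b by (intro sum_mono2) (auto simp: multi_indices_iff)
    also have "(\<Sum>cs\<in>multi_indices (length bs). \<bar>partials cs g x\<bar>) \<le> ?S"
      by (intro sum_mono2 multi_indices_mono) auto
    finally show ?thesis using B1(1) B2(1) by (simp add: distrib_right mult_left_mono add_mono)
  qed
  then show ?case using B1(1) B2(1) by (intro exI[of _ "B1 + B2"]) auto
qed

lemma smooth_sq_integrable_on_ball:
  fixes f :: "'a::euclidean_space \<Rightarrow> real"
  assumes "smooth f" shows "integrable (lebesgue_on (ball 0 R)) (\<lambda>x. (f x)\<^sup>2)"
proof -
  have "locally_integrable UNIV (\<lambda>x. f x * f x)"
    by (intro smooth_locally_integrable smooth_mult assms)
  then have "integrable (lebesgue_on (cball 0 R)) (\<lambda>x. (f x)\<^sup>2)"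
    by (simp add: locally_integrable_def power2_eq_square)
  then have "integrable lebesgue (\<lambda>x. indicator (cball 0 R) x *\<^sub>R (f x)\<^sup>2)"
    by (intro integrable_restrict_space[THEN iffD1]) auto
  then have i: "integrable (lebesgue_on (ball 0 R)) (\<lambda>x. indicator (cball 0 R) x *\<^sub>R (f x)\<^sup>2)"
    by (rule integrable_lebesgue_on) auto
  have eq: "indicator (cball 0 R) x *\<^sub>R (f x)\<^sup>2 = (f x)\<^sup>2" if "x \<in> space (lebesgue_on (ball 0 R))" for x
    using that by simp
  show ?thesis
    by (rule Bochner_Integration.integrable_cong[OF refl eq, THEN iffD1]) (use i in auto)
qed

text \<open>Here g is an arbitrary smooth function without decay; only its derivatives on a ball
  count. The radius is enlarged by one so that points off the ball have a neighbourhood where \<eta>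
  is zero, whence all derivatives of the product vanish there.\<close>

lemma Leibniz_energy:
  fixes \<eta> :: "'a::euclidean_space \<Rightarrow> real"
  assumes \<eta>: "smooth \<eta>" "\<And>x. norm x \<ge> R \<Longrightarrow> \<eta> x = 0"
  shows "\<exists>C\<ge>0. \<forall>g. smooth g \<longrightarrow> top_energy m (\<lambda>x. \<eta> x * g x) \<le>
    C * (\<Sum>cs\<in>multi_indices m. LINT x|lebesgue_on (ball 0 (R + 1)). (partials cs g x)\<^sup>2)"
proof -
  have t: "\<eta> \<in> test_functions UNIV"
    by (rule test_functionsI[of _ "cball 0 R"]) (use \<eta> in auto)
  have "\<forall>bs\<in>(index_lists m :: 'a list set). \<exists>B\<ge>0. \<forall>g. smooth g \<longrightarrow> (\<forall>x. \<bar>partials bs (\<lambda>x. \<eta> x * g x) x\<bar> \<le>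
      B * (\<Sum>cs\<in>multi_indices m. \<bar>partials cs g x\<bar>))"
    using Leibniz_pointwise[OF t] by (auto simp: index_lists_def)
  then obtain B where B: "\<And>bs. bs \<in> (index_lists m :: 'a list set) \<Longrightarrow> B bs \<ge> 0"
    "\<And>bs g x. bs \<in> index_lists m \<Longrightarrow> smooth g \<Longrightarrow> \<bar>partials bs (\<lambda>x. \<eta> x * g x) x\<bar> \<le>
      B bs * (\<Sum>cs\<in>multi_indices m. \<bar>partials cs g x\<bar>)"
    by (auto dest!: bchoice)
  let ?b = "ball 0 (R + 1) :: 'a set"
  let ?k = "real (card (multi_indices m :: 'a list set))"
  define C where "C = (\<Sum>bs\<in>index_lists m. (B bs)\<^sup>2 * ?k)"
  have "top_energy m (\<lambda>x. \<eta> x * g x) \<le> C * (\<Sum>cs\<in>multi_indices m. LINT x|lebesgue_on ?b. (partials cs g x)\<^sup>2)"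
    if g: "smooth g" for g
  proof -
    let ?S = "\<Sum>cs\<in>multi_indices m. LINT x|lebesgue_on ?b. (partials cs g x)\<^sup>2"
    have i: "integrable (lebesgue_on ?b) (\<lambda>x. (partials cs g x)\<^sup>2)" if "cs \<in> multi_indices m" for cs
      using that by (intro smooth_sq_integrable_on_ball smooth_partials g) (auto simp: multi_indices_iff)
    have "(LINT x|lebesgue. (partials bs (\<lambda>x. \<eta> x * g x) x)\<^sup>2) \<le> (B bs)\<^sup>2 * ?k * ?S" if bs: "bs \<in> index_lists m" for bs
    proof -
      have sm: "smooth (partials bs (\<lambda>x. \<eta> x * g x))"
        using bs \<eta>(1) g by (intro smooth_partials smooth_mult) (auto dest: index_lists_D)
      have out: "partials bs (\<lambda>x. \<eta> x * g x) x = 0" if "x \<notin> ?b" for x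
        using partials_local[of "- cball 0 R" "\<lambda>x. \<eta> x * g x" "\<lambda>x. 0" x bs] \<eta>(2) that by auto
      have "(LINT x|lebesgue. (partials bs (\<lambda>x. \<eta> x * g x) x)\<^sup>2) = (LINT x|lebesgue_on ?b. (partials bs (\<lambda>x. \<eta> x * g x) x)\<^sup>2)"
        by (subst integral_restrict_space) (auto intro!: Bochner_Integration.integral_cong simp: indicator_def out)
      also have "\<dots> \<le> (LINT x|lebesgue_on ?b. (B bs)\<^sup>2 * ?k * (\<Sum>cs\<in>multi_indices m. (partials cs g x)\<^sup>2))"
      proof (rule integral_mono)
        show "integrable (lebesgue_on ?b) (\<lambda>x. (partials bs (\<lambda>x. \<eta> x * g x) x)\<^sup>2)"
          by (rule smooth_sq_integrable_on_ball[OF sm])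
        show "integrable (lebesgue_on ?b) (\<lambda>x. (B bs)\<^sup>2 * ?k * (\<Sum>cs\<in>multi_indices m. (partials cs g x)\<^sup>2))"
          using i by (intro integrable_mult_right Bochner_Integration.integrable_sum)
        fix x
        have "(partials bs (\<lambda>x. \<eta> x * g x) x)\<^sup>2 = \<bar>partials bs (\<lambda>x. \<eta> x * g x) x\<bar>\<^sup>2" by simp
        also have "\<dots> \<le> (B bs * (\<Sum>cs\<in>multi_indices m. \<bar>partials cs g x\<bar>))\<^sup>2"
          by (intro power_mono B(2)[OF bs g]) simp
        also have "\<dots> \<le> (B bs)\<^sup>2 * (?k * (\<Sum>cs\<in>multi_indices m. (partials cs g x)\<^sup>2))"
          using sum_squared_le_sum_of_squares[of "\<lambda>cs. \<bar>partials cs g x\<bar>" "multi_indices m"]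
          by (simp add: power_mult_distrib mult_left_mono mult.commute)
        finally show "(partials bs (\<lambda>x. \<eta> x * g x) x)\<^sup>2 \<le> (B bs)\<^sup>2 * ?k * (\<Sum>cs\<in>multi_indices m. (partials cs g x)\<^sup>2)"
          by (simp add: mult.assoc)
      qed
      also have "\<dots> = (B bs)\<^sup>2 * ?k * ?S" using i by simp
      finally show ?thesis .
    qed
    then have "top_energy m (\<lambda>x. \<eta> x * g x) \<le> (\<Sum>bs\<in>index_lists m. (B bs)\<^sup>2 * ?k * ?S)"
      unfolding top_energy_def by (rule sum_mono)
    then show ?thesis by (simp add: C_def sum_distrib_right)
  qed
  moreover have "C \<ge> 0" unfolding C_def by (intro sum_nonneg) auto
  ultimately show ?thesis by blast
qed

text \<open>Compares squares with q-th powers at a scale e. Integrated over a set of finite measure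
  it bounds the L^2 norm by the L^q norm, once e is taken of the size of the latter.\<close>

lemma sq_le_powr:
  fixes t e q :: real
  assumes "e > 0" "q \<ge> 2"
  shows "t\<^sup>2 \<le> e\<^sup>2 * (1 + \<bar>t\<bar> powr q / e powr q)"
proof (cases "\<bar>t\<bar> \<le> e")
  case True
  then have "t\<^sup>2 \<le> e\<^sup>2" by (metis abs_le_square_iff abs_of_pos assms(1))
  also have "\<dots> \<le> e\<^sup>2 * (1 + \<bar>t\<bar> powr q / e powr q)"
    using mult_left_mono[of 1 "1 + \<bar>t\<bar> powr q / e powr q" "e\<^sup>2"] by simp
  finally show ?thesis .
next
  case False
  have "(\<bar>t\<bar> / e) powr 2 \<le> (\<bar>t\<bar> / e) powr q" using False assms by (intro powr_mono) auto
  then have "t\<^sup>2 / e\<^sup>2 \<le> \<bar>t\<bar> powr q / e powr q"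
    using assms by (simp add: powr_divide powr_numeral power_divide)
  then have "t\<^sup>2 \<le> e\<^sup>2 * (\<bar>t\<bar> powr q / e powr q)" using assms by (simp add: field_simps)
  also have "\<dots> \<le> e\<^sup>2 * (1 + \<bar>t\<bar> powr q / e powr q)" by (intro mult_left_mono) auto
  finally show ?thesis .
qed

text \<open>All Sobolev exponents are at least 2 and the ball has finite measure \<open>V\<close>,
  so the global bounds on the derivatives yield local L^2 bounds.\<close>

lemma local_energy_bound:
  assumes N: "DIM('a::euclidean_space) > 2 * m"
  shows "\<exists>C\<ge>0. \<forall>\<phi>\<in>test_functions (UNIV :: 'a set).
    (\<Sum>cs\<in>multi_indices m. LINT x|lebesgue_on (ball 0 R). (partials cs \<phi> x)\<^sup>2) \<le> C * top_energy m \<phi>"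
proof -
  obtain C where C: "C \<ge> 0" "\<And>(\<phi> :: 'a \<Rightarrow> real) bs. \<phi> \<in> test_functions UNIV \<Longrightarrow> bs \<in> multi_indices m \<Longrightarrow>
      Lnorm (chain_exp TYPE('a) m (length bs)) (partials bs \<phi>) \<le> C * sqrt (top_energy m \<phi>)"
    using Sobolev_derivatives[OF N] by metis
  let ?b = "ball 0 R :: 'a set"
  let ?q = "\<lambda>cs :: 'a list. chain_exp TYPE('a) m (length cs)"
  define V where "V = (LINT x|lebesgue_on ?b. (1::real))"
  have V0: "V \<ge> 0" by (simp add: V_def)
  have i1: "integrable (lebesgue_on ?b) (\<lambda>x. 1::real)"
    using smooth_sq_integrable_on_ball[OF smooth_const[of 1], of R] by simp
  have main: "(LINT x|lebesgue_on ?b. (partials cs \<phi> x)\<^sup>2) \<le> (V + C powr ?q cs) * top_energy m \<phi>"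
    if \<phi>: "\<phi> \<in> test_functions (UNIV :: 'a set)" and cs: "cs \<in> multi_indices m" for \<phi> cs
  proof -
    let ?X = "LINT x|lebesgue_on ?b. (partials cs \<phi> x)\<^sup>2"
    have q: "?q cs \<ge> 2" by (rule chain_exp(1)[OF N])
    have tp: "partials cs \<phi> \<in> test_functions UNIV"
      using test_functions_partials[OF \<phi>] cs by (auto simp: multi_indices_iff)
    define I where "I = (LINT x|lebesgue. \<bar>partials cs \<phi> x\<bar> powr ?q cs)"
    have I0: "I \<ge> 0" by (simp add: I_def)
    have Ii: "integrable lebesgue (\<lambda>x. \<bar>partials cs \<phi> x\<bar> powr ?q cs)"
      using test_functions_powr_integrable[OF tp] q by simp
    have Ile: "(LINT x|lebesgue_on ?b. \<bar>partials cs \<phi> x\<bar> powr ?q cs) \<le> I"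
    proof -
      have "integrable lebesgue (\<lambda>x. indicator ?b x *\<^sub>R \<bar>partials cs \<phi> x\<bar> powr ?q cs)"
        by (rule integrable_mult_indicator[OF _ Ii]) simp
      then have "(LINT x|lebesgue. indicator ?b x *\<^sub>R \<bar>partials cs \<phi> x\<bar> powr ?q cs) \<le> I"
        unfolding I_def by (rule integral_mono[OF _ Ii]) (simp add: indicator_def)
      then show ?thesis by (subst integral_restrict_space) auto
    qed
    have le: "?X \<le> (V + C powr ?q cs) * e\<^sup>2" if e: "e > sqrt (top_energy m \<phi>)" for e
    proof -
      have e0: "e > 0" using e real_sqrt_ge_zero[OF top_energy_nonneg, of m \<phi>] by linarith
      have "I powr (1 / ?q cs) \<le> C * sqrt (top_energy m \<phi>)"
        using C(2)[OF \<phi> cs] by (simp add: Lnorm_def I_def)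
      also have "\<dots> \<le> C * e" using C(1) e by (intro mult_left_mono) auto
      finally have "(I powr (1 / ?q cs)) powr ?q cs \<le> (C * e) powr ?q cs"
        using q by (intro powr_mono2) auto
      then have IC: "I \<le> C powr ?q cs * e powr ?q cs"
        using q I0 C(1) e0 by (simp add: powr_powr powr_mult)
      have ib: "integrable (lebesgue_on ?b) (\<lambda>x. \<bar>partials cs \<phi> x\<bar> powr ?q cs)"
        by (rule integrable_lebesgue_on[OF Ii]) auto
      have "?X \<le> (LINT x|lebesgue_on ?b. e\<^sup>2 * (1 + \<bar>partials cs \<phi> x\<bar> powr ?q cs / e powr ?q cs))"
        using i1 ib by (intro integral_mono smooth_sq_integrable_on_ball test_functions_smooth[OF tp] sq_le_powr e0 q) auto
      also have "\<dots> = e\<^sup>2 * (V + (LINT x|lebesgue_on ?b. \<bar>partials cs \<phi> x\<bar> powr ?q cs) / e powr ?q cs)"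
        using i1 ib by (simp add: V_def)
      also have "\<dots> \<le> e\<^sup>2 * (V + C powr ?q cs)"
      proof (intro mult_left_mono add_left_mono)
        have "(LINT x|lebesgue_on ?b. \<bar>partials cs \<phi> x\<bar> powr ?q cs) \<le> C powr ?q cs * e powr ?q cs"
          using Ile IC by linarith
        then show "(LINT x|lebesgue_on ?b. \<bar>partials cs \<phi> x\<bar> powr ?q cs) / e powr ?q cs \<le> C powr ?q cs"
          using e0 by (simp add: field_simps)
      qed simp
      finally show ?thesis by (simp add: mult.commute)
    qed
    \<comment> \<open>The scale must be positive; letting it decrease to the energy norm covers zero
      energy.\<close>
    have "((\<lambda>e. (V + C powr ?q cs) * e\<^sup>2) \<longlongrightarrow> (V + C powr ?q cs) * (sqrt (top_energy m \<phi>))\<^sup>2) (at_right (sqrt (top_energy m \<phi>)))"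
      by (intro tendsto_intros)
    moreover have "\<forall>\<^sub>F e in at_right (sqrt (top_energy m \<phi>)). ?X \<le> (V + C powr ?q cs) * e\<^sup>2"
      using le by (auto simp: eventually_at_right_field intro!: exI[of _ "sqrt (top_energy m \<phi>) + 1"])
    ultimately have "?X \<le> (V + C powr ?q cs) * (sqrt (top_energy m \<phi>))\<^sup>2"
      by (intro tendsto_lowerbound) auto
    then show ?thesis by simp
  qed
  have "(\<Sum>cs\<in>multi_indices m. LINT x|lebesgue_on ?b. (partials cs \<phi> x)\<^sup>2)
      \<le> (\<Sum>cs\<in>(multi_indices m :: 'a list set). V + C powr ?q cs) * top_energy m \<phi>"
    if "\<phi> \<in> test_functions (UNIV :: 'a set)" for \<phi>
    unfolding sum_distrib_right using main[OF that] by (intro sum_mono)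
  moreover have "(\<Sum>cs\<in>(multi_indices m :: 'a list set). V + C powr ?q cs) \<ge> 0"
    using V0 by (intro sum_nonneg) auto
  ultimately show ?thesis by blast
qed

text \<open>The lower-order terms of the product rule live on a ball, where the Sobolev inequality
  bounds them by the energy. This permits truncation of functions about which only the energy is
  known.\<close>

lemma cutoff_energy_bound:
  fixes \<zeta> :: "'a::euclidean_space \<Rightarrow> real"
  assumes N: "DIM('a) > 2 * m" and \<zeta>: "smooth \<zeta>" "\<And>x. norm x \<ge> R \<Longrightarrow> \<zeta> x = 0"
  shows "\<exists>C\<ge>0. \<forall>\<phi>\<in>test_functions UNIV. top_energy m (\<lambda>x. \<zeta> x * \<phi> x) \<le> C * top_energy m \<phi>"
proof -
  obtain C1 where C1: "C1 \<ge> 0" "\<And>g. smooth g \<Longrightarrow> top_energy m (\<lambda>x. \<zeta> x * g x) \<le>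
      C1 * (\<Sum>cs\<in>multi_indices m. LINT x|lebesgue_on (ball 0 (R + 1)). (partials cs g x)\<^sup>2)"
    using Leibniz_energy[OF \<zeta>] by blast
  obtain C2 where C2: "C2 \<ge> 0" "\<And>\<phi>. \<phi> \<in> test_functions (UNIV :: 'a set) \<Longrightarrow>
      (\<Sum>cs\<in>multi_indices m. LINT x|lebesgue_on (ball 0 (R + 1)). (partials cs \<phi> x)\<^sup>2) \<le> C2 * top_energy m \<phi>"
    using local_energy_bound[OF N] by blast
  have "top_energy m (\<lambda>x. \<zeta> x * \<phi> x) \<le> (C1 * C2) * top_energy m \<phi>" if "\<phi> \<in> test_functions UNIV" for \<phi>
    using C1(2)[OF test_functions_smooth[OF that]] mult_left_mono[OF C2(2)[OF that] C1(1)] by simp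
  then show ?thesis using C1(1) C2(1) by (intro exI[of _ "C1 * C2"]) auto
qed

subsection \<open>Scaling\<close>

lemma lebesgue_scaling_measure:
  assumes "c \<noteq> 0"
  shows "lebesgue = density (distr lebesgue lebesgue (\<lambda>x::'a::euclidean_space. c *\<^sub>R x)) (\<lambda>_. ennreal (\<bar>c\<bar> ^ DIM('a)))"
    and "(\<lambda>x::'a. c *\<^sub>R x) \<in> lebesgue \<rightarrow>\<^sub>M lebesgue"
proof -
  have T: "(0 + (\<Sum>j\<in>Basis. (c * (x \<bullet> j)) *\<^sub>R j)) = c *\<^sub>R x" for x :: 'a
    by (simp add: scaleR_scaleR[symmetric] scaleR_sum_right[symmetric] euclidean_representation del: scaleR_scaleR)
  show "lebesgue = density (distr lebesgue lebesgue (\<lambda>x::'a. c *\<^sub>R x)) (\<lambda>_. ennreal (\<bar>c\<bar> ^ DIM('a)))"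
    using lebesgue_affine_euclidean[of "\<lambda>_::'a. c" 0] assms unfolding T by simp
  show "(\<lambda>x::'a. c *\<^sub>R x) \<in> lebesgue \<rightarrow>\<^sub>M lebesgue"
    using lebesgue_affine_measurable[of "\<lambda>_::'a. c" 0] assms unfolding T by simp
qed

lemma integral_scaling:
  fixes f :: "'a::euclidean_space \<Rightarrow> real"
  assumes f: "f \<in> borel_measurable lebesgue" and c: "c > 0"
  shows "(LINT x|lebesgue. f (c *\<^sub>R x)) = (LINT x|lebesgue. f x) / c ^ DIM('a)"
    and "integrable lebesgue f \<Longrightarrow> integrable lebesgue (\<lambda>x. f (c *\<^sub>R x))"
    and "(\<lambda>x. f (c *\<^sub>R x)) \<in> borel_measurable lebesgue"
proof -
  have T: "(\<lambda>x::'a. c *\<^sub>R x) \<in> lebesgue \<rightarrow>\<^sub>M lebesgue" and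
    L: "lebesgue = density (distr lebesgue lebesgue (\<lambda>x::'a. c *\<^sub>R x)) (\<lambda>_. ennreal (c ^ DIM('a)))"
    using lebesgue_scaling_measure[of c] c by auto
  show "(\<lambda>x. f (c *\<^sub>R x)) \<in> borel_measurable lebesgue" by (rule measurable_compose[OF T f])
  have "(LINT x|lebesgue. f x) = (LINT x|density (distr lebesgue lebesgue (\<lambda>x::'a. c *\<^sub>R x)) (\<lambda>_. ennreal (c ^ DIM('a))). f x)"
    using L by simp
  also have "\<dots> = (LINT x|distr lebesgue lebesgue (\<lambda>x::'a. c *\<^sub>R x). c ^ DIM('a) *\<^sub>R f x)"
    using f c by (intro integral_density) auto
  also have "\<dots> = (LINT x|lebesgue. c ^ DIM('a) *\<^sub>R f (c *\<^sub>R x))"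
    using f by (intro integral_distr[OF T]) auto
  finally show "(LINT x|lebesgue. f (c *\<^sub>R x)) = (LINT x|lebesgue. f x) / c ^ DIM('a)"
    using c by simp
  assume "integrable lebesgue f"
  then have "integrable (density (distr lebesgue lebesgue (\<lambda>x::'a. c *\<^sub>R x)) (\<lambda>_. ennreal (c ^ DIM('a)))) f"
    using L by simp
  then have "integrable (distr lebesgue lebesgue (\<lambda>x::'a. c *\<^sub>R x)) (\<lambda>x. c ^ DIM('a) *\<^sub>R f x)"
    using f c by (subst (asm) integrable_density) auto
  then have "integrable lebesgue (\<lambda>x. c ^ DIM('a) *\<^sub>R f (c *\<^sub>R x))"
    using f by (subst (asm) integrable_distr_eq[OF T]) auto
  then show "integrable lebesgue (\<lambda>x. f (c *\<^sub>R x))" using c by simp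
qed

text \<open>Squared derivatives of order m give 2m powers of c, and the change of variables takes N
  of them away.\<close>

lemma top_energy_scaling:
  fixes \<phi> :: "'a::euclidean_space \<Rightarrow> real"
  assumes "smooth \<phi>" "c > 0"
  shows "top_energy m (\<lambda>x. a * \<phi> (c *\<^sub>R x)) = a\<^sup>2 * c ^ (2 * m) / c ^ DIM('a) * top_energy m \<phi>"
  unfolding top_energy_def sum_distrib_left
proof (rule sum.cong[OF refl])
  fix bs :: "'a list" assume "bs \<in> index_lists m"
  then have bs: "set bs \<subseteq> Basis" "length bs = m" by (auto dest: index_lists_D)
  have sm: "smooth (\<lambda>x. \<phi> (c *\<^sub>R x))" by (rule partials_scaleR(2)[OF assms(1) bs(1)])
  have m: "(\<lambda>x. (partials bs \<phi> x)\<^sup>2) \<in> borel_measurable lebesgue"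
    using smooth_measurable[OF smooth_partials[OF assms(1) bs(1)]] by simp
  have "(LINT x|lebesgue. (partials bs (\<lambda>x. a * \<phi> (c *\<^sub>R x)) x)\<^sup>2) = (LINT x|lebesgue. a\<^sup>2 * c ^ (2 * m) * (partials bs \<phi> (c *\<^sub>R x))\<^sup>2)"
    unfolding partials_cmult[OF sm bs(1)] partials_scaleR(1)[OF assms(1) bs(1)]
    by (simp add: bs(2) power_mult_distrib power_mult[symmetric] mult.commute mult.left_commute)
  also have "\<dots> = a\<^sup>2 * c ^ (2 * m) / c ^ DIM('a) * (LINT x|lebesgue. (partials bs \<phi> x)\<^sup>2)"
    using integral_scaling(1)[OF m assms(2)] by simp
  finally show "(LINT x|lebesgue. (partials bs (\<lambda>x. a * \<phi> (c *\<^sub>R x)) x)\<^sup>2) = a\<^sup>2 * c ^ (2 * m) / c ^ DIM('a) * (LINT x|lebesgue. (partials bs \<phi> x)\<^sup>2)" .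
qed

lemma locally_integrable_scaling:
  fixes w :: "'a::euclidean_space \<Rightarrow> real"
  assumes "locally_integrable \<Omega> w" "c > 0" "(\<lambda>x. c *\<^sub>R x) ` B \<subseteq> \<Omega>"
  shows "locally_integrable B (\<lambda>x. a * w (c *\<^sub>R x))"
  unfolding locally_integrable_def
proof (intro allI impI)
  fix C :: "'a set" assume C: "compact C \<and> C \<subseteq> B"
  let ?C = "(\<lambda>x. c *\<^sub>R x) ` C"
  have cC: "compact ?C" "?C \<subseteq> \<Omega>" using C assms(3) by (auto simp: compact_scaling)
  have Cl: "C \<in> sets lebesgue" "?C \<in> sets lebesgue" using C cC by (auto simp: lmeasurable_compact fmeasurableD)
  have "integrable (lebesgue_on ?C) w" using assms(1) cC unfolding locally_integrable_def by blast
  then have i: "integrable lebesgue (\<lambda>x. indicator ?C x *\<^sub>R w x)"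
    using Cl by (intro integrable_restrict_space[THEN iffD1]) auto
  have "integrable lebesgue (\<lambda>x. indicator ?C (c *\<^sub>R x) *\<^sub>R w (c *\<^sub>R x))"
    by (rule integral_scaling(2)[OF borel_measurable_integrable[OF i] assms(2) i])
  moreover have "(indicator ?C (c *\<^sub>R x) :: real) = indicator C x" for x
    using assms(2) by (auto simp: indicator_def)
  ultimately have "integrable lebesgue (\<lambda>x. a * (indicator C x *\<^sub>R w (c *\<^sub>R x)))" by simp
  then have "integrable lebesgue (\<lambda>x. indicator C x *\<^sub>R (a * w (c *\<^sub>R x)))" by (simp add: mult.left_commute)
  then show "integrable (lebesgue_on C) (\<lambda>x. a * w (c *\<^sub>R x))"
    using Cl by (intro integrable_restrict_space[THEN iffD2]) auto
qed

lemma has_weak_deriv_scaling: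
  fixes w :: "'a::euclidean_space \<Rightarrow> real"
  assumes "open \<Omega>" "open B" "set bs \<subseteq> Basis" "has_weak_deriv \<Omega> bs w v" "c > 0" "(\<lambda>x. c *\<^sub>R x) ` B \<subseteq> \<Omega>"
  shows "has_weak_deriv B bs (\<lambda>x. a * w (c *\<^sub>R x)) (\<lambda>x. a * c ^ length bs * v (c *\<^sub>R x))"
  unfolding has_weak_deriv_iff[OF assms(2,3)]
proof (intro conjI ballI)
  note w = assms(4)[unfolded has_weak_deriv_iff[OF assms(1,3)]]
  show "locally_integrable B (\<lambda>x. a * w (c *\<^sub>R x))" "locally_integrable B (\<lambda>x. a * c ^ length bs * v (c *\<^sub>R x))"
    using w assms by (auto intro: locally_integrable_scaling)
  fix \<phi> :: "'a \<Rightarrow> real" assume \<phi>: "\<phi> \<in> test_functions B"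
  define \<psi> where "\<psi> = (\<lambda>x. \<phi> ((1 / c) *\<^sub>R x))"
  have sub: "(\<lambda>x. x /\<^sub>R (1 / c)) ` B \<subseteq> \<Omega>" using assms(6) by (simp add: inverse_eq_divide)
  have "\<psi> \<in> test_functions ((\<lambda>x. x /\<^sub>R (1 / c)) ` B)"
    unfolding \<psi>_def by (rule test_functions_scaleR[OF \<phi>]) (use assms(5) in simp)
  then have \<psi>: "\<psi> \<in> test_functions \<Omega>" by (rule test_functions_mono[OF sub])
  have \<phi>_eq: "\<phi> = (\<lambda>x. \<psi> (c *\<^sub>R x))" using assms(5) by (simp add: \<psi>_def)
  have p: "partials bs \<phi> x = c ^ length bs * partials bs \<psi> (c *\<^sub>R x)" for x
    unfolding \<phi>_eq partials_scaleR(1)[OF test_functions_smooth[OF \<psi>] assms(3)] ..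
  have m1: "(\<lambda>x. w x * partials bs \<psi> x) \<in> borel_measurable lebesgue"
    using w \<psi> assms(3) by (intro borel_measurable_integrable locally_integrable_mult_test[of \<Omega>] test_functions_partials) auto
  have m2: "(\<lambda>x. v x * \<psi> x) \<in> borel_measurable lebesgue"
    using w \<psi> by (intro borel_measurable_integrable locally_integrable_mult_test[of \<Omega>]) auto
  have "(LINT x|lebesgue. a * w (c *\<^sub>R x) * partials bs \<phi> x)
      = a * c ^ length bs * (LINT x|lebesgue. w (c *\<^sub>R x) * partials bs \<psi> (c *\<^sub>R x))"
    unfolding p by (subst integral_mult_right_zero[symmetric]) (simp add: mult_ac)
  also have "\<dots> = (-1) ^ length bs * (a * c ^ length bs * (LINT x|lebesgue. v (c *\<^sub>R x) * \<psi> (c *\<^sub>R x)))"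
    using integral_scaling(1)[OF m1 assms(5)] integral_scaling(1)[OF m2 assms(5)] w \<psi> by simp
  also have "a * c ^ length bs * (LINT x|lebesgue. v (c *\<^sub>R x) * \<psi> (c *\<^sub>R x)) = (LINT x|lebesgue. a * c ^ length bs * v (c *\<^sub>R x) * \<phi> x)"
    unfolding \<phi>_eq by (subst integral_mult_right_zero[symmetric]) (simp add: mult_ac)
  finally show "(LINT x|lebesgue. a * w (c *\<^sub>R x) * partials bs \<phi> x) = (-1) ^ length bs * (LINT x|lebesgue. a * c ^ length bs * v (c *\<^sub>R x) * \<phi> x)" .
qed

text \<open>For c at most 1 the powers of c from the derivatives may be dropped, which leaves the
  amplitude and the Jacobian.\<close>

lemma Hm_scaling:
  fixes w :: "'a::euclidean_space \<Rightarrow> real"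
  assumes \<Omega>: "open \<Omega>" and B: "open B" and w: "w \<in> Hm m \<Omega>" and c: "0 < c" "c \<le> 1" and sub: "(\<lambda>x. c *\<^sub>R x) ` B \<subseteq> \<Omega>"
  shows "(\<lambda>x. a * w (c *\<^sub>R x)) \<in> Hm m B"
    and "(Hm_norm m B (\<lambda>x. a * w (c *\<^sub>R x)))\<^sup>2 \<le> a\<^sup>2 / c ^ DIM('a) * (Hm_norm m \<Omega> w)\<^sup>2"
proof -
  obtain D where D: "weak_family m \<Omega> w D" "\<And>bs. bs \<in> multi_indices m \<Longrightarrow> D bs \<in> L2 \<Omega>"
    using Hm_family[OF w] by blast
  define E where "E bs x = a * c ^ length bs * D bs (c *\<^sub>R x)" for bs x
  have fam: "weak_family m B (\<lambda>x. a * w (c *\<^sub>R x)) E"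
    unfolding weak_family_def E_def
    using D(1) has_weak_deriv_scaling[OF \<Omega> B _ _ c(1) sub] by (auto simp: weak_family_def multi_indices_iff)
  have Os: "\<Omega> \<in> sets lebesgue" and Bs: "B \<in> sets lebesgue" using \<Omega> B by auto
  have sq: "integrable (lebesgue_on B) (\<lambda>x. (k * v (c *\<^sub>R x))\<^sup>2)"
    "(\<lambda>x. k * v (c *\<^sub>R x)) \<in> borel_measurable (lebesgue_on B)"
    "(LINT x|lebesgue_on B. (k * v (c *\<^sub>R x))\<^sup>2) \<le> k\<^sup>2 / c ^ DIM('a) * (LINT x|lebesgue_on \<Omega>. (v x)\<^sup>2)"
    if v: "v \<in> L2 \<Omega>" for v k
  proof -
    have "integrable (lebesgue_on \<Omega>) (\<lambda>x. (v x)\<^sup>2)" "v \<in> borel_measurable (lebesgue_on \<Omega>)"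
      using v by (auto simp: L2_def)
    then have i: "integrable lebesgue (\<lambda>x. indicator \<Omega> x *\<^sub>R (v x)\<^sup>2)"
      and mv: "(\<lambda>x. indicator \<Omega> x *\<^sub>R v x) \<in> borel_measurable lebesgue"
      using Os by (auto simp: integrable_restrict_space borel_measurable_restrict_space_iff)
    have im: "(\<lambda>x. indicator \<Omega> x *\<^sub>R (v x)\<^sup>2) \<in> borel_measurable lebesgue" using i by (rule borel_measurable_integrable)
    have ic: "integrable lebesgue (\<lambda>x. indicator \<Omega> (c *\<^sub>R x) *\<^sub>R (v (c *\<^sub>R x))\<^sup>2)"
      by (rule integral_scaling(2)[OF im c(1) i])
    then have ib: "integrable lebesgue (\<lambda>x. indicator B x *\<^sub>R (k\<^sup>2 * (indicator \<Omega> (c *\<^sub>R x) *\<^sub>R (v (c *\<^sub>R x))\<^sup>2)))"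
      using Bs by (intro integrable_mult_indicator integrable_mult_right)
    have eq: "indicator B x *\<^sub>R (k\<^sup>2 * (indicator \<Omega> (c *\<^sub>R x) *\<^sub>R (v (c *\<^sub>R x))\<^sup>2)) = indicator B x *\<^sub>R (k * v (c *\<^sub>R x))\<^sup>2" for x
      using sub by (auto simp: indicator_def power_mult_distrib)
    have ib': "integrable lebesgue (\<lambda>x. indicator B x *\<^sub>R (k * v (c *\<^sub>R x))\<^sup>2)" using ib unfolding eq .
    then show "integrable (lebesgue_on B) (\<lambda>x. (k * v (c *\<^sub>R x))\<^sup>2)"
      using Bs by (intro integrable_restrict_space[THEN iffD2]) auto
    have "(\<lambda>x. indicator B x *\<^sub>R (k * (indicator \<Omega> (c *\<^sub>R x) *\<^sub>R v (c *\<^sub>R x)))) \<in> borel_measurable lebesgue"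
      using Bs by (intro borel_measurable_scaleR borel_measurable_indicator borel_measurable_times borel_measurable_const
        integral_scaling(3)[OF mv c(1)]) auto
    moreover have eqv: "indicator B x *\<^sub>R (k * (indicator \<Omega> (c *\<^sub>R x) *\<^sub>R v (c *\<^sub>R x))) = indicator B x *\<^sub>R (k * v (c *\<^sub>R x))" for x
      using sub by (auto simp: indicator_def)
    ultimately have "(\<lambda>x. indicator B x *\<^sub>R (k * v (c *\<^sub>R x))) \<in> borel_measurable lebesgue"
      by (simp only: eqv)
    then show "(\<lambda>x. k * v (c *\<^sub>R x)) \<in> borel_measurable (lebesgue_on B)"
      using Bs by (subst borel_measurable_restrict_space_iff) auto
    have "(LINT x|lebesgue_on B. (k * v (c *\<^sub>R x))\<^sup>2) = (LINT x|lebesgue. indicator B x *\<^sub>R (k * v (c *\<^sub>R x))\<^sup>2)"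
      using Bs by (subst integral_restrict_space) auto
    also have "\<dots> \<le> (LINT x|lebesgue. k\<^sup>2 * (indicator \<Omega> (c *\<^sub>R x) *\<^sub>R (v (c *\<^sub>R x))\<^sup>2))"
      unfolding eq[symmetric] by (rule integral_mono[OF ib integrable_mult_right[OF ic]]) (simp add: indicator_def)
    also have "\<dots> = k\<^sup>2 / c ^ DIM('a) * (LINT x|lebesgue_on \<Omega>. (v x)\<^sup>2)"
      using integral_scaling(1)[OF im c(1)] Os by (simp add: integral_restrict_space)
    finally show "(LINT x|lebesgue_on B. (k * v (c *\<^sub>R x))\<^sup>2) \<le> k\<^sup>2 / c ^ DIM('a) * (LINT x|lebesgue_on \<Omega>. (v x)\<^sup>2)" .
  qed
  have EL2: "E bs \<in> L2 B" if "bs \<in> multi_indices m" for bs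
    unfolding E_def L2_def using sq(1,2)[OF D(2)[OF that], of "a * c ^ length bs"] by simp
  have "w \<in> L2 \<Omega>" using w by (simp add: Hm_def)
  then have "(\<lambda>x. a * w (c *\<^sub>R x)) \<in> L2 B" using sq(1,2)[of w a] by (simp add: L2_def)
  then show "(\<lambda>x. a * w (c *\<^sub>R x)) \<in> Hm m B"
    using EL2 fam unfolding Hm_def weak_family_def by blast
  have "(Hm_norm m B (\<lambda>x. a * w (c *\<^sub>R x)))\<^sup>2 = (\<Sum>bs\<in>multi_indices m. LINT x|lebesgue_on B. (E bs x)\<^sup>2)"
    by (rule Hm_norm_sq[OF B fam])
  also have "\<dots> \<le> (\<Sum>bs\<in>multi_indices m. a\<^sup>2 / c ^ DIM('a) * (LINT x|lebesgue_on \<Omega>. (D bs x)\<^sup>2))"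
  proof (rule sum_mono)
    fix bs :: "'a list" assume bs: "bs \<in> multi_indices m"
    have "(LINT x|lebesgue_on B. (E bs x)\<^sup>2) \<le> (a * c ^ length bs)\<^sup>2 / c ^ DIM('a) * (LINT x|lebesgue_on \<Omega>. (D bs x)\<^sup>2)"
      unfolding E_def by (rule sq(3)[OF D(2)[OF bs]])
    also have "\<dots> \<le> a\<^sup>2 / c ^ DIM('a) * (LINT x|lebesgue_on \<Omega>. (D bs x)\<^sup>2)"
    proof (intro mult_right_mono divide_right_mono)
      have "(c ^ length bs)\<^sup>2 \<le> 1" using c by (simp add: power_le_one)
      then show "(a * c ^ length bs)\<^sup>2 \<le> a\<^sup>2" by (simp add: power_mult_distrib mult_left_le)
    qed (use c in auto)
    finally show "(LINT x|lebesgue_on B. (E bs x)\<^sup>2) \<le> a\<^sup>2 / c ^ DIM('a) * (LINT x|lebesgue_on \<Omega>. (D bs x)\<^sup>2)" .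
  qed
  also have "\<dots> = a\<^sup>2 / c ^ DIM('a) * (Hm_norm m \<Omega> w)\<^sup>2"
    by (simp add: Hm_norm_sq[OF \<Omega> D(1)] sum_distrib_left)
  finally show "(Hm_norm m B (\<lambda>x. a * w (c *\<^sub>R x)))\<^sup>2 \<le> a\<^sup>2 / c ^ DIM('a) * (Hm_norm m \<Omega> w)\<^sup>2" .
qed

subsection \<open>Mosco convergence and test functions\<close>

lemma Dm_norm_seminorm: "Dm_norm m = semi_inner.seminorm (dirichlet_form m UNIV)"
  by (rule ext) (simp add: Dm_norm_def semi_inner_seminorm)

lemma Dm0_weak_compactness:
  fixes \<theta> :: "nat \<Rightarrow> 'a::euclidean_space \<Rightarrow> real"
  assumes N: "DIM('a) > 2 * m" and t: "\<And>n. \<theta> n \<in> test_functions UNIV" and bnd: "\<And>n. Dm_norm m (\<theta> n) \<le> C"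
  obtains r u where "strict_mono r" "u \<in> Dm0 m" "Dm_weakly_tendsto m (\<lambda>n. \<theta> (r n)) u sequentially"
proof -
  interpret E: semi_inner "weak_space m (UNIV :: 'a set)" "dirichlet_form m (UNIV :: 'a set)"
    by (rule semi_inner_weak_space) simp
  have \<theta>V: "range \<theta> \<subseteq> weak_space m UNIV" using test_functions_weak_space[OF t] by auto
  have \<theta>bnd: "dirichlet_form m UNIV (\<theta> n) (\<theta> n) \<le> C\<^sup>2" for n
  proof -
    have "dirichlet_form m UNIV (\<theta> n) (\<theta> n) = (Dm_norm m (\<theta> n))\<^sup>2"
      unfolding Dm_norm_seminorm by (rule E.seminorm_sq[symmetric]) (use \<theta>V in auto)
    also have "\<dots> \<le> C\<^sup>2" by (intro power_mono bnd) (simp add: Dm_norm_def dirichlet_energy_def)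
    finally show ?thesis .
  qed
  obtain r :: "nat \<Rightarrow> nat" where r: "strict_mono r"
    "\<And>v. v \<in> weak_space m UNIV \<Longrightarrow> convergent (\<lambda>n. dirichlet_form m UNIV (\<theta> (r n)) v)"
    using E.weak_subsequence[OF \<theta>V \<theta>bnd] by blast
  define \<theta>' where "\<theta>' n = \<theta> (r n)" for n
  have \<theta>'V: "range \<theta>' \<subseteq> weak_space m UNIV" using \<theta>V by (auto simp: \<theta>'_def)
  obtain y where y: "\<And>k. y k \<in> E.convex_tail \<theta>' k"
    "\<forall>e>0. \<exists>M. \<forall>n\<ge>M. \<forall>k\<ge>M. E.seminorm (\<lambda>x. y n x - y k x) < e"
    using E.convex_tail_Cauchy[OF \<theta>'V, of "C\<^sup>2"] \<theta>bnd by (auto simp: \<theta>'_def)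
  \<comment> \<open>Convex combinations of test functions are test functions, so the Cauchy sequence
    is one that \<open>Dm0\<close> admits.\<close>
  have "f \<in> test_functions UNIV" if "f \<in> E.convex_tail \<theta>' k" for f k
    using that by induction (auto simp: \<theta>'_def intro: t test_functions_lin)
  then have yt: "y k \<in> test_functions UNIV" for k using y(1) by blast
  then have "Dm_Cauchy m y" using y(2) by (simp add: Dm_Cauchy_def Dm_norm_seminorm)
  from Dm0_complete[OF N this] obtain u where u: "u \<in> Dm0 m" "(\<lambda>n. Dm_norm m (\<lambda>x. y n x - u x)) \<longlonglongrightarrow> 0"
    by blast
  have "(\<lambda>n. dirichlet_form m UNIV (\<theta>' n) v) \<longlonglongrightarrow> dirichlet_form m UNIV u v" if "v \<in> Dm0 m" for v
    using r(2)[OF Dm0_weak_space[OF N that]] u(2)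
    by (intro E.convex_tail_weak_limit[OF \<theta>'V y(1) Dm0_weak_space[OF N that] _ Dm0_weak_space[OF N u(1)]])
      (simp_all add: \<theta>'_def Dm_norm_seminorm)
  then have "Dm_weakly_tendsto m (\<lambda>n. \<theta> (r n)) u sequentially"
    by (simp add: Dm_weakly_tendsto_def \<theta>'_def)
  with r(1) u(1) that show ?thesis by blast
qed

text \<open>Weak lower semicontinuity, obtained by pairing with the limit v itself: the bound passes
  to the limit as ||v||^2 at most L ||v||. The fixed summand h is kept outside the Mosco argument,
  which concerns only the part avoiding the sets.\<close>

lemma mosco_lower:
  fixes h :: "'a::euclidean_space \<Rightarrow> real"
  assumes N: "DIM('a) > 2 * m" and mosco: "Dm_mosco m A K" and h: "h \<in> test_functions UNIV"
    and e: "\<And>n. e n > 0" "e \<longlonglongrightarrow> 0" and t: "\<And>n. \<theta> n \<in> test_functions (- A (e n))"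
    and L: "\<And>n. Dm_norm m (\<lambda>x. \<theta> n x + h x) \<le> L"
  obtains w where "w \<in> Dm0_minus m K" "Dm_norm m (\<lambda>x. w x + h x) \<le> L"
proof -
  interpret E: semi_inner "weak_space m (UNIV :: 'a set)" "dirichlet_form m (UNIV :: 'a set)"
    by (rule semi_inner_weak_space) simp
  have tU: "\<theta> n \<in> test_functions UNIV" for n using test_functions_mono[OF _ t] by simp
  have V: "\<theta> n \<in> weak_space m UNIV" "h \<in> weak_space m UNIV" for n
    using test_functions_weak_space[OF tU] test_functions_weak_space[OF h] by auto
  have bnd: "Dm_norm m (\<theta> n) \<le> L + Dm_norm m h" for n
    using E.seminorm_triangle_diff[OF V(1) E.add_mem[OF V], of n n] L[of n]
      E.seminorm_cmult[OF V(2), of "-1"] unfolding Dm_norm_seminorm by simp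
  obtain r w where r: "strict_mono r" and w: "w \<in> Dm0 m"
    and weak: "Dm_weakly_tendsto m (\<lambda>n. \<theta> (r n)) w sequentially"
    by (rule Dm0_weak_compactness[OF N tU bnd])
  have "w \<in> Dm0_minus m K"
    using mosco[unfolded Dm_mosco_def, THEN conjunct1, rule_format, of "\<lambda>n. e (r n)" "\<lambda>n. \<theta> (r n)" w]
      e LIMSEQ_subseq_LIMSEQ[OF e(2) r] test_functions_Dm0_minus[OF N t] w weak by (simp add: o_def)
  moreover have "Dm_norm m (\<lambda>x. w x + h x) \<le> L"
  proof -
    define v where "v = (\<lambda>x. w x + h x)"
    have v: "v \<in> Dm0 m" unfolding v_def by (rule Dm0_add_test[OF N w h])
    have vV: "v \<in> weak_space m UNIV" and wV: "w \<in> weak_space m UNIV" using Dm0_weak_space[OF N] v w by auto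
    have "(\<lambda>n. dirichlet_form m UNIV (\<theta> (r n)) v + dirichlet_form m UNIV h v) \<longlonglongrightarrow> dirichlet_form m UNIV w v + dirichlet_form m UNIV h v"
      using weak v by (intro tendsto_add tendsto_const) (simp add: Dm_weakly_tendsto_def)
    moreover have "dirichlet_form m UNIV (\<theta> (r n)) v + dirichlet_form m UNIV h v \<le> L * Dm_norm m v" for n
    proof -
      have "dirichlet_form m UNIV (\<theta> (r n)) v + dirichlet_form m UNIV h v = dirichlet_form m UNIV (\<lambda>x. \<theta> (r n) x + h x) v"
        by (rule E.form_add[OF V vV, symmetric])
      also have "\<dots> \<le> Dm_norm m (\<lambda>x. \<theta> (r n) x + h x) * Dm_norm m v"
        using E.Cauchy_Schwarz[OF E.add_mem[OF V] vV] unfolding Dm_norm_seminorm by (simp add: abs_le_iff)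
      also have "\<dots> \<le> L * Dm_norm m v"
        using E.seminorm_nonneg[OF vV] by (intro mult_right_mono L) (simp add: Dm_norm_seminorm)
      finally show ?thesis .
    qed
    ultimately have "dirichlet_form m UNIV w v + dirichlet_form m UNIV h v \<le> L * Dm_norm m v"
      by (intro LIMSEQ_le_const2) auto
    moreover have "dirichlet_form m UNIV w v + dirichlet_form m UNIV h v = (Dm_norm m v)\<^sup>2"
      using E.form_add[OF wV V(2) vV] E.seminorm_sq[OF vV] unfolding Dm_norm_seminorm v_def by simp
    ultimately have "Dm_norm m v * Dm_norm m v \<le> L * Dm_norm m v" by (simp add: power2_eq_square)
    moreover have "Dm_norm m v \<ge> 0" using E.seminorm_nonneg[OF vV] by (simp add: Dm_norm_seminorm)
    moreover have "L \<ge> 0" using L[of 0] E.seminorm_nonneg[OF E.add_mem[OF V], of 0] by (simp add: Dm_norm_seminorm)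
    ultimately have "Dm_norm m v \<le> L" by (cases "Dm_norm m v = 0") auto
    then show ?thesis by (simp add: v_def)
  qed
  ultimately show ?thesis using that by blast
qed

text \<open>The recovery functions given by Mosco convergence may spread over the whole space.
  Multiplication by \<zeta> confines them to a fixed ball, costs a constant in the energy, and does
  not alter \<psi>.\<close>

lemma mosco_upper:
  fixes \<psi> :: "'a::euclidean_space \<Rightarrow> real"
  assumes N: "DIM('a) > 2 * m" and mosco: "Dm_mosco m A K" and \<psi>: "\<psi> \<in> test_functions (- K)"
    and \<zeta>: "smooth \<zeta>" "\<And>x. norm x \<ge> R \<Longrightarrow> \<zeta> x = 0" "\<And>x. \<zeta> x * \<psi> x = \<psi> x" and d: "d > 0"
  shows "\<forall>\<^sub>F \<epsilon> in at_right 0. \<exists>\<theta>\<in>test_functions (- A \<epsilon>). Dm_norm m (\<lambda>x. \<zeta> x * \<theta> x - \<psi> x) < d"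
proof -
  interpret E: semi_inner "weak_space m (UNIV :: 'a set)" "dirichlet_form m (UNIV :: 'a set)"
    by (rule semi_inner_weak_space) simp
  obtain C where C: "C \<ge> 0" "\<And>\<phi>. \<phi> \<in> test_functions UNIV \<Longrightarrow> top_energy m (\<lambda>x. \<zeta> x * \<phi> x) \<le> C * top_energy m \<phi>"
    using cutoff_energy_bound[OF N \<zeta>(1,2)] by blast
  obtain w where w: "\<And>\<epsilon>. \<epsilon> > 0 \<Longrightarrow> w \<epsilon> \<in> Dm0_minus m (A \<epsilon>)"
    "((\<lambda>\<epsilon>. Dm_norm m (\<lambda>x. w \<epsilon> x - \<psi> x)) \<longlongrightarrow> 0) (at_right 0)"
    using mosco[unfolded Dm_mosco_def, THEN conjunct2] test_functions_Dm0_minus[OF N \<psi>] by blast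
  \<comment> \<open>Two errors of size \<open>d'\<close> add up, the recovery and its replacement by
    a test function, and the cutoff multiplies them by at most \<open>sqrt C\<close>.\<close>
  define d' where "d' = d / (2 * (sqrt C + 1))"
  have d': "d' > 0" using d C(1) by (simp add: d'_def add_nonneg_pos)
  have "\<forall>\<^sub>F \<epsilon> in at_right 0. Dm_norm m (\<lambda>x. w \<epsilon> x - \<psi> x) < d'"
    using order_tendstoD(2)[OF w(2) d'] .
  moreover have "\<forall>\<^sub>F \<epsilon>::real in at_right 0. \<epsilon> > 0" by (simp add: eventually_at_right_less)
  ultimately show ?thesis
  proof eventually_elim
    case (elim \<epsilon>)
    have wD: "w \<epsilon> \<in> Dm0_minus m (A \<epsilon>)" using w(1) elim by blast
    then obtain \<phi> where \<phi>: "\<And>n::nat. \<phi> n \<in> test_functions (- A \<epsilon>)" "(\<lambda>n. Dm_norm m (\<lambda>x. \<phi> n x - w \<epsilon> x)) \<longlonglongrightarrow> 0"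
      and wD0: "w \<epsilon> \<in> Dm0 m" by (auto simp: Dm0_minus_def)
    obtain n where n: "Dm_norm m (\<lambda>x. \<phi> n x - w \<epsilon> x) < d'"
      using order_tendstoD(2)[OF \<phi>(2) d'] by (auto simp: eventually_sequentially)
    have tU: "\<phi> n \<in> test_functions UNIV" "\<psi> \<in> test_functions UNIV"
      using test_functions_mono[OF _ \<phi>(1)] test_functions_mono[OF _ \<psi>] by auto
    have dt: "(\<lambda>x. \<phi> n x - \<psi> x) \<in> test_functions UNIV" by (rule test_functions_diff[OF tU])
    have V: "\<phi> n \<in> weak_space m UNIV" "w \<epsilon> \<in> weak_space m UNIV" "\<psi> \<in> weak_space m UNIV"
      using test_functions_weak_space[OF tU(1)] test_functions_weak_space[OF tU(2)] Dm0_weak_space[OF N wD0] by auto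
    have "Dm_norm m (\<lambda>x. \<phi> n x - \<psi> x) < 2 * d'"
      using E.seminorm_triangle3[OF V] n elim(1) unfolding Dm_norm_seminorm by simp
    then have le: "Dm_norm m (\<lambda>x. \<phi> n x - \<psi> x) \<le> 2 * d'" by simp
    have "Dm_norm m (\<lambda>x. \<zeta> x * (\<phi> n x - \<psi> x)) = sqrt (top_energy m (\<lambda>x. \<zeta> x * (\<phi> n x - \<psi> x)))"
      by (rule Dm_norm_test[OF test_functions_smooth_mult(1)[OF dt \<zeta>(1)]])
    also have "\<dots> \<le> sqrt (C * top_energy m (\<lambda>x. \<phi> n x - \<psi> x))" by (intro real_sqrt_le_mono C(2) dt)
    also have "\<dots> = sqrt C * Dm_norm m (\<lambda>x. \<phi> n x - \<psi> x)" by (simp add: real_sqrt_mult Dm_norm_test[OF dt])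
    also have "\<dots> \<le> sqrt C * (2 * d')" using le C(1) by (intro mult_left_mono) auto
    also have "\<dots> < (sqrt C + 1) * (2 * d')" using d' by simp
    also have "\<dots> = d"
    proof -
      have "k * (2 * (d / (2 * k))) = d" if "k \<noteq> 0" for k :: real using that by simp
      moreover have "sqrt C + 1 \<noteq> 0" using C(1) real_sqrt_ge_zero[of C] by linarith
      ultimately show ?thesis unfolding d'_def by blast
    qed
    finally have "Dm_norm m (\<lambda>x. \<zeta> x * (\<phi> n x - \<psi> x)) < d" .
    moreover have "\<zeta> x * (\<phi> n x - \<psi> x) = \<zeta> x * \<phi> n x - \<psi> x" for x using \<zeta>(3)[of x] by (simp add: right_diff_distrib)
    ultimately show ?case using \<phi>(1) by auto
  qed
qed

subsection \<open>Capacities and test functions\<close>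

text \<open>Removing an open set from the compact support leaves it compact, and the product
  vanishes on the part removed.\<close>

lemma test_functions_mult_one_minus:
  fixes \<phi> :: "'a::euclidean_space \<Rightarrow> real"
  assumes \<phi>: "\<phi> \<in> test_functions U" and \<eta>: "smooth \<eta>" "open V" "\<And>x. x \<in> V \<Longrightarrow> \<eta> x = c"
  shows "(\<lambda>x. (c - \<eta> x) * \<phi> x) \<in> test_functions (U - V)"
proof -
  obtain C where C: "smooth \<phi>" "compact C" "C \<subseteq> U" "\<And>x. x \<notin> C \<Longrightarrow> \<phi> x = 0"
    using test_functionsE[OF \<phi>] by metis
  show ?thesis
  proof (rule test_functionsI[of _ "C - V"])
    show "smooth (\<lambda>x. (c - \<eta> x) * \<phi> x)" using C(1) \<eta>(1) by (intro smooth_mult smooth_diff smooth_const)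
    show "compact (C - V)" using C(2) \<eta>(2) by (rule compact_diff)
  qed (use C \<eta> in auto)
qed

lemma cap_RN_lower:
  fixes U0 :: "'a::euclidean_space \<Rightarrow> real"
  assumes N: "DIM('a) > 2 * m" and U0: "smooth U0" and \<eta>: "cutoff K \<eta>"
    and w: "w \<in> Dm0_minus m K"
  shows "cap_RN m K U0 \<le> (Dm_norm m (\<lambda>x. w x + \<eta> x * U0 x))\<^sup>2"
proof -
  have h: "(\<lambda>x. \<eta> x * U0 x) \<in> test_functions UNIV"
    using \<eta> U0 by (intro test_functions_smooth_mult(2)) (auto simp: cutoff_def)
  have "(\<lambda>x. w x + \<eta> x * U0 x) \<in> Dm0 m"
    using w by (intro Dm0_add_test[OF N _ h]) (simp add: Dm0_minus_def)
  moreover have "(\<lambda>x. (w x + \<eta> x * U0 x) - \<eta> x * U0 x) \<in> Dm0_minus m K" using w by simp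
  ultimately have "dirichlet_energy m UNIV (\<lambda>x. w x + \<eta> x * U0 x) \<in> {dirichlet_energy m UNIV f | f. f \<in> Dm0 m \<and>
      (\<exists>\<eta>. cutoff K \<eta> \<and> (\<lambda>x. f x - \<eta> x * U0 x) \<in> Dm0_minus m K)}"
    using \<eta> by blast
  then have "cap_RN m K U0 \<le> dirichlet_energy m UNIV (\<lambda>x. w x + \<eta> x * U0 x)"
    unfolding cap_RN_def by (rule cInf_lower) (auto intro!: bdd_belowI[of _ 0] simp: dirichlet_energy_def)
  then show ?thesis by (simp add: Dm_norm_def dirichlet_energy_def)
qed

lemma cap_RN_nonneg:
  fixes U0 :: "'a::euclidean_space \<Rightarrow> real"
  assumes N: "DIM('a) > 2 * m" and U0: "smooth U0" and \<eta>: "cutoff K \<eta>"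
  shows "cap_RN m K U0 \<ge> 0"
    and "{dirichlet_energy m UNIV f | f. f \<in> Dm0 m \<and>
      (\<exists>\<eta>. cutoff K \<eta> \<and> (\<lambda>x. f x - \<eta> x * U0 x) \<in> Dm0_minus m K)} \<noteq> {}"
proof -
  have h: "(\<lambda>x. \<eta> x * U0 x) \<in> test_functions UNIV"
    using \<eta> U0 by (intro test_functions_smooth_mult(2)) (auto simp: cutoff_def)
  have "(\<lambda>x. \<eta> x * U0 x - \<eta> x * U0 x) \<in> Dm0_minus m K"
    using test_functions_Dm0_minus[OF N, of "\<lambda>x. 0"] by simp
  with test_functions_Dm0[OF N h] \<eta>
  show ne: "{dirichlet_energy m UNIV f | f. f \<in> Dm0 m \<and>
      (\<exists>\<eta>. cutoff K \<eta> \<and> (\<lambda>x. f x - \<eta> x * U0 x) \<in> Dm0_minus m K)} \<noteq> {}" by blast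
  show "cap_RN m K U0 \<ge> 0"
    unfolding cap_RN_def by (rule cInf_greatest[OF ne]) (auto simp: dirichlet_energy_def)
qed

text \<open>A near-minimiser may come with its own cutoff \<eta>'. The two cutoffs agree near K, so
  (\<eta>' - \<eta>) U0 is a test function on the complement and can be absorbed into
  \<psi>.\<close>

lemma cap_RN_upper:
  fixes U0 :: "'a::euclidean_space \<Rightarrow> real"
  assumes N: "DIM('a) > 2 * m" and U0: "smooth U0" and \<eta>: "cutoff K \<eta>" and d: "d > 0"
  obtains \<psi> where "\<psi> \<in> test_functions (- K)" "Dm_norm m (\<lambda>x. \<psi> x + \<eta> x * U0 x) < sqrt (cap_RN m K U0) + d"
proof -
  interpret E: semi_inner "weak_space m (UNIV :: 'a set)" "dirichlet_form m (UNIV :: 'a set)"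
    by (rule semi_inner_weak_space) simp
  let ?c = "cap_RN m K U0"
  have c: "?c \<ge> 0" by (rule cap_RN_nonneg(1)[OF N U0 \<eta>])
  have "(sqrt ?c)\<^sup>2 < (sqrt ?c + d / 2)\<^sup>2" using c d by (intro power_strict_mono) auto
  then have "?c < (sqrt ?c + d / 2)\<^sup>2" using c by simp
  from cInf_lessD[OF cap_RN_nonneg(2)[OF N U0 \<eta>] this[unfolded cap_RN_def[of m K U0]]]
  obtain f \<eta>' where f: "f \<in> Dm0 m" "cutoff K \<eta>'" "(\<lambda>x. f x - \<eta>' x * U0 x) \<in> Dm0_minus m K"
    and fe: "dirichlet_energy m UNIV f < (sqrt ?c + d / 2)\<^sup>2"
    unfolding cap_RN_def[of m K U0, symmetric] by blast
  have "sqrt (dirichlet_energy m UNIV f) < sqrt ((sqrt ?c + d / 2)\<^sup>2)" using fe by (rule real_sqrt_less_mono)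
  then have fn: "Dm_norm m f < sqrt ?c + d / 2" using c d by (simp add: Dm_norm_def)
  obtain \<psi> where \<psi>: "\<And>n::nat. \<psi> n \<in> test_functions (- K)"
    "(\<lambda>n. Dm_norm m (\<lambda>x. \<psi> n x - (f x - \<eta>' x * U0 x))) \<longlonglongrightarrow> 0"
    using f(3) by (auto simp: Dm0_minus_def)
  obtain n where n: "Dm_norm m (\<lambda>x. \<psi> n x - (f x - \<eta>' x * U0 x)) < d / 2"
    using order_tendstoD(2)[OF \<psi>(2), of "d / 2"] d by (auto simp: eventually_sequentially)
  obtain V V' where V: "open V" "K \<subseteq> V" "\<And>x. x \<in> V \<Longrightarrow> \<eta> x = 1" "open V'" "K \<subseteq> V'" "\<And>x. x \<in> V' \<Longrightarrow> \<eta>' x = 1"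
    using \<eta> f(2) unfolding cutoff_def by metis
  have t: "\<eta> \<in> test_functions UNIV" "\<eta>' \<in> test_functions UNIV" using \<eta> f(2) by (auto simp: cutoff_def)
  note sm = test_functions_smooth[OF t(1)] test_functions_smooth[OF t(2)]
  have gt: "(\<lambda>x. (\<eta>' x - \<eta> x) * U0 x) \<in> test_functions (- K)"
  proof -
    obtain C where C: "compact C" "\<And>x. x \<notin> C \<Longrightarrow> \<eta> x = 0" using test_functionsE[OF t(1)] by metis
    obtain C' where C': "compact C'" "\<And>x. x \<notin> C' \<Longrightarrow> \<eta>' x = 0" using test_functionsE[OF t(2)] by metis
    show ?thesis
    proof (rule test_functionsI[of _ "(C \<union> C') - (V \<inter> V')"])
      show "smooth (\<lambda>x. (\<eta>' x - \<eta> x) * U0 x)" by (intro smooth_mult smooth_diff sm U0)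
      show "compact (C \<union> C' - V \<inter> V')" using C C' V by (intro compact_diff compact_Un open_Int)
      show "C \<union> C' - V \<inter> V' \<subseteq> - K" using V by auto
      show "(\<eta>' x - \<eta> x) * U0 x = 0" if "x \<notin> C \<union> C' - V \<inter> V'" for x
        using that C C' V by (cases "x \<in> V \<inter> V'") auto
    qed
  qed
  define \<theta> where "\<theta> = (\<lambda>x. \<psi> n x + (\<eta>' x - \<eta> x) * U0 x)"
  have \<theta>: "\<theta> \<in> test_functions (- K)" unfolding \<theta>_def by (rule test_functions_add[OF \<psi>(1) gt])
  have h: "(\<lambda>x. \<eta> x * U0 x) \<in> test_functions UNIV" by (rule test_functions_smooth_mult(2)[OF t(1) U0])
  have tU: "\<theta> \<in> test_functions UNIV" by (rule test_functions_mono[OF _ \<theta>]) simp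
  have hV: "(\<lambda>x. \<theta> x + \<eta> x * U0 x) \<in> weak_space m UNIV"
    using test_functions_weak_space[OF test_functions_add[OF tU h]] by simp
  have "Dm_norm m (\<lambda>x. \<theta> x + \<eta> x * U0 x) \<le> Dm_norm m f + Dm_norm m (\<lambda>x. (\<theta> x + \<eta> x * U0 x) - f x)"
    using E.seminorm_triangle_diff[OF hV Dm0_weak_space[OF N f(1)]] unfolding Dm_norm_seminorm .
  moreover have "(\<theta> x + \<eta> x * U0 x) - f x = \<psi> n x - (f x - \<eta>' x * U0 x)" for x
    by (simp add: \<theta>_def algebra_simps)
  ultimately have "Dm_norm m (\<lambda>x. \<theta> x + \<eta> x * U0 x) < sqrt ?c + d" using n fn by simp
  with \<theta> that show ?thesis by blast
qed

subsection \<open>Blow-up at the origin\<close>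

locale capacity_setting =
  fixes \<Omega> :: "'a::euclidean_space set" and K :: "real \<Rightarrow> 'a set" and K0 :: "'a set"
    and m \<gamma> :: nat and u U0 \<eta> :: "'a \<Rightarrow> real" and R :: real
  assumes N: "DIM('a) > 2 * m"
    and \<Omega>: "open \<Omega>" "0 \<in> \<Omega>"
    and u: "u \<in> Hm0 m \<Omega> \<Omega>"
    and U0: "smooth U0"
    and profile: "\<And>r. r > 0 \<Longrightarrow> tendsto_Hm m (ball 0 r) (\<lambda>\<epsilon> x. u (\<epsilon> *\<^sub>R x) / \<epsilon> ^ \<gamma>) U0 (at_right 0)"
    and R: "R > 0"
    and K: "\<And>\<epsilon>. 0 < \<epsilon> \<Longrightarrow> \<epsilon> < 1 \<Longrightarrow> rescaled K \<epsilon> \<subseteq> ball 0 R" "K0 \<subseteq> ball 0 R"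
    and mosco: "Dm_mosco m (rescaled K) K0"
    and \<eta>: "smooth \<eta>" "\<And>x. norm x \<le> R \<Longrightarrow> \<eta> x = 1" "\<And>x. norm x \<ge> R + 1 \<Longrightarrow> \<eta> x = 0"
begin

definition h :: "'a \<Rightarrow> real" where "h x = \<eta> x * U0 x"
text \<open>The factor between the energy of a function and that of its blow-up: N - 2m from the
  change of variables and the derivatives, 2\<gamma> from the amplitude.\<close>

definition P :: "real \<Rightarrow> real" where "P \<epsilon> = \<epsilon> ^ (DIM('a) - 2 * m + 2 * \<gamma>)"
definition up :: "real \<Rightarrow> ('a \<Rightarrow> real) \<Rightarrow> 'a \<Rightarrow> real" where "up \<epsilon> \<phi> x = (1 / \<epsilon> ^ \<gamma>) * \<phi> (\<epsilon> *\<^sub>R x)"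
definition down :: "real \<Rightarrow> ('a \<Rightarrow> real) \<Rightarrow> 'a \<Rightarrow> real" where "down \<epsilon> g x = \<epsilon> ^ \<gamma> * g ((1 / \<epsilon>) *\<^sub>R x)"
definition S :: "('a \<Rightarrow> real) \<Rightarrow> real" where "S f = sqrt (dirichlet_energy m \<Omega> f)"
definition \<kappa> :: real where "\<kappa> = sqrt (real (card (index_lists m :: 'a list set)))"
text \<open>The square root is taken because the comparisons below are triangle inequalities for
  energy norms.\<close>

definition s :: "real \<Rightarrow> real" where "s \<epsilon> = sqrt (cap_in m \<Omega> (K \<epsilon>) u / P \<epsilon>)"

sublocale E: semi_inner "weak_space m (UNIV :: 'a set)" "dirichlet_form m (UNIV :: 'a set)"
  by (rule semi_inner_weak_space) simp

sublocale O: semi_inner "weak_space m \<Omega>" "dirichlet_form m \<Omega>"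
  by (rule semi_inner_weak_space[OF \<Omega>(1)])

lemma S_seminorm: "S = O.seminorm"
  by (rule ext) (simp add: S_def semi_inner_seminorm[OF \<Omega>(1)])

lemma \<eta>_test: "\<eta> \<in> test_functions UNIV"
  by (rule test_functionsI[of _ "cball 0 (R + 1)"]) (use \<eta> in auto)

lemma \<eta>_cutoff: "cutoff K0 \<eta>"
  unfolding cutoff_def using \<eta>_test K(2) \<eta>(2) by (intro conjI exI[of _ "ball 0 R"]) auto

lemma h_test: "h \<in> test_functions UNIV"
  unfolding h_def[abs_def] by (rule test_functions_smooth_mult(2)[OF \<eta>_test U0])

lemma P_pos: "\<epsilon> > 0 \<Longrightarrow> P \<epsilon> > 0"
  by (simp add: P_def)

lemma \<kappa>_nonneg: "\<kappa> \<ge> 0" by (simp add: \<kappa>_def)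

lemma up_test: "\<phi> \<in> test_functions W \<Longrightarrow> \<epsilon> > 0 \<Longrightarrow> up \<epsilon> \<phi> \<in> test_functions {x. \<epsilon> *\<^sub>R x \<in> W}"
proof -
  assume \<phi>: "\<phi> \<in> test_functions W" and e: "\<epsilon> > 0"
  have "(\<lambda>x. \<phi> (\<epsilon> *\<^sub>R x)) \<in> test_functions ((\<lambda>x. x /\<^sub>R \<epsilon>) ` W)"
    by (rule test_functions_scaleR[OF \<phi>]) (use e in simp)
  moreover have "(\<lambda>x. x /\<^sub>R \<epsilon>) ` W \<subseteq> {x. \<epsilon> *\<^sub>R x \<in> W}" using e by auto
  ultimately have "(\<lambda>x. \<phi> (\<epsilon> *\<^sub>R x)) \<in> test_functions {x. \<epsilon> *\<^sub>R x \<in> W}"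
    by (rule test_functions_mono[rotated])
  then show ?thesis unfolding up_def[abs_def] by (rule test_functions_cmult)
qed

lemma down_test: "g \<in> test_functions {x. \<epsilon> *\<^sub>R x \<in> W} \<Longrightarrow> \<epsilon> > 0 \<Longrightarrow> down \<epsilon> g \<in> test_functions W"
proof -
  assume g: "g \<in> test_functions {x. \<epsilon> *\<^sub>R x \<in> W}" and e: "\<epsilon> > 0"
  have "(\<lambda>x. g ((1 / \<epsilon>) *\<^sub>R x)) \<in> test_functions ((\<lambda>x. x /\<^sub>R (1 / \<epsilon>)) ` {x. \<epsilon> *\<^sub>R x \<in> W})"
    by (rule test_functions_scaleR[OF g]) (use e in simp)
  moreover have "(\<lambda>x. x /\<^sub>R (1 / \<epsilon>)) ` {x. \<epsilon> *\<^sub>R x \<in> W} \<subseteq> W" by (auto simp: inverse_eq_divide)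
  ultimately have "(\<lambda>x. g ((1 / \<epsilon>) *\<^sub>R x)) \<in> test_functions W"
    by (rule test_functions_mono[rotated])
  then show ?thesis unfolding down_def[abs_def] by (rule test_functions_cmult)
qed

lemma up_down: "\<epsilon> > 0 \<Longrightarrow> up \<epsilon> (down \<epsilon> g) = g"
  by (rule ext) (simp add: up_def down_def)

lemma up_add: "up \<epsilon> (\<lambda>x. f x + g x) = (\<lambda>x. up \<epsilon> f x + up \<epsilon> g x)"
  by (rule ext) (simp add: up_def distrib_left)

lemma rescaled_iff: "\<epsilon> > 0 \<Longrightarrow> x \<in> rescaled K \<epsilon> \<longleftrightarrow> \<epsilon> *\<^sub>R x \<in> K \<epsilon>"
  by (force simp: rescaled_def image_iff)

lemma Dm_norm_up:
  assumes "\<phi> \<in> test_functions W" "\<epsilon> > 0"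
  shows "Dm_norm m \<phi> = sqrt (P \<epsilon>) * Dm_norm m (up \<epsilon> \<phi>)"
proof -
  have p: "\<phi> \<in> test_functions UNIV" by (rule test_functions_mono[OF _ assms(1)]) simp
  have upt: "up \<epsilon> \<phi> \<in> test_functions UNIV" by (rule test_functions_mono[OF _ up_test[OF p assms(2)]]) simp
  \<comment> \<open>The exponent in \<open>P\<close> is a truncated difference of naturals; it is a
    genuine one since N > 2m.\<close>
  have "\<epsilon> ^ DIM('a) = \<epsilon> ^ (DIM('a) - 2 * m) * \<epsilon> ^ (2 * m)"
    using N by (simp add: power_add[symmetric])
  then have k: "P \<epsilon> * ((1 / \<epsilon> ^ \<gamma>)\<^sup>2 * \<epsilon> ^ (2 * m) / \<epsilon> ^ DIM('a)) = 1"
    using assms(2) by (simp add: P_def power_add power_mult power_divide mult.commute[of 2])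
  have "top_energy m \<phi> = P \<epsilon> * top_energy m (up \<epsilon> \<phi>)"
  proof -
    have "P \<epsilon> * top_energy m (up \<epsilon> \<phi>) = (P \<epsilon> * ((1 / \<epsilon> ^ \<gamma>)\<^sup>2 * \<epsilon> ^ (2 * m) / \<epsilon> ^ DIM('a))) * top_energy m \<phi>"
      unfolding up_def[abs_def] top_energy_scaling[OF test_functions_smooth[OF p] assms(2)] by (rule mult.assoc[symmetric])
    then show ?thesis unfolding k by simp
  qed
  then show ?thesis by (simp add: Dm_norm_test[OF p] Dm_norm_test[OF upt] real_sqrt_mult)
qed

lemma S_test: "\<phi> \<in> test_functions \<Omega> \<Longrightarrow> S \<phi> = Dm_norm m \<phi>"
proof -
  assume \<phi>: "\<phi> \<in> test_functions \<Omega>"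
  have "\<phi> \<in> test_functions UNIV" by (rule test_functions_mono[OF _ \<phi>]) simp
  then show ?thesis by (simp add: S_def dirichlet_energy_test[OF \<phi> \<Omega>(1)] Dm_norm_test)
qed

lemma S_le_Hm_norm: "f \<in> Hm m \<Omega> \<Longrightarrow> S f \<le> \<kappa> * \<bar>Hm_norm m \<Omega> f\<bar>"
  using real_sqrt_le_mono[OF dirichlet_energy_le_Hm_norm[OF \<Omega>(1), of f m]]
  by (simp add: S_def \<kappa>_def real_sqrt_mult)

lemma small_ball:
  obtains r where "r > 0" "ball 0 r \<subseteq> \<Omega>"
  using \<Omega> open_contains_ball by blast

text \<open>The blow-up multiplies the squared norm by at most \<epsilon>^(-N-2\<gamma>). Against
  the square of \<epsilon>^(N+\<gamma>+1) this leaves \<epsilon>^N times \<epsilon>^2.\<close>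

lemma Hm_norm_blow_up_le:
  assumes "w \<in> Hm m \<Omega>" "\<bar>Hm_norm m \<Omega> w\<bar> \<le> \<epsilon> ^ (DIM('a) + \<gamma> + 1)" "0 < \<epsilon>" "\<epsilon> < 1" "open B" "(\<lambda>x. \<epsilon> *\<^sub>R x) ` B \<subseteq> \<Omega>"
  shows "up \<epsilon> w \<in> Hm m B" "(Hm_norm m B (up \<epsilon> w))\<^sup>2 \<le> \<epsilon>\<^sup>2"
proof -
  show "up \<epsilon> w \<in> Hm m B"
    unfolding up_def[abs_def] by (rule Hm_scaling(1)[OF \<Omega>(1) assms(5,1,3) less_imp_le[OF assms(4)] assms(6)])
  have "(Hm_norm m B (up \<epsilon> w))\<^sup>2 \<le> (1 / \<epsilon> ^ \<gamma>)\<^sup>2 / \<epsilon> ^ DIM('a) * (Hm_norm m \<Omega> w)\<^sup>2"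
    unfolding up_def[abs_def] by (rule Hm_scaling(2)[OF \<Omega>(1) assms(5,1,3) less_imp_le[OF assms(4)] assms(6)])
  also have "\<dots> \<le> (1 / \<epsilon> ^ \<gamma>)\<^sup>2 / \<epsilon> ^ DIM('a) * (\<epsilon> ^ (DIM('a) + \<gamma> + 1))\<^sup>2"
    using power_mono[OF assms(2), of 2] assms(3) by (intro mult_left_mono) auto
  also have "\<dots> = \<epsilon> ^ DIM('a) * \<epsilon>\<^sup>2"
    using assms(3) by (simp add: power_add power_mult_distrib power_divide power2_eq_square)
  also have "\<dots> \<le> 1 * \<epsilon>\<^sup>2" using assms(3,4) by (intro mult_right_mono power_le_one) auto
  finally show "(Hm_norm m B (up \<epsilon> w))\<^sup>2 \<le> \<epsilon>\<^sup>2" by simp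
qed

text \<open>The test function changes with \<epsilon>, so its distance to u can be a high power of
  \<epsilon>: small against \<open>sqrt (P \<epsilon>)\<close> on \<Omega> and still small after the
  blow-up. The product rule is applied to the smooth difference of
  \<open>up \<epsilon> \<phi>\<close> and U0, never to the blow-up of u.\<close>

lemma test_approximation:
  assumes \<delta>: "\<delta> > 0"
  shows "\<forall>\<^sub>F \<epsilon> in at_right 0. \<exists>\<phi>\<in>test_functions \<Omega>. S (\<lambda>x. \<phi> x - u x) \<le> \<delta> * sqrt (P \<epsilon>) \<and>
    Dm_norm m (\<lambda>x. \<eta> x * up \<epsilon> \<phi> x - h x) \<le> \<delta>"
proof -
  \<comment> \<open>\<eta> vanishes from radius R + 1 on, and \<open>Leibniz_energy\<close>
    integrates over a ball larger by one.\<close>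
  let ?B = "ball 0 (R + 1 + 1) :: 'a set"
  obtain C where C: "C \<ge> 0" "\<And>g. smooth g \<Longrightarrow> top_energy m (\<lambda>x. \<eta> x * g x) \<le>
      C * (\<Sum>cs\<in>multi_indices m. LINT x|lebesgue_on ?B. (partials cs g x)\<^sup>2)"
    using Leibniz_energy[OF \<eta>(1,3), where m = m] by blast
  \<comment> \<open>Two errors of at most \<rho>, from the test function and from the profile, give
    a squared norm of at most 4\<rho>^2; times the Leibniz constant this must not exceed
    \<delta>^2.\<close>
  define \<rho> where "\<rho> = \<delta> / (2 * sqrt (C + 1))"
  have \<rho>: "\<rho> > 0" using \<delta> C(1) by (simp add: \<rho>_def)
  have C\<rho>: "C * (4 * \<rho>\<^sup>2) \<le> \<delta>\<^sup>2"
  proof -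
    have "4 * \<rho>\<^sup>2 = \<delta>\<^sup>2 / (C + 1)" using C(1) by (simp add: \<rho>_def power_divide power_mult_distrib field_simps)
    then have "C * (4 * \<rho>\<^sup>2) + 4 * \<rho>\<^sup>2 = \<delta>\<^sup>2" using C(1) by (simp add: field_simps)
    then show ?thesis using zero_le_power2[of \<rho>] by linarith
  qed
  obtain r where r: "r > 0" "ball 0 r \<subseteq> \<Omega>" by (rule small_ball)
  have prof: "tendsto_Hm m ?B (\<lambda>\<epsilon> x. u (\<epsilon> *\<^sub>R x) / \<epsilon> ^ \<gamma>) U0 (at_right 0)" using R by (intro profile) simp
  have ev1: "\<forall>\<^sub>F \<epsilon> in at_right 0. (\<lambda>x. u (\<epsilon> *\<^sub>R x) / \<epsilon> ^ \<gamma>) \<in> Hm m ?B"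
    using prof by (simp add: tendsto_Hm_def)
  have ev2: "\<forall>\<^sub>F \<epsilon> in at_right 0. dist (Hm_norm m ?B (\<lambda>x. u (\<epsilon> *\<^sub>R x) / \<epsilon> ^ \<gamma> - U0 x)) 0 < \<rho>"
  proof (rule tendstoD[OF _ \<rho>])
    show "((\<lambda>\<epsilon>. Hm_norm m ?B (\<lambda>x. u (\<epsilon> *\<^sub>R x) / \<epsilon> ^ \<gamma> - U0 x)) \<longlongrightarrow> 0) (at_right 0)"
      using prof by (simp add: tendsto_Hm_def)
  qed
  have U0B: "U0 \<in> Hm m ?B" using prof by (simp add: tendsto_Hm_def)
  \<comment> \<open>In turn: powers of \<epsilon> become comparable, the ball \<open>?B\<close>
    shrunk by \<epsilon> fits into \<Omega>, the blow-up error is below \<rho>, and \<kappa>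
    \<epsilon> is below \<delta>.\<close>
  define e0 where "e0 = min (min 1 (r / (R + 2))) (min \<rho> (\<delta> / (\<kappa> + 1)))"
  have e0: "e0 > 0" using r(1) R \<rho> \<delta> \<kappa>_nonneg by (simp add: e0_def)
  have ev3: "\<forall>\<^sub>F \<epsilon> in at_right 0. 0 < \<epsilon> \<and> \<epsilon> < e0"
    using e0 by (auto simp: eventually_at_right_field)
  from ev1 ev2 ev3 show ?thesis
  proof eventually_elim
    case (elim \<epsilon>)
    have e: "0 < \<epsilon>" "\<epsilon> < 1" "\<epsilon> < \<rho>" "\<epsilon> < r / (R + 2)" "\<epsilon> < \<delta> / (\<kappa> + 1)" using elim(3) by (auto simp: e0_def)
    have sub: "(\<lambda>x. \<epsilon> *\<^sub>R x) ` ?B \<subseteq> \<Omega>"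
    proof -
      have "norm (\<epsilon> *\<^sub>R x) < r" if "x \<in> ?B" for x
      proof -
        have "norm (\<epsilon> *\<^sub>R x) \<le> \<epsilon> * (R + 2)" using that e(1) by (simp add: mult_left_mono)
        also have "\<dots> < r" using e(4) R by (simp add: field_simps)
        finally show ?thesis .
      qed
      then show ?thesis using r(2) by (auto simp: subset_iff)
    qed
    obtain \<phi> where \<phi>: "\<phi> \<in> test_functions \<Omega>" "\<phi> \<in> Hm m \<Omega>" "\<bar>Hm_norm m \<Omega> (\<lambda>x. \<phi> x - u x)\<bar> < \<epsilon> ^ (DIM('a) + \<gamma> + 1)"
      using Hm0_approx[OF u, of "\<epsilon> ^ (DIM('a) + \<gamma> + 1)"] e(1) by auto
    have w: "(\<lambda>x. \<phi> x - u x) \<in> Hm m \<Omega>"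
      using Hm_lin[OF \<Omega>(1) \<phi>(2) Hm0_Hm[OF u], of 1 "-1"] by simp
    have "S (\<lambda>x. \<phi> x - u x) \<le> \<kappa> * \<epsilon> ^ (DIM('a) + \<gamma> + 1)"
      using S_le_Hm_norm[OF w] mult_left_mono[OF less_imp_le[OF \<phi>(3)] \<kappa>_nonneg] by linarith
    also have "\<dots> = (\<kappa> * \<epsilon>) * \<epsilon> ^ (DIM('a) + \<gamma>)" by simp
    also have "\<dots> \<le> \<delta> * sqrt (P \<epsilon>)"
    proof (rule mult_mono)
      have "\<kappa> * \<epsilon> \<le> (\<kappa> + 1) * \<epsilon>" using e(1) by simp
      also have "\<dots> \<le> \<delta>" using e(5) \<kappa>_nonneg by (simp add: field_simps)
      finally show "\<kappa> * \<epsilon> \<le> \<delta>" .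
      have "(\<epsilon> ^ (DIM('a) + \<gamma>))\<^sup>2 = \<epsilon> ^ ((DIM('a) + \<gamma>) * 2)" by (rule power_mult[symmetric])
      \<comment> \<open>\<open>P \<epsilon>\<close> has the smaller exponent N - 2m + 2\<gamma>,
        hence is the larger power as \<epsilon> < 1.\<close>
      also have "\<dots> \<le> P \<epsilon>" unfolding P_def using e(1,2) by (intro power_decreasing) auto
      finally show "\<epsilon> ^ (DIM('a) + \<gamma>) \<le> sqrt (P \<epsilon>)" by (rule real_le_rsqrt)
    qed (use \<delta> e in auto)
    finally have 1: "S (\<lambda>x. \<phi> x - u x) \<le> \<delta> * sqrt (P \<epsilon>)" .
    let ?v = "up \<epsilon> (\<lambda>x. \<phi> x - u x)"
    have v: "?v \<in> Hm m ?B" "(Hm_norm m ?B ?v)\<^sup>2 \<le> \<epsilon>\<^sup>2"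
      using Hm_norm_blow_up_le[OF w less_imp_le[OF \<phi>(3)] e(1,2) open_ball sub] by auto
    let ?z = "\<lambda>x. u (\<epsilon> *\<^sub>R x) / \<epsilon> ^ \<gamma> - U0 x"
    have z: "?z \<in> Hm m ?B" using Hm_lin[OF open_ball elim(1) U0B, of 1 "-1"] by simp
    have z2: "(Hm_norm m ?B ?z)\<^sup>2 \<le> \<rho>\<^sup>2"
      using power_mono[of "\<bar>Hm_norm m ?B ?z\<bar>" \<rho> 2] elim(2) by simp
    define g where "g = (\<lambda>x. up \<epsilon> \<phi> x - U0 x)"
    have g_eq: "g = (\<lambda>x. ?v x + ?z x)"
      by (rule ext) (simp add: g_def up_def right_diff_distrib)
    have upt: "up \<epsilon> \<phi> \<in> test_functions UNIV" by (rule test_functions_mono[OF _ up_test[OF \<phi>(1) e(1)]]) simp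
    have gs: "smooth g" unfolding g_def by (intro smooth_diff test_functions_smooth[OF upt] U0)
    have "(Hm_norm m ?B g)\<^sup>2 \<le> 2 * (Hm_norm m ?B ?v)\<^sup>2 + 2 * (Hm_norm m ?B ?z)\<^sup>2"
      unfolding g_eq by (rule Hm_norm_sq_add_le[OF open_ball v(1) z])
    also have "\<dots> \<le> 2 * \<rho>\<^sup>2 + 2 * \<rho>\<^sup>2"
      using v(2) z2 power_mono[OF less_imp_le[OF e(3)] less_imp_le[OF e(1)], of 2] by linarith
    finally have gB: "(\<Sum>cs\<in>multi_indices m. LINT x|lebesgue_on ?B. (partials cs g x)\<^sup>2) \<le> 4 * \<rho>\<^sup>2"
      unfolding Hm_norm_sq[OF open_ball smooth_weak_family[OF gs open_ball]] by simp
    have \<eta>g: "(\<lambda>x. \<eta> x * up \<epsilon> \<phi> x - h x) = (\<lambda>x. \<eta> x * g x)"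
      by (rule ext) (simp add: g_def h_def right_diff_distrib)
    have "top_energy m (\<lambda>x. \<eta> x * g x) \<le> \<delta>\<^sup>2"
      using C(2)[OF gs] mult_left_mono[OF gB C(1)] C\<rho> by linarith
    then have "sqrt (top_energy m (\<lambda>x. \<eta> x * g x)) \<le> sqrt (\<delta>\<^sup>2)" by (rule real_sqrt_le_mono)
    then have 2: "Dm_norm m (\<lambda>x. \<eta> x * up \<epsilon> \<phi> x - h x) \<le> \<delta>"
      unfolding \<eta>g using Dm_norm_test[OF test_functions_smooth_mult(2)[OF \<eta>_test gs]] \<delta> by simp
    show ?case using \<phi>(1) 1 2 by blast
  qed
qed

lemma outer_part_test:
  assumes "\<phi> \<in> test_functions \<Omega>" "0 < \<epsilon>" "\<epsilon> < 1"
  shows "(\<lambda>x. (1 - \<eta> x) * up \<epsilon> \<phi> x) \<in> test_functions ({x. \<epsilon> *\<^sub>R x \<in> \<Omega>} - rescaled K \<epsilon>)"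
proof -
  have "(\<lambda>x. (1 - \<eta> x) * up \<epsilon> \<phi> x) \<in> test_functions ({x. \<epsilon> *\<^sub>R x \<in> \<Omega>} - ball 0 R)"
    by (rule test_functions_mult_one_minus[OF up_test[OF assms(1,2)] \<eta>(1) open_ball]) (use \<eta>(2) in auto)
  moreover have "{x. \<epsilon> *\<^sub>R x \<in> \<Omega>} - ball 0 R \<subseteq> {x. \<epsilon> *\<^sub>R x \<in> \<Omega>} - rescaled K \<epsilon>"
    using K(1)[OF assms(2,3)] by blast
  ultimately show ?thesis by (rule test_functions_mono[rotated])
qed

section \<open>Comparison of the rescaled capacity with the limit capacity\<close>

lemma cap_in_set:
  shows "{dirichlet_energy m \<Omega> f | f. f \<in> Hm0 m \<Omega> \<Omega> \<and> (\<lambda>x. f x - u x) \<in> Hm0 m \<Omega> (\<Omega> - K \<epsilon>)} \<noteq> {}"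
    and "bdd_below {dirichlet_energy m \<Omega> f | f. f \<in> Hm0 m \<Omega> \<Omega> \<and> (\<lambda>x. f x - u x) \<in> Hm0 m \<Omega> (\<Omega> - K \<epsilon>)}"
    and "cap_in m \<Omega> (K \<epsilon>) u \<ge> 0"
proof -
  have "(\<lambda>x. u x - u x) \<in> Hm0 m \<Omega> (\<Omega> - K \<epsilon>)"
    using test_functions_Hm0[OF test_functions_zero \<Omega>(1)] by simp
  then show ne: "{dirichlet_energy m \<Omega> f | f. f \<in> Hm0 m \<Omega> \<Omega> \<and> (\<lambda>x. f x - u x) \<in> Hm0 m \<Omega> (\<Omega> - K \<epsilon>)} \<noteq> {}"
    using u by blast
  show "bdd_below {dirichlet_energy m \<Omega> f | f. f \<in> Hm0 m \<Omega> \<Omega> \<and> (\<lambda>x. f x - u x) \<in> Hm0 m \<Omega> (\<Omega> - K \<epsilon>)}"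
    by (rule bdd_belowI[of _ 0]) (auto simp: dirichlet_energy_def)
  show "cap_in m \<Omega> (K \<epsilon>) u \<ge> 0"
    unfolding cap_in_def by (rule cInf_greatest[OF ne]) (auto simp: dirichlet_energy_def)
qed

lemma sqrt_cap_in: "\<epsilon> > 0 \<Longrightarrow> sqrt (cap_in m \<Omega> (K \<epsilon>) u) = sqrt (P \<epsilon>) * s \<epsilon>"
  using P_pos[of \<epsilon>] by (simp add: s_def real_sqrt_mult[symmetric])

text \<open>A near-minimiser f has f - u close to a test function \<psi> avoiding
  \<open>K \<epsilon>\<close>, and u is close to \<phi>, so \<phi> + \<psi> carries almost the
  energy of f. After the blow-up its inner part \<eta> \<open>up \<epsilon> \<phi>\<close> is
  exchanged for h; what remains, the outer part together with \<open>up \<epsilon> \<psi>\<close>,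
  is the required \<theta>.\<close>

lemma lower_competitor:
  assumes \<rho>: "\<rho> > 0"
  shows "\<forall>\<^sub>F \<epsilon> in at_right 0. \<exists>\<theta>\<in>test_functions (- rescaled K \<epsilon>). Dm_norm m (\<lambda>x. \<theta> x + h x) \<le> s \<epsilon> + \<rho>"
proof -
  \<comment> \<open>Four errors: near-minimality, the approximation of u, that of f - u, and the
    exchange of the inner part for h.\<close>
  define \<delta> where "\<delta> = \<rho> / 4"
  have \<delta>: "\<delta> > 0" using \<rho> by (simp add: \<delta>_def)
  have "\<forall>\<^sub>F \<epsilon>::real in at_right 0. 0 < \<epsilon> \<and> \<epsilon> < 1"
    by (auto simp: eventually_at_right_field intro!: exI[of _ 1])
  with test_approximation[OF \<delta>] show ?thesis
  proof eventually_elim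
    case (elim \<epsilon>)
    then obtain \<phi> where \<phi>: "\<phi> \<in> test_functions \<Omega>" "S (\<lambda>x. \<phi> x - u x) \<le> \<delta> * sqrt (P \<epsilon>)"
      "Dm_norm m (\<lambda>x. \<eta> x * up \<epsilon> \<phi> x - h x) \<le> \<delta>" and e: "0 < \<epsilon>" "\<epsilon> < 1" by blast
    have sP: "sqrt (P \<epsilon>) > 0" using P_pos[OF e(1)] by simp
    let ?c = "cap_in m \<Omega> (K \<epsilon>) u"
    have c0: "?c \<ge> 0" by (rule cap_in_set(3))
    have "(sqrt ?c)\<^sup>2 < (sqrt ?c + \<delta> * sqrt (P \<epsilon>))\<^sup>2" using \<delta> sP c0 by (intro power_strict_mono) auto
    then have "Inf {dirichlet_energy m \<Omega> f | f. f \<in> Hm0 m \<Omega> \<Omega> \<and> (\<lambda>x. f x - u x) \<in> Hm0 m \<Omega> (\<Omega> - K \<epsilon>)} < (sqrt ?c + \<delta> * sqrt (P \<epsilon>))\<^sup>2"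
      using c0 by (simp add: cap_in_def)
    from cInf_lessD[OF cap_in_set(1) this]
    obtain f where f: "f \<in> Hm0 m \<Omega> \<Omega>" "(\<lambda>x. f x - u x) \<in> Hm0 m \<Omega> (\<Omega> - K \<epsilon>)"
      "dirichlet_energy m \<Omega> f < (sqrt ?c + \<delta> * sqrt (P \<epsilon>))\<^sup>2" by blast
    have "S f \<le> sqrt ((sqrt ?c + \<delta> * sqrt (P \<epsilon>))\<^sup>2)"
      unfolding S_def using f(3) by (intro real_sqrt_le_mono) simp
    then have Sf: "S f \<le> sqrt (P \<epsilon>) * s \<epsilon> + \<delta> * sqrt (P \<epsilon>)"
      using c0 \<delta> sP by (simp add: sqrt_cap_in[OF e(1), symmetric])
    define \<tau> where "\<tau> = \<delta> * sqrt (P \<epsilon>) / (\<kappa> + 1)"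
    have \<tau>: "\<tau> > 0" "\<kappa> * \<tau> \<le> \<delta> * sqrt (P \<epsilon>)"
      using \<delta> sP \<kappa>_nonneg by (auto simp: \<tau>_def field_simps)
    obtain \<psi> where \<psi>: "\<psi> \<in> test_functions (\<Omega> - K \<epsilon>)" "\<psi> \<in> Hm m \<Omega>"
      "\<bar>Hm_norm m \<Omega> (\<lambda>x. \<psi> x - (f x - u x))\<bar> < \<tau>"
      using Hm0_approx[OF f(2) \<tau>(1)] by blast
    have \<psi>\<Omega>: "\<psi> \<in> test_functions \<Omega>" by (rule test_functions_mono[OF _ \<psi>(1)]) blast
    have wH: "(\<lambda>x. \<psi> x - (f x - u x)) \<in> Hm m \<Omega>"
      using Hm_lin[OF \<Omega>(1) \<psi>(2) Hm0_Hm[OF f(2)], of 1 "-1"]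
      by (simp only: mult_1 mult_minus1 add_uminus_conv_diff)
    have S\<psi>: "S (\<lambda>x. \<psi> x - (f x - u x)) \<le> \<delta> * sqrt (P \<epsilon>)"
      using S_le_Hm_norm[OF wH] mult_left_mono[OF less_imp_le[OF \<psi>(3)] \<kappa>_nonneg] \<tau>(2) by linarith
    have V: "f \<in> weak_space m \<Omega>" "(\<lambda>x. \<phi> x - u x) \<in> weak_space m \<Omega>" "(\<lambda>x. \<psi> x - (f x - u x)) \<in> weak_space m \<Omega>"
      using Hm_weak_space[OF Hm0_Hm[OF f(1)]] Hm_weak_space[OF wH]
        O.diff_mem[OF test_functions_weak_space[OF \<phi>(1) \<Omega>(1)] Hm_weak_space[OF Hm0_Hm[OF u]]] by auto
    have sum_eq: "(\<lambda>x. (f x + (\<phi> x - u x)) + (\<psi> x - (f x - u x))) = (\<lambda>x. \<phi> x + \<psi> x)" by auto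
    have tsum: "(\<lambda>x. \<phi> x + \<psi> x) \<in> test_functions \<Omega>" by (rule test_functions_add[OF \<phi>(1) \<psi>\<Omega>])
    have "S (\<lambda>x. \<phi> x + \<psi> x) \<le> S f + S (\<lambda>x. \<phi> x - u x) + S (\<lambda>x. \<psi> x - (f x - u x))"
      using O.seminorm_triangle[OF O.add_mem[OF V(1,2)] V(3)] O.seminorm_triangle[OF V(1,2)]
      unfolding sum_eq S_seminorm by linarith
    also have "\<dots> \<le> sqrt (P \<epsilon>) * (s \<epsilon> + 3 * \<delta>)" using Sf \<phi>(2) S\<psi> by (simp add: algebra_simps)
    finally have "sqrt (P \<epsilon>) * Dm_norm m (up \<epsilon> (\<lambda>x. \<phi> x + \<psi> x)) \<le> sqrt (P \<epsilon>) * (s \<epsilon> + 3 * \<delta>)"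
      using S_test[OF tsum] Dm_norm_up[OF tsum e(1)] by simp
    then have up_le: "Dm_norm m (up \<epsilon> (\<lambda>x. \<phi> x + \<psi> x)) \<le> s \<epsilon> + 3 * \<delta>"
      using sP by simp
    define \<theta> where "\<theta> = (\<lambda>x. (1 - \<eta> x) * up \<epsilon> \<phi> x + up \<epsilon> \<psi> x)"
    have "\<theta> \<in> test_functions (- rescaled K \<epsilon>)"
      unfolding \<theta>_def
    proof (rule test_functions_add)
      show "(\<lambda>x. (1 - \<eta> x) * up \<epsilon> \<phi> x) \<in> test_functions (- rescaled K \<epsilon>)"
        by (rule test_functions_mono[OF _ outer_part_test[OF \<phi>(1) e]]) blast
      show "up \<epsilon> \<psi> \<in> test_functions (- rescaled K \<epsilon>)"
        by (rule test_functions_mono[OF _ up_test[OF \<psi>(1) e(1)]]) (use rescaled_iff[OF e(1)] in auto)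
    qed
    moreover have "Dm_norm m (\<lambda>x. \<theta> x + h x) \<le> s \<epsilon> + \<rho>"
    proof -
      have upt: "up \<epsilon> \<phi> \<in> test_functions UNIV" "up \<epsilon> (\<lambda>x. \<phi> x + \<psi> x) \<in> test_functions UNIV"
        using test_functions_mono[OF _ up_test[OF \<phi>(1) e(1)]] test_functions_mono[OF _ up_test[OF tsum e(1)]] by auto
      have a: "up \<epsilon> (\<lambda>x. \<phi> x + \<psi> x) \<in> weak_space m UNIV"
        by (rule test_functions_weak_space[OF upt(2) open_UNIV])
      have b: "(\<lambda>x. \<eta> x * up \<epsilon> \<phi> x - h x) \<in> weak_space m UNIV"
        by (rule test_functions_weak_space[OF test_functions_diff[OF test_functions_smooth_mult(1)[OF upt(1) \<eta>(1)] h_test] open_UNIV])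
      have "(\<lambda>x. \<theta> x + h x) = (\<lambda>x. up \<epsilon> (\<lambda>x. \<phi> x + \<psi> x) x - (\<eta> x * up \<epsilon> \<phi> x - h x))"
        by (rule ext) (simp add: \<theta>_def up_add algebra_simps)
      moreover have "E.seminorm (\<lambda>x. f x - g x) \<le> E.seminorm f + E.seminorm g"
        if "f \<in> weak_space m UNIV" "g \<in> weak_space m UNIV" for f g
        using E.seminorm_triangle_diff[OF E.diff_mem[OF that] E.cmult_mem[OF that(2), of "-1"]]
          E.seminorm_cmult[OF that(2), of "-1"] by simp
      ultimately have "Dm_norm m (\<lambda>x. \<theta> x + h x) \<le> Dm_norm m (up \<epsilon> (\<lambda>x. \<phi> x + \<psi> x)) + Dm_norm m (\<lambda>x. \<eta> x * up \<epsilon> \<phi> x - h x)"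
        using a b by (simp only: Dm_norm_seminorm)
      then show ?thesis using up_le \<phi>(3) by (simp add: \<delta>_def)
    qed
    ultimately show ?case by blast
  qed
qed

text \<open>If the bound failed for arbitrarily small \<epsilon>, the competitors along a null
  sequence would have a weak limit admissible for the limit set, with energy norm below the
  infimum.\<close>

lemma sqrt_cap_lower:
  assumes \<rho>: "\<rho> > 0"
  shows "\<forall>\<^sub>F \<epsilon> in at_right 0. s \<epsilon> > sqrt (cap_RN m K0 U0) - \<rho>"
proof (rule ccontr)
  let ?c = "sqrt (cap_RN m K0 U0)"
  assume "\<not> ?thesis"
  then have fr: "\<exists>\<^sub>F \<epsilon> in at_right 0. s \<epsilon> \<le> ?c - \<rho>" by (simp add: frequently_def not_le)
  \<comment> \<open>The frequent failure is combined with the eventual existence of competitors;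
    half of \<rho> is spent on the latter.\<close>
  have "\<exists>\<epsilon>>0. \<epsilon> < inverse (real (Suc n)) \<and> (\<exists>\<theta>\<in>test_functions (- rescaled K \<epsilon>). Dm_norm m (\<lambda>x. \<theta> x + h x) \<le> ?c - \<rho> / 2)" for n
  proof -
    have "\<forall>\<^sub>F \<epsilon>::real in at_right 0. 0 < \<epsilon> \<and> \<epsilon> < inverse (real (Suc n))"
      by (auto simp: eventually_at_right_field intro!: exI[of _ "inverse (real (Suc n))"])
    with lower_competitor[of "\<rho> / 2"] \<rho>
    have "\<forall>\<^sub>F \<epsilon> in at_right 0. (0 < \<epsilon> \<and> \<epsilon> < inverse (real (Suc n))) \<and>
        (\<exists>\<theta>\<in>test_functions (- rescaled K \<epsilon>). Dm_norm m (\<lambda>x. \<theta> x + h x) \<le> s \<epsilon> + \<rho> / 2)"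
      by (simp add: eventually_conj_iff)
    from frequently_eventually_frequently[OF fr this] obtain \<epsilon> \<theta> where
      "s \<epsilon> \<le> ?c - \<rho>" "0 < \<epsilon>" "\<epsilon> < inverse (real (Suc n))"
      "\<theta> \<in> test_functions (- rescaled K \<epsilon>)" "Dm_norm m (\<lambda>x. \<theta> x + h x) \<le> s \<epsilon> + \<rho> / 2"
      using frequently_ex by blast
    then show ?thesis by (intro exI[of _ \<epsilon>] conjI bexI[of _ \<theta>]) auto
  qed
  then obtain e where e: "\<And>n. e n > 0" "\<And>n. e n < inverse (real (Suc n))"
    "\<And>n. \<exists>\<theta>\<in>test_functions (- rescaled K (e n)). Dm_norm m (\<lambda>x. \<theta> x + h x) \<le> ?c - \<rho> / 2" by metis
  then obtain \<theta> where \<theta>: "\<And>n. \<theta> n \<in> test_functions (- rescaled K (e n))"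
    "\<And>n. Dm_norm m (\<lambda>x. \<theta> n x + h x) \<le> ?c - \<rho> / 2" by metis
  have e0: "e \<longlonglongrightarrow> 0"
    by (rule tendsto_sandwich[OF always_eventually always_eventually tendsto_const LIMSEQ_inverse_real_of_nat])
      (use e in \<open>auto intro: less_imp_le\<close>)
  obtain w where w: "w \<in> Dm0_minus m K0" "Dm_norm m (\<lambda>x. w x + h x) \<le> ?c - \<rho> / 2"
    by (rule mosco_lower[OF N mosco h_test e(1) e0 \<theta>])
  have nn: "Dm_norm m (\<lambda>x. w x + h x) \<ge> 0" by (simp add: Dm_norm_def dirichlet_energy_def)
  have "cap_RN m K0 U0 \<le> (Dm_norm m (\<lambda>x. w x + h x))\<^sup>2"
    unfolding h_def by (rule cap_RN_lower[OF N U0 \<eta>_cutoff w(1)])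
  then have "?c \<le> sqrt ((Dm_norm m (\<lambda>x. w x + h x))\<^sup>2)" by (rule real_sqrt_le_mono)
  then show False using w(2) \<rho> nn by simp
qed

text \<open>The competitor on \<Omega> is u plus a test function G avoiding
  \<open>K \<epsilon>\<close>, so admissibility is immediate. For the energy, u is replaced by
  \<phi>, and the blow-up of \<phi> + G is close to \<psi> + h, whose energy norm almost attains the
  limit capacity.\<close>

lemma sqrt_cap_upper:
  assumes \<rho>: "\<rho> > 0"
  shows "\<forall>\<^sub>F \<epsilon> in at_right 0. s \<epsilon> < sqrt (cap_RN m K0 U0) + \<rho>"
proof -
  let ?c = "sqrt (cap_RN m K0 U0)"
  \<comment> \<open>Four errors of size \<delta>: the choice of \<psi>, its recovery by \<theta>,
    the exchange for h, and the approximation of u. The fifth part makes the inequality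
    strict.\<close>
  define \<delta> where "\<delta> = \<rho> / 5"
  have \<delta>: "\<delta> > 0" using \<rho> by (simp add: \<delta>_def)
  obtain \<psi> where \<psi>: "\<psi> \<in> test_functions (- K0)" "Dm_norm m (\<lambda>x. \<psi> x + h x) < ?c + \<delta>"
    unfolding h_def using cap_RN_upper[OF N U0 \<eta>_cutoff \<delta>] by blast
  obtain C where C: "smooth \<psi>" "compact C" "C \<subseteq> - K0" "\<And>x. x \<notin> C \<Longrightarrow> \<psi> x = 0"
    using test_functionsE[OF \<psi>(1)] by metis
  obtain R1 where R1: "R1 > 0" "C \<subseteq> ball 0 R1"
    using bounded_subset_ballD[OF compact_imp_bounded[OF C(2)], of 0] by blast
  obtain \<zeta> :: "'a \<Rightarrow> real" where \<zeta>: "smooth \<zeta>" "\<And>x. norm x \<le> R1 \<Longrightarrow> \<zeta> x = 1" "\<And>x. norm x \<ge> R1 + 1 \<Longrightarrow> \<zeta> x = 0"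
    using cutoff_ball_exists[OF R1(1)] by blast
  have \<zeta>\<psi>: "\<zeta> x * \<psi> x = \<psi> x" for x
    using \<zeta>(2)[of x] C(4)[of x] R1(2) by (cases "x \<in> C") auto
  obtain r where r: "r > 0" "ball 0 r \<subseteq> \<Omega>" by (rule small_ball)
  \<comment> \<open>The support of \<zeta>, shrunk by \<epsilon> < \<open>e0\<close>, fits into the
    ball of radius r inside \<Omega>.\<close>
  define e0 where "e0 = min 1 (r / (R1 + 1))"
  have ev: "\<forall>\<^sub>F \<epsilon> in at_right 0. \<exists>\<theta>\<in>test_functions (- rescaled K \<epsilon>). Dm_norm m (\<lambda>x. \<zeta> x * \<theta> x - \<psi> x) < \<delta>"
  proof (rule mosco_upper[OF N mosco \<psi>(1) \<zeta>(1) _ \<zeta>\<psi> \<delta>])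
    show "\<zeta> x = 0" if "norm x \<ge> R1 + 1" for x by (rule \<zeta>(3)[OF that])
  qed
  have "\<forall>\<^sub>F \<epsilon>::real in at_right 0. 0 < \<epsilon> \<and> \<epsilon> < e0"
    using r(1) R1(1) by (auto simp: eventually_at_right_field e0_def intro!: exI[of _ e0])
  with test_approximation[OF \<delta>] ev show ?thesis
  proof eventually_elim
    case (elim \<epsilon>)
    then obtain \<phi> \<theta> where \<phi>: "\<phi> \<in> test_functions \<Omega>" "S (\<lambda>x. \<phi> x - u x) \<le> \<delta> * sqrt (P \<epsilon>)"
      "Dm_norm m (\<lambda>x. \<eta> x * up \<epsilon> \<phi> x - h x) \<le> \<delta>" and e: "0 < \<epsilon>" "\<epsilon> < e0"
      and \<theta>: "\<theta> \<in> test_functions (- rescaled K \<epsilon>)" "Dm_norm m (\<lambda>x. \<zeta> x * \<theta> x - \<psi> x) < \<delta>" by blast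
    have e1: "\<epsilon> < 1" using e(2) by (simp add: e0_def)
    have sP: "sqrt (P \<epsilon>) > 0" using P_pos[OF e(1)] by simp
    let ?W = "{x. \<epsilon> *\<^sub>R x \<in> \<Omega> - K \<epsilon>}"
    have \<zeta>\<theta>: "(\<lambda>x. \<zeta> x * \<theta> x) \<in> test_functions ?W"
    proof -
      obtain D where D: "smooth \<theta>" "compact D" "D \<subseteq> - rescaled K \<epsilon>" "\<And>x. x \<notin> D \<Longrightarrow> \<theta> x = 0"
        using test_functionsE[OF \<theta>(1)] by metis
      show ?thesis
      proof (rule test_functionsI[of _ "D \<inter> cball 0 (R1 + 1)"])
        show "smooth (\<lambda>x. \<zeta> x * \<theta> x)" by (intro smooth_mult \<zeta>(1) D(1))
        show "compact (D \<inter> cball 0 (R1 + 1))" by (rule compact_Int[OF D(2) compact_cball])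
        show "D \<inter> cball 0 (R1 + 1) \<subseteq> ?W"
        proof
          fix x assume x: "x \<in> D \<inter> cball 0 (R1 + 1)"
          have "norm (\<epsilon> *\<^sub>R x) \<le> \<epsilon> * (R1 + 1)" using x e(1) by (simp add: mult_left_mono)
          also have "\<dots> < r"
          proof -
            have "\<epsilon> < r / (R1 + 1)" using e(2) by (simp add: e0_def)
            then show ?thesis using R1(1) by (simp add: pos_less_divide_eq)
          qed
          finally have "\<epsilon> *\<^sub>R x \<in> \<Omega>" using r(2) by (auto simp: subset_iff)
          then show "x \<in> ?W" using x D(3) rescaled_iff[OF e(1), of x] by blast
        qed
        show "\<zeta> x * \<theta> x = 0" if "x \<notin> D \<inter> cball 0 (R1 + 1)" for x
          using that D(4)[of x] \<zeta>(3)[of x] by (cases "x \<in> D") auto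
      qed
    qed
    have outer: "(\<lambda>x. (1 - \<eta> x) * up \<epsilon> \<phi> x) \<in> test_functions ?W"
      by (rule test_functions_mono[OF _ outer_part_test[OF \<phi>(1) e(1) e1]]) (use rescaled_iff[OF e(1)] in auto)
    \<comment> \<open>Subtracting the outer part cancels that of \<open>up \<epsilon> \<phi>\<close>
      in the sum \<open>up \<epsilon> \<phi> x + g x\<close>, leaving
      \<open>\<eta> x * up \<epsilon> \<phi> x + \<zeta> x * \<theta> x\<close>. Both pieces of g
      avoid the rescaled set.\<close>
    define g where "g = (\<lambda>x. \<zeta> x * \<theta> x - (1 - \<eta> x) * up \<epsilon> \<phi> x)"
    have gt: "g \<in> test_functions ?W" unfolding g_def by (rule test_functions_diff[OF \<zeta>\<theta> outer])
    define G where "G = down \<epsilon> g"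
    have G: "G \<in> test_functions (\<Omega> - K \<epsilon>)" unfolding G_def by (rule down_test[OF gt e(1)])
    have G\<Omega>: "G \<in> test_functions \<Omega>" by (rule test_functions_mono[OF _ G]) blast
    define f where "f = (\<lambda>x. u x + G x)"
    have f: "f \<in> Hm0 m \<Omega> \<Omega>" unfolding f_def by (rule Hm0_add_test[OF u G\<Omega> \<Omega>(1)])
    have "(\<lambda>x. f x - u x) = G" by (simp add: f_def)
    then have fu: "(\<lambda>x. f x - u x) \<in> Hm0 m \<Omega> (\<Omega> - K \<epsilon>)" using test_functions_Hm0[OF G \<Omega>(1)] by simp
    have "cap_in m \<Omega> (K \<epsilon>) u \<le> dirichlet_energy m \<Omega> f"
      unfolding cap_in_def by (rule cInf_lower[OF _ cap_in_set(2)]) (use f fu in blast)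
    then have capS: "sqrt (P \<epsilon>) * s \<epsilon> \<le> S f"
      unfolding sqrt_cap_in[OF e(1), symmetric] S_def by (rule real_sqrt_le_mono)
    have tsum: "(\<lambda>x. \<phi> x + G x) \<in> test_functions \<Omega>" by (rule test_functions_add[OF \<phi>(1) G\<Omega>])
    have V: "f \<in> weak_space m \<Omega>" "(\<lambda>x. \<phi> x + G x) \<in> weak_space m \<Omega>" "\<phi> \<in> weak_space m \<Omega>" "u \<in> weak_space m \<Omega>"
      using Hm_weak_space[OF Hm0_Hm[OF f]] Hm_weak_space[OF Hm0_Hm[OF u]]
        test_functions_weak_space[OF tsum \<Omega>(1)] test_functions_weak_space[OF \<phi>(1) \<Omega>(1)] by auto
    have eq: "S (\<lambda>x. \<phi> x + G x) = sqrt (P \<epsilon>) * Dm_norm m (\<lambda>x. up \<epsilon> \<phi> x + g x)"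
      using S_test[OF tsum] Dm_norm_up[OF tsum e(1)] by (simp add: up_add G_def up_down[OF e(1)])
    have le: "Dm_norm m (\<lambda>x. up \<epsilon> \<phi> x + g x) \<le> ?c + 3 * \<delta>"
    proof -
      have upt: "up \<epsilon> \<phi> \<in> test_functions UNIV" "(\<lambda>x. \<zeta> x * \<theta> x) \<in> test_functions UNIV" "\<psi> \<in> test_functions UNIV"
        using test_functions_mono[OF _ up_test[OF \<phi>(1) e(1)]] test_functions_mono[OF _ \<zeta>\<theta>] test_functions_mono[OF _ \<psi>(1)] by auto
      have a: "(\<lambda>x. \<psi> x + h x) \<in> weak_space m UNIV"
        by (rule test_functions_weak_space[OF test_functions_add[OF upt(3) h_test] open_UNIV])
      have b: "(\<lambda>x. \<eta> x * up \<epsilon> \<phi> x - h x) \<in> weak_space m UNIV"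
        by (rule test_functions_weak_space[OF test_functions_diff[OF test_functions_smooth_mult(1)[OF upt(1) \<eta>(1)] h_test] open_UNIV])
      have d: "(\<lambda>x. \<zeta> x * \<theta> x - \<psi> x) \<in> weak_space m UNIV"
        by (rule test_functions_weak_space[OF test_functions_diff[OF upt(2,3)] open_UNIV])
      have "(\<lambda>x. up \<epsilon> \<phi> x + g x) = (\<lambda>x. ((\<psi> x + h x) + (\<eta> x * up \<epsilon> \<phi> x - h x)) + (\<zeta> x * \<theta> x - \<psi> x))"
        by (rule ext) (simp add: g_def algebra_simps)
      then have "Dm_norm m (\<lambda>x. up \<epsilon> \<phi> x + g x) \<le> Dm_norm m (\<lambda>x. \<psi> x + h x)
          + Dm_norm m (\<lambda>x. \<eta> x * up \<epsilon> \<phi> x - h x) + Dm_norm m (\<lambda>x. \<zeta> x * \<theta> x - \<psi> x)"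
        using E.seminorm_triangle[OF E.add_mem[OF a b] d] E.seminorm_triangle[OF a b]
        unfolding Dm_norm_seminorm by simp
      then show ?thesis using \<psi>(2) \<phi>(3) \<theta>(2) by linarith
    qed
    have "(\<lambda>x. f x - (\<phi> x + G x)) = (\<lambda>x. u x - \<phi> x)" by (simp add: f_def)
    then have tri: "S f \<le> S (\<lambda>x. \<phi> x + G x) + S (\<lambda>x. \<phi> x - u x)"
      using O.seminorm_triangle_diff[OF V(1,2)] O.seminorm_minus_commute[OF V(3,4)] unfolding S_seminorm by simp
    have "S f \<le> sqrt (P \<epsilon>) * (?c + 3 * \<delta>) + S (\<lambda>x. \<phi> x - u x)"
      using tri mult_left_mono[OF le less_imp_le[OF sP]] unfolding eq by linarith
    then have "sqrt (P \<epsilon>) * s \<epsilon> \<le> sqrt (P \<epsilon>) * (?c + 4 * \<delta>)"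
      using capS \<phi>(2) by (simp add: algebra_simps)
    then have "s \<epsilon> \<le> ?c + 4 * \<delta>" using sP by simp
    then show ?case using \<rho> by (simp add: \<delta>_def)
  qed
qed

text \<open>Squaring undoes the root in \<open>s\<close>; the capacities are non-negative, so
  nothing is lost.\<close>

theorem capacity_limit: "((\<lambda>\<epsilon>. cap_in m \<Omega> (K \<epsilon>) u / P \<epsilon>) \<longlongrightarrow> cap_RN m K0 U0) (at_right 0)"
proof -
  have "(s \<longlongrightarrow> sqrt (cap_RN m K0 U0)) (at_right 0)"
  proof (rule order_tendstoI)
    show "\<forall>\<^sub>F \<epsilon> in at_right 0. a < s \<epsilon>" if "a < sqrt (cap_RN m K0 U0)" for a
      using sqrt_cap_lower[of "sqrt (cap_RN m K0 U0) - a"] that by simp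
    show "\<forall>\<^sub>F \<epsilon> in at_right 0. s \<epsilon> < a" if "sqrt (cap_RN m K0 U0) < a" for a
      using sqrt_cap_upper[of "a - sqrt (cap_RN m K0 U0)"] that by simp
  qed
  then have "((\<lambda>\<epsilon>. (s \<epsilon>)\<^sup>2) \<longlongrightarrow> (sqrt (cap_RN m K0 U0))\<^sup>2) (at_right 0)" by (rule tendsto_power)
  moreover have "(sqrt (cap_RN m K0 U0))\<^sup>2 = cap_RN m K0 U0"
    using cap_RN_nonneg(1)[OF N U0 \<eta>_cutoff] by simp
  moreover have "\<forall>\<^sub>F \<epsilon> in at_right 0. (s \<epsilon>)\<^sup>2 = cap_in m \<Omega> (K \<epsilon>) u / P \<epsilon>"
    using eventually_at_right_less[of "0::real"]
  proof eventually_elim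
    case (elim \<epsilon>)
    then show ?case using cap_in_set(3)[of \<epsilon>] P_pos[of \<epsilon>] by (simp add: s_def)
  qed
  ultimately show ?thesis using Lim_transform_eventually by force
qed

end

theorem theorem4p4:
  fixes \<Omega> :: "'a::euclidean_space set"
    and K :: "real \<Rightarrow> 'a set" and \<K> :: "'a set"
    and m \<gamma> :: nat and lam :: real and u U0 :: "'a \<Rightarrow> real"
  assumes "m \<ge> 2" and "DIM('a) > 2 * m"
    and "bounded_smooth_domain \<Omega>" and "0 \<in> \<Omega>"
    and "\<forall>\<epsilon>>0. compact (K \<epsilon>)" and "uniformly_concentrating K"
    and "compact \<K>"
    and "\<exists>M. compact M \<and> (\<forall>\<epsilon>\<in>{0<..<1}. rescaled K \<epsilon> \<subseteq> M)"
    and "Dm_mosco m (rescaled K) \<K>"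
    and "dirichlet_eigenpair m \<Omega> lam u"
    and "(LINT x|lebesgue_on \<Omega>. (u x)\<^sup>2) = 1"
    and "vanishing_profile m u \<gamma> U0"
  shows "\<exists>r \<in> o[at_right 0](\<lambda>_. 1 :: real). \<forall>\<^sub>F \<epsilon> in at_right 0.
    cap_in m \<Omega> (K \<epsilon>) u = \<epsilon> ^ (DIM('a) - 2 * m + 2 * \<gamma>) * (cap_RN m \<K> U0 + r \<epsilon>)"
proof -
  obtain M where M: "compact M" "\<And>\<epsilon>. 0 < \<epsilon> \<Longrightarrow> \<epsilon> < 1 \<Longrightarrow> rescaled K \<epsilon> \<subseteq> M" using assms(8) by auto
  \<comment> \<open>One radius encloses the whole family and the limit set, so a single cutoff
    serves for all \<epsilon>.\<close>
  obtain R where R: "R > 0" "M \<union> \<K> \<subseteq> ball 0 R"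
    using bounded_subset_ballD[OF compact_imp_bounded[OF compact_Un[OF M(1) assms(7)]], of 0] by blast
  obtain \<eta> :: "'a \<Rightarrow> real" where \<eta>: "smooth \<eta>" "\<And>x. norm x \<le> R \<Longrightarrow> \<eta> x = 1" "\<And>x. norm x \<ge> R + 1 \<Longrightarrow> \<eta> x = 0"
    using cutoff_ball_exists[OF R(1)] by blast
  interpret capacity_setting \<Omega> K \<K> m \<gamma> u U0 \<eta> R
  proof
    show "open \<Omega>" using assms(3) by (simp add: bounded_smooth_domain_def)
    show "u \<in> Hm0 m \<Omega> \<Omega>" using assms(10) by (simp add: dirichlet_eigenpair_def)
    show "smooth U0" using assms(12)
      by (auto simp: vanishing_profile_def homogeneous_polyharmonic_def intro: smooth_real_polynomial_function)
    show "rescaled K \<epsilon> \<subseteq> ball 0 R" if "0 < \<epsilon>" "\<epsilon> < 1" for \<epsilon> using M(2)[OF that] R(2) by blast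
    show "tendsto_Hm m (ball 0 r) (\<lambda>\<epsilon> x. u (\<epsilon> *\<^sub>R x) / \<epsilon> ^ \<gamma>) U0 (at_right 0)" if "r > 0" for r
      using assms(12) that by (simp add: vanishing_profile_def)
  qed (use assms R \<eta> in auto)
  define r where "r \<epsilon> = cap_in m \<Omega> (K \<epsilon>) u / P \<epsilon> - cap_RN m \<K> U0" for \<epsilon>
  have "(r \<longlongrightarrow> 0) (at_right 0)"
    unfolding r_def[abs_def] using capacity_limit by (simp add: LIM_zero_iff)
  then have "r \<in> o[at_right 0](\<lambda>_. 1 :: real)" by (intro smalloI_tendsto) auto
  moreover have "\<forall>\<^sub>F \<epsilon> in at_right 0.
      cap_in m \<Omega> (K \<epsilon>) u = \<epsilon> ^ (DIM('a) - 2 * m + 2 * \<gamma>) * (cap_RN m \<K> U0 + r \<epsilon>)"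
    using eventually_at_right_less[of "0::real"]
  proof eventually_elim
    case (elim \<epsilon>)
    then show ?case using P_pos[of \<epsilon>] by (simp add: r_def P_def)
  qed
  ultimately show ?thesis by blast
qed

end
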